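(* Let $\mathcal{T}$ be a triangulated category with a Serre functor $\mathbb{S}$ over a field $k$. Then the maps $$\mathcal{U}\longmapsto\mathcal{X}:=\mathcal{U}\cap{}^{\bot}\mathcal{U}[1]\qquad\text{and}\qquad\mathcal{X}\longmapsto\mathcal{U}:={}^{\bot}\mathcal{X}[1]$$ give mutually inverse bijections between: (I) maximal functorially finite extension closed subcategories $\mathcal{U}$ of $\mathcal{T}$ such that $\mathbb{S}(\mathcal{U})=\mathcal{U}[2]$; (II) functorially finite rigid subcategories $\mathcal{X}$ of $\mathcal{T}$ such that $\mathbb{S}(\mathcal{X})=\mathcal{X}[2]$. Whenever $\mathcal{U}$ as in (I) and $\mathcal{X}$ as in (II) correspond to each other under these bijections, i.e. $\mathcal{X}=\mathcal{U}\cap{}^{\bot}\mathcal{U}[1]$ and $\mathcal{U}={}^{\bot}\mathcal{X}[1]$, $\mathcal{U}$ is $\mathcal{X}$-Frobenius and the subfactor category $\mathcal{U}/\mathcal{X}$ is triangulated.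
   Context: $\mathcal{T}$ is a $k$-linear Hom-finite triangulated category with split idempotents and shift $[1]$, with a Serre functor: a triangulated equivalence $\mathbb{S}:\mathcal{T}\to\mathcal{T}$ with natural bifunctorial isomorphisms $\mathrm{Hom}_k(\mathcal{T}(A,B),k)\cong\mathcal{T}(B,\mathbb{S}(A))$. Subcategories are full, additive, closed under isomorphisms and direct summands. $\mathcal{X}$ is rigid if $\mathcal{T}(\mathcal{X},\mathcal{X}[1])=0$. $\mathcal{X}^{\bot}=\{A\mid\mathcal{T}(\mathcal{X},A)=0\}$, ${}^{\bot}\mathcal{X}=\{A\mid\mathcal{T}(A,\mathcal{X})=0\}$, and ${}^{\bot}\mathcal{X}[1]$ means $({}^{\bot}\mathcal{X})[1]={}^{\bot}(\mathcal{X}[1])$. A right $\mathcal{X}$-approximation of $A$ is a map $X_A\to A$, $X_A\in\mathcal{X}$, with $\mathcal{T}(\mathcal{X},X_A)\to\mathcal{T}(\mathcal{X},A)$ surjective; left approximations are dual; $\mathcal{X}$ is functorially finite if all objects have both. Heart and maximality: if $\mathcal{U}$ is extension closed with $\mathbb{S}(\mathcal{U})=\mathcal{U}[2]$, then ${}^{\bot}\mathcal{U}[1]=\mathcal{U}^{\bot}[-1]$, and the heart of $\mathcal{U}$ is $\mathcal{U}\cap{}^{\bot}\mathcal{U}[1]=\mathcal{U}\cap\mathcal{U}^{\bot}[-1]$. Such a $\mathcal{U}$ is maximal if it is maximal among those with the same heart: whenever $\mathcal{V}$ is extension closed with $\mathbb{S}(\mathcal{V})=\mathcal{V}[2]$,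 $\mathcal{U}\subseteq\mathcal{V}$, and $\mathcal{V}$ has the same heart as $\mathcal{U}$, then $\mathcal{U}=\mathcal{V}$. For an object $A$ let $\Omega^1_{\mathcal{X}}(A)\to X^0_A\to A\to\Omega^1_{\mathcal{X}}(A)[1]$ and $\Sigma^1_{\mathcal{X}}(A)[-1]\to A\to X^A_0\to\Sigma^1_{\mathcal{X}}(A)$ be triangles whose maps $X^0_A\to A$, $A\to X^A_0$ are a right, resp. left, $\mathcal{X}$-approximation. A map $f$ is $\mathcal{X}$-ghost (resp. $\mathcal{X}$-coghost) if $\mathcal{T}(\mathcal{X},f)=0$ (resp. $\mathcal{T}(f,\mathcal{X})=0$); $\mathsf{Gh}_{\mathcal{X}}(A,B)$, $\mathsf{CoGh}_{\mathcal{X}}(A,B)$ denote the groups of such maps $A\to B$. $\mathcal{U}$ is $\mathcal{X}$-Frobenius if: $\mathcal{U}$ is closed under extensions and direct summands; $\mathcal{X}\subseteq\mathcal{U}$ is functorially finite in $\mathcal{U}$; $\mathsf{Gh}_{\mathcal{X}}(\mathcal{U},\mathcal{X}[1])=0=\mathsf{CoGh}_{\mathcal{X}}(\mathcal{X}[-1],\mathcal{U})$; and $\Omega^1_{\mathcal{X}}(\mathcal{U})\subseteq\mathcal{U}\supseteq\Sigma^1_{\mathcal{X}}(\mathcal{U})$. $\mathcal{U}/\mathcal{X}$ has the objects of $\mathcal{U}$ and morphisms those of $\mathcal{T}$ modulo maps factoring through $\mathcal{X}$; "triangulated" refers to the suspension $\Sigma^1_{\mathcal{X}}$ (which must be an equivalence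 of $\mathcal{U}/\mathcal{X}$, with quasi-inverse $\Omega^1_{\mathcal{X}}$) and the triangles isomorphic to $A\to B\to C\to\Sigma^1_{\mathcal{X}}(A)$ obtained from a map $A\to B$ in $\mathcal{U}$ by completing the composite $\Sigma^1_{\mathcal{X}}(A)[-1]\to A\to B$ to a triangle $\Sigma^1_{\mathcal{X}}(A)[-1]\to B\to C\to\Sigma^1_{\mathcal{X}}(A)$ in $\mathcal{T}$. *)

theory Defs
  imports "HOL-Algebra.Module"
begin

section \<open>Categories and functors\<close>

record ('o, 'm) precat =
  Ob :: "'o set"
  Hom :: "'o \<Rightarrow> 'o \<Rightarrow> 'm set"
  Ident :: "'o \<Rightarrow> 'm"
  Comp :: "'m \<Rightarrow> 'm \<Rightarrow> 'm"  (infixl "\<bullet>\<index>" 70)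

locale category =
  fixes C :: "('o, 'm, 'z) precat_scheme" (structure)
  assumes Hom_disjoint:
    "\<lbrakk>A \<in> Ob C; B \<in> Ob C; A' \<in> Ob C; B' \<in> Ob C; f \<in> Hom C A B; f \<in> Hom C A' B'\<rbrakk>
      \<Longrightarrow> A = A' \<and> B = B'"
    and Ident_closed: "A \<in> Ob C \<Longrightarrow> Ident C A \<in> Hom C A A"
    and Comp_closed:
    "\<lbrakk>A \<in> Ob C; B \<in> Ob C; D \<in> Ob C; f \<in> Hom C A B; g \<in> Hom C B D\<rbrakk> \<Longrightarrow> g \<bullet> f \<in> Hom C A D"
    and Comp_Ident:
    "\<lbrakk>A \<in> Ob C; B \<in> Ob C; f \<in> Hom C A B\<rbrakk> \<Longrightarrow> f \<bullet> Ident C A = f"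
    and Ident_Comp:
    "\<lbrakk>A \<in> Ob C; B \<in> Ob C; f \<in> Hom C A B\<rbrakk> \<Longrightarrow> Ident C B \<bullet> f = f"
    and Comp_assoc:
    "\<lbrakk>A \<in> Ob C; B \<in> Ob C; D \<in> Ob C; E \<in> Ob C;
      f \<in> Hom C A B; g \<in> Hom C B D; h \<in> Hom C D E\<rbrakk> \<Longrightarrow> h \<bullet> (g \<bullet> f) = (h \<bullet> g) \<bullet> f"

definition isos :: "('o, 'm, 'z) precat_scheme \<Rightarrow> 'o \<Rightarrow> 'o \<Rightarrow> 'm set" where
  "isos C A B = {f \<in> Hom C A B. \<exists>g \<in> Hom C B A.
     g \<bullet>\<^bsub>C\<^esub> f = Ident C A \<and> f \<bullet>\<^bsub>C\<^esub> g = Ident C B}"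

definition isomorphic :: "('o, 'm, 'z) precat_scheme \<Rightarrow> 'o \<Rightarrow> 'o \<Rightarrow> bool" where
  "isomorphic C A B \<longleftrightarrow> isos C A B \<noteq> {}"

definition split_idempotents :: "('o, 'm, 'z) precat_scheme \<Rightarrow> bool" where
  "split_idempotents C \<longleftrightarrow>
    (\<forall>A \<in> Ob C. \<forall>e \<in> Hom C A A. e \<bullet>\<^bsub>C\<^esub> e = e \<longrightarrow>
      (\<exists>B \<in> Ob C. \<exists>r \<in> Hom C A B. \<exists>s \<in> Hom C B A.
        s \<bullet>\<^bsub>C\<^esub> r = e \<and> r \<bullet>\<^bsub>C\<^esub> s = Ident C B))"

record ('o, 'm, 'p, 'n) func =
  ob :: "'o \<Rightarrow> 'p"
  mor :: "'m \<Rightarrow> 'n"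

definition id_func :: "('o, 'm, 'o, 'm) func" where
  "id_func = \<lparr>ob = (\<lambda>A. A), mor = (\<lambda>f. f)\<rparr>"

definition comp_func ::
  "('p, 'n, 'q, 'l) func \<Rightarrow> ('o, 'm, 'p, 'n) func \<Rightarrow> ('o, 'm, 'q, 'l) func" where
  "comp_func G F = \<lparr>ob = ob G \<circ> ob F, mor = mor G \<circ> mor F\<rparr>"

definition is_functor ::
  "('o, 'm, 'z) precat_scheme \<Rightarrow> ('p, 'n, 'y) precat_scheme \<Rightarrow> ('o, 'm, 'p, 'n) func \<Rightarrow> bool" where
  "is_functor C D F \<longleftrightarrow>
    (\<forall>A \<in> Ob C. ob F A \<in> Ob D) \<and>
    (\<forall>A \<in> Ob C. \<forall>B \<in> Ob C. \<forall>f \<in> Hom C A B. mor F f \<in> Hom D (ob F A) (ob F B)) \<and>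
    (\<forall>A \<in> Ob C. mor F (Ident C A) = Ident D (ob F A)) \<and>
    (\<forall>A \<in> Ob C. \<forall>B \<in> Ob C. \<forall>E \<in> Ob C. \<forall>f \<in> Hom C A B. \<forall>g \<in> Hom C B E.
      mor F (g \<bullet>\<^bsub>C\<^esub> f) = mor F g \<bullet>\<^bsub>D\<^esub> mor F f)"

definition natural_iso ::
  "('o, 'm, 'z) precat_scheme \<Rightarrow> ('p, 'n, 'y) precat_scheme \<Rightarrow>
   ('o, 'm, 'p, 'n) func \<Rightarrow> ('o, 'm, 'p, 'n) func \<Rightarrow> ('o \<Rightarrow> 'n) \<Rightarrow> bool" where
  "natural_iso C D F G \<eta> \<longleftrightarrow>
    (\<forall>A \<in> Ob C. \<eta> A \<in> isos D (ob F A) (ob G A)) \<and>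
    (\<forall>A \<in> Ob C. \<forall>B \<in> Ob C. \<forall>f \<in> Hom C A B. \<eta> B \<bullet>\<^bsub>D\<^esub> mor F f = mor G f \<bullet>\<^bsub>D\<^esub> \<eta> A)"

definition quasi_inverse ::
  "('o, 'm, 'z) precat_scheme \<Rightarrow> ('p, 'n, 'y) precat_scheme \<Rightarrow>
   ('o, 'm, 'p, 'n) func \<Rightarrow> ('p, 'n, 'o, 'm) func \<Rightarrow> bool" where
  "quasi_inverse C D F G \<longleftrightarrow>
    is_functor C D F \<and> is_functor D C G \<and>
    (\<exists>\<eta>. natural_iso C C id_func (comp_func G F) \<eta>) \<and>
    (\<exists>\<epsilon>. natural_iso D D (comp_func F G) id_func \<epsilon>)"

definition is_equivalence ::
  "('o, 'm, 'z) precat_scheme \<Rightarrow> ('p, 'n, 'y) precat_scheme \<Rightarrow> ('o, 'm, 'p, 'n) func \<Rightarrow> bool" where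
  "is_equivalence C D F \<longleftrightarrow> (\<exists>G. quasi_inverse C D F G)"


section \<open>Additive categories\<close>

record ('o, 'm) preadd = "('o, 'm) precat" +
  Add :: "'m \<Rightarrow> 'm \<Rightarrow> 'm"
  Zero :: "'o \<Rightarrow> 'o \<Rightarrow> 'm"

definition hom_group :: "('o, 'm, 'z) preadd_scheme \<Rightarrow> 'o \<Rightarrow> 'o \<Rightarrow> 'm monoid" where
  "hom_group C A B = \<lparr>carrier = Hom C A B, mult = Add C, one = Zero C A B\<rparr>"

definition Neg :: "('o, 'm, 'z) preadd_scheme \<Rightarrow> 'o \<Rightarrow> 'o \<Rightarrow> 'm \<Rightarrow> 'm" where
  "Neg C A B f = inv\<^bsub>hom_group C A B\<^esub> f"

locale preadditive_category = category C
  for C :: "('o, 'm, 'z) preadd_scheme" (structure) +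
  assumes hom_comm_group: "\<lbrakk>A \<in> Ob C; B \<in> Ob C\<rbrakk> \<Longrightarrow> comm_group (hom_group C A B)"
    and Comp_Add:
    "\<lbrakk>A \<in> Ob C; B \<in> Ob C; D \<in> Ob C; f \<in> Hom C A B; f' \<in> Hom C A B; g \<in> Hom C B D\<rbrakk>
      \<Longrightarrow> g \<bullet> Add C f f' = Add C (g \<bullet> f) (g \<bullet> f')"
    and Add_Comp:
    "\<lbrakk>A \<in> Ob C; B \<in> Ob C; D \<in> Ob C; f \<in> Hom C A B; g \<in> Hom C B D; g' \<in> Hom C B D\<rbrakk>
      \<Longrightarrow> Add C g g' \<bullet> f = Add C (g \<bullet> f) (g' \<bullet> f)"

definition zero_object :: "('o, 'm, 'z) precat_scheme \<Rightarrow> 'o \<Rightarrow> bool" where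
  "zero_object C Z \<longleftrightarrow> Z \<in> Ob C \<and>
    (\<forall>A \<in> Ob C. (\<exists>!f. f \<in> Hom C Z A) \<and> (\<exists>!f. f \<in> Hom C A Z))"

definition is_biproduct :: "('o, 'm, 'z) preadd_scheme \<Rightarrow> 'o \<Rightarrow> 'o \<Rightarrow> 'o \<Rightarrow> bool" where
  "is_biproduct C A B P \<longleftrightarrow> P \<in> Ob C \<and>
    (\<exists>i \<in> Hom C A P. \<exists>j \<in> Hom C B P. \<exists>p \<in> Hom C P A. \<exists>q \<in> Hom C P B.
      p \<bullet>\<^bsub>C\<^esub> i = Ident C A \<and> q \<bullet>\<^bsub>C\<^esub> j = Ident C B \<and>
      q \<bullet>\<^bsub>C\<^esub> i = Zero C A B \<and> p \<bullet>\<^bsub>C\<^esub> j = Zero C B A \<and>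
      Add C (i \<bullet>\<^bsub>C\<^esub> p) (j \<bullet>\<^bsub>C\<^esub> q) = Ident C P)"

locale additive_category = preadditive_category C
  for C :: "('o, 'm, 'z) preadd_scheme" (structure) +
  assumes ex_zero_object: "\<exists>Z. zero_object C Z"
    and ex_biproduct: "\<lbrakk>A \<in> Ob C; B \<in> Ob C\<rbrakk> \<Longrightarrow> \<exists>P. is_biproduct C A B P"

definition additive_functor ::
  "('o, 'm, 'z) preadd_scheme \<Rightarrow> ('p, 'n, 'y) preadd_scheme \<Rightarrow> ('o, 'm, 'p, 'n) func \<Rightarrow> bool" where
  "additive_functor C D F \<longleftrightarrow> is_functor C D F \<and>
    (\<forall>A \<in> Ob C. \<forall>B \<in> Ob C. \<forall>f \<in> Hom C A B. \<forall>g \<in> Hom C A B.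
      mor F (Add C f g) = Add D (mor F f) (mor F g))"


section \<open>Triangulated categories\<close>

type_synonym ('o, 'm) tri = "'o \<times> 'o \<times> 'o \<times> 'm \<times> 'm \<times> 'm"

record ('o, 'm) triang = "('o, 'm) preadd" +
  Sus :: "('o, 'm, 'o, 'm) func"
  Tri :: "('o, 'm) tri set"

text \<open>
  A tuple \<open>(A, B, C, f, g, h)\<close> stands for \<open>A \<rightarrow> B \<rightarrow> C \<rightarrow> A[1]\<close> with maps \<open>f\<close>, \<open>g\<close>, \<open>h\<close>.
\<close>

definition candidate_triangles :: "('o, 'm, 'z) triang_scheme \<Rightarrow> ('o, 'm) tri set" where
  "candidate_triangles T = {(A, B, C, f, g, h).
     A \<in> Ob T \<and> B \<in> Ob T \<and> C \<in> Ob T \<and>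
     f \<in> Hom T A B \<and> g \<in> Hom T B C \<and> h \<in> Hom T C (ob (Sus T) A)}"

fun tri_map ::
  "('o, 'm, 'z) triang_scheme \<Rightarrow> ('o, 'm) tri \<Rightarrow> ('o, 'm) tri \<Rightarrow> 'm \<times> 'm \<times> 'm \<Rightarrow> bool" where
  "tri_map T (A, B, C, f, g, h) (A', B', C', f', g', h') (a, b, c) \<longleftrightarrow>
    a \<in> Hom T A A' \<and> b \<in> Hom T B B' \<and> c \<in> Hom T C C' \<and>
    b \<bullet>\<^bsub>T\<^esub> f = f' \<bullet>\<^bsub>T\<^esub> a \<and> c \<bullet>\<^bsub>T\<^esub> g = g' \<bullet>\<^bsub>T\<^esub> b \<and>
    mor (Sus T) a \<bullet>\<^bsub>T\<^esub> h = h' \<bullet>\<^bsub>T\<^esub> c"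

fun tri_iso :: "('o, 'm, 'z) triang_scheme \<Rightarrow> ('o, 'm) tri \<Rightarrow> ('o, 'm) tri \<Rightarrow> bool" where
  "tri_iso T (A, B, C, f, g, h) (A', B', C', f', g', h') \<longleftrightarrow>
    (\<exists>a \<in> isos T A A'. \<exists>b \<in> isos T B B'. \<exists>c \<in> isos T C C'.
      tri_map T (A, B, C, f, g, h) (A', B', C', f', g', h') (a, b, c))"

text \<open>
  The suspension is only required to be an autoequivalence, not an automorphism.
\<close>

locale triangulated_category = additive_category T
  for T :: "('o, 'm, 'z) triang_scheme" (structure) +
  assumes Sus_equivalence: "is_equivalence T T (Sus T)"
    and Sus_additive: "additive_functor T T (Sus T)"
    and Tri_candidate: "Tri T \<subseteq> candidate_triangles T"
    and Tri_iso_closed: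
    "\<lbrakk>t \<in> Tri T; t' \<in> candidate_triangles T; tri_iso T t t'\<rbrakk> \<Longrightarrow> t' \<in> Tri T"
    and Tri_Ident:
    "\<lbrakk>A \<in> Ob T; zero_object T Z\<rbrakk>
      \<Longrightarrow> (A, A, Z, Ident T A, Zero T A Z, Zero T Z (ob (Sus T) A)) \<in> Tri T"
    and Tri_complete:
    "\<lbrakk>A \<in> Ob T; B \<in> Ob T; f \<in> Hom T A B\<rbrakk> \<Longrightarrow> \<exists>C g h. (A, B, C, f, g, h) \<in> Tri T"
    and Tri_rotate:
    "(A, B, C, f, g, h) \<in> candidate_triangles T \<Longrightarrow>
      (A, B, C, f, g, h) \<in> Tri T \<longleftrightarrow>
      (B, C, ob (Sus T) A, g, h, Neg T (ob (Sus T) A) (ob (Sus T) B) (mor (Sus T) f)) \<in> Tri T"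
    and Tri_map_complete:
    "\<lbrakk>(A, B, C, f, g, h) \<in> Tri T; (A', B', C', f', g', h') \<in> Tri T;
      a \<in> Hom T A A'; b \<in> Hom T B B'; b \<bullet> f = f' \<bullet> a\<rbrakk>
      \<Longrightarrow> \<exists>c. tri_map T (A, B, C, f, g, h) (A', B', C', f', g', h') (a, b, c)"
    and octahedral:
    "\<lbrakk>(X, Y, P, f, p, p') \<in> Tri T; (Y, Z, Q, g, q, q') \<in> Tri T; (X, Z, R, g \<bullet> f, r, r') \<in> Tri T\<rbrakk>
      \<Longrightarrow> \<exists>u v. (P, R, Q, u, v, mor (Sus T) p \<bullet> q') \<in> Tri T \<and>
        tri_map T (X, Y, P, f, p, p') (X, Z, R, g \<bullet> f, r, r') (Ident T X, g, u) \<and>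
        tri_map T (X, Z, R, g \<bullet> f, r, r') (Y, Z, Q, g, q, q') (f, Ident T Z, v)"

definition triangulated_equivalence ::
  "('o, 'm, 'z) triang_scheme \<Rightarrow> ('p, 'n, 'y) triang_scheme \<Rightarrow> ('o, 'm, 'p, 'n) func \<Rightarrow> bool" where
  "triangulated_equivalence T T' F \<longleftrightarrow>
    is_equivalence T T' F \<and> additive_functor T T' F \<and>
    (\<exists>\<xi>. natural_iso T T' (comp_func F (Sus T)) (comp_func (Sus T') F) \<xi> \<and>
      (\<forall>A B C f g h. (A, B, C, f, g, h) \<in> Tri T \<longrightarrow>
        (ob F A, ob F B, ob F C, mor F f, mor F g, \<xi> A \<bullet>\<^bsub>T'\<^esub> mor F h) \<in> Tri T'))"


section \<open>Linear structure and Serre functors\<close>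

record ('k, 'o, 'm) lin_triang = "('o, 'm) triang" +
  Smult :: "'k \<Rightarrow> 'm \<Rightarrow> 'm"

text \<open>The multiplicative fields of the record are irrelevant to the module structure.\<close>

definition hom_module ::
  "('k, 'o, 'm, 'z) lin_triang_scheme \<Rightarrow> 'o \<Rightarrow> 'o \<Rightarrow> ('k, 'm) module" where
  "hom_module T A B = \<lparr>carrier = Hom T A B, mult = undefined, one = undefined,
     zero = Zero T A B, add = Add T, smult = Smult T\<rparr>"

definition finite_dimensional ::
  "('k, 'r) ring_scheme \<Rightarrow> ('k, 'm, 'z) module_scheme \<Rightarrow> bool" where
  "finite_dimensional K M \<longleftrightarrow>
    (\<exists>S. finite S \<and> S \<subseteq> carrier M \<and>
      (\<forall>x \<in> carrier M. \<exists>c \<in> S \<rightarrow> carrier K. x = (\<Oplus>\<^bsub>M\<^esub>s\<in>S. c s \<odot>\<^bsub>M\<^esub> s)))"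

locale linear_triangulated_category = field K + triangulated_category T
  for K :: "('k, 'r) ring_scheme" (structure)
    and T :: "('k, 'o, 'm, 'z) lin_triang_scheme" (structure) +
  assumes hom_vector_space: "\<lbrakk>A \<in> Ob T; B \<in> Ob T\<rbrakk> \<Longrightarrow> module K (hom_module T A B)"
    and Comp_Smult:
    "\<lbrakk>A \<in> Ob T; B \<in> Ob T; D \<in> Ob T; f \<in> Hom T A B; g \<in> Hom T B D; a \<in> carrier K\<rbrakk>
      \<Longrightarrow> g \<bullet>\<^bsub>T\<^esub> Smult T a f = Smult T a (g \<bullet>\<^bsub>T\<^esub> f)"
    and Smult_Comp:
    "\<lbrakk>A \<in> Ob T; B \<in> Ob T; D \<in> Ob T; f \<in> Hom T A B; g \<in> Hom T B D; a \<in> carrier K\<rbrakk>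
      \<Longrightarrow> Smult T a g \<bullet>\<^bsub>T\<^esub> f = Smult T a (g \<bullet>\<^bsub>T\<^esub> f)"
    and Sus_Smult:
    "\<lbrakk>A \<in> Ob T; B \<in> Ob T; f \<in> Hom T A B; a \<in> carrier K\<rbrakk>
      \<Longrightarrow> mor (Sus T) (Smult T a f) = Smult T a (mor (Sus T) f)"

definition dual_space ::
  "('k, 'r) ring_scheme \<Rightarrow> ('k, 'm, 'z) module_scheme \<Rightarrow> ('m \<Rightarrow> 'k) set" where
  "dual_space K M = {\<phi> \<in> hom (add_monoid M) (add_monoid K) \<inter> extensional (carrier M).
     \<forall>a \<in> carrier K. \<forall>x \<in> carrier M. \<phi> (a \<odot>\<^bsub>M\<^esub> x) = a \<otimes>\<^bsub>K\<^esub> \<phi> x}"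

text \<open>
  \<open>\<eta> A B\<close> is the isomorphism from the dual of \<open>Hom A B\<close> to \<open>Hom B (S A)\<close>.
\<close>

definition serre_duality ::
  "('k, 'r) ring_scheme \<Rightarrow> ('k, 'o, 'm, 'z) lin_triang_scheme \<Rightarrow> ('o, 'm, 'o, 'm) func \<Rightarrow>
   ('o \<Rightarrow> 'o \<Rightarrow> ('m \<Rightarrow> 'k) \<Rightarrow> 'm) \<Rightarrow> bool" where
  "serre_duality K T S \<eta> \<longleftrightarrow>
    (\<forall>A \<in> Ob T. \<forall>B \<in> Ob T.
      bij_betw (\<eta> A B) (dual_space K (hom_module T A B)) (Hom T B (ob S A)) \<and>
      (\<forall>\<phi> \<in> dual_space K (hom_module T A B). \<forall>\<psi> \<in> dual_space K (hom_module T A B).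
        \<eta> A B (\<lambda>f \<in> Hom T A B. \<phi> f \<oplus>\<^bsub>K\<^esub> \<psi> f) = Add T (\<eta> A B \<phi>) (\<eta> A B \<psi>)) \<and>
      (\<forall>a \<in> carrier K. \<forall>\<phi> \<in> dual_space K (hom_module T A B).
        \<eta> A B (\<lambda>f \<in> Hom T A B. a \<otimes>\<^bsub>K\<^esub> \<phi> f) = Smult T a (\<eta> A B \<phi>))) \<and>
    (\<forall>A \<in> Ob T. \<forall>A' \<in> Ob T. \<forall>B \<in> Ob T. \<forall>B' \<in> Ob T. \<forall>a \<in> Hom T A A'. \<forall>b \<in> Hom T B' B.
      \<forall>\<phi> \<in> dual_space K (hom_module T A B).
        \<eta> A' B' (\<lambda>f \<in> Hom T A' B'. \<phi> (b \<bullet>\<^bsub>T\<^esub> (f \<bullet>\<^bsub>T\<^esub> a)))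
          = mor S a \<bullet>\<^bsub>T\<^esub> (\<eta> A B \<phi> \<bullet>\<^bsub>T\<^esub> b))"

locale serre_triangulated_category = linear_triangulated_category K T
  for K :: "('k, 'r) ring_scheme" (structure)
    and T :: "('k, 'o, 'm, 'z) lin_triang_scheme" (structure) +
  fixes S :: "('o, 'm, 'o, 'm) func"
  assumes Hom_finite: "\<lbrakk>A \<in> Ob T; B \<in> Ob T\<rbrakk> \<Longrightarrow> finite_dimensional K (hom_module T A B)"
    and idempotents_split: "split_idempotents T"
    and Serre_equivalence: "triangulated_equivalence T T S"
    and Serre_duality: "\<exists>\<eta>. serre_duality K T S \<eta>"


section \<open>Subcategories\<close>

text \<open>Full subcategories are given by their sets of objects.\<close>

definition subcategory :: "('o, 'm, 'z) preadd_scheme \<Rightarrow> 'o set \<Rightarrow> bool" where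
  "subcategory T \<U> \<longleftrightarrow> \<U> \<subseteq> Ob T \<and>
    (\<exists>Z \<in> \<U>. zero_object T Z) \<and>
    (\<forall>A \<in> \<U>. \<forall>B \<in> \<U>. \<forall>P. is_biproduct T A B P \<longrightarrow> P \<in> \<U>) \<and>
    (\<forall>A \<in> \<U>. \<forall>B \<in> Ob T. isomorphic T A B \<longrightarrow> B \<in> \<U>) \<and>
    (\<forall>P \<in> \<U>. \<forall>A \<in> Ob T. \<forall>B \<in> Ob T. is_biproduct T A B P \<longrightarrow> A \<in> \<U> \<and> B \<in> \<U>)"

definition extension_closed :: "('o, 'm, 'z) triang_scheme \<Rightarrow> 'o set \<Rightarrow> bool" where
  "extension_closed T \<U> \<longleftrightarrow>
    (\<forall>A B C f g h. (A, B, C, f, g, h) \<in> Tri T \<longrightarrow> A \<in> \<U> \<longrightarrow> C \<in> \<U> \<longrightarrow> B \<in> \<U>)"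

definition replete_image ::
  "('o, 'm, 'z) precat_scheme \<Rightarrow> ('o, 'm, 'o, 'm) func \<Rightarrow> 'o set \<Rightarrow> 'o set" where
  "replete_image T F \<U> = {A \<in> Ob T. \<exists>B \<in> \<U>. isomorphic T A (ob F B)}"

definition shift :: "('o, 'm, 'z) triang_scheme \<Rightarrow> 'o set \<Rightarrow> 'o set" where
  "shift T \<U> = replete_image T (Sus T) \<U>"

text \<open>No inverse of the suspension is chosen; \<open>A \<cong> B[-1]\<close> is expressed as \<open>A[1] \<cong> B\<close>.\<close>

definition unshift :: "('o, 'm, 'z) triang_scheme \<Rightarrow> 'o set \<Rightarrow> 'o set" where
  "unshift T \<U> = {A \<in> Ob T. \<exists>B \<in> \<U>. isomorphic T (ob (Sus T) A) B}"

definition left_perp :: "('o, 'm, 'z) preadd_scheme \<Rightarrow> 'o set \<Rightarrow> 'o set" where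
  "left_perp T \<X> = {A \<in> Ob T. \<forall>X \<in> \<X>. Hom T A X = {Zero T A X}}"

definition rigid :: "('o, 'm, 'z) triang_scheme \<Rightarrow> 'o set \<Rightarrow> bool" where
  "rigid T \<X> \<longleftrightarrow> (\<forall>X \<in> \<X>. \<forall>Y \<in> shift T \<X>. Hom T X Y = {Zero T X Y})"

definition right_approx ::
  "('o, 'm, 'z) precat_scheme \<Rightarrow> 'o set \<Rightarrow> 'o \<Rightarrow> 'o \<Rightarrow> 'm \<Rightarrow> bool" where
  "right_approx T \<X> A X f \<longleftrightarrow> X \<in> \<X> \<and> f \<in> Hom T X A \<and>
    (\<forall>Y \<in> \<X>. \<forall>g \<in> Hom T Y A. \<exists>h \<in> Hom T Y X. g = f \<bullet>\<^bsub>T\<^esub> h)"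

definition left_approx ::
  "('o, 'm, 'z) precat_scheme \<Rightarrow> 'o set \<Rightarrow> 'o \<Rightarrow> 'o \<Rightarrow> 'm \<Rightarrow> bool" where
  "left_approx T \<X> A X f \<longleftrightarrow> X \<in> \<X> \<and> f \<in> Hom T A X \<and>
    (\<forall>Y \<in> \<X>. \<forall>g \<in> Hom T A Y. \<exists>h \<in> Hom T X Y. g = h \<bullet>\<^bsub>T\<^esub> f)"

definition functorially_finite_in ::
  "('o, 'm, 'z) precat_scheme \<Rightarrow> 'o set \<Rightarrow> 'o set \<Rightarrow> bool" where
  "functorially_finite_in T \<U> \<X> \<longleftrightarrow>
    (\<forall>A \<in> \<U>. (\<exists>X f. right_approx T \<X> A X f) \<and> (\<exists>X f. left_approx T \<X> A X f))"

definition heart :: "('o, 'm, 'z) triang_scheme \<Rightarrow> 'o set \<Rightarrow> 'o set" where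
  "heart T \<U> = \<U> \<inter> shift T (left_perp T \<U>)"

definition serre_stable ::
  "('o, 'm, 'z) triang_scheme \<Rightarrow> ('o, 'm, 'o, 'm) func \<Rightarrow> 'o set \<Rightarrow> bool" where
  "serre_stable T S \<U> \<longleftrightarrow> replete_image T S \<U> = shift T (shift T \<U>)"

definition maximal_subcat ::
  "('o, 'm, 'z) triang_scheme \<Rightarrow> ('o, 'm, 'o, 'm) func \<Rightarrow> 'o set \<Rightarrow> bool" where
  "maximal_subcat T S \<U> \<longleftrightarrow>
    (\<forall>\<V>. subcategory T \<V> \<and> extension_closed T \<V> \<and> serre_stable T S \<V> \<and>
      \<U> \<subseteq> \<V> \<and> heart T \<V> = heart T \<U> \<longrightarrow> \<U> = \<V>)"

definition maximal_extension_closed_subcats ::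
  "('o, 'm, 'z) triang_scheme \<Rightarrow> ('o, 'm, 'o, 'm) func \<Rightarrow> 'o set set" where
  "maximal_extension_closed_subcats T S = {\<U>. subcategory T \<U> \<and>
     functorially_finite_in T (Ob T) \<U> \<and> extension_closed T \<U> \<and>
     serre_stable T S \<U> \<and> maximal_subcat T S \<U>}"

definition rigid_subcats ::
  "('o, 'm, 'z) triang_scheme \<Rightarrow> ('o, 'm, 'o, 'm) func \<Rightarrow> 'o set set" where
  "rigid_subcats T S = {\<X>. subcategory T \<X> \<and>
     functorially_finite_in T (Ob T) \<X> \<and> rigid T \<X> \<and> serre_stable T S \<X>}"


section \<open>Frobenius subcategories\<close>

definition Gh :: "('o, 'm, 'z) preadd_scheme \<Rightarrow> 'o set \<Rightarrow> 'o \<Rightarrow> 'o \<Rightarrow> 'm set" where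
  "Gh T \<X> A B = {f \<in> Hom T A B. \<forall>X \<in> \<X>. \<forall>g \<in> Hom T X A. f \<bullet>\<^bsub>T\<^esub> g = Zero T X B}"

definition CoGh :: "('o, 'm, 'z) preadd_scheme \<Rightarrow> 'o set \<Rightarrow> 'o \<Rightarrow> 'o \<Rightarrow> 'm set" where
  "CoGh T \<X> A B = {f \<in> Hom T A B. \<forall>X \<in> \<X>. \<forall>g \<in> Hom T B X. g \<bullet>\<^bsub>T\<^esub> f = Zero T A X}"

text \<open>
  The arguments \<open>X\<close>, \<open>W\<close>, \<open>i\<close>, \<open>p\<close>, \<open>q\<close> of \<open>omega_triangle\<close> form
  \<open>W \<rightarrow> X \<rightarrow> A \<rightarrow> W[1]\<close>. The triangle \<open>W[-1] \<rightarrow> A \<rightarrow> X \<rightarrow> W\<close> of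
  \<open>sigma_triangle\<close> is recorded in its rotated form \<open>A \<rightarrow> X \<rightarrow> W \<rightarrow> A[1]\<close>, where
  \<open>q : W \<rightarrow> A[1]\<close> is the negative of the suspension of \<open>W[-1] \<rightarrow> A\<close>.
\<close>

definition omega_triangle ::
  "('o, 'm, 'z) triang_scheme \<Rightarrow> 'o set \<Rightarrow> 'o \<Rightarrow> 'o \<Rightarrow> 'o \<Rightarrow> 'm \<Rightarrow> 'm \<Rightarrow> 'm \<Rightarrow> bool" where
  "omega_triangle T \<X> A X W i p q \<longleftrightarrow>
    (W, X, A, i, p, q) \<in> Tri T \<and> right_approx T \<X> A X p"

definition sigma_triangle ::
  "('o, 'm, 'z) triang_scheme \<Rightarrow> 'o set \<Rightarrow> 'o \<Rightarrow> 'o \<Rightarrow> 'o \<Rightarrow> 'm \<Rightarrow> 'm \<Rightarrow> 'm \<Rightarrow> bool" where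
  "sigma_triangle T \<X> A X W i p q \<longleftrightarrow>
    (A, X, W, i, p, q) \<in> Tri T \<and> left_approx T \<X> A X i"

definition frobenius_subcat :: "('o, 'm, 'z) triang_scheme \<Rightarrow> 'o set \<Rightarrow> 'o set \<Rightarrow> bool" where
  "frobenius_subcat T \<X> \<U> \<longleftrightarrow>
    subcategory T \<U> \<and> extension_closed T \<U> \<and>
    subcategory T \<X> \<and> \<X> \<subseteq> \<U> \<and> functorially_finite_in T \<U> \<X> \<and>
    (\<forall>A \<in> \<U>. \<forall>B \<in> shift T \<X>. Gh T \<X> A B = {Zero T A B}) \<and>
    (\<forall>A \<in> unshift T \<X>. \<forall>B \<in> \<U>. CoGh T \<X> A B = {Zero T A B}) \<and>
    (\<forall>A \<in> \<U>. \<forall>X W i p q. omega_triangle T \<X> A X W i p q \<longrightarrow> W \<in> \<U>) \<and>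
    (\<forall>A \<in> \<U>. \<forall>X W i p q. sigma_triangle T \<X> A X W i p q \<longrightarrow> W \<in> \<U>)"


section \<open>The subfactor category\<close>

definition factoring_maps ::
  "('o, 'm, 'z) precat_scheme \<Rightarrow> 'o set \<Rightarrow> 'o \<Rightarrow> 'o \<Rightarrow> 'm set" where
  "factoring_maps T \<X> A B =
    {b \<bullet>\<^bsub>T\<^esub> a | X a b. X \<in> \<X> \<and> a \<in> Hom T A X \<and> b \<in> Hom T X B}"

definition cls :: "('o, 'm, 'z) preadd_scheme \<Rightarrow> 'o set \<Rightarrow> 'o set \<Rightarrow> 'm \<Rightarrow> 'm set" where
  "cls T \<U> \<X> f = {g. \<exists>A \<in> \<U>. \<exists>B \<in> \<U>. f \<in> Hom T A B \<and> g \<in> Hom T A B \<and>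
     Add T g (Neg T A B f) \<in> factoring_maps T \<X> A B}"

text \<open>A choice, for each object, of a triangle as in \<open>omega_triangle\<close> or \<open>sigma_triangle\<close>.\<close>

record ('o, 'm) syzygy_choice =
  chX :: "'o \<Rightarrow> 'o"
  chW :: "'o \<Rightarrow> 'o"
  chi :: "'o \<Rightarrow> 'm"
  chp :: "'o \<Rightarrow> 'm"
  chq :: "'o \<Rightarrow> 'm"

definition omega_choice ::
  "('o, 'm, 'z) triang_scheme \<Rightarrow> 'o set \<Rightarrow> 'o set \<Rightarrow> ('o, 'm) syzygy_choice \<Rightarrow> bool" where
  "omega_choice T \<U> \<X> \<omega> \<longleftrightarrow>
    (\<forall>A \<in> \<U>. omega_triangle T \<X> A (chX \<omega> A) (chW \<omega> A) (chi \<omega> A) (chp \<omega> A) (chq \<omega> A))"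

definition sigma_choice ::
  "('o, 'm, 'z) triang_scheme \<Rightarrow> 'o set \<Rightarrow> 'o set \<Rightarrow> ('o, 'm) syzygy_choice \<Rightarrow> bool" where
  "sigma_choice T \<U> \<X> \<sigma> \<longleftrightarrow>
    (\<forall>A \<in> \<U>. sigma_triangle T \<X> A (chX \<sigma> A) (chW \<sigma> A) (chi \<sigma> A) (chp \<sigma> A) (chq \<sigma> A))"

text \<open>
  On a class \<open>F\<close> of maps \<open>A \<rightarrow> B\<close>, the functors below take the classes of all maps \<open>s\<close> between
  the chosen objects that complete some \<open>f \<in> F\<close> to a morphism of the chosen triangles; that
  these classes all coincide is part of the assertion that a functor is obtained.
\<close>

definition sigma_functor ::
  "('o, 'm, 'z) triang_scheme \<Rightarrow> 'o set \<Rightarrow> 'o set \<Rightarrow> ('o, 'm) syzygy_choice \<Rightarrow>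
   ('o, 'm set, 'o, 'm set) func" where
  "sigma_functor T \<U> \<X> \<sigma> = \<lparr>ob = chW \<sigma>,
     mor = (\<lambda>F. \<Union>{cls T \<U> \<X> s | A B f x s. A \<in> \<U> \<and> B \<in> \<U> \<and> f \<in> F \<and>
       tri_map T (A, chX \<sigma> A, chW \<sigma> A, chi \<sigma> A, chp \<sigma> A, chq \<sigma> A)
                 (B, chX \<sigma> B, chW \<sigma> B, chi \<sigma> B, chp \<sigma> B, chq \<sigma> B) (f, x, s)})\<rparr>"

definition omega_functor ::
  "('o, 'm, 'z) triang_scheme \<Rightarrow> 'o set \<Rightarrow> 'o set \<Rightarrow> ('o, 'm) syzygy_choice \<Rightarrow>
   ('o, 'm set, 'o, 'm set) func" where
  "omega_functor T \<U> \<X> \<omega> = \<lparr>ob = chW \<omega>,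
     mor = (\<lambda>F. \<Union>{cls T \<U> \<X> s | A B f x s. A \<in> \<U> \<and> B \<in> \<U> \<and> f \<in> F \<and>
       tri_map T (chW \<omega> A, chX \<omega> A, A, chi \<omega> A, chp \<omega> A, chq \<omega> A)
                 (chW \<omega> B, chX \<omega> B, B, chi \<omega> B, chp \<omega> B, chq \<omega> B) (s, x, f)})\<rparr>"

text \<open>
  With \<open>W = \<Sigma>(A)\<close>, completing \<open>W[-1] \<rightarrow> A \<rightarrow> B\<close> to a triangle \<open>W[-1] \<rightarrow> B \<rightarrow> C \<rightarrow> W\<close>
  is stated in rotated form: \<open>B \<rightarrow> C \<rightarrow> W \<rightarrow> B[1]\<close> with last map \<open>f[1] \<circ> q\<close>. The sign
  is the one already contained in \<open>q\<close>.
\<close>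

definition standard_triangles ::
  "('o, 'm, 'z) triang_scheme \<Rightarrow> 'o set \<Rightarrow> 'o set \<Rightarrow> ('o, 'm) syzygy_choice \<Rightarrow>
   ('o, 'm set) tri set" where
  "standard_triangles T \<U> \<X> \<sigma> =
    {(A, B, C, cls T \<U> \<X> f, cls T \<U> \<X> v, cls T \<U> \<X> w) | A B C f v w.
      A \<in> \<U> \<and> B \<in> \<U> \<and> f \<in> Hom T A B \<and>
      (B, C, chW \<sigma> A, v, w, mor (Sus T) f \<bullet>\<^bsub>T\<^esub> chq \<sigma> A) \<in> Tri T}"

text \<open>
  The subfactor category together with its suspension. The component \<open>Tri\<close> is filled in
  afterwards, since isomorphism of triangles refers to the other components.
\<close>

definition suspended_subfactor ::
  "('o, 'm, 'z) triang_scheme \<Rightarrow> 'o set \<Rightarrow> 'o set \<Rightarrow> ('o, 'm) syzygy_choice \<Rightarrow>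
   ('o, 'm set) triang" where
  "suspended_subfactor T \<U> \<X> \<sigma> = \<lparr>
     Ob = \<U>,
     Hom = (\<lambda>A B. cls T \<U> \<X> ` Hom T A B),
     Ident = (\<lambda>A. cls T \<U> \<X> (Ident T A)),
     Comp = (\<lambda>G F. \<Union>g \<in> G. \<Union>f \<in> F. cls T \<U> \<X> (g \<bullet>\<^bsub>T\<^esub> f)),
     Add = (\<lambda>F G. \<Union>f \<in> F. \<Union>g \<in> G. cls T \<U> \<X> (Add T f g)),
     Zero = (\<lambda>A B. cls T \<U> \<X> (Zero T A B)),
     Sus = sigma_functor T \<U> \<X> \<sigma>,
     Tri = {}\<rparr>"

definition subfactor ::
  "('o, 'm, 'z) triang_scheme \<Rightarrow> 'o set \<Rightarrow> 'o set \<Rightarrow> ('o, 'm) syzygy_choice \<Rightarrow>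
   ('o, 'm set) triang" where
  "subfactor T \<U> \<X> \<sigma> = (let Q = suspended_subfactor T \<U> \<X> \<sigma> in
     Q\<lparr>Tri := {t \<in> candidate_triangles Q. \<exists>t' \<in> standard_triangles T \<U> \<X> \<sigma>. tri_iso Q t t'}\<rparr>)"

end

theory Submission
  imports Defs
begin

text \<open>Since \<open>T(\<U>, \<X>[1]) = 0 = T(\<X>, \<U>[1])\<close>, composition with \<open>\<Sigma> A \<rightarrow> A[1]\<close> identifies the maps \<open>C \<rightarrow> \<Sigma> A\<close> of \<open>\<U>/\<X>\<close> with
  \<open>T(C, A[1])\<close>. Hence every triangle \<open>A \<rightarrow> B \<rightarrow> C \<rightarrow> A[1]\<close> of \<open>T\<close> with terms in \<open>\<U>\<close> induces a
  triangle of \<open>\<U>/\<X>\<close>, every standard triangle arises in this way up to isomorphism, and the axioms,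
  the octahedral one included, descend from \<open>T\<close>.

  For the correspondence, Serre duality and \<open>S \<X> = \<X>[2]\<close> make the left and right orthogonals agree up to
  shift, so \<open>\<X>\<close> can be recovered from \<open>\<^sup>\<bottom>\<X>[1]\<close> as its heart. Approximations are replaced by minimal
  ones, which exist by Fitting's lemma; Wakamatsu's lemma then places their cones in orthogonals.\<close>

section \<open>Morphisms that determine their ends, and isomorphisms\<close>

section \<open>Categories\<close>

text \<open>Two features of the setting shape the proof. The suspension is only an equivalence, so
  no object \<open>A[-1]\<close> is given: statements about desuspensions are proved one shift
  higher and brought back by full faithfulness, and an object is desuspended by choosing a preimage
  up to isomorphism. Moreover, equality in \<open>\<U>/\<X>\<close> is equality modulo an ideal,
  whereas the axioms of \<open>T\<close> ask for squares that commute strictly. Extension classes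
  reconcile the two: the composite of a map with a class in \<open>T(C, A[1])\<close>, for
  \<open>A\<close> and \<open>C\<close> in \<open>\<U>\<close>, does not change when that map
  changes by one factoring through \<open>\<X>\<close>, so a square of \<open>\<U>/\<X>\<close>
  becomes a strict square at the last map of a triangle.

  On the side of the correspondence, approximations by the heart take two stages: an approximation
  by \<open>\<U>\<close>, then the third vertex of a triangle on a minimal approximation from the
  other side. Minimality comes from counting dimensions in endomorphism algebras, without
  decomposing objects into indecomposables. Maximality excludes those \<open>\<U>\<close> that are
  strictly smaller than \<open>\<^sup>\<bottom>\<X>[1]\<close> but have the same heart.\<close>

definition arrow :: "('o, 'm, 'z) precat_scheme \<Rightarrow> 'm \<Rightarrow> 'o \<Rightarrow> 'o \<Rightarrow> bool"
    ("\<guillemotleft>_ :/ _ \<rightarrow>\<index> _\<guillemotright>") where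
  "arrow C f A B \<longleftrightarrow> A \<in> Ob C \<and> B \<in> Ob C \<and> f \<in> Hom C A B"

definition ar :: "('o, 'm, 'z) precat_scheme \<Rightarrow> 'm \<Rightarrow> bool" where
  "ar C f \<longleftrightarrow> (\<exists>A B. arrow C f A B)"

text \<open>Well defined because distinct Hom sets are disjoint. Reading the ends off a morphism
  lets composites be simplified equationally, with side conditions on ends in place of membership in
  Hom sets.\<close>

definition src :: "('o, 'm, 'z) precat_scheme \<Rightarrow> 'm \<Rightarrow> 'o" where
  "src C f = (THE A. \<exists>B. arrow C f A B)"

definition tgt :: "('o, 'm, 'z) precat_scheme \<Rightarrow> 'm \<Rightarrow> 'o" where
  "tgt C f = (THE B. \<exists>A. arrow C f A B)"

lemma arrowI: "\<lbrakk>A \<in> Ob C; B \<in> Ob C; f \<in> Hom C A B\<rbrakk> \<Longrightarrow> arrow C f A B"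
  by (simp add: arrow_def)

lemma arrow_Hom: "arrow C f A B \<Longrightarrow> f \<in> Hom C A B"
  by (simp add: arrow_def)

lemma in_Hom_iff: "\<lbrakk>A \<in> Ob C; B \<in> Ob C\<rbrakk> \<Longrightarrow> f \<in> Hom C A B \<longleftrightarrow> arrow C f A B"
  by (simp add: arrow_def)

lemma arrow_Ob: "arrow C f A B \<Longrightarrow> A \<in> Ob C \<and> B \<in> Ob C"
  by (simp add: arrow_def)

definition is_iso :: "('o, 'm, 'z) precat_scheme \<Rightarrow> 'm \<Rightarrow> bool" where
  "is_iso C f \<longleftrightarrow> ar C f \<and> (\<exists>g. arrow C g (tgt C f) (src C f) \<and>
     g \<bullet>\<^bsub>C\<^esub> f = Ident C (src C f) \<and> f \<bullet>\<^bsub>C\<^esub> g = Ident C (tgt C f))"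

definition inv_of :: "('o, 'm, 'z) precat_scheme \<Rightarrow> 'm \<Rightarrow> 'm" where
  "inv_of C f = (SOME g. arrow C g (tgt C f) (src C f) \<and>
     g \<bullet>\<^bsub>C\<^esub> f = Ident C (src C f) \<and> f \<bullet>\<^bsub>C\<^esub> g = Ident C (tgt C f))"

context category
begin

lemma arrow_iff [simp]:
  "\<guillemotleft>f : A \<rightarrow> B\<guillemotright> \<longleftrightarrow> ar C f \<and> src C f = A \<and> tgt C f = B"
proof -
  have *: "src C f = A \<and> tgt C f = B" if "\<guillemotleft>f : A \<rightarrow> B\<guillemotright>" for A B
    unfolding src_def tgt_def
    by (intro conjI the_equality) (use that Hom_disjoint in \<open>auto simp: arrow_def\<close>)
  show ?thesis
    using * unfolding ar_def by metis
qed

lemma ar_Ob [simp]: "ar C f \<Longrightarrow> src C f \<in> Ob C" "ar C f \<Longrightarrow> tgt C f \<in> Ob C"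
  using arrow_Ob arrow_iff by metis+

lemma Hom_arrow: "\<lbrakk>f \<in> Hom C A B; A \<in> Ob C; B \<in> Ob C\<rbrakk> \<Longrightarrow> ar C f \<and> src C f = A \<and> tgt C f = B"
  using arrow_iff arrowI by metis

lemma Hom_iff: "\<lbrakk>A \<in> Ob C; B \<in> Ob C\<rbrakk> \<Longrightarrow> f \<in> Hom C A B \<longleftrightarrow> ar C f \<and> src C f = A \<and> tgt C f = B"
  using arrow_iff in_Hom_iff by metis

lemma arrow_self: "ar C f \<Longrightarrow> f \<in> Hom C (src C f) (tgt C f)"
  using arrow_Hom arrow_iff by metis

lemma Ident_arrow [simp]:
  assumes "A \<in> Ob C"
  shows "ar C (Ident C A)" "src C (Ident C A) = A" "tgt C (Ident C A) = A"
  using Hom_arrow Ident_closed assms by metis+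

lemma Comp_arrow [simp]:
  assumes "ar C f" "ar C g" "src C g = tgt C f"
  shows "ar C (g \<bullet> f)" "src C (g \<bullet> f) = src C f" "tgt C (g \<bullet> f) = tgt C g"
proof -
  have "g \<bullet> f \<in> Hom C (src C f) (tgt C g)"
    using Comp_closed[of "src C f" "tgt C f" "tgt C g" f g] arrow_self assms
    by (metis ar_Ob(1,2))
  then show "ar C (g \<bullet> f)" "src C (g \<bullet> f) = src C f" "tgt C (g \<bullet> f) = tgt C g"
    using Hom_arrow assms by simp_all
qed

lemma Comp_Ident' [simp]: "\<lbrakk>ar C f; src C f = A\<rbrakk> \<Longrightarrow> f \<bullet> Ident C A = f"
  using Comp_Ident arrow_self ar_Ob by metis

lemma Ident_Comp' [simp]: "\<lbrakk>ar C f; tgt C f = A\<rbrakk> \<Longrightarrow> Ident C A \<bullet> f = f"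
  using Ident_Comp arrow_self ar_Ob by metis

lemma Comp_assoc' [simp]:
  assumes "ar C f" "ar C g" "ar C h" "src C g = tgt C f" "src C h = tgt C g"
  shows "(h \<bullet> g) \<bullet> f = h \<bullet> (g \<bullet> f)"
  using Comp_assoc[of "src C f" "tgt C f" "tgt C g" "tgt C h" f g h] assms arrow_self ar_Ob
  by metis

text \<open>Compositions are normalised to the right; this turns an equation between composites into one
  that applies inside a longer composite.\<close>

lemma Comp_reduce:
  assumes "g \<bullet> f = k" "ar C f" "ar C g" "src C g = tgt C f" "ar C x" "src C f = tgt C x"
  shows "g \<bullet> (f \<bullet> x) = k \<bullet> x"
  using assms Comp_assoc' by metis

lemma isoI:
  assumes "ar C f" "ar C g" "src C g = tgt C f" "tgt C g = src C f"
    "g \<bullet> f = Ident C (src C f)" "f \<bullet> g = Ident C (tgt C f)"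
  shows "is_iso C f"
  using assms unfolding is_iso_def by auto

lemma iso_ar [simp]: "is_iso C f \<Longrightarrow> ar C f"
  by (simp add: is_iso_def)

lemma inv_of_props [simp]:
  assumes "is_iso C f"
  shows "ar C (inv_of C f)" "src C (inv_of C f) = tgt C f" "tgt C (inv_of C f) = src C f"
    "inv_of C f \<bullet> f = Ident C (src C f)" "f \<bullet> inv_of C f = Ident C (tgt C f)"
proof -
  have "\<guillemotleft>inv_of C f : tgt C f \<rightarrow> src C f\<guillemotright> \<and>
     inv_of C f \<bullet> f = Ident C (src C f) \<and> f \<bullet> inv_of C f = Ident C (tgt C f)"
    using assms unfolding is_iso_def inv_of_def by (metis (mono_tags, lifting) someI_ex)
  then show "ar C (inv_of C f)" "src C (inv_of C f) = tgt C f" "tgt C (inv_of C f) = src C f"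
    "inv_of C f \<bullet> f = Ident C (src C f)" "f \<bullet> inv_of C f = Ident C (tgt C f)"
    by simp_all
qed

lemma inv_of_cancel [simp]:
  "\<lbrakk>is_iso C f; ar C x; tgt C x = src C f\<rbrakk> \<Longrightarrow> inv_of C f \<bullet> (f \<bullet> x) = x"
  "\<lbrakk>is_iso C f; ar C x; tgt C x = tgt C f\<rbrakk> \<Longrightarrow> f \<bullet> (inv_of C f \<bullet> x) = x"
  by (subst Comp_reduce, (rule inv_of_props; simp), simp_all)+

lemma iso_inv_of [simp]: "is_iso C f \<Longrightarrow> is_iso C (inv_of C f)"
  by (rule isoI[where g = f]) simp_all

lemma iso_Ident [simp]: "A \<in> Ob C \<Longrightarrow> is_iso C (Ident C A)"
  by (rule isoI[where g = "Ident C A"]) simp_all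

lemma iso_Comp [simp]: "\<lbrakk>is_iso C f; is_iso C g; src C g = tgt C f\<rbrakk> \<Longrightarrow> is_iso C (g \<bullet> f)"
  by (rule isoI[where g = "inv_of C f \<bullet> inv_of C g"]) simp_all

lemma iso_cancel_right:
  assumes "is_iso C f" "ar C x" "ar C y" "src C x = tgt C f" "src C y = tgt C f" "x \<bullet> f = y \<bullet> f"
  shows "x = y"
proof -
  have "(x \<bullet> f) \<bullet> inv_of C f = (y \<bullet> f) \<bullet> inv_of C f"
    using assms by simp
  then show ?thesis
    using assms(1-5) by simp
qed

lemma iso_cancel_left:
  assumes "is_iso C f" "ar C x" "ar C y" "tgt C x = src C f" "tgt C y = src C f" "f \<bullet> x = f \<bullet> y"
  shows "x = y"
proof -
  have "inv_of C f \<bullet> (f \<bullet> x) = inv_of C f \<bullet> (f \<bullet> y)"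
    using assms(6) by (simp only:)
  then show ?thesis
    using assms(1-5) by simp
qed

lemma isos_iff: "\<lbrakk>A \<in> Ob C; B \<in> Ob C\<rbrakk> \<Longrightarrow> f \<in> isos C A B \<longleftrightarrow> is_iso C f \<and> src C f = A \<and> tgt C f = B"
  unfolding isos_def is_iso_def using Hom_iff arrow_iff by auto

lemma isomorphic_iff:
  "\<lbrakk>A \<in> Ob C; B \<in> Ob C\<rbrakk> \<Longrightarrow> isomorphic C A B \<longleftrightarrow> (\<exists>f. is_iso C f \<and> src C f = A \<and> tgt C f = B)"
  unfolding isomorphic_def using isos_iff by blast

lemma isomorphic_refl: "A \<in> Ob C \<Longrightarrow> isomorphic C A A"
  using isomorphic_iff iso_Ident Ident_arrow by blast

lemma isomorphic_sym: "\<lbrakk>A \<in> Ob C; B \<in> Ob C; isomorphic C A B\<rbrakk> \<Longrightarrow> isomorphic C B A"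
  by (metis inv_of_props(2,3) iso_inv_of isomorphic_iff)

lemma isomorphic_trans:
  assumes "A \<in> Ob C" "B \<in> Ob C" "D \<in> Ob C" "isomorphic C A B" "isomorphic C B D"
  shows "isomorphic C A D"
proof -
  obtain f g where "is_iso C f" "src C f = A" "tgt C f = B" "is_iso C g" "src C g = B" "tgt C g = D"
    using assms isomorphic_iff by metis
  then show ?thesis
    using assms isomorphic_iff[of A D] by (intro iffD2[OF isomorphic_iff] exI[of _ "g \<bullet> f"]) simp_all
qed

text \<open>The inverses of the two composites yield a left inverse and a right inverse of
  \<open>f\<close>, and these coincide.\<close>

lemma iso_of_left_right:
  assumes "ar C f" "ar C g" "ar C h" "src C g = tgt C f" "src C f = tgt C h"
    "is_iso C (g \<bullet> f)" "is_iso C (f \<bullet> h)"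
  shows "is_iso C f"
proof -
  define l where "l = inv_of C (g \<bullet> f) \<bullet> g"
  define r where "r = h \<bullet> inv_of C (f \<bullet> h)"
  have gf: "inv_of C (g \<bullet> f) \<bullet> (g \<bullet> f) = Ident C (src C f)"
    and fh: "f \<bullet> (h \<bullet> inv_of C (f \<bullet> h)) = Ident C (tgt C f)"
    using assms inv_of_props(4)[of "g \<bullet> f"] inv_of_props(5)[of "f \<bullet> h"]
      Comp_assoc'[of "inv_of C (f \<bullet> h)" h f] by simp_all
  have l: "ar C l" "src C l = tgt C f" "tgt C l = src C f" "l \<bullet> f = Ident C (src C f)"
    using assms gf by (simp_all add: l_def)
  have r: "ar C r" "src C r = tgt C f" "tgt C r = src C f" "f \<bullet> r = Ident C (tgt C f)"
    using assms fh by (simp_all add: r_def)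
  have "l = r"
    using Comp_assoc'[of r f l] l r assms(1) by simp
  then show ?thesis
    using isoI[of f l] l r assms by simp
qed

lemma inv_of_square:
  assumes "is_iso C a" "is_iso C b" "ar C f" "ar C g" "src C a = src C f" "src C b = tgt C f"
    "src C g = tgt C a" "tgt C g = tgt C b" "b \<bullet> f = g \<bullet> a"
  shows "inv_of C b \<bullet> g = f \<bullet> inv_of C a"
proof (rule iso_cancel_right[of a])
  have "(inv_of C b \<bullet> g) \<bullet> a = inv_of C b \<bullet> (b \<bullet> f)"
    using assms by simp
  also have "\<dots> = (f \<bullet> inv_of C a) \<bullet> a"
    using assms(1-8) by simp
  finally show "(inv_of C b \<bullet> g) \<bullet> a = (f \<bullet> inv_of C a) \<bullet> a" .
qed (use assms(1-8) in simp_all)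

end

section \<open>Arithmetic of maps, zero objects and biproducts\<close>

section \<open>Preadditive categories\<close>

definition neg :: "('o, 'm, 'z) preadd_scheme \<Rightarrow> 'm \<Rightarrow> 'm" where
  "neg C f = Neg C (src C f) (tgt C f) f"

definition diff :: "('o, 'm, 'z) preadd_scheme \<Rightarrow> 'm \<Rightarrow> 'm \<Rightarrow> 'm" where
  "diff C f g = Add C f (neg C g)"

context preadditive_category
begin

lemma hom_group_sel [simp]:
  "carrier (hom_group C A B) = Hom C A B" "mult (hom_group C A B) = Add C"
  "one (hom_group C A B) = Zero C A B"
  by (simp_all add: hom_group_def)

lemma hom_group_group: "\<lbrakk>A \<in> Ob C; B \<in> Ob C\<rbrakk> \<Longrightarrow> group (hom_group C A B)"
  using hom_comm_group comm_group.axioms(2) by blast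

lemma Zero_arrow [simp]:
  assumes "A \<in> Ob C" "B \<in> Ob C"
  shows "ar C (Zero C A B)" "src C (Zero C A B) = A" "tgt C (Zero C A B) = B"
  using group.is_monoid[OF hom_group_group[OF assms]] monoid.one_closed Hom_arrow[OF _ assms]
  by fastforce+

lemma Add_arrow [simp]:
  assumes "ar C f" "ar C g" "src C g = src C f" "tgt C g = tgt C f"
  shows "ar C (Add C f g)" "src C (Add C f g) = src C f" "tgt C (Add C f g) = tgt C f"
proof -
  have "Add C f g \<in> Hom C (src C f) (tgt C f)"
    using monoid.m_closed[OF group.is_monoid[OF hom_group_group]] assms arrow_self ar_Ob
    by (metis hom_group_sel(1,2))
  then show "ar C (Add C f g)" "src C (Add C f g) = src C f" "tgt C (Add C f g) = tgt C f"
    using Hom_arrow assms by simp_all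
qed

lemma neg_arrow [simp]:
  assumes "ar C f"
  shows "ar C (neg C f)" "src C (neg C f) = src C f" "tgt C (neg C f) = tgt C f"
proof -
  have "neg C f \<in> Hom C (src C f) (tgt C f)"
    unfolding neg_def Neg_def
    using group.inv_closed[OF hom_group_group] assms arrow_self ar_Ob by (metis hom_group_sel(1))
  then show "ar C (neg C f)" "src C (neg C f) = src C f" "tgt C (neg C f) = tgt C f"
    using Hom_arrow assms by simp_all
qed

lemma Neg_eq: "\<lbrakk>ar C f; src C f = A; tgt C f = B\<rbrakk> \<Longrightarrow> Neg C A B f = neg C f"
  by (simp add: neg_def)

lemma Add_assoc [simp]:
  assumes "ar C f" "ar C g" "ar C h" "src C g = src C f" "tgt C g = tgt C f"
    "src C h = src C f" "tgt C h = tgt C f"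
  shows "Add C (Add C f g) h = Add C f (Add C g h)"
  using monoid.m_assoc[OF group.is_monoid[OF hom_group_group[of "src C f" "tgt C f"]], of f g h]
    assms arrow_self[of f] arrow_self[of g] arrow_self[of h] by simp

lemma Add_commute:
  assumes "ar C f" "ar C g" "src C g = src C f" "tgt C g = tgt C f"
  shows "Add C f g = Add C g f"
  using comm_monoid.m_comm[OF comm_group.axioms(1)[OF hom_comm_group[of "src C f" "tgt C f"]], of f g]
    assms arrow_self[of f] arrow_self[of g] by simp

lemma Add_Zero [simp]:
  assumes "ar C f" "src C f = A" "tgt C f = B"
  shows "Add C f (Zero C A B) = f" "Add C (Zero C A B) f = f"
  using monoid.r_one[OF group.is_monoid[OF hom_group_group[of A B]], of f]
    monoid.l_one[OF group.is_monoid[OF hom_group_group[of A B]], of f] assms arrow_self[of f] ar_Ob[of f]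
  by simp_all

lemma Add_neg [simp]:
  assumes "ar C f"
  shows "Add C f (neg C f) = Zero C (src C f) (tgt C f)"
    "Add C (neg C f) f = Zero C (src C f) (tgt C f)"
  using group.r_inv[OF hom_group_group[of "src C f" "tgt C f"], of f]
    group.l_inv[OF hom_group_group[of "src C f" "tgt C f"], of f] assms arrow_self[of f]
  unfolding neg_def Neg_def by simp_all

lemma Add_neg_cancel [simp]:
  assumes "ar C f" "ar C g" "src C g = src C f" "tgt C g = tgt C f"
  shows "Add C f (Add C (neg C f) g) = g" "Add C (neg C f) (Add C f g) = g"
  using Add_assoc[of f "neg C f" g] Add_assoc[of "neg C f" f g] assms by simp_all

lemma Comp_Add' [simp]:
  assumes "ar C f" "ar C f'" "ar C g" "src C f' = src C f" "tgt C f' = tgt C f" "src C g = tgt C f"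
  shows "g \<bullet> Add C f f' = Add C (g \<bullet> f) (g \<bullet> f')"
  using Comp_Add[of "src C f" "tgt C f" "tgt C g" f f' g] assms arrow_self[of f] arrow_self[of f']
    arrow_self[of g] by simp

lemma Add_Comp' [simp]:
  assumes "ar C f" "ar C g" "ar C g'" "src C g' = src C g" "tgt C g' = tgt C g" "src C g = tgt C f"
  shows "Add C g g' \<bullet> f = Add C (g \<bullet> f) (g' \<bullet> f)"
  using Add_Comp[of "src C f" "tgt C f" "tgt C g" f g g'] assms arrow_self[of f] arrow_self[of g]
    arrow_self[of g'] by simp

lemma neg_unique:
  assumes "ar C f" "ar C g" "src C g = src C f" "tgt C g = tgt C f"
    "Add C f g = Zero C (src C f) (tgt C f)"
  shows "g = neg C f"
  by (metis Add_Zero(1) Add_neg_cancel(2) assms neg_arrow)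

text \<open>Through this, additivity alone gives that composition and additive functors preserve
  zero maps.\<close>

lemma Add_idem_Zero:
  assumes "ar C f" "Add C f f = f"
  shows "f = Zero C (src C f) (tgt C f)"
  by (metis Add_neg(2) Add_neg_cancel(2) assms)

lemma Comp_Zero [simp]:
  assumes "ar C g" "A \<in> Ob C" "src C g = B"
  shows "g \<bullet> Zero C A B = Zero C A (tgt C g)"
proof -
  have B: "B \<in> Ob C"
    using assms by auto
  have "Add C (g \<bullet> Zero C A B) (g \<bullet> Zero C A B) = g \<bullet> Zero C A B"
    using assms B by (subst Comp_Add'[symmetric]) simp_all
  then show ?thesis
    using Add_idem_Zero[of "g \<bullet> Zero C A B"] assms B by simp
qed

lemma Zero_Comp [simp]:
  assumes "ar C f" "B \<in> Ob C" "tgt C f = A"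
  shows "Zero C A B \<bullet> f = Zero C (src C f) B"
proof -
  have A: "A \<in> Ob C"
    using assms by auto
  have "Add C (Zero C A B \<bullet> f) (Zero C A B \<bullet> f) = Zero C A B \<bullet> f"
    using assms A by (subst Add_Comp'[symmetric]) simp_all
  then show ?thesis
    using Add_idem_Zero[of "Zero C A B \<bullet> f"] assms A by simp
qed

lemma neg_neg [simp]: "ar C f \<Longrightarrow> neg C (neg C f) = f"
  by (rule neg_unique[symmetric]) simp_all

lemma neg_Zero [simp]: "\<lbrakk>A \<in> Ob C; B \<in> Ob C\<rbrakk> \<Longrightarrow> neg C (Zero C A B) = Zero C A B"
  by (rule neg_unique[symmetric]) simp_all

lemma Comp_neg [simp]:
  assumes "ar C f" "ar C g" "src C g = tgt C f"
  shows "g \<bullet> neg C f = neg C (g \<bullet> f)" "neg C g \<bullet> f = neg C (g \<bullet> f)"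
proof -
  have "Add C (g \<bullet> f) (g \<bullet> neg C f) = Zero C (src C f) (tgt C g)"
    using assms by (subst Comp_Add'[symmetric]) simp_all
  then show "g \<bullet> neg C f = neg C (g \<bullet> f)"
    using assms by (intro neg_unique) simp_all
  have "Add C (g \<bullet> f) (neg C g \<bullet> f) = Zero C (src C f) (tgt C g)"
    using assms by (subst Add_Comp'[symmetric]) simp_all
  then show "neg C g \<bullet> f = neg C (g \<bullet> f)"
    using assms by (intro neg_unique) simp_all
qed

lemma neg_eq_iff [simp]: "\<lbrakk>ar C f; ar C g\<rbrakk> \<Longrightarrow> neg C f = neg C g \<longleftrightarrow> f = g"
  by (metis neg_neg)

lemma iso_neg [simp]: "is_iso C f \<Longrightarrow> is_iso C (neg C f)"
  by (rule isoI[where g = "neg C (inv_of C f)"]) simp_all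

lemma diff_arrow [simp]:
  assumes "ar C f" "ar C g" "src C g = src C f" "tgt C g = tgt C f"
  shows "ar C (diff C f g)" "src C (diff C f g) = src C f" "tgt C (diff C f g) = tgt C f"
  using assms by (simp_all add: diff_def)

lemma diff_self [simp]: "ar C f \<Longrightarrow> diff C f f = Zero C (src C f) (tgt C f)"
  by (simp add: diff_def)

lemma diff_eq_Zero_iff:
  assumes "ar C f" "ar C g" "src C g = src C f" "tgt C g = tgt C f"
  shows "diff C f g = Zero C (src C f) (tgt C f) \<longleftrightarrow> f = g"
  by (metis assms diff_def diff_self neg_arrow neg_neg neg_unique)

lemma Comp_diff [simp]:
  assumes "ar C f" "ar C f'" "ar C g" "src C f' = src C f" "tgt C f' = tgt C f" "src C g = tgt C f"
  shows "g \<bullet> diff C f f' = diff C (g \<bullet> f) (g \<bullet> f')"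
  using assms by (simp add: diff_def)

lemma diff_Comp [simp]:
  assumes "ar C f" "ar C g" "ar C g'" "src C g' = src C g" "tgt C g' = tgt C g" "src C g = tgt C f"
  shows "diff C g g' \<bullet> f = diff C (g \<bullet> f) (g' \<bullet> f)"
  using assms by (simp add: diff_def)

lemma neg_Add [simp]:
  assumes "ar C f" "ar C g" "src C g = src C f" "tgt C g = tgt C f"
  shows "neg C (Add C f g) = Add C (neg C f) (neg C g)"
proof (rule neg_unique[symmetric])
  have "Add C (Add C f g) (Add C (neg C f) (neg C g)) = Add C (Add C g f) (Add C (neg C f) (neg C g))"
    using assms Add_commute by metis
  then show "Add C (Add C f g) (Add C (neg C f) (neg C g)) = Zero C (src C (Add C f g)) (tgt C (Add C f g))"
    using assms by simp
qed (use assms in simp_all)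

lemma neg_diff: 
  assumes "ar C f" "ar C g" "src C g = src C f" "tgt C g = tgt C f"
  shows "neg C (diff C f g) = diff C g f"
  using assms Add_commute[of "neg C f" g] by (simp add: diff_def)

lemma Add_diff_diff:
  assumes "ar C f" "ar C g" "ar C h" "src C g = src C f" "tgt C g = tgt C f"
    "src C h = src C f" "tgt C h = tgt C f"
  shows "Add C (diff C f g) (diff C g h) = diff C f h"
  using assms by (simp add: diff_def)

lemma diff_Add_Add:
  assumes "ar C f" "ar C g" "ar C f'" "ar C g'" "src C g = src C f" "tgt C g = tgt C f"
    "src C f' = src C f" "tgt C f' = tgt C f" "src C g' = src C f" "tgt C g' = tgt C f"
  shows "diff C (Add C f g) (Add C f' g') = Add C (diff C f f') (diff C g g')"
proof -
  have "Add C g (Add C (neg C f') (neg C g')) = Add C (neg C f') (Add C g (neg C g'))"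
    using assms Add_assoc[of g "neg C f'" "neg C g'"] Add_assoc[of "neg C f'" g "neg C g'"]
      Add_commute[of g "neg C f'"] by simp
  then show ?thesis
    using assms by (simp add: diff_def)
qed

lemma diff_Add_cancel:
  assumes "ar C f" "ar C g" "src C g = src C f" "tgt C g = tgt C f"
  shows "Add C (diff C f g) g = f" "diff C f (diff C f g) = g" "Add C g (diff C f g) = f"
proof -
  show "Add C (diff C f g) g = f"
    using assms by (simp add: diff_def)
  then show "Add C g (diff C f g) = f"
    using assms Add_commute[of g "diff C f g"] by simp
  show "diff C f (diff C f g) = g"
    using assms neg_diff[of f g] Add_neg_cancel Add_commute
    by (simp add: diff_def)
qed

text \<open>The inverse is \<open>1 - n\<close>. In the subfactor this is applied to the difference
  between an endomorphism of a triangle and the identity.\<close>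

lemma iso_Ident_Add:
  assumes "ar C n" "tgt C n = src C n" "n \<bullet> n = Zero C (src C n) (src C n)"
  shows "is_iso C (Add C (Ident C (src C n)) n)"
proof (rule isoI[of _ "diff C (Ident C (src C n)) n"])
  show "diff C (Ident C (src C n)) n \<bullet> Add C (Ident C (src C n)) n
      = Ident C (src C (Add C (Ident C (src C n)) n))"
    "Add C (Ident C (src C n)) n \<bullet> diff C (Ident C (src C n)) n
      = Ident C (tgt C (Add C (Ident C (src C n)) n))"
    using assms by (simp_all add: diff_def)
qed (use assms in simp_all)

text \<open>Reduces the universal property to one equation between endomorphisms, which passes
  directly to images under additive functors and to quotients by an ideal.\<close>

lemma zero_object_iff: "zero_object C Z \<longleftrightarrow> Z \<in> Ob C \<and> Ident C Z = Zero C Z Z"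
proof
  assume "zero_object C Z"
  then show "Z \<in> Ob C \<and> Ident C Z = Zero C Z Z"
    unfolding zero_object_def using arrow_self Ident_arrow Zero_arrow by metis
next
  assume Z: "Z \<in> Ob C \<and> Ident C Z = Zero C Z Z"
  have "f = Zero C A Z" if "A \<in> Ob C" "f \<in> Hom C A Z" for f A
    using that Z Ident_Comp'[of f Z] Zero_Comp[of f Z Z] Hom_arrow[of f A Z] by simp
  moreover have "f = Zero C Z A" if "A \<in> Ob C" "f \<in> Hom C Z A" for f A
    using that Z Comp_Ident'[of f Z] Comp_Zero[of f Z Z] Hom_arrow[of f Z A] by simp
  ultimately show "zero_object C Z"
    unfolding zero_object_def using Z Hom_iff Zero_arrow by (metis (no_types, lifting))
qed

lemma zero_object_Ob: "zero_object C Z \<Longrightarrow> Z \<in> Ob C"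
  by (simp add: zero_object_iff)

lemma zero_object_from: "\<lbrakk>zero_object C Z; ar C f; src C f = Z\<rbrakk> \<Longrightarrow> f = Zero C Z (tgt C f)"
  by (metis Comp_Ident' Comp_Zero ar_Ob(1) zero_object_iff)

lemma zero_object_to: "\<lbrakk>zero_object C Z; ar C f; tgt C f = Z\<rbrakk> \<Longrightarrow> f = Zero C (src C f) Z"
  by (metis Ident_Comp' Zero_Comp ar_Ob(2) zero_object_iff)

lemma is_biproductI:
  assumes "ar C i" "ar C j" "ar C p" "ar C q" "src C i = A" "tgt C i = P" "src C j = B" "tgt C j = P"
    "src C p = P" "tgt C p = A" "src C q = P" "tgt C q = B"
    "p \<bullet> i = Ident C A" "q \<bullet> j = Ident C B" "q \<bullet> i = Zero C A B" "p \<bullet> j = Zero C B A"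
    "Add C (i \<bullet> p) (j \<bullet> q) = Ident C P"
  shows "is_biproduct C A B P"
  unfolding is_biproduct_def using assms arrow_self ar_Ob by metis

lemma is_biproductE:
  assumes "is_biproduct C A B P" "A \<in> Ob C" "B \<in> Ob C"
  obtains i j p q where
    "P \<in> Ob C" "ar C i" "ar C j" "ar C p" "ar C q" "src C i = A" "tgt C i = P" "src C j = B" "tgt C j = P"
    "src C p = P" "tgt C p = A" "src C q = P" "tgt C q = B"
    "p \<bullet> i = Ident C A" "q \<bullet> j = Ident C B" "q \<bullet> i = Zero C A B" "p \<bullet> j = Zero C B A"
    "Add C (i \<bullet> p) (j \<bullet> q) = Ident C P"
  using assms unfolding is_biproduct_def by (metis Hom_iff)

lemma zero_object_iso:
  assumes "zero_object C Z" "zero_object C Z'"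
  shows "is_iso C (Zero C Z Z')"
proof -
  have "Z \<in> Ob C" "Z' \<in> Ob C" "Ident C Z = Zero C Z Z" "Ident C Z' = Zero C Z' Z'"
    using assms by (simp_all add: zero_object_iff)
  then show ?thesis
    by (intro isoI[of "Zero C Z Z'" "Zero C Z' Z"]) simp_all
qed

end

section \<open>Full faithfulness and essential surjectivity, and additive functors\<close>

section \<open>Equivalences\<close>

context category
begin

lemma functor_Ob: "\<lbrakk>is_functor C C F; A \<in> Ob C\<rbrakk> \<Longrightarrow> ob F A \<in> Ob C"
  by (simp add: is_functor_def)

lemma functor_arrow:
  assumes "is_functor C C F" "ar C f"
  shows "ar C (mor F f)" "src C (mor F f) = ob F (src C f)" "tgt C (mor F f) = ob F (tgt C f)"
proof -
  have "mor F f \<in> Hom C (ob F (src C f)) (ob F (tgt C f))"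
    using assms arrow_self ar_Ob unfolding is_functor_def by blast
  then show "ar C (mor F f)" "src C (mor F f) = ob F (src C f)" "tgt C (mor F f) = ob F (tgt C f)"
    using Hom_arrow functor_Ob assms ar_Ob by simp_all
qed

lemma functor_Ident: "\<lbrakk>is_functor C C F; A \<in> Ob C\<rbrakk> \<Longrightarrow> mor F (Ident C A) = Ident C (ob F A)"
  by (simp add: is_functor_def)

lemma functor_Comp:
  assumes "is_functor C C F" "ar C f" "ar C g" "src C g = tgt C f"
  shows "mor F (g \<bullet> f) = mor F g \<bullet> mor F f"
proof -
  have *: "\<And>A B E f g. \<lbrakk>A \<in> Ob C; B \<in> Ob C; E \<in> Ob C; f \<in> Hom C A B; g \<in> Hom C B E\<rbrakk>
      \<Longrightarrow> mor F (g \<bullet> f) = mor F g \<bullet> mor F f"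
    using assms(1) unfolding is_functor_def by blast
  show ?thesis
    by (rule *[of "src C f" "tgt C f" "tgt C g"])
      (use assms(2-4) arrow_self[of f] arrow_self[of g] in simp_all)
qed

lemma is_functorI:
  assumes "\<And>A. A \<in> Ob C \<Longrightarrow> ob F A \<in> Ob C"
    "\<And>f. ar C f \<Longrightarrow> ar C (mor F f) \<and> src C (mor F f) = ob F (src C f) \<and> tgt C (mor F f) = ob F (tgt C f)"
    "\<And>A. A \<in> Ob C \<Longrightarrow> mor F (Ident C A) = Ident C (ob F A)"
    "\<And>f g. \<lbrakk>ar C f; ar C g; src C g = tgt C f\<rbrakk> \<Longrightarrow> mor F (g \<bullet> f) = mor F g \<bullet> mor F f"
  shows "is_functor C C F"
  unfolding is_functor_def using assms by (auto simp: Hom_iff)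

lemma functor_iso:
  assumes "is_functor C C F" "is_iso C f"
  shows "is_iso C (mor F f)" "inv_of C (mor F f) = mor F (inv_of C f)"
proof -
  have 1: "mor F (inv_of C f) \<bullet> mor F f = Ident C (ob F (src C f))"
    "mor F f \<bullet> mor F (inv_of C f) = Ident C (ob F (tgt C f))"
    using assms by (simp_all add: functor_Comp[symmetric] functor_Ident)
  then show is_iso: "is_iso C (mor F f)"
    using assms by (intro isoI[where g = "mor F (inv_of C f)"]) (simp_all add: functor_arrow)
  show "inv_of C (mor F f) = mor F (inv_of C f)"
    by (rule iso_cancel_left[of "mor F f"]) (use assms is_iso 1 in \<open>simp_all add: functor_arrow\<close>)
qed

lemma natural_isoE:
  assumes "natural_iso C C F G \<eta>" "\<And>A. A \<in> Ob C \<Longrightarrow> ob F A \<in> Ob C \<and> ob G A \<in> Ob C"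
  shows "A \<in> Ob C \<Longrightarrow> is_iso C (\<eta> A) \<and> src C (\<eta> A) = ob F A \<and> tgt C (\<eta> A) = ob G A"
    "ar C f \<Longrightarrow> \<eta> (tgt C f) \<bullet> mor F f = mor G f \<bullet> \<eta> (src C f)"
  using assms isos_iff arrow_self ar_Ob unfolding natural_iso_def by metis+

lemma natural_isoI:
  assumes "\<And>A. A \<in> Ob C \<Longrightarrow> ob F A \<in> Ob C \<and> ob G A \<in> Ob C"
    "\<And>A. A \<in> Ob C \<Longrightarrow> is_iso C (\<eta> A) \<and> src C (\<eta> A) = ob F A \<and> tgt C (\<eta> A) = ob G A"
    "\<And>f. ar C f \<Longrightarrow> \<eta> (tgt C f) \<bullet> mor F f = mor G f \<bullet> \<eta> (src C f)"
  shows "natural_iso C C F G \<eta>"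
  unfolding natural_iso_def
proof (intro conjI ballI)
  show "\<eta> A \<in> isos C (ob F A) (ob G A)" if "A \<in> Ob C" for A
    using assms that isos_iff by simp
  show "\<eta> B \<bullet> mor F f = mor G f \<bullet> \<eta> A" if "A \<in> Ob C" "B \<in> Ob C" "f \<in> Hom C A B" for A B f
    using assms(3)[of f] that Hom_iff by simp
qed

context
  fixes F
  assumes F: "is_equivalence C C F"
begin

lemma equivalence_functor: "is_functor C C F"
  using F by (auto simp: is_equivalence_def quasi_inverse_def)

text \<open>Despite the name, \<open>\<eta>\<close> and \<open>\<epsilon>\<close> are two unrelated
  natural isomorphisms: no triangle identities link them, since \<open>quasi_inverse\<close>
  provides none.\<close>

definition adjoint_inverse where
  "adjoint_inverse G \<eta> \<epsilon> \<longleftrightarrow> is_functor C C G \<and>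
    (\<forall>A \<in> Ob C. is_iso C (\<eta> A) \<and> src C (\<eta> A) = A \<and> tgt C (\<eta> A) = ob G (ob F A)) \<and>
    (\<forall>f. ar C f \<longrightarrow> \<eta> (tgt C f) \<bullet> f = mor G (mor F f) \<bullet> \<eta> (src C f)) \<and>
    (\<forall>A \<in> Ob C. is_iso C (\<epsilon> A) \<and> src C (\<epsilon> A) = ob F (ob G A) \<and> tgt C (\<epsilon> A) = A) \<and>
    (\<forall>f. ar C f \<longrightarrow> \<epsilon> (tgt C f) \<bullet> mor F (mor G f) = f \<bullet> \<epsilon> (src C f))"

lemma ex_adjoint_inverse: "\<exists>G \<eta> \<epsilon>. adjoint_inverse G \<eta> \<epsilon>"
proof -
  obtain G \<eta> \<epsilon> where G: "is_functor C C G"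
    and \<eta>: "natural_iso C C id_func (comp_func G F) \<eta>"
    and \<epsilon>: "natural_iso C C (comp_func F G) id_func \<epsilon>"
    using F unfolding is_equivalence_def quasi_inverse_def by auto
  have "ob G (ob F A) \<in> Ob C" "ob F (ob G A) \<in> Ob C" if "A \<in> Ob C" for A
    using that functor_Ob G equivalence_functor by simp_all
  then have "adjoint_inverse G \<eta> \<epsilon>"
    unfolding adjoint_inverse_def
    using G natural_isoE[OF \<eta>] natural_isoE[OF \<epsilon>] by (simp add: id_func_def comp_func_def)
  then show ?thesis
    by blast
qed

lemma adjoint_inverseD:
  assumes "adjoint_inverse G \<eta> \<epsilon>"
  shows "is_functor C C G"
    "\<And>A. A \<in> Ob C \<Longrightarrow> is_iso C (\<eta> A) \<and> src C (\<eta> A) = A \<and> tgt C (\<eta> A) = ob G (ob F A)"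
    "\<And>f. ar C f \<Longrightarrow> \<eta> (tgt C f) \<bullet> f = mor G (mor F f) \<bullet> \<eta> (src C f)"
    "\<And>A. A \<in> Ob C \<Longrightarrow> is_iso C (\<epsilon> A) \<and> src C (\<epsilon> A) = ob F (ob G A) \<and> tgt C (\<epsilon> A) = A"
    "\<And>f. ar C f \<Longrightarrow> \<epsilon> (tgt C f) \<bullet> mor F (mor G f) = f \<bullet> \<epsilon> (src C f)"
  using assms unfolding adjoint_inverse_def by simp_all

lemma equivalence_faithful:
  assumes "ar C f" "ar C g" "src C f = src C g" "tgt C f = tgt C g" "mor F f = mor F g"
  shows "f = g"
proof -
  obtain G \<eta> \<epsilon> where "adjoint_inverse G \<eta> \<epsilon>"
    using ex_adjoint_inverse by blast
  note G = adjoint_inverseD[OF this]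
  have *: "\<eta> (tgt C f) \<bullet> f = \<eta> (tgt C f) \<bullet> g"
    using G(3)[of f] G(3)[of g] assms by simp
  show ?thesis
    by (rule iso_cancel_left[OF _ _ _ _ _ *]) (use assms(1-4) G(2)[of "tgt C g"] in simp_all)
qed

lemma equivalence_full:
  assumes "A \<in> Ob C" "B \<in> Ob C" "ar C h" "src C h = ob F A" "tgt C h = ob F B"
  obtains f where "ar C f" "src C f = A" "tgt C f = B" "mor F f = h"
proof -
  obtain G \<eta> \<epsilon> where "adjoint_inverse G \<eta> \<epsilon>"
    using ex_adjoint_inverse by blast
  note G = adjoint_inverseD[OF this]
  note F' = functor_arrow[OF equivalence_functor]
  note G' = functor_arrow[OF G(1)]
  define f where "f = inv_of C (\<eta> B) \<bullet> (mor G h \<bullet> \<eta> A)"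
  have f: "ar C f" "src C f = A" "tgt C f = B"
    using G(2) assms by (simp_all add: f_def G')
  have "mor G (mor F f) \<bullet> \<eta> A = \<eta> B \<bullet> f"
    using G(3)[of f] f by simp
  also have "\<dots> = mor G h \<bullet> \<eta> A"
    using G(2) assms by (simp add: f_def G')
  finally have *: "mor G (mor F f) \<bullet> \<eta> A = mor G h \<bullet> \<eta> A" .
  have Geq: "mor G (mor F f) = mor G h"
    by (rule iso_cancel_right[of "\<eta> A"]) (use * G(2)[of A] assms f in \<open>simp_all add: F' G'\<close>)
  \<comment> \<open>At this point \<open>f\<close> is only known to have the right image under
    \<open>G F\<close>. Applying \<open>F\<close> once more and using naturality of
    \<open>\<epsilon>\<close> on both sides removes \<open>G\<close>.\<close>
  have *: "mor F f \<bullet> \<epsilon> (ob F A) = h \<bullet> \<epsilon> (ob F A)"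
    using G(5)[of "mor F f"] G(5)[of h] f assms Geq F' by simp
  have "mor F f = h"
    by (rule iso_cancel_right[of "\<epsilon> (ob F A)"])
      (use * G(4)[of "ob F A"] assms f F' functor_Ob[OF equivalence_functor] in simp_all)
  then show thesis
    using that f by simp
qed

lemma equivalence_surj:
  assumes "B \<in> Ob C"
  obtains A e where "A \<in> Ob C" "is_iso C e" "src C e = ob F A" "tgt C e = B"
proof -
  obtain G \<eta> \<epsilon> where "adjoint_inverse G \<eta> \<epsilon>"
    using ex_adjoint_inverse by blast
  note G = adjoint_inverseD[OF this]
  then show thesis
    using that[of "ob G B" "\<epsilon> B"] assms functor_Ob[OF G(1)] G(4)[of B] by simp
qed

lemma equivalence_iso_reflect:
  assumes "ar C f" "is_iso C (mor F f)"
  shows "is_iso C f"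
proof -
  note F' = functor_arrow[OF equivalence_functor]
  obtain g where g: "ar C g" "src C g = tgt C f" "tgt C g = src C f" "mor F g = inv_of C (mor F f)"
    using equivalence_full[of "tgt C f" "src C f" "inv_of C (mor F f)"] assms F' by auto
  have "mor F (g \<bullet> f) = mor F (Ident C (src C f))" "mor F (f \<bullet> g) = mor F (Ident C (tgt C f))"
    using g assms by (simp_all add: functor_Comp functor_Ident equivalence_functor F')
  then have "g \<bullet> f = Ident C (src C f)" "f \<bullet> g = Ident C (tgt C f)"
    using equivalence_faithful[of "g \<bullet> f" "Ident C (src C f)"]
      equivalence_faithful[of "f \<bullet> g" "Ident C (tgt C f)"] g assms by simp_all
  then show ?thesis
    using g assms by (intro isoI[of f g]) simp_all
qed

lemma equivalence_isomorphic_iff: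
  assumes "A \<in> Ob C" "B \<in> Ob C"
  shows "isomorphic C (ob F A) (ob F B) \<longleftrightarrow> isomorphic C A B"
proof
  have Ob: "ob F A \<in> Ob C" "ob F B \<in> Ob C"
    using assms functor_Ob[OF equivalence_functor] by simp_all
  show "isomorphic C A B" if is_iso: "isomorphic C (ob F A) (ob F B)"
  proof -
    obtain h where h: "is_iso C h" "src C h = ob F A" "tgt C h = ob F B"
      using is_iso isomorphic_iff[OF Ob] by blast
    obtain f where "ar C f" "src C f = A" "tgt C f = B" "mor F f = h"
      by (rule equivalence_full[OF assms, of h]) (use h in simp_all)
    then show ?thesis
      using equivalence_iso_reflect[of f] h assms isomorphic_iff[of A B] by blast
  qed
  show "isomorphic C (ob F A) (ob F B)" if is_iso: "isomorphic C A B"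
  proof -
    obtain f where "is_iso C f" "src C f = A" "tgt C f = B"
      using is_iso isomorphic_iff[of A B] assms by blast
    then have "is_iso C (mor F f) \<and> src C (mor F f) = ob F A \<and> tgt C (mor F f) = ob F B"
      using functor_arrow[OF equivalence_functor] functor_iso(1)[OF equivalence_functor] by simp
    then show ?thesis
      using isomorphic_iff[OF Ob] by blast
  qed
qed

end

end

context preadditive_category
begin

context
  fixes F
  assumes F: "additive_functor C C F"
begin

lemma additive_is_functor: "is_functor C C F"
  using F by (simp add: additive_functor_def)

lemma additive_Add:
  assumes "ar C f" "ar C g" "src C g = src C f" "tgt C g = tgt C f"
  shows "mor F (Add C f g) = Add C (mor F f) (mor F g)"
proof -
  have *: "\<And>A B f g. \<lbrakk>A \<in> Ob C; B \<in> Ob C; f \<in> Hom C A B; g \<in> Hom C A B\<rbrakk>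
      \<Longrightarrow> mor F (Add C f g) = Add C (mor F f) (mor F g)"
    using F unfolding additive_functor_def by blast
  show ?thesis
    by (rule *[of "src C f" "tgt C f"]) (use assms arrow_self[of f] arrow_self[of g] in simp_all)
qed

lemma additive_Zero:
  assumes "A \<in> Ob C" "B \<in> Ob C"
  shows "mor F (Zero C A B) = Zero C (ob F A) (ob F B)"
proof -
  note F' = functor_arrow[OF additive_is_functor] functor_Ob[OF additive_is_functor]
  have "Add C (mor F (Zero C A B)) (mor F (Zero C A B)) = mor F (Zero C A B)"
    using assms by (simp add: additive_Add[symmetric])
  then show ?thesis
    using Add_idem_Zero[of "mor F (Zero C A B)"] assms F' by simp
qed

lemma additive_neg:
  assumes "ar C f"
  shows "mor F (neg C f) = neg C (mor F f)"
proof (rule neg_unique)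
  note F' = functor_arrow[OF additive_is_functor] functor_Ob[OF additive_is_functor]
  show "Add C (mor F f) (mor F (neg C f)) = Zero C (src C (mor F f)) (tgt C (mor F f))"
    using assms F' by (simp add: additive_Add[symmetric] additive_Zero)
qed (use assms functor_arrow[OF additive_is_functor] in simp_all)

end

end

section \<open>Exactness, shifts and octahedra in a triangulated category\<close>

section \<open>Triangles\<close>

text \<open>Isolates what the arrow forms of candidate triangles and their morphisms depend on, so
  that they apply to the subfactor before it is known to be triangulated.\<close>

locale suspended_category = preadditive_category C
  for C :: "('o, 'm, 'z) triang_scheme" (structure) +
  assumes Sus_functor: "is_functor C C (Sus C)"
begin

lemma candidateI:
  assumes "ar C f" "src C f = A" "tgt C f = B" "ar C g" "src C g = B" "tgt C g = D"
    "ar C h" "src C h = D" "tgt C h = ob (Sus C) A"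
  shows "(A, B, D, f, g, h) \<in> candidate_triangles C"
  using assms arrow_self[of f] arrow_self[of g] arrow_self[of h] ar_Ob
  by (auto simp: candidate_triangles_def)

lemma candidateD:
  assumes "(A, B, D, f, g, h) \<in> candidate_triangles C"
  shows "A \<in> Ob C" "B \<in> Ob C" "D \<in> Ob C"
    "ar C f" "src C f = A" "tgt C f = B" "ar C g" "src C g = B" "tgt C g = D"
    "ar C h" "src C h = D" "tgt C h = ob (Sus C) A"
proof -
  have *: "A \<in> Ob C \<and> B \<in> Ob C \<and> D \<in> Ob C \<and> f \<in> Hom C A B \<and> g \<in> Hom C B D \<and> h \<in> Hom C D (ob (Sus C) A)"
    using assms by (auto simp: candidate_triangles_def)
  moreover have "ob (Sus C) A \<in> Ob C"
    using * functor_Ob[OF Sus_functor] by simp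
  ultimately show "A \<in> Ob C" "B \<in> Ob C" "D \<in> Ob C"
    "ar C f" "src C f = A" "tgt C f = B" "ar C g" "src C g = B" "tgt C g = D"
    "ar C h" "src C h = D" "tgt C h = ob (Sus C) A"
    using Hom_iff by auto
qed

lemma tri_map_iff:
  assumes "(A, B, D, f, g, h) \<in> candidate_triangles C" "(A', B', D', f', g', h') \<in> candidate_triangles C"
  shows "tri_map C (A, B, D, f, g, h) (A', B', D', f', g', h') (a, b, c) \<longleftrightarrow>
    ar C a \<and> src C a = A \<and> tgt C a = A' \<and> ar C b \<and> src C b = B \<and> tgt C b = B' \<and>
    ar C c \<and> src C c = D \<and> tgt C c = D' \<and> b \<bullet> f = f' \<bullet> a \<and> c \<bullet> g = g' \<bullet> b \<and> mor (Sus C) a \<bullet> h = h' \<bullet> c"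
  using assms Hom_iff by (auto simp: candidate_triangles_def)

lemma tri_iso_iff:
  assumes "(A, B, D, f, g, h) \<in> candidate_triangles C" "(A', B', D', f', g', h') \<in> candidate_triangles C"
  shows "tri_iso C (A, B, D, f, g, h) (A', B', D', f', g', h') \<longleftrightarrow>
    (\<exists>a b c. is_iso C a \<and> src C a = A \<and> tgt C a = A' \<and> is_iso C b \<and> src C b = B \<and> tgt C b = B' \<and>
      is_iso C c \<and> src C c = D \<and> tgt C c = D' \<and> b \<bullet> f = f' \<bullet> a \<and> c \<bullet> g = g' \<bullet> b \<and> mor (Sus C) a \<bullet> h = h' \<bullet> c)"
proof -
  have "a \<in> isos C A A' \<longleftrightarrow> is_iso C a \<and> src C a = A \<and> tgt C a = A'"
    "b \<in> isos C B B' \<longleftrightarrow> is_iso C b \<and> src C b = B \<and> tgt C b = B'"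
    "c \<in> isos C D D' \<longleftrightarrow> is_iso C c \<and> src C c = D \<and> tgt C c = D'" for a b c
    using assms isos_iff by (simp_all add: candidate_triangles_def)
  then show ?thesis
    using tri_map_iff[OF assms] iso_ar unfolding tri_iso.simps by blast
qed

end

sublocale triangulated_category \<subseteq> suspended_category T
  by unfold_locales (use Sus_equivalence equivalence_functor in simp)

context triangulated_category
begin

abbreviation sh :: "'o \<Rightarrow> 'o" where
  "sh \<equiv> ob (Sus T)"

abbreviation shm :: "'m \<Rightarrow> 'm" where
  "shm \<equiv> mor (Sus T)"

lemmas sh_Ob [simp] = functor_Ob[OF Sus_functor]
lemmas shm_arrow [simp] = functor_arrow[OF Sus_functor]
lemmas shm_Ident [simp] = functor_Ident[OF Sus_functor]
lemmas shm_Comp [simp] = functor_Comp[OF Sus_functor]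
lemmas shm_iso [simp] = functor_iso[OF Sus_functor]
lemmas shm_Add [simp] = additive_Add[OF Sus_additive]
lemmas shm_Zero [simp] = additive_Zero[OF Sus_additive]
lemmas shm_neg [simp] = additive_neg[OF Sus_additive]
lemmas shm_full = equivalence_full[OF Sus_equivalence]
lemmas shm_surj = equivalence_surj[OF Sus_equivalence]
lemmas sh_isomorphic_iff = equivalence_isomorphic_iff[OF Sus_equivalence]

lemma shm_diff [simp]:
  "\<lbrakk>ar T f; ar T g; src T g = src T f; tgt T g = tgt T f\<rbrakk> \<Longrightarrow> shm (diff T f g) = diff T (shm f) (shm g)"
  by (simp add: diff_def)

lemma shm_eq_iff:
  "\<lbrakk>ar T f; ar T g; src T f = src T g; tgt T f = tgt T g\<rbrakk> \<Longrightarrow> shm f = shm g \<longleftrightarrow> f = g"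
  using equivalence_faithful[OF Sus_equivalence] by blast

lemma shm_inj:
  "\<lbrakk>shm f = shm g; ar T f; ar T g; src T f = src T g; tgt T f = tgt T g\<rbrakk> \<Longrightarrow> f = g"
  using equivalence_faithful[OF Sus_equivalence] by blast

lemma TriD:
  assumes "(A, B, D, f, g, h) \<in> Tri T"
  shows "A \<in> Ob T" "B \<in> Ob T" "D \<in> Ob T"
    "ar T f" "src T f = A" "tgt T f = B" "ar T g" "src T g = B" "tgt T g = D"
    "ar T h" "src T h = D" "tgt T h = sh A"
  using candidateD[of A B D f g h] assms Tri_candidate by auto

lemma Tri_rot:
  assumes "(A, B, D, f, g, h) \<in> Tri T"
  shows "(B, D, sh A, g, h, neg T (shm f)) \<in> Tri T"
  using Tri_rotate[of A B D f g h] assms Tri_candidate TriD[OF assms]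
  by (auto simp: neg_def)

lemma Tri_unrot:
  assumes "(B, D, sh A, g, h, neg T (shm f)) \<in> Tri T" "ar T f" "src T f = A" "tgt T f = B"
  shows "(A, B, D, f, g, h) \<in> Tri T"
  using Tri_rotate[of A B D f g h] assms TriD[OF assms(1)] candidateI[of f A B g D h]
  by (simp add: neg_def)

lemma Tri_isoI:
  assumes "(A, B, D, f, g, h) \<in> Tri T" "is_iso T a" "is_iso T b" "is_iso T c" "src T a = A" "src T b = B"
    "src T c = D" "ar T f'" "ar T g'" "ar T h'"
    "src T f' = tgt T a" "tgt T f' = tgt T b" "src T g' = tgt T b" "tgt T g' = tgt T c"
    "src T h' = tgt T c" "tgt T h' = sh (tgt T a)"
    "b \<bullet> f = f' \<bullet> a" "c \<bullet> g = g' \<bullet> b" "shm a \<bullet> h = h' \<bullet> c"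
  shows "(tgt T a, tgt T b, tgt T c, f', g', h') \<in> Tri T"
proof (rule Tri_iso_closed[OF assms(1)])
  show cand: "(tgt T a, tgt T b, tgt T c, f', g', h') \<in> candidate_triangles T"
    using assms by (intro candidateI) simp_all
  show "tri_iso T (A, B, D, f, g, h) (tgt T a, tgt T b, tgt T c, f', g', h')"
    using assms Tri_candidate by (subst tri_iso_iff[OF _ cand]) blast+
qed

text \<open>Replacing the identity by its negative at a single vertex is an isomorphism of triangles
  and changes the signs of the two adjacent maps.\<close>

lemma Tri_neg:
  assumes "(A, B, D, f, g, h) \<in> Tri T"
  shows "(A, B, D, neg T f, neg T g, h) \<in> Tri T" "(A, B, D, neg T f, g, neg T h) \<in> Tri T"
    "(A, B, D, f, neg T g, neg T h) \<in> Tri T"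
proof -
  note t = TriD[OF assms]
  show "(A, B, D, neg T f, neg T g, h) \<in> Tri T"
    using Tri_isoI[OF assms, of "Ident T A" "neg T (Ident T B)" "Ident T D" "neg T f" "neg T g" h] t by simp
  show "(A, B, D, neg T f, g, neg T h) \<in> Tri T"
    using Tri_isoI[OF assms, of "neg T (Ident T A)" "Ident T B" "Ident T D" "neg T f" g "neg T h"] t by simp
  show "(A, B, D, f, neg T g, neg T h) \<in> Tri T"
    using Tri_isoI[OF assms, of "Ident T A" "Ident T B" "neg T (Ident T D)" f "neg T g" "neg T h"] t by simp
qed

lemma Tri_map3:
  assumes "(A, B, D, f, g, h) \<in> Tri T" "(A', B', D', f', g', h') \<in> Tri T"
    "ar T a" "src T a = A" "tgt T a = A'" "ar T b" "src T b = B" "tgt T b = B'" "b \<bullet> f = f' \<bullet> a"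
  obtains c where "ar T c" "src T c = D" "tgt T c = D'" "c \<bullet> g = g' \<bullet> b" "h' \<bullet> c = shm a \<bullet> h"
proof -
  obtain c where "tri_map T (A, B, D, f, g, h) (A', B', D', f', g', h') (a, b, c)"
    using Tri_map_complete[OF assms(1,2), of a b] assms(3-) arrow_self[of a] arrow_self[of b] by auto
  then have "ar T c \<and> src T c = D \<and> tgt T c = D' \<and> c \<bullet> g = g' \<bullet> b \<and> h' \<bullet> c = shm a \<bullet> h"
    using assms(1,2) Tri_candidate by (subst (asm) tri_map_iff) auto
  then show thesis
    using that by blast
qed

text \<open>After two rotations \<open>c\<close> and \<open>a[1]\<close> are the first two
  components. The completed component then lies between suspensions and descends by fullness, its
  equations by faithfulness.\<close>

lemma Tri_map2:
  assumes "(A, B, D, f, g, h) \<in> Tri T" "(A', B', D', f', g', h') \<in> Tri T"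
    "ar T a" "src T a = A" "tgt T a = A'" "ar T c" "src T c = D" "tgt T c = D'" "h' \<bullet> c = shm a \<bullet> h"
  obtains b where "ar T b" "src T b = B" "tgt T b = B'" "b \<bullet> f = f' \<bullet> a" "c \<bullet> g = g' \<bullet> b"
proof -
  note t = TriD[OF assms(1)] and t' = TriD[OF assms(2)]
  obtain \<beta> where \<beta>: "ar T \<beta>" "src T \<beta> = sh B" "tgt T \<beta> = sh B'"
    "\<beta> \<bullet> neg T (shm f) = neg T (shm f') \<bullet> shm a" "neg T (shm g') \<bullet> \<beta> = shm c \<bullet> neg T (shm g)"
    by (rule Tri_map3[OF Tri_rot[OF Tri_rot[OF assms(1)]] Tri_rot[OF Tri_rot[OF assms(2)]], of c "shm a"])
      (use assms t t' in simp_all)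
  obtain b where b: "ar T b" "src T b = B" "tgt T b = B'" "shm b = \<beta>"
    using shm_full[of B B' \<beta>] \<beta> t t' by auto
  have "b \<bullet> f = f' \<bullet> a"
    by (rule shm_inj) (use \<beta>(4)[folded b(4)] b(1-3) t t' assms(3-8) in simp_all)
  moreover have "c \<bullet> g = g' \<bullet> b"
    by (rule shm_inj) (use \<beta>(5)[folded b(4)] b(1-3) t t' assms(3-8) in simp_all)
  ultimately show thesis
    using that b by blast
qed

lemma ex_zero: obtains Z where "Z \<in> Ob T" "zero_object T Z"
  using ex_zero_object zero_object_Ob by blast

lemma sh_zero_object: "zero_object T Z \<Longrightarrow> zero_object T (sh Z)"
  unfolding zero_object_iff by (metis shm_Ident shm_Zero sh_Ob)

text \<open>The triangle of \<open>Ident T A\<close> maps to the given one by the identity and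
  \<open>f\<close>. The third component starts at a zero object, and \<open>g \<bullet> f\<close>
  factors through it.\<close>

lemma Tri_comp_zero:
  assumes "(A, B, D, f, g, h) \<in> Tri T"
  shows "g \<bullet> f = Zero T A D"
proof -
  note t = TriD[OF assms]
  obtain Z where Z: "Z \<in> Ob T" "zero_object T Z"
    using ex_zero .
  obtain c where "ar T c" "src T c = Z" "tgt T c = D" "c \<bullet> Zero T A Z = g \<bullet> f"
    by (rule Tri_map3[OF Tri_Ident[OF t(1) Z(2)] assms, of "Ident T A" f]) (use t Z in simp_all)
  then show ?thesis
    using t Z by simp
qed

lemma Tri_comp_zero2: "(A, B, D, f, g, h) \<in> Tri T \<Longrightarrow> h \<bullet> g = Zero T B (sh A)"
  using Tri_comp_zero[OF Tri_rot] by simp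

lemma Tri_comp_zero3:
  assumes "(A, B, D, f, g, h) \<in> Tri T"
  shows "shm f \<bullet> h = Zero T D (sh B)"
proof -
  note t = TriD[OF assms]
  have "neg T (shm f) \<bullet> h = Zero T D (sh B)"
    using Tri_comp_zero2[OF Tri_rot[OF assms]] .
  then have "neg T (neg T (shm f \<bullet> h)) = Zero T D (sh B)"
    using t by simp
  then show ?thesis
    using t by simp
qed

text \<open>A map killed by \<open>g\<close> gives a morphism from the rotated triangle of its
  source's identity to the rotated given triangle. The completed third component desuspends to the
  factor \<open>y\<close>.\<close>

lemma exact2:
  assumes "(A, B, D, f, g, h) \<in> Tri T" "ar T x" "tgt T x = B" "g \<bullet> x = Zero T (src T x) D"
  obtains y where "ar T y" "src T y = src T x" "tgt T y = A" "x = f \<bullet> y"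
proof -
  note t = TriD[OF assms(1)]
  obtain Z where Z: "Z \<in> Ob T" "zero_object T Z"
    using ex_zero .
  let ?E = "src T x"
  have E: "?E \<in> Ob T"
    using assms by simp
  obtain y' where y': "ar T y'" "src T y' = sh ?E" "tgt T y' = sh A"
    "neg T (shm f) \<bullet> y' = shm x \<bullet> neg T (shm (Ident T ?E))"
    by (rule Tri_map3[OF Tri_rot[OF Tri_Ident[OF E Z(2)]] Tri_rot[OF assms(1)], of x "Zero T Z D"])
      (use t Z E assms in simp_all)
  obtain y where y: "ar T y" "src T y = ?E" "tgt T y = A" "shm y = y'"
    using shm_full[of ?E A y'] y' t E by auto
  have "x = f \<bullet> y"
    by (rule shm_inj) (use y'(4)[folded y(4)] y(1-3) t assms E in simp_all)
  then show thesis
    using that y by blast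
qed

lemma exact3:
  assumes "(A, B, D, f, g, h) \<in> Tri T" "ar T x" "tgt T x = D" "h \<bullet> x = Zero T (src T x) (sh A)"
  obtains y where "ar T y" "src T y = src T x" "tgt T y = B" "x = g \<bullet> y"
  using exact2[OF Tri_rot[OF assms(1)] assms(2-)] by metis

lemma exact4:
  assumes "(A, B, D, f, g, h) \<in> Tri T" "ar T x" "tgt T x = sh A"
    "shm f \<bullet> x = Zero T (src T x) (sh B)"
  obtains y where "ar T y" "src T y = src T x" "tgt T y = D" "x = h \<bullet> y"
proof -
  note t = TriD[OF assms(1)]
  have "neg T (shm f) \<bullet> x = Zero T (src T x) (sh B)"
    using assms t by simp
  then show thesis
    using exact3[OF Tri_rot[OF assms(1)] assms(2-3)] that by metis
qed

lemma coexact2: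
  assumes "(A, B, D, f, g, h) \<in> Tri T" "ar T x" "src T x = B" "x \<bullet> f = Zero T A (tgt T x)"
  obtains y where "ar T y" "src T y = D" "tgt T y = tgt T x" "x = y \<bullet> g"
proof -
  note t = TriD[OF assms(1)]
  obtain Z where Z: "Z \<in> Ob T" "zero_object T Z"
    using ex_zero .
  let ?E = "tgt T x"
  have E: "?E \<in> Ob T"
    using assms by simp
  \<comment> \<open>\<open>Z[1]\<close> is again a zero object, so the triangle of the identity can
    be read as a rotated triangle starting with \<open>Z\<close>; unrotating puts the identity in
    second place.\<close>
  have "(?E, ?E, sh Z, Ident T ?E, Zero T ?E (sh Z), neg T (shm (Zero T Z ?E))) \<in> Tri T"
    using Tri_Ident[OF E sh_zero_object[OF Z(2)]] Z E
      zero_object_from[OF sh_zero_object[OF Z(2)], of "neg T (shm (Zero T Z ?E))"] by simp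
  then have u: "(Z, ?E, ?E, Zero T Z ?E, Ident T ?E, Zero T ?E (sh Z)) \<in> Tri T"
    by (rule Tri_unrot) (use Z E in simp_all)
  obtain y where "ar T y" "src T y = D" "tgt T y = ?E" "y \<bullet> g = Ident T ?E \<bullet> x"
    by (rule Tri_map3[OF assms(1) u, of "Zero T A Z" x]) (use t Z E assms in simp_all)
  then show thesis
    using that assms by simp
qed

lemma coexact3:
  assumes "(A, B, D, f, g, h) \<in> Tri T" "ar T x" "src T x = D" "x \<bullet> g = Zero T B (tgt T x)"
  obtains y where "ar T y" "src T y = sh A" "tgt T y = tgt T x" "x = y \<bullet> h"
  using coexact2[OF Tri_rot[OF assms(1)] assms(2-)] by metis

lemma coexact1:
  assumes "(A, B, D, f, g, h) \<in> Tri T" "ar T x" "src T x = A" "shm x \<bullet> h = Zero T D (sh (tgt T x))"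
  obtains y where "ar T y" "src T y = B" "tgt T y = tgt T x" "x = y \<bullet> f"
proof -
  note t = TriD[OF assms(1)]
  have x': "ar T (shm x)" "src T (shm x) = sh A" "shm x \<bullet> h = Zero T D (tgt T (shm x))"
    using assms by simp_all
  obtain y' where y': "ar T y'" "src T y' = sh B" "tgt T y' = tgt T (shm x)" "shm x = y' \<bullet> neg T (shm f)"
    using coexact3[OF Tri_rot[OF assms(1)] x'] .
  obtain y where y: "ar T y" "src T y = B" "tgt T y = tgt T x" "shm y = neg T y'"
    using shm_full[of B "tgt T x" "neg T y'"] y'(1-3) t(2) assms(2) by auto
  have "shm x = shm (y \<bullet> f)"
    using y y'(1-3) t by (simp add: y'(4))
  then have "x = y \<bullet> f"
    using y t assms shm_eq_iff[of x "y \<bullet> f"] by simp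
  then show thesis
    using that y by blast
qed

text \<open>Three rotations suspend the triangle and negate all three maps; two of the signs cancel
  by \<open>Tri_neg\<close>, so one remains.\<close>

lemma Tri_shift:
  assumes "ar T f" "src T f = A" "tgt T f = B" "ar T g" "src T g = B" "tgt T g = D"
    "ar T h" "src T h = D" "tgt T h = sh A"
  shows "(sh A, sh B, sh D, shm f, shm g, neg T (shm h)) \<in> Tri T \<longleftrightarrow> (A, B, D, f, g, h) \<in> Tri T"
proof
  show "(sh A, sh B, sh D, shm f, shm g, neg T (shm h)) \<in> Tri T" if "(A, B, D, f, g, h) \<in> Tri T"
    using Tri_neg(1)[OF Tri_rot[OF Tri_rot[OF Tri_rot[OF that]]]] assms by simp
  show "(A, B, D, f, g, h) \<in> Tri T" if t: "(sh A, sh B, sh D, shm f, shm g, neg T (shm h)) \<in> Tri T"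
    by (rule Tri_unrot, rule Tri_unrot, rule Tri_unrot)
      (use Tri_neg(1)[OF t] assms in simp_all)
qed

lemma Tri_unshift:
  assumes "(sh A, sh B, sh D, shm f, shm g, k) \<in> Tri T" "ar T f" "src T f = A" "tgt T f = B"
    "ar T g" "src T g = B" "tgt T g = D"
  obtains h where "(A, B, D, f, g, h) \<in> Tri T"
proof -
  note t = TriD[OF assms(1)]
  have "A \<in> Ob T" "D \<in> Ob T"
    using assms ar_Ob by blast+
  then obtain h where "ar T h" "src T h = D" "tgt T h = sh A" "shm h = neg T k"
    using shm_full[of D "sh A" "neg T k"] t by auto
  then show thesis
    using that Tri_shift[of f A B g D h] assms t by simp
qed

lemma Tri_complete1:
  assumes "ar T f" "src T f = A" "tgt T f = B"
  obtains D g h where "(A, B, D, f, g, h) \<in> Tri T"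
  using Tri_complete[of A B f] assms arrow_self[of f] by auto

text \<open>A triangle that starts with \<open>h\<close> ends at an object that is isomorphic to a
  suspension \<open>B[1]\<close>. Transporting it along this isomorphism makes it a rotation of a
  triangle through \<open>B\<close>.\<close>

lemma Tri_complete3:
  assumes "ar T h" "src T h = D" "tgt T h = sh A" "A \<in> Ob T"
  obtains B f g where "(A, B, D, f, g, h) \<in> Tri T"
proof -
  obtain E m n where t: "(D, sh A, E, h, m, n) \<in> Tri T"
    using Tri_complete1[OF assms(1-3)] .
  note t' = TriD[OF t]
  obtain B e where e: "B \<in> Ob T" "is_iso T e" "src T e = sh B" "tgt T e = E"
    using shm_surj t'(3) .
  have u: "(D, sh A, sh B, h, inv_of T e \<bullet> m, n \<bullet> e) \<in> Tri T"
    using Tri_isoI[OF t, of "Ident T D" "Ident T (sh A)" "inv_of T e" h "inv_of T e \<bullet> m" "n \<bullet> e"] t' e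
    by simp
  obtain f where f: "ar T f" "src T f = A" "tgt T f = B" "shm f = neg T (inv_of T e \<bullet> m)"
    using shm_full[of A B "neg T (inv_of T e \<bullet> m)"] e assms t' by auto
  obtain g where g: "ar T g" "src T g = B" "tgt T g = D" "shm g = neg T (n \<bullet> e)"
    using shm_full[of B D "neg T (n \<bullet> e)"] e assms t' by auto
  have "(A, B, D, f, g, h) \<in> Tri T"
    by (rule Tri_unrot, rule Tri_unrot) (use u f g t' e in simp_all)
  then show thesis
    using that by blast
qed

lemma Tri_complete2:
  assumes "ar T g" "src T g = B" "tgt T g = D"
  obtains A f h where "(A, B, D, f, g, h) \<in> Tri T"
proof -
  obtain E m n where t: "(B, D, E, g, m, n) \<in> Tri T"
    using Tri_complete1[OF assms] .
  note t' = TriD[OF t]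
  obtain A e where e: "A \<in> Ob T" "is_iso T e" "src T e = sh A" "tgt T e = E"
    using shm_surj t'(3) .
  have u: "(B, D, sh A, g, inv_of T e \<bullet> m, n \<bullet> e) \<in> Tri T"
    using Tri_isoI[OF t, of "Ident T B" "Ident T D" "inv_of T e" g "inv_of T e \<bullet> m" "n \<bullet> e"] t' e
    by simp
  obtain f where f: "ar T f" "src T f = A" "tgt T f = B" "shm f = neg T (n \<bullet> e)"
    using shm_full[of A B "neg T (n \<bullet> e)"] e assms t' by auto
  have "(A, B, D, f, g, inv_of T e \<bullet> m) \<in> Tri T"
    by (rule Tri_unrot) (use u f t' e in simp_all)
  then show thesis
    using that by blast
qed

lemma octahedron:
  assumes "(X, Y, P, f, p, p') \<in> Tri T" "(Y, Z, Q, g, q, q') \<in> Tri T" "(X, Z, R, g \<bullet> f, r, r') \<in> Tri T"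
  obtains u v where "(P, R, Q, u, v, shm p \<bullet> q') \<in> Tri T" "u \<bullet> p = r \<bullet> g" "r' \<bullet> u = p'"
    "v \<bullet> r = q" "q' \<bullet> v = shm f \<bullet> r'"
proof -
  note t = TriD[OF assms(1)] TriD[OF assms(2)] TriD[OF assms(3)]
  obtain u v where uv: "(P, R, Q, u, v, shm p \<bullet> q') \<in> Tri T"
    "tri_map T (X, Y, P, f, p, p') (X, Z, R, g \<bullet> f, r, r') (Ident T X, g, u)"
    "tri_map T (X, Z, R, g \<bullet> f, r, r') (Y, Z, Q, g, q, q') (f, Ident T Z, v)"
    using octahedral[OF assms] by auto
  note w = TriD[OF uv(1)]
  have "u \<bullet> p = r \<bullet> g \<and> r' \<bullet> u = p'"
    using uv(2) t w by simp
  moreover have "v \<bullet> r = q \<and> q' \<bullet> v = shm f \<bullet> r'"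
    using uv(3) t w by simp
  ultimately show thesis
    using that uv(1) by blast
qed

text \<open>The octahedral axiom for the rotated triangles, shifted back by one.\<close>

lemma octahedron_extension:
  assumes "(B, C1, W, v1, w1, k) \<in> Tri T" "(B, E, M, a, b, h) \<in> Tri T" "(E, R, W, v, w, shm a \<bullet> k) \<in> Tri T"
  obtains \<mu> \<nu> where "(C1, R, M, \<mu>, \<nu>, shm v1 \<bullet> h) \<in> Tri T" "\<mu> \<bullet> v1 = v \<bullet> a" "w \<bullet> \<mu> = w1"
    "\<nu> \<bullet> v = b" "h \<bullet> \<nu> = neg T (k \<bullet> w)"
proof -
  note t = TriD[OF assms(1)] TriD[OF assms(2)] TriD[OF assms(3)]
  have sh_a: "(sh B, sh E, sh M, shm a, neg T (shm b), shm h) \<in> Tri T"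
    using Tri_neg(3)[OF Tri_shift[THEN iffD2, OF _ _ _ _ _ _ _ _ _ assms(2)]] t by simp
  obtain u v' where uv: "(sh C1, sh R, sh M, u, v', shm (neg T (shm v1)) \<bullet> shm h) \<in> Tri T"
    "u \<bullet> neg T (shm v1) = neg T (shm v) \<bullet> shm a" "neg T (shm w) \<bullet> u = neg T (shm w1)"
    "v' \<bullet> neg T (shm v) = neg T (shm b)" "shm h \<bullet> v' = shm k \<bullet> neg T (shm w)"
    using octahedron[OF Tri_rot[OF Tri_rot[OF assms(1)]] sh_a Tri_rot[OF Tri_rot[OF assms(3)]]]
    by metis
  note t' = TriD[OF uv(1)]
  obtain \<mu> where \<mu>: "ar T \<mu>" "src T \<mu> = C1" "tgt T \<mu> = R" "shm \<mu> = u"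
    using shm_full[of C1 R u] t t' by auto
  obtain \<nu> where \<nu>: "ar T \<nu>" "src T \<nu> = R" "tgt T \<nu> = M" "shm \<nu> = v'"
    using shm_full[of R M v'] t t' by auto
  have "(C1, R, M, \<mu>, \<nu>, shm v1 \<bullet> h) \<in> Tri T"
    using uv(1) \<mu> \<nu> t by (subst Tri_shift[symmetric]) simp_all
  moreover have "\<mu> \<bullet> v1 = v \<bullet> a" "w \<bullet> \<mu> = w1" "\<nu> \<bullet> v = b" "h \<bullet> \<nu> = neg T (k \<bullet> w)"
    by (rule shm_inj; use uv(2-)[folded \<mu>(4) \<nu>(4)] \<mu>(1-3) \<nu>(1-3) t in simp)+
  ultimately show thesis
    using that by blast
qed

text \<open>The octahedron of the composite \<open>q \<bullet> w\<close>. \<open>E\<close> plays the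
  part of a homotopy pullback of \<open>X \<rightarrow> W\<close> along
  \<open>w : D \<rightarrow> W\<close>, so the fibre \<open>B\<close> of \<open>w\<close> is also
  the fibre of \<open>E \<rightarrow> X\<close>.\<close>

lemma octahedron_base_change:
  assumes "(A, X, W, i, p, q) \<in> Tri T" "(A, E, D, a, b, q \<bullet> w) \<in> Tri T" "(B, D, W, v, w, k) \<in> Tri T"
  obtains y e l where "(B, E, X, y, e, l) \<in> Tri T" "b \<bullet> y = v" "shm y \<bullet> k = neg T (shm a \<bullet> q)"
    "e \<bullet> a = i" "p \<bullet> e = w \<bullet> b"
proof -
  note t = TriD[OF assms(1)] TriD[OF assms(2)] TriD[OF assms(3)]
  obtain u v' where uv: "(sh B, sh E, sh X, u, v', shm k \<bullet> neg T (shm p)) \<in> Tri T"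
    "u \<bullet> k = neg T (shm a) \<bullet> q" "neg T (shm b) \<bullet> u = neg T (shm v)"
    "v' \<bullet> neg T (shm a) = neg T (shm i)" "neg T (shm p) \<bullet> v' = shm w \<bullet> neg T (shm b)"
    using octahedron[OF Tri_rot[OF assms(3)] Tri_rot[OF Tri_rot[OF assms(1)]] Tri_rot[OF Tri_rot[OF assms(2)]]]
    by metis
  note t' = TriD[OF uv(1)]
  obtain y where y: "ar T y" "src T y = B" "tgt T y = E" "shm y = u"
    using shm_full[of B E u] t t' by auto
  obtain e where e: "ar T e" "src T e = E" "tgt T e = X" "shm e = v'"
    using shm_full[of E X v'] t t' by auto
  obtain l where "(B, E, X, y, e, l) \<in> Tri T"
    using Tri_unshift[OF uv(1)[folded y(4) e(4)] y(1-3) e(1-3)] .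
  moreover have "b \<bullet> y = v" "shm y \<bullet> k = neg T (shm a \<bullet> q)" "e \<bullet> a = i" "p \<bullet> e = w \<bullet> b"
    by (rule shm_inj; use uv(2-)[folded y(4) e(4)] y(1-3) e(1-3) t in simp)+
  ultimately show thesis
    using that by blast
qed

end

section \<open>The subfactor of a subcategory orthogonal to its projective-injectives\<close>

section \<open>Frobenius subfactors\<close>

text \<open>In place of approximation properties, the chosen triangles are required to have all
  terms in \<open>\<U>\<close>. Then \<open>Ext_U_X\<close> makes every map from \<open>A\<close> to
  \<open>\<X>\<close> extend along \<open>chi \<sigma> A\<close>, and \<open>Ext_X_U\<close> makes
  every map from \<open>\<X>\<close> to \<open>A\<close> lift along
  \<open>chp \<omega> A\<close>.\<close>

locale frobenius_subfactor = triangulated_category T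
  for T :: "('o, 'm, 'z) triang_scheme" (structure) +
  fixes \<U> \<X> :: "'o set" and \<sigma> \<omega> :: "('o, 'm) syzygy_choice"
  assumes sub_U: "subcategory T \<U>" and ext_U: "extension_closed T \<U>"
    and sub_X: "subcategory T \<X>" and X_subset: "\<X> \<subseteq> \<U>"
    and Ext_U_X: "\<lbrakk>A \<in> \<U>; B \<in> \<X>\<rbrakk> \<Longrightarrow> Hom T A (ob (Sus T) B) = {Zero T A (ob (Sus T) B)}"
    and Ext_X_U: "\<lbrakk>A \<in> \<X>; B \<in> \<U>\<rbrakk> \<Longrightarrow> Hom T A (ob (Sus T) B) = {Zero T A (ob (Sus T) B)}"
    and sigma: "A \<in> \<U> \<Longrightarrow> (A, chX \<sigma> A, chW \<sigma> A, chi \<sigma> A, chp \<sigma> A, chq \<sigma> A) \<in> Tri T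
      \<and> chX \<sigma> A \<in> \<X> \<and> chW \<sigma> A \<in> \<U>"
    and omega: "A \<in> \<U> \<Longrightarrow> (chW \<omega> A, chX \<omega> A, A, chi \<omega> A, chp \<omega> A, chq \<omega> A) \<in> Tri T
      \<and> chX \<omega> A \<in> \<X> \<and> chW \<omega> A \<in> \<U>"
begin

lemma U_Ob [simp]: "A \<in> \<U> \<Longrightarrow> A \<in> Ob T"
  using sub_U unfolding subcategory_def by blast

lemma X_U [simp]: "A \<in> \<X> \<Longrightarrow> A \<in> \<U>"
  using X_subset by blast

lemma ext_closed: "\<lbrakk>(A, B, D, f, g, h) \<in> Tri T; A \<in> \<U>; D \<in> \<U>\<rbrakk> \<Longrightarrow> B \<in> \<U>"
  using ext_U unfolding extension_closed_def by blast

lemma zero_U_X: "\<lbrakk>ar T f; src T f \<in> \<U>; tgt T f = sh B; B \<in> \<X>\<rbrakk> \<Longrightarrow> f = Zero T (src T f) (sh B)"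
  using Ext_U_X[of "src T f" B] arrow_self[of f] by auto

lemma zero_X_U: "\<lbrakk>ar T f; src T f \<in> \<X>; tgt T f = sh B; B \<in> \<U>\<rbrakk> \<Longrightarrow> f = Zero T (src T f) (sh B)"
  using Ext_X_U[of "src T f" B] arrow_self[of f] by auto

subsection \<open>Maps modulo the ideal of \<open>\<X>\<close>\<close>

definition thru :: "'m \<Rightarrow> bool" where
  "thru f \<longleftrightarrow> (\<exists>a b. ar T a \<and> ar T b \<and> src T b = tgt T a \<and> tgt T a \<in> \<X> \<and> f = b \<bullet> a)"

lemma thru_ar [simp]: "thru f \<Longrightarrow> ar T f"
  unfolding thru_def by auto

lemma thruI: "\<lbrakk>ar T a; ar T b; src T b = tgt T a; tgt T a \<in> \<X>\<rbrakk> \<Longrightarrow> thru (b \<bullet> a)"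
  unfolding thru_def by blast

lemma thruE:
  assumes "thru f"
  obtains a b where "ar T a" "ar T b" "src T b = tgt T a" "tgt T a \<in> \<X>" "f = b \<bullet> a"
  using assms unfolding thru_def by blast

lemma factoring_maps_iff:
  assumes "A \<in> Ob T" "B \<in> Ob T"
  shows "f \<in> factoring_maps T \<X> A B \<longleftrightarrow> thru f \<and> src T f = A \<and> tgt T f = B"
proof
  assume "f \<in> factoring_maps T \<X> A B"
  then obtain Y a b where Y: "Y \<in> \<X>" "a \<in> Hom T A Y" "b \<in> Hom T Y B" "f = b \<bullet> a"
    unfolding factoring_maps_def by blast
  then show "thru f \<and> src T f = A \<and> tgt T f = B"
    using Hom_arrow[of a A Y] Hom_arrow[of b Y B] assms thruI[of a b] by simp
next
  assume f: "thru f \<and> src T f = A \<and> tgt T f = B"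
  then obtain a b where ab: "ar T a" "ar T b" "src T b = tgt T a" "tgt T a \<in> \<X>" "f = b \<bullet> a"
    unfolding thru_def by blast
  then have "a \<in> Hom T A (tgt T a)" "b \<in> Hom T (tgt T a) B"
    using f arrow_self[of a] arrow_self[of b] by auto
  then show "f \<in> factoring_maps T \<X> A B"
    unfolding factoring_maps_def using ab by blast
qed

lemma thru_Comp_left [simp]:
  assumes "thru f" "ar T g" "src T g = tgt T f"
  shows "thru (g \<bullet> f)"
proof -
  obtain a b where ab: "ar T a" "ar T b" "src T b = tgt T a" "tgt T a \<in> \<X>" "f = b \<bullet> a"
    using thruE[OF assms(1)] .
  have "thru ((g \<bullet> b) \<bullet> a)"
    by (rule thruI) (use ab assms in simp_all)
  then show ?thesis
    using ab assms by simp
qed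

lemma thru_Comp_right [simp]:
  assumes "thru f" "ar T g" "src T f = tgt T g"
  shows "thru (f \<bullet> g)"
proof -
  obtain a b where ab: "ar T a" "ar T b" "src T b = tgt T a" "tgt T a \<in> \<X>" "f = b \<bullet> a"
    using thruE[OF assms(1)] .
  have "thru (b \<bullet> (a \<bullet> g))"
    by (rule thruI) (use ab assms in simp_all)
  then show ?thesis
    using ab assms by simp
qed

lemma thru_Zero [simp]:
  assumes "A \<in> Ob T" "B \<in> Ob T"
  shows "thru (Zero T A B)"
proof -
  obtain Z where Z: "Z \<in> \<X>"
    using sub_X unfolding subcategory_def by blast
  have "thru (Zero T Z B \<bullet> Zero T A Z)"
    by (rule thruI) (use Z assms in simp_all)
  then show ?thesis
    using Z assms by simp
qed

lemma thru_neg [simp]: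
  assumes "thru f"
  shows "thru (neg T f)"
proof -
  obtain a b where ab: "ar T a" "ar T b" "src T b = tgt T a" "tgt T a \<in> \<X>" "f = b \<bullet> a"
    using thruE[OF assms(1)] .
  have "thru (neg T b \<bullet> a)"
    by (rule thruI) (use ab assms in simp_all)
  then show ?thesis
    using ab assms by simp
qed

text \<open>The two intermediate objects are merged into their biproduct, which stays in
  \<open>\<X>\<close>.\<close>

lemma thru_Add [simp]:
  assumes "thru f" "thru g" "src T g = src T f" "tgt T g = tgt T f"
  shows "thru (Add T f g)"
proof -
  obtain a b where ab: "ar T a" "ar T b" "src T b = tgt T a" "tgt T a \<in> \<X>" "f = b \<bullet> a"
    using thruE[OF assms(1)] .
  obtain c d where cd: "ar T c" "ar T d" "src T d = tgt T c" "tgt T c \<in> \<X>" "g = d \<bullet> c"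
    using thruE[OF assms(2)] .
  have Ob: "tgt T a \<in> Ob T" "tgt T c \<in> Ob T"
    using ab cd by simp_all
  obtain P where P: "is_biproduct T (tgt T a) (tgt T c) P"
    using ex_biproduct[OF Ob] by blast
  have "P \<in> \<X>"
    using sub_X P ab cd unfolding subcategory_def by blast
  obtain i j p q where b: "P \<in> Ob T" "ar T i" "ar T j" "ar T p" "ar T q" "src T i = tgt T a" "tgt T i = P"
    "src T j = tgt T c" "tgt T j = P"
    "src T p = P" "tgt T p = tgt T a" "src T q = P" "tgt T q = tgt T c"
    "p \<bullet> i = Ident T (tgt T a)" "q \<bullet> j = Ident T (tgt T c)" "q \<bullet> i = Zero T (tgt T a) (tgt T c)"
    "p \<bullet> j = Zero T (tgt T c) (tgt T a)"
    using is_biproductE[OF P Ob] .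
  have [simp]: "p \<bullet> (i \<bullet> a) = a" "q \<bullet> (j \<bullet> c) = c" "q \<bullet> (i \<bullet> a) = Zero T (src T a) (tgt T c)"
    "p \<bullet> (j \<bullet> c) = Zero T (src T c) (tgt T a)"
    using Comp_reduce[OF b(14), of a] Comp_reduce[OF b(15), of c] Comp_reduce[OF b(16), of a]
      Comp_reduce[OF b(17), of c] b(1-13) ab cd assms Ob by simp_all
  have "thru (Add T (b \<bullet> p) (d \<bullet> q) \<bullet> Add T (i \<bullet> a) (j \<bullet> c))"
    by (rule thruI) (use b(1-13) ab cd assms \<open>P \<in> \<X>\<close> in simp_all)
  moreover have "Add T (b \<bullet> p) (d \<bullet> q) \<bullet> Add T (i \<bullet> a) (j \<bullet> c) = Add T f g"
    using b(1-13) ab cd assms(3,4) by simp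
  ultimately show ?thesis
    by simp
qed

definition eqv :: "'m \<Rightarrow> 'm \<Rightarrow> bool" where
  "eqv f g \<longleftrightarrow> ar T f \<and> ar T g \<and> src T g = src T f \<and> tgt T g = tgt T f \<and> thru (diff T f g)"

lemma eqv_refl [simp]: "ar T f \<Longrightarrow> eqv f f"
  by (simp add: eqv_def)

lemma eqv_sym:
  assumes "eqv f g"
  shows "eqv g f"
  using assms thru_neg[of "diff T f g"] neg_diff[of f g] by (simp add: eqv_def)

lemma eqv_trans:
  assumes "eqv f g" "eqv g h"
  shows "eqv f h"
  using assms thru_Add[of "diff T f g" "diff T g h"] Add_diff_diff[of f g h] by (simp add: eqv_def)

lemma eqv_Comp_left: "\<lbrakk>eqv f f'; ar T g; src T g = tgt T f\<rbrakk> \<Longrightarrow> eqv (g \<bullet> f) (g \<bullet> f')"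
  using thru_Comp_left[of "diff T f f'" g] by (simp add: eqv_def)

lemma eqv_Comp_right: "\<lbrakk>eqv g g'; ar T f; src T g = tgt T f\<rbrakk> \<Longrightarrow> eqv (g \<bullet> f) (g' \<bullet> f)"
  using thru_Comp_right[of "diff T g g'" f] by (simp add: eqv_def)

lemma eqv_Comp:
  assumes "eqv f f'" "eqv g g'" "src T g = tgt T f"
  shows "eqv (g \<bullet> f) (g' \<bullet> f')"
proof (rule eqv_trans)
  show "eqv (g \<bullet> f) (g \<bullet> f')"
    using assms by (intro eqv_Comp_left) (simp_all add: eqv_def)
  show "eqv (g \<bullet> f') (g' \<bullet> f')"
    using assms by (intro eqv_Comp_right) (simp_all add: eqv_def)
qed

lemma eqv_Add:
  assumes "eqv f f'" "eqv g g'" "src T g = src T f" "tgt T g = tgt T f"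
  shows "eqv (Add T f g) (Add T f' g')"
  using assms diff_Add_Add[of f g f' g'] thru_Add[of "diff T f f'" "diff T g g'"]
  by (simp add: eqv_def)

lemma eqv_Zero_iff: "ar T f \<Longrightarrow> eqv f (Zero T (src T f) (tgt T f)) \<longleftrightarrow> thru f"
  by (simp add: eqv_def diff_def)

abbreviation cl :: "'m \<Rightarrow> 'm set" where
  "cl \<equiv> cls T \<U> \<X>"

lemma cl_iff:
  assumes "ar T f" "src T f \<in> \<U>" "tgt T f \<in> \<U>"
  shows "g \<in> cl f \<longleftrightarrow> eqv g f"
proof
  assume "g \<in> cl f"
  then obtain A B where *: "A \<in> \<U>" "B \<in> \<U>" "f \<in> Hom T A B" "g \<in> Hom T A B"
    "Add T g (Neg T A B f) \<in> factoring_maps T \<X> A B"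
    unfolding cls_def by blast
  have f: "ar T f" "src T f = A" "tgt T f = B" and g: "ar T g" "src T g = A" "tgt T g = B"
    using Hom_arrow[OF *(3)] Hom_arrow[OF *(4)] * by simp_all
  then show "eqv g f"
    using * Neg_eq[OF f] factoring_maps_iff by (simp add: eqv_def diff_def)
next
  assume e: "eqv g f"
  have "Add T g (Neg T (src T f) (tgt T f) f) = diff T g f"
    by (simp add: diff_def neg_def)
  moreover have "diff T g f \<in> factoring_maps T \<X> (src T f) (tgt T f)"
    using e assms factoring_maps_iff[of "src T f" "tgt T f" "diff T g f"] by (simp add: eqv_def)
  moreover have "f \<in> Hom T (src T f) (tgt T f)" "g \<in> Hom T (src T f) (tgt T f)"
    using e arrow_self[of f] arrow_self[of g] by (simp_all add: eqv_def)
  ultimately show "g \<in> cl f"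
    unfolding cls_def using assms by fastforce
qed

lemma cl_eq_iff:
  assumes "ar T f" "src T f \<in> \<U>" "tgt T f \<in> \<U>" "ar T g" "src T g \<in> \<U>" "tgt T g \<in> \<U>"
  shows "cl f = cl g \<longleftrightarrow> eqv f g"
proof
  assume "cl f = cl g"
  moreover have "f \<in> cl f"
    using cl_iff[OF assms(1-3), of f] assms(1) by simp
  ultimately show "eqv f g"
    using cl_iff[OF assms(4-6), of f] by simp
next
  assume *: "eqv f g"
  have "eqv h f \<longleftrightarrow> eqv h g" for h
    using eqv_trans[of h f g] eqv_trans[of h g f] * eqv_sym[OF *] by blast
  then show "cl f = cl g"
    using cl_iff[OF assms(1-3)] cl_iff[OF assms(4-6)] by blast
qed

lemma cl_eqI: "\<lbrakk>eqv f g; src T f \<in> \<U>; tgt T f \<in> \<U>\<rbrakk> \<Longrightarrow> cl f = cl g"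
  using cl_eq_iff[of f g] by (simp add: eqv_def)

subsection \<open>The additive structure of the subfactor\<close>

text \<open>The sign in the third map of a standard triangle is the opposite of the one in the definition
  of \<open>standard_triangles\<close>; it is recovered by changing the signs of \<open>chp\<close> and \<open>chq\<close>.\<close>

definition std :: "('o, 'm set) tri set" where
  "std = {(A, B, D, cl f, cl v, cl w) | A B D f v w. A \<in> \<U> \<and> B \<in> \<U> \<and> f \<in> Hom T A B \<and>
      (B, D, chW \<sigma> A, v, w, neg T (shm f \<bullet> chq \<sigma> A)) \<in> Tri T}"

definition Q :: "('o, 'm set) triang" where
  "Q = (let R = suspended_subfactor T \<U> \<X> \<sigma> in
     R\<lparr>Tri := {t \<in> candidate_triangles R. \<exists>t' \<in> std. tri_iso R t t'}\<rparr>)"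

lemma Q_sel [simp]:
  "Ob Q = \<U>" "Hom Q A B = cl ` Hom T A B" "Ident Q A = cl (Ident T A)" "Zero Q A B = cl (Zero T A B)"
  by (simp_all add: Q_def suspended_subfactor_def Let_def)

lemma Sus_Q: "Sus Q = sigma_functor T \<U> \<X> \<sigma>"
  by (simp add: Q_def suspended_subfactor_def Let_def)

lemma cl_Comp [simp]:
  assumes "ar T f" "ar T g" "src T g = tgt T f" "src T f \<in> \<U>" "tgt T f \<in> \<U>" "tgt T g \<in> \<U>"
  shows "cl g \<bullet>\<^bsub>Q\<^esub> cl f = cl (g \<bullet> f)"
proof -
  have "cl (g' \<bullet> f') = cl (g \<bullet> f)" if "g' \<in> cl g" "f' \<in> cl f" for f' g'
  proof (rule cl_eqI)
    have "eqv g' g" "eqv f' f"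
      using that assms cl_iff[of g g'] cl_iff[of f f'] by simp_all
    then show "eqv (g' \<bullet> f') (g \<bullet> f)" "src T (g' \<bullet> f') \<in> \<U>" "tgt T (g' \<bullet> f') \<in> \<U>"
      using assms eqv_Comp by (simp_all add: eqv_def)
  qed
  moreover have "g \<in> cl g" "f \<in> cl f"
    using assms cl_iff[of g g] cl_iff[of f f] by simp_all
  ultimately have "(\<Union>g' \<in> cl g. \<Union>f' \<in> cl f. cl (g' \<bullet> f')) = cl (g \<bullet> f)"
    by blast
  then show ?thesis
    by (simp add: Q_def suspended_subfactor_def Let_def)
qed

lemma cl_Add [simp]:
  assumes "ar T f" "ar T g" "src T g = src T f" "tgt T g = tgt T f" "src T f \<in> \<U>" "tgt T f \<in> \<U>"
  shows "Add Q (cl f) (cl g) = cl (Add T f g)"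
proof -
  have "cl (Add T f' g') = cl (Add T f g)" if "g' \<in> cl g" "f' \<in> cl f" for f' g'
  proof (rule cl_eqI)
    have "eqv g' g" "eqv f' f"
      using that assms cl_iff[of g g'] cl_iff[of f f'] by simp_all
    then show "eqv (Add T f' g') (Add T f g)" "src T (Add T f' g') \<in> \<U>" "tgt T (Add T f' g') \<in> \<U>"
      using assms eqv_Add by (simp_all add: eqv_def)
  qed
  moreover have "g \<in> cl g" "f \<in> cl f"
    using assms cl_iff[of g g] cl_iff[of f f] by simp_all
  ultimately have "(\<Union>f' \<in> cl f. \<Union>g' \<in> cl g. cl (Add T f' g')) = cl (Add T f g)"
    by blast
  then show ?thesis
    by (simp add: Q_def suspended_subfactor_def Let_def)
qed

lemma cl_in_Hom: "\<lbrakk>ar T f; src T f = A; tgt T f = B\<rbrakk> \<Longrightarrow> cl f \<in> cl ` Hom T A B"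
  using arrow_self by blast

lemma Q_HomE:
  assumes "F \<in> cl ` Hom T A B" "A \<in> \<U>" "B \<in> \<U>"
  obtains f where "ar T f" "src T f = A" "tgt T f = B" "F = cl f"
  using assms Hom_arrow U_Ob by blast

lemma Q_category: "category Q"
proof
  fix A B A' B' F
  assume *: "A \<in> Ob Q" "B \<in> Ob Q" "A' \<in> Ob Q" "B' \<in> Ob Q" "F \<in> Hom Q A B" "F \<in> Hom Q A' B'"
  obtain f where f: "ar T f" "src T f = A" "tgt T f = B" "F = cl f"
    by (rule Q_HomE[of F A B]) (use * in auto)
  obtain f' where f': "ar T f'" "src T f' = A'" "tgt T f' = B'" "F = cl f'"
    by (rule Q_HomE[of F A' B']) (use * in auto)
  \<comment> \<open>Equivalent maps are parallel by definition, so a class still determines its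
    ends.\<close>
  have "eqv f f'"
    using f f' * cl_eq_iff[of f f'] by simp
  then show "A = A' \<and> B = B'"
    using f f' by (simp add: eqv_def)
next
  fix A assume "A \<in> Ob Q"
  then show "Ident Q A \<in> Hom Q A A"
    by (simp add: cl_in_Hom)
next
  fix A B D F G
  assume *: "A \<in> Ob Q" "B \<in> Ob Q" "D \<in> Ob Q" "F \<in> Hom Q A B" "G \<in> Hom Q B D"
  obtain f where f: "ar T f" "src T f = A" "tgt T f = B" "F = cl f"
    by (rule Q_HomE[of F A B]) (use * in auto)
  obtain g where g: "ar T g" "src T g = B" "tgt T g = D" "G = cl g"
    by (rule Q_HomE[of G B D]) (use * in auto)
  show "G \<bullet>\<^bsub>Q\<^esub> F \<in> Hom Q A D"
    using * f g by (simp add: cl_in_Hom)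
next
  fix A B F
  assume *: "A \<in> Ob Q" "B \<in> Ob Q" "F \<in> Hom Q A B"
  obtain f where f: "ar T f" "src T f = A" "tgt T f = B" "F = cl f"
    by (rule Q_HomE[of F A B]) (use * in auto)
  show "F \<bullet>\<^bsub>Q\<^esub> Ident Q A = F" "Ident Q B \<bullet>\<^bsub>Q\<^esub> F = F"
    using * f by simp_all
next
  fix A B D E F G H
  assume *: "A \<in> Ob Q" "B \<in> Ob Q" "D \<in> Ob Q" "E \<in> Ob Q" "F \<in> Hom Q A B" "G \<in> Hom Q B D" "H \<in> Hom Q D E"
  obtain f where f: "ar T f" "src T f = A" "tgt T f = B" "F = cl f"
    by (rule Q_HomE[of F A B]) (use * in auto)
  obtain g where g: "ar T g" "src T g = B" "tgt T g = D" "G = cl g"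
    by (rule Q_HomE[of G B D]) (use * in auto)
  obtain h where h: "ar T h" "src T h = D" "tgt T h = E" "H = cl h"
    by (rule Q_HomE[of H D E]) (use * in auto)
  show "H \<bullet>\<^bsub>Q\<^esub> (G \<bullet>\<^bsub>Q\<^esub> F) = H \<bullet>\<^bsub>Q\<^esub> G \<bullet>\<^bsub>Q\<^esub> F"
    using * f g h by simp
qed

lemma Q_hom_comm_group:
  assumes "A \<in> \<U>" "B \<in> \<U>"
  shows "comm_group (hom_group Q A B)"
proof (rule comm_groupI; unfold hom_group_def monoid.simps partial_object.simps)
  fix F assume F: "F \<in> Hom Q A B"
  obtain f where f: "ar T f" "src T f = A" "tgt T f = B" "F = cl f"
    by (rule Q_HomE[of F A B]) (use F assms in auto)
  show "Add Q (Zero Q A B) F = F"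
    using f assms by simp
  show "\<exists>y \<in> Hom Q A B. Add Q y F = Zero Q A B"
    using f assms by (intro bexI[of _ "cl (neg T f)"]) (simp_all add: cl_in_Hom)
  fix G assume G: "G \<in> Hom Q A B"
  obtain g where g: "ar T g" "src T g = A" "tgt T g = B" "G = cl g"
    by (rule Q_HomE[of G A B]) (use G assms in auto)
  show "Add Q F G \<in> Hom Q A B"
    using f g assms by (simp add: cl_in_Hom)
  show "Add Q F G = Add Q G F"
    using f g assms Add_commute[of f g] by simp
  fix H assume H: "H \<in> Hom Q A B"
  obtain h where h: "ar T h" "src T h = A" "tgt T h = B" "H = cl h"
    by (rule Q_HomE[of H A B]) (use H assms in auto)
  show "Add Q (Add Q F G) H = Add Q F (Add Q G H)"
    using f g h assms by simp
qed (use assms in \<open>simp_all add: cl_in_Hom\<close>)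

lemma Q_preadditive: "preadditive_category Q"
proof (intro preadditive_category.intro Q_category preadditive_category_axioms.intro)
  fix A B assume "A \<in> Ob Q" "B \<in> Ob Q"
  then show "comm_group (hom_group Q A B)"
    using Q_hom_comm_group by simp
next
  fix A B D F F' G
  assume *: "A \<in> Ob Q" "B \<in> Ob Q" "D \<in> Ob Q" "F \<in> Hom Q A B" "F' \<in> Hom Q A B" "G \<in> Hom Q B D"
  obtain f where f: "ar T f" "src T f = A" "tgt T f = B" "F = cl f"
    by (rule Q_HomE[of F A B]) (use * in auto)
  obtain f' where f': "ar T f'" "src T f' = A" "tgt T f' = B" "F' = cl f'"
    by (rule Q_HomE[of F' A B]) (use * in auto)
  obtain g where g: "ar T g" "src T g = B" "tgt T g = D" "G = cl g"
    by (rule Q_HomE[of G B D]) (use * in auto)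
  show "G \<bullet>\<^bsub>Q\<^esub> Add Q F F' = Add Q (G \<bullet>\<^bsub>Q\<^esub> F) (G \<bullet>\<^bsub>Q\<^esub> F')"
    using * f f' g by simp
next
  fix A B D F G G'
  assume *: "A \<in> Ob Q" "B \<in> Ob Q" "D \<in> Ob Q" "F \<in> Hom Q A B" "G \<in> Hom Q B D" "G' \<in> Hom Q B D"
  obtain f where f: "ar T f" "src T f = A" "tgt T f = B" "F = cl f"
    by (rule Q_HomE[of F A B]) (use * in auto)
  obtain g where g: "ar T g" "src T g = B" "tgt T g = D" "G = cl g"
    by (rule Q_HomE[of G B D]) (use * in auto)
  obtain g' where g': "ar T g'" "src T g' = B" "tgt T g' = D" "G' = cl g'"
    by (rule Q_HomE[of G' B D]) (use * in auto)
  show "Add Q G G' \<bullet>\<^bsub>Q\<^esub> F = Add Q (G \<bullet>\<^bsub>Q\<^esub> F) (G' \<bullet>\<^bsub>Q\<^esub> F)"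
    using * f g g' by simp
qed

sublocale Q: preadditive_category Q
  by (rule Q_preadditive)

lemma cl_arrow [simp]:
  assumes "ar T f" "src T f \<in> \<U>" "tgt T f \<in> \<U>"
  shows "ar Q (cl f)" "src Q (cl f) = src T f" "tgt Q (cl f) = tgt T f"
  using Q.Hom_arrow[of "cl f" "src T f" "tgt T f"] assms cl_in_Hom[of f] by simp_all

lemma Q_rep:
  assumes "ar Q F"
  obtains f where "ar T f" "src T f \<in> \<U>" "tgt T f \<in> \<U>" "F = cl f"
proof -
  have *: "src Q F \<in> \<U>" "tgt Q F \<in> \<U>"
    using Q.ar_Ob[OF assms] by simp_all
  have "F \<in> cl ` Hom T (src Q F) (tgt Q F)"
    using Q.arrow_self[OF assms] by simp
  then obtain f where "ar T f" "src T f = src Q F" "tgt T f = tgt Q F" "F = cl f"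
    using Q_HomE * by metis
  then show thesis
    using that * by metis
qed

lemma cl_neg [simp]:
  assumes "ar T f" "src T f \<in> \<U>" "tgt T f \<in> \<U>"
  shows "neg Q (cl f) = cl (neg T f)"
  by (rule Q.neg_unique[symmetric]) (use assms in simp_all)

lemma Q_zero_object_iff: "zero_object Q A \<longleftrightarrow> A \<in> \<U> \<and> thru (Ident T A)"
  using Q.zero_object_iff[of A] cl_eq_iff[of "Ident T A" "Zero T A A"] eqv_Zero_iff[of "Ident T A"]
  by auto

lemma X_zero_object: "A \<in> \<X> \<Longrightarrow> zero_object Q A"
  using thruI[of "Ident T A" "Ident T A"] by (simp add: Q_zero_object_iff)

lemma Q_additive: "additive_category Q"
proof (intro additive_category.intro Q_preadditive additive_category_axioms.intro)
  obtain Z where "Z \<in> \<X>"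
    using sub_X unfolding subcategory_def by blast
  then show "\<exists>Z. zero_object Q Z"
    using X_zero_object by blast
next
  fix A B assume AB: "A \<in> Ob Q" "B \<in> Ob Q"
  then have Ob: "A \<in> Ob T" "B \<in> Ob T" "A \<in> \<U>" "B \<in> \<U>"
    by simp_all
  obtain P where P: "is_biproduct T A B P"
    using ex_biproduct[OF Ob(1,2)] by blast
  have PU: "P \<in> \<U>"
    using sub_U P Ob unfolding subcategory_def by blast
  obtain i j p q where b: "P \<in> Ob T" "ar T i" "ar T j" "ar T p" "ar T q" "src T i = A" "tgt T i = P"
    "src T j = B" "tgt T j = P" "src T p = P" "tgt T p = A" "src T q = P" "tgt T q = B"
    "p \<bullet> i = Ident T A" "q \<bullet> j = Ident T B" "q \<bullet> i = Zero T A B" "p \<bullet> j = Zero T B A"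
    "Add T (i \<bullet> p) (j \<bullet> q) = Ident T P"
    using is_biproductE[OF P Ob(1,2)] .
  have "is_biproduct Q A B P"
    by (rule Q.is_biproductI[of "cl i" "cl j" "cl p" "cl q"]) (use b PU Ob in simp_all)
  then show "\<exists>P. is_biproduct Q A B P"
    by blast
qed

lemma Q_isoI:
  assumes "ar T f" "ar T g" "src T g = tgt T f" "tgt T g = src T f" "src T f \<in> \<U>" "tgt T f \<in> \<U>"
    "eqv (g \<bullet> f) (Ident T (src T f))" "eqv (f \<bullet> g) (Ident T (tgt T f))"
  shows "is_iso Q (cl f)"
  by (rule Q.isoI[of _ "cl g"]) (use assms in \<open>simp_all add: cl_eq_iff\<close>)

subsection \<open>Extensions as maps of the subfactor\<close>

abbreviation "W \<equiv> chW \<sigma>"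
abbreviation "q \<equiv> chq \<sigma>"

lemma sigma_facts [simp]:
  assumes "A \<in> \<U>"
  shows "chX \<sigma> A \<in> \<X>" "W A \<in> \<U>" "ar T (chi \<sigma> A)" "src T (chi \<sigma> A) = A" "tgt T (chi \<sigma> A) = chX \<sigma> A"
    "ar T (chp \<sigma> A)" "src T (chp \<sigma> A) = chX \<sigma> A" "tgt T (chp \<sigma> A) = W A"
    "ar T (q A)" "src T (q A) = W A" "tgt T (q A) = sh A"
  using sigma[OF assms] TriD[of A "chX \<sigma> A" "W A" "chi \<sigma> A" "chp \<sigma> A" "q A"] by simp_all

text \<open>Treats the chosen triangles for \<open>\<Sigma>\<close> and \<open>\<Omega>\<close>
  alike: \<open>V\<close> is a cosyzygy of \<open>A\<close>, and \<open>A\<close> a syzygy of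
  \<open>V\<close>. Only the class \<open>r\<close> is kept, because composition with it identifies
  \<open>(\<U>/\<X>)(C, V)\<close> with \<open>T(C, A[1])\<close> and
  \<open>(\<U>/\<X>)(A, D)\<close> with \<open>T(V, D[1])\<close> for \<open>C\<close> and
  \<open>D\<close> in \<open>\<U>\<close>.\<close>

definition syz :: "'o \<Rightarrow> 'o \<Rightarrow> 'm \<Rightarrow> bool" where
  "syz A V r \<longleftrightarrow> A \<in> \<U> \<and> V \<in> \<U> \<and> (\<exists>Y \<in> \<X>. \<exists>i p. (A, Y, V, i, p, r) \<in> Tri T)"

lemma syzI: "\<lbrakk>(A, Y, V, i, p, r) \<in> Tri T; Y \<in> \<X>; A \<in> \<U>; V \<in> \<U>\<rbrakk> \<Longrightarrow> syz A V r"
  unfolding syz_def by blast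

lemma syz_sigma: "A \<in> \<U> \<Longrightarrow> syz A (W A) (q A)"
  using sigma[of A] syzI by blast

lemma syz_omega: "A \<in> \<U> \<Longrightarrow> syz (chW \<omega> A) A (chq \<omega> A)"
  using omega[of A] syzI by blast

lemma syzE:
  assumes "syz A V r"
  obtains Y i p where "(A, Y, V, i, p, r) \<in> Tri T" "Y \<in> \<X>" "A \<in> \<U>" "V \<in> \<U>"
    "ar T r" "src T r = V" "tgt T r = sh A"
proof -
  obtain Y i p where "(A, Y, V, i, p, r) \<in> Tri T" "Y \<in> \<X>" "A \<in> \<U>" "V \<in> \<U>"
    using assms unfolding syz_def by blast
  then show thesis
    using that[of Y i p] TriD(10-12)[of A Y V i p r] by blast
qed

text \<open>A map from \<open>\<X>\<close> to \<open>A[1]\<close> vanishes. Together with the dual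
  below, this makes composition with extension classes well defined on the quotient.\<close>

lemma thru_ext_zero:
  assumes "thru d" "ar T h" "src T h = tgt T d" "tgt T h = sh A" "A \<in> \<U>"
  shows "h \<bullet> d = Zero T (src T d) (sh A)"
proof -
  obtain a b where ab: "ar T a" "ar T b" "src T b = tgt T a" "tgt T a \<in> \<X>" "d = b \<bullet> a"
    using thruE[OF assms(1)] .
  have "h \<bullet> b = Zero T (tgt T a) (sh A)"
    using zero_X_U[of "h \<bullet> b" A] ab assms by simp
  then show ?thesis
    using Comp_reduce[of h b "Zero T (tgt T a) (sh A)" a] ab assms by simp
qed

lemma ext_thru_zero:
  assumes "thru d" "ar T h" "tgt T h = sh (src T d)" "src T h \<in> \<U>"
  shows "shm d \<bullet> h = Zero T (src T h) (sh (tgt T d))"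
proof -
  obtain a b where ab: "ar T a" "ar T b" "src T b = tgt T a" "tgt T a \<in> \<X>" "d = b \<bullet> a"
    using thruE[OF assms(1)] .
  have "shm a \<bullet> h = Zero T (src T h) (sh (tgt T a))"
    using zero_U_X[of "shm a \<bullet> h" "tgt T a"] ab assms by simp
  then show ?thesis
    using ab assms by simp
qed

lemma ext_eqv_right:
  assumes "eqv s s'" "ar T h" "src T h = tgt T s" "tgt T h = sh A" "A \<in> \<U>"
  shows "h \<bullet> s = h \<bullet> s'"
proof -
  have "h \<bullet> diff T s s' = Zero T (src T s) (sh A)"
    using thru_ext_zero[of "diff T s s'" h A] assms by (simp add: eqv_def)
  then show ?thesis
    using diff_eq_Zero_iff[of "h \<bullet> s" "h \<bullet> s'"] assms by (simp add: eqv_def)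
qed

lemma ext_eqv_left:
  assumes "eqv s s'" "ar T h" "tgt T h = sh (src T s)" "src T h \<in> \<U>"
  shows "shm s \<bullet> h = shm s' \<bullet> h"
proof -
  have "shm (diff T s s') \<bullet> h = Zero T (src T h) (sh (tgt T s))"
    using ext_thru_zero[of "diff T s s'" h] assms by (simp add: eqv_def)
  then show ?thesis
    using diff_eq_Zero_iff[of "shm s \<bullet> h" "shm s' \<bullet> h"] assms by (simp add: eqv_def)
qed

text \<open>Surjectivity of \<open>s \<mapsto> r \<bullet> s\<close> onto extension classes: the
  obstruction is a map from \<open>\<U>\<close> to \<open>Y[1]\<close>.\<close>

lemma syz_lift:
  assumes "syz A V r" "ar T h" "src T h \<in> \<U>" "tgt T h = sh A"
  obtains s where "ar T s" "src T s = src T h" "tgt T s = V" "h = r \<bullet> s"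
proof -
  obtain Y i p where t: "(A, Y, V, i, p, r) \<in> Tri T" "Y \<in> \<X>" "A \<in> \<U>" "V \<in> \<U>"
    using syzE[OF assms(1)] .
  note t' = TriD[OF t(1)]
  have "shm i \<bullet> h = Zero T (src T h) (sh Y)"
    using zero_U_X[of "shm i \<bullet> h" Y] t t' assms by simp
  then show thesis
    using exact4[OF t(1) assms(2,4)] that by blast
qed

text \<open>Surjectivity on the other side: the obstruction is the restriction of \<open>h\<close>
  to \<open>Y\<close>, a map from \<open>\<X>\<close> to \<open>D[1]\<close>.\<close>

lemma syz_extend:
  assumes "syz A V r" "ar T h" "src T h = V" "tgt T h = sh D" "D \<in> \<U>"
  obtains s where "ar T s" "src T s = A" "tgt T s = D" "h = shm s \<bullet> r"
proof -
  obtain Y i p where t: "(A, Y, V, i, p, r) \<in> Tri T" "Y \<in> \<X>" "A \<in> \<U>" "V \<in> \<U>"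
    using syzE[OF assms(1)] .
  note t' = TriD[OF t(1)]
  have z: "h \<bullet> p = Zero T Y (tgt T h)"
    using zero_X_U[of "h \<bullet> p" D] t t' assms by simp
  obtain y where y: "ar T y" "src T y = sh A" "tgt T y = tgt T h" "h = y \<bullet> r"
    using coexact3[OF t(1) assms(2,3) z] .
  obtain s where s: "ar T s" "src T s = A" "tgt T s = D" "shm s = y"
    using shm_full[of A D y] y(1-3) t assms(4,5) by auto
  then show thesis
    using that y(4) by blast
qed

text \<open>Injectivity modulo \<open>\<X>\<close>: a map killed by \<open>r\<close> factors through
  the middle term \<open>Y\<close> of the triangle.\<close>

lemma syz_eqv_iff_right:
  assumes "syz A V r" "ar T s" "ar T s'" "src T s' = src T s" "tgt T s = V" "tgt T s' = V" "src T s \<in> \<U>"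
  shows "r \<bullet> s = r \<bullet> s' \<longleftrightarrow> eqv s s'"
proof
  obtain Y i p where t: "(A, Y, V, i, p, r) \<in> Tri T" "Y \<in> \<X>" "A \<in> \<U>" "V \<in> \<U>"
    using syzE[OF assms(1)] .
  note t' = TriD[OF t(1)]
  show "eqv s s'" if "r \<bullet> s = r \<bullet> s'"
  proof -
    have *: "ar T (diff T s s')" "tgt T (diff T s s') = V"
      "r \<bullet> diff T s s' = Zero T (src T (diff T s s')) (sh A)"
      using that assms t' by simp_all
    obtain y where "ar T y" "src T y = src T (diff T s s')" "tgt T y = Y" "diff T s s' = p \<bullet> y"
      using exact3[OF t(1) *] .
    then have "thru (diff T s s')"
      using thruI[of y p] t t' by simp
    then show ?thesis
      using assms by (simp add: eqv_def)
  qed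
  show "r \<bullet> s = r \<bullet> s'" if "eqv s s'"
    using ext_eqv_right[OF that] t t' assms by simp
qed

lemma syz_eqv_iff_left:
  assumes "syz A V r" "ar T s" "ar T s'" "src T s = A" "src T s' = A" "tgt T s' = tgt T s" "tgt T s \<in> \<U>"
  shows "shm s \<bullet> r = shm s' \<bullet> r \<longleftrightarrow> eqv s s'"
proof
  obtain Y i p where t: "(A, Y, V, i, p, r) \<in> Tri T" "Y \<in> \<X>" "A \<in> \<U>" "V \<in> \<U>"
    using syzE[OF assms(1)] .
  note t' = TriD[OF t(1)]
  show "eqv s s'" if "shm s \<bullet> r = shm s' \<bullet> r"
  proof -
    have *: "ar T (diff T s s')" "src T (diff T s s') = A"
      "shm (diff T s s') \<bullet> r = Zero T V (sh (tgt T (diff T s s')))"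
      using that assms t' by simp_all
    obtain y where "ar T y" "src T y = Y" "tgt T y = tgt T (diff T s s')" "diff T s s' = y \<bullet> i"
      using coexact1[OF t(1) *] .
    then have "thru (diff T s s')"
      using thruI[of i y] t t' by simp
    then show ?thesis
      using assms by (simp add: eqv_def)
  qed
  show "shm s \<bullet> r = shm s' \<bullet> r" if "eqv s s'"
    using ext_eqv_left[OF that] t t' assms by simp
qed

text \<open>Syzygies of one object are unique in \<open>\<U>/\<X>\<close>. A map back is obtained by
  extending \<open>r\<close>, and both composites act as the identity on the classes
  \<open>r\<close> and \<open>r'\<close>.\<close>

lemma syz_iso_left:
  assumes "syz A V r" "syz A' V r'" "ar T e" "src T e = A" "tgt T e = A'" "shm e \<bullet> r = r'"
  shows "is_iso Q (cl e)"
proof -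
  have t: "ar T r" "src T r = V" "tgt T r = sh A" "A \<in> \<U>" "ar T r'" "src T r' = V" "tgt T r' = sh A'" "A' \<in> \<U>"
    using syzE[OF assms(1)] syzE[OF assms(2)] by metis+
  obtain e' where e': "ar T e'" "src T e' = A'" "tgt T e' = A" "r = shm e' \<bullet> r'"
    by (rule syz_extend[OF assms(2) t(1,2,3,4)])
  have "eqv (e' \<bullet> e) (Ident T A)"
    using syz_eqv_iff_left[OF assms(1), of "e' \<bullet> e" "Ident T A"] e'(1-3) e'(4)[symmetric] assms(3-) t by simp
  moreover have "eqv (e \<bullet> e') (Ident T A')"
    using syz_eqv_iff_left[OF assms(2), of "e \<bullet> e'" "Ident T A'"] e'(1-3) e'(4)[symmetric] assms(3-) t by simp
  ultimately show ?thesis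
    using Q_isoI[of e e'] e'(1-3) assms(3-5) t by simp
qed

lemma syz_iso_right:
  assumes "syz A V r" "syz A V' r'" "ar T e" "src T e = V" "tgt T e = V'" "r' \<bullet> e = r"
  shows "is_iso Q (cl e)"
proof -
  have t: "ar T r" "src T r = V" "tgt T r = sh A" "V \<in> \<U>" "ar T r'" "src T r' = V'" "tgt T r' = sh A" "V' \<in> \<U>"
    using syzE[OF assms(1)] syzE[OF assms(2)] by metis+
  have t8: "src T r' \<in> \<U>"
    using t by simp
  obtain e' where e': "ar T e'" "src T e' = src T r'" "tgt T e' = V" "r' = r \<bullet> e'"
    by (rule syz_lift[OF assms(1) t(5) t8 t(7)])
  have "eqv (e' \<bullet> e) (Ident T V)"
    using syz_eqv_iff_right[OF assms(1), of "e' \<bullet> e" "Ident T V"] e'(1-3) assms(3-) t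
      Comp_reduce[OF e'(4)[symmetric], of e] by simp
  moreover have "eqv (e \<bullet> e') (Ident T V')"
    using syz_eqv_iff_right[OF assms(2), of "e \<bullet> e'" "Ident T V'"] e'(1-3) e'(4)[symmetric] assms(3-) t
      Comp_reduce[OF assms(6), of e'] by simp
  ultimately show ?thesis
    using Q_isoI[of e e'] e'(1-3) assms(3-5) t by simp
qed

subsection \<open>Suspension\<close>

lemma ex_susp:
  assumes "ar T a" "src T a \<in> \<U>" "tgt T a \<in> \<U>"
  obtains s where "ar T s" "src T s = W (src T a)" "tgt T s = W (tgt T a)"
    "q (tgt T a) \<bullet> s = shm a \<bullet> q (src T a)"
proof -
  have *: "ar T (shm a \<bullet> q (src T a))" "src T (shm a \<bullet> q (src T a)) \<in> \<U>"
    "tgt T (shm a \<bullet> q (src T a)) = sh (tgt T a)"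
    using assms by simp_all
  obtain s where s: "ar T s" "src T s = src T (shm a \<bullet> q (src T a))" "tgt T s = W (tgt T a)"
    "shm a \<bullet> q (src T a) = q (tgt T a) \<bullet> s"
    using syz_lift[OF syz_sigma[OF assms(3)] *] .
  have "src T s = W (src T a)"
    using s(2) assms by simp
  then show thesis
    using that[OF s(1) _ s(3) s(4)[symmetric]] by blast
qed

text \<open>Reduces the union in \<open>sigma_functor\<close> to the single relation between
  \<open>s\<close> and \<open>a[1]\<close>. The middle component demanded there is supplied by
  \<open>Tri_map2\<close>.\<close>

lemma susp_cl:
  assumes a: "ar T a" "src T a = A" "tgt T a = B" "A \<in> \<U>" "B \<in> \<U>"
    and s: "ar T s" "src T s = W A" "tgt T s = W B" "q B \<bullet> s = shm a \<bullet> q A"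
  shows "mor (Sus Q) (cl a) = cl s"
proof -
  let ?M = "\<lambda>A B. tri_map T (A, chX \<sigma> A, W A, chi \<sigma> A, chp \<sigma> A, q A) (B, chX \<sigma> B, W B, chi \<sigma> B, chp \<sigma> B, q B)"
  have M: "?M A B (f, x, s) \<longleftrightarrow> ar T f \<and> src T f = A \<and> tgt T f = B \<and>
      ar T x \<and> src T x = chX \<sigma> A \<and> tgt T x = chX \<sigma> B \<and> ar T s \<and> src T s = W A \<and> tgt T s = W B \<and>
      x \<bullet> chi \<sigma> A = chi \<sigma> B \<bullet> f \<and> s \<bullet> chp \<sigma> A = chp \<sigma> B \<bullet> x \<and> shm f \<bullet> q A = q B \<bullet> s"
    if "A \<in> \<U>" "B \<in> \<U>" for A B f x s
    using sigma[OF that(1)] sigma[OF that(2)] Tri_candidate by (intro tri_map_iff) auto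
  \<comment> \<open>The class of \<open>a\<close> determines \<open>a[1] \<bullet> q A\<close>,
    hence \<open>q B \<bullet> s'\<close>, hence \<open>s'\<close> modulo \<open>\<X>\<close>. So
    all sets in the union coincide.\<close>
  have cl: "cl s' = cl s" if AB: "A' \<in> \<U>" "B' \<in> \<U>" and f: "f \<in> cl a" and m: "?M A' B' (f, x, s')" for A' B' f x s'
  proof -
    have fa: "eqv f a"
      using f cl_iff a by simp
    note m' = m[unfolded M[OF AB]]
    have AB': "A' = A" "B' = B"
      using fa m' a by (auto simp: eqv_def)
    have "shm f \<bullet> q A = shm a \<bullet> q A"
      using ext_eqv_left[OF fa, of "q A"] m' AB' a by simp
    then have "q B \<bullet> s' = q B \<bullet> s"
      using m' AB' s by simp
    then have "eqv s' s"
      using syz_eqv_iff_right[OF syz_sigma[OF a(5)], of s' s] m' AB' s a by simp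
    then show ?thesis
      using cl_eqI m' AB' a by simp
  qed
  obtain x where x: "ar T x" "src T x = chX \<sigma> A" "tgt T x = chX \<sigma> B"
    "x \<bullet> chi \<sigma> A = chi \<sigma> B \<bullet> a" "s \<bullet> chp \<sigma> A = chp \<sigma> B \<bullet> x"
    by (rule Tri_map2[OF conjunct1[OF sigma[OF a(4)]] conjunct1[OF sigma[OF a(5)]] a(1-3) s(1-4)])
  have "?M A B (a, x, s)"
    unfolding M[OF a(4,5)] using a s x by simp
  moreover have "a \<in> cl a"
    using cl_iff[of a a] a by simp
  ultimately have "{cl s' | A' B' f x s'. A' \<in> \<U> \<and> B' \<in> \<U> \<and> f \<in> cl a \<and> ?M A' B' (f, x, s')} = {cl s}"
    using cl a(4,5) by blast
  then show ?thesis
    by (simp add: Sus_Q sigma_functor_def)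
qed

lemma ob_Sus_Q [simp]: "ob (Sus Q) = W"
  by (simp add: Sus_Q sigma_functor_def)

lemma susp_rep:
  assumes "ar T a" "src T a = A" "tgt T a = B" "A \<in> \<U>" "B \<in> \<U>"
  obtains s where "ar T s" "src T s = W A" "tgt T s = W B" "q B \<bullet> s = shm a \<bullet> q A" "mor (Sus Q) (cl a) = cl s"
  using ex_susp[of a] susp_cl assms by metis

lemma Sus_Q_functor: "is_functor Q Q (Sus Q)"
proof (rule Q.is_functorI)
  show "ob (Sus Q) A \<in> Ob Q" if "A \<in> Ob Q" for A
    using that by simp
next
  fix F assume "ar Q F"
  then obtain f where f: "ar T f" "src T f \<in> \<U>" "tgt T f \<in> \<U>" "F = cl f"
    by (rule Q_rep)
  obtain s where "ar T s" "src T s = W (src T f)" "tgt T s = W (tgt T f)"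
    "mor (Sus Q) (cl f) = cl s"
    using susp_rep[OF f(1) refl refl f(2,3)] by blast
  then show "ar Q (mor (Sus Q) F) \<and> src Q (mor (Sus Q) F) = ob (Sus Q) (src Q F) \<and>
      tgt Q (mor (Sus Q) F) = ob (Sus Q) (tgt Q F)"
    using f by simp
next
  fix A assume "A \<in> Ob Q"
  then have A: "A \<in> \<U>"
    by simp
  show "mor (Sus Q) (Ident Q A) = Ident Q (ob (Sus Q) A)"
    using susp_cl[of "Ident T A" A A "Ident T (W A)"] A by simp
next
  fix F G assume FG: "ar Q F" "ar Q G" "src Q G = tgt Q F"
  obtain f where f: "ar T f" "src T f \<in> \<U>" "tgt T f \<in> \<U>" "F = cl f"
    using Q_rep[OF FG(1)] .
  obtain g where g: "ar T g" "src T g \<in> \<U>" "tgt T g \<in> \<U>" "G = cl g"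
    using Q_rep[OF FG(2)] .
  have U: "src T f \<in> \<U>" "tgt T f \<in> \<U>" "src T g = tgt T f" "tgt T g \<in> \<U>"
    using f g FG by simp_all
  obtain s where s: "ar T s" "src T s = W (src T f)" "tgt T s = W (tgt T f)"
    "q (tgt T f) \<bullet> s = shm f \<bullet> q (src T f)" "mor (Sus Q) (cl f) = cl s"
    using susp_rep[OF f(1) refl refl U(1,2)] .
  obtain r where r: "ar T r" "src T r = W (tgt T f)" "tgt T r = W (tgt T g)"
    "q (tgt T g) \<bullet> r = shm g \<bullet> q (tgt T f)" "mor (Sus Q) (cl g) = cl r"
    using susp_rep[OF g(1) U(3) refl U(2,4)] .
  have "mor (Sus Q) (cl (g \<bullet> f)) = cl (r \<bullet> s)"
    by (rule susp_cl[of _ "src T f" "tgt T g"])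
      (use f(1) g(1) U s(1-4) r(1-3) Comp_reduce[OF r(4), of s] in simp_all)
  then show "mor (Sus Q) (G \<bullet>\<^bsub>Q\<^esub> F) = mor (Sus Q) G \<bullet>\<^bsub>Q\<^esub> mor (Sus Q) F"
    unfolding f(4) g(4) using f(1) g(1) U s r by simp
qed

lemma Sus_Q_additive: "additive_functor Q Q (Sus Q)"
  unfolding additive_functor_def
proof (intro conjI Sus_Q_functor ballI)
  fix A B F G assume *: "A \<in> Ob Q" "B \<in> Ob Q" "F \<in> Hom Q A B" "G \<in> Hom Q A B"
  have U: "A \<in> \<U>" "B \<in> \<U>"
    using * by simp_all
  obtain f where f: "ar T f" "src T f = A" "tgt T f = B" "F = cl f"
    by (rule Q_HomE[of F A B]) (use * in auto)
  obtain g where g: "ar T g" "src T g = A" "tgt T g = B" "G = cl g"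
    by (rule Q_HomE[of G A B]) (use * in auto)
  obtain s where s: "ar T s" "src T s = W A" "tgt T s = W B"
    "q B \<bullet> s = shm f \<bullet> q A" "mor (Sus Q) (cl f) = cl s"
    using susp_rep[OF f(1-3) U] .
  obtain r where r: "ar T r" "src T r = W A" "tgt T r = W B"
    "q B \<bullet> r = shm g \<bullet> q A" "mor (Sus Q) (cl g) = cl r"
    using susp_rep[OF g(1-3) U] .
  have "mor (Sus Q) (cl (Add T f g)) = cl (Add T s r)"
    by (rule susp_cl[of _ A B]) (use f(1-3) g(1-3) U s(1-4) r(1-4) in simp_all)
  then show "mor (Sus Q) (Add Q F G) = Add Q (mor (Sus Q) F) (mor (Sus Q) G)"
    unfolding f(4) g(4) using f(1-3) g(1-3) U s r by simp
qed

text \<open>The syzygies of \<open>\<omega>\<close> are governed by the same relation \<open>chq \<omega> B \<bullet> a = shm s \<bullet> chq \<omega> A\<close>, read from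
  right to left.\<close>

lemma omega_facts [simp]:
  assumes "A \<in> \<U>"
  shows "chX \<omega> A \<in> \<X>" "chW \<omega> A \<in> \<U>" "ar T (chq \<omega> A)" "src T (chq \<omega> A) = A" "tgt T (chq \<omega> A) = sh (chW \<omega> A)"
  using omega[OF assms] TriD[of "chW \<omega> A" "chX \<omega> A" A "chi \<omega> A" "chp \<omega> A" "chq \<omega> A"] by simp_all

lemma loop_cl:
  assumes a: "ar T a" "src T a = A" "tgt T a = B" "A \<in> \<U>" "B \<in> \<U>"
    and s: "ar T s" "src T s = chW \<omega> A" "tgt T s = chW \<omega> B" "shm s \<bullet> chq \<omega> A = chq \<omega> B \<bullet> a"
  shows "mor (omega_functor T \<U> \<X> \<omega>) (cl a) = cl s"
proof -
  let ?M = "\<lambda>A B. tri_map T (chW \<omega> A, chX \<omega> A, A, chi \<omega> A, chp \<omega> A, chq \<omega> A)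
    (chW \<omega> B, chX \<omega> B, B, chi \<omega> B, chp \<omega> B, chq \<omega> B)"
  have M: "?M A B (s, x, f) \<longleftrightarrow> ar T s \<and> src T s = chW \<omega> A \<and> tgt T s = chW \<omega> B \<and>
      ar T x \<and> src T x = chX \<omega> A \<and> tgt T x = chX \<omega> B \<and> ar T f \<and> src T f = A \<and> tgt T f = B \<and>
      x \<bullet> chi \<omega> A = chi \<omega> B \<bullet> s \<and> f \<bullet> chp \<omega> A = chp \<omega> B \<bullet> x \<and> shm s \<bullet> chq \<omega> A = chq \<omega> B \<bullet> f"
    if "A \<in> \<U>" "B \<in> \<U>" for A B f x s
    using omega[OF that(1)] omega[OF that(2)] Tri_candidate by (intro tri_map_iff) auto
  have cl: "cl s' = cl s" if AB: "A' \<in> \<U>" "B' \<in> \<U>" and f: "f \<in> cl a" and m: "?M A' B' (s', x, f)" for A' B' f x s'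
  proof -
    have fa: "eqv f a"
      using f cl_iff a by simp
    note m' = m[unfolded M[OF AB]]
    have AB': "A' = A" "B' = B"
      using fa m' a by (auto simp: eqv_def)
    have "chq \<omega> B \<bullet> f = chq \<omega> B \<bullet> a"
      by (rule ext_eqv_right[OF fa, of "chq \<omega> B" "chW \<omega> B"]) (use m' AB' a in simp_all)
    then have "shm s' \<bullet> chq \<omega> A = shm s \<bullet> chq \<omega> A"
      using m' AB' s by simp
    then have "eqv s' s"
      using syz_eqv_iff_left[OF syz_omega[OF a(4)], of s' s] m' AB' s a by simp
    then show ?thesis
      using cl_eqI m' AB' a by simp
  qed
  have s4: "chq \<omega> B \<bullet> a = shm s \<bullet> chq \<omega> A"
    using s(4) by simp
  obtain x where x: "ar T x" "src T x = chX \<omega> A" "tgt T x = chX \<omega> B"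
    "x \<bullet> chi \<omega> A = chi \<omega> B \<bullet> s" "a \<bullet> chp \<omega> A = chp \<omega> B \<bullet> x"
    by (rule Tri_map2[OF conjunct1[OF omega[OF a(4)]] conjunct1[OF omega[OF a(5)]] s(1-3) a(1-3) s4])
  have "?M A B (s, x, a)"
    unfolding M[OF a(4,5)] using a s x by simp
  moreover have "a \<in> cl a"
    using cl_iff[of a a] a by simp
  ultimately have "{cl s' | A' B' f x s'. A' \<in> \<U> \<and> B' \<in> \<U> \<and> f \<in> cl a \<and> ?M A' B' (s', x, f)} = {cl s}"
    using cl a(4,5) by blast
  then show ?thesis
    by (simp add: omega_functor_def)
qed

lemma loop_rep:
  assumes "ar T a" "src T a = A" "tgt T a = B" "A \<in> \<U>" "B \<in> \<U>"
  obtains s where "ar T s" "src T s = chW \<omega> A" "tgt T s = chW \<omega> B" "shm s \<bullet> chq \<omega> A = chq \<omega> B \<bullet> a"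
    "mor (omega_functor T \<U> \<X> \<omega>) (cl a) = cl s"
proof -
  have *: "ar T (chq \<omega> B \<bullet> a)" "src T (chq \<omega> B \<bullet> a) = A" "tgt T (chq \<omega> B \<bullet> a) = sh (chW \<omega> B)" "chW \<omega> B \<in> \<U>"
    using assms by simp_all
  obtain s where s: "ar T s" "src T s = chW \<omega> A" "tgt T s = chW \<omega> B" "chq \<omega> B \<bullet> a = shm s \<bullet> chq \<omega> A"
    using syz_extend[OF syz_omega[OF assms(4)] *] .
  then show thesis
    using that[of s] loop_cl[OF assms, of s] by simp
qed

lemma loop_functor: "is_functor Q Q (omega_functor T \<U> \<X> \<omega>)"
proof (rule Q.is_functorI)
  let ?L = "omega_functor T \<U> \<X> \<omega>"
  have [simp]: "ob ?L = chW \<omega>"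
    by (simp add: omega_functor_def)
  show "ob ?L A \<in> Ob Q" if "A \<in> Ob Q" for A
    using that by simp
  show "ar Q (mor ?L F) \<and> src Q (mor ?L F) = ob ?L (src Q F) \<and> tgt Q (mor ?L F) = ob ?L (tgt Q F)"
    if F: "ar Q F" for F
  proof -
    obtain f where f: "ar T f" "src T f \<in> \<U>" "tgt T f \<in> \<U>" "F = cl f"
      using Q_rep[OF F] .
    obtain s where "ar T s" "src T s = chW \<omega> (src T f)" "tgt T s = chW \<omega> (tgt T f)" "mor ?L (cl f) = cl s"
      using loop_rep[OF f(1) refl refl f(2,3)] by blast
    then show ?thesis
      using f by simp
  qed
  show "mor ?L (Ident Q A) = Ident Q (ob ?L A)" if "A \<in> Ob Q" for A
    using loop_cl[of "Ident T A" A A "Ident T (chW \<omega> A)"] that by simp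
  show "mor ?L (G \<bullet>\<^bsub>Q\<^esub> F) = mor ?L G \<bullet>\<^bsub>Q\<^esub> mor ?L F" if FG: "ar Q F" "ar Q G" "src Q G = tgt Q F" for F G
  proof -
    obtain f where f: "ar T f" "src T f \<in> \<U>" "tgt T f \<in> \<U>" "F = cl f"
      using Q_rep[OF FG(1)] .
    obtain g where g: "ar T g" "src T g \<in> \<U>" "tgt T g \<in> \<U>" "G = cl g"
      using Q_rep[OF FG(2)] .
    have U: "src T f \<in> \<U>" "tgt T f \<in> \<U>" "src T g = tgt T f" "tgt T g \<in> \<U>"
      using f g FG by simp_all
    obtain s where s: "ar T s" "src T s = chW \<omega> (src T f)" "tgt T s = chW \<omega> (tgt T f)"
      "shm s \<bullet> chq \<omega> (src T f) = chq \<omega> (tgt T f) \<bullet> f" "mor ?L (cl f) = cl s"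
      using loop_rep[OF f(1) refl refl U(1,2)] .
    obtain r where r: "ar T r" "src T r = chW \<omega> (tgt T f)" "tgt T r = chW \<omega> (tgt T g)"
      "shm r \<bullet> chq \<omega> (tgt T f) = chq \<omega> (tgt T g) \<bullet> g" "mor ?L (cl g) = cl r"
      using loop_rep[OF g(1) U(3) refl U(2,4)] .
    have "mor ?L (cl (g \<bullet> f)) = cl (r \<bullet> s)"
      by (rule loop_cl[of _ "src T f" "tgt T g"])
        (use f(1) g(1) U s(1-4) r(1-3) Comp_reduce[OF r(4), of f] in simp_all)
    then show ?thesis
      unfolding f(4) g(4) using f(1) g(1) U s r by simp
  qed
qed

lemma quasi_inverse_Sus_loop: "quasi_inverse Q Q (Sus Q) (omega_functor T \<U> \<X> \<omega>)"
  unfolding quasi_inverse_def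
proof (intro conjI exI Sus_Q_functor loop_functor)
  let ?L = "omega_functor T \<U> \<X> \<omega>"
  have L [simp]: "ob ?L = chW \<omega>"
    by (simp add: omega_functor_def)
  \<comment> \<open>\<open>A\<close> and the chosen syzygy of \<open>W A\<close> are both syzygies
    of \<open>W A\<close>; the unit compares their classes \<open>q A\<close> and
    \<open>chq \<omega> (W A)\<close>.\<close>
  have ex_unit: "\<exists>e. ar T e \<and> src T e = A \<and> tgt T e = chW \<omega> (W A) \<and> chq \<omega> (W A) = shm e \<bullet> q A" if A: "A \<in> \<U>" for A
    by (rule syz_extend[OF syz_sigma[OF A], of "chq \<omega> (W A)" "chW \<omega> (W A)"]) (use A in auto)
  define e where "e A = (SOME e. ar T e \<and> src T e = A \<and> tgt T e = chW \<omega> (W A) \<and> chq \<omega> (W A) = shm e \<bullet> q A)" for A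
  have e: "ar T (e A)" "src T (e A) = A" "tgt T (e A) = chW \<omega> (W A)" "chq \<omega> (W A) = shm (e A) \<bullet> q A"
    if "A \<in> \<U>" for A
    using someI_ex[OF ex_unit[OF that]] unfolding e_def by simp_all
  show "natural_iso Q Q id_func (comp_func ?L (Sus Q)) (\<lambda>A. cl (e A))"
  proof (rule Q.natural_isoI)
    fix A assume "A \<in> Ob Q"
    then have A: "A \<in> \<U>"
      by simp
    show "ob id_func A \<in> Ob Q \<and> ob (comp_func ?L (Sus Q)) A \<in> Ob Q"
      using A by (simp add: id_func_def comp_func_def)
    have "is_iso Q (cl (e A))"
      by (rule syz_iso_left[OF syz_sigma[OF A] syz_omega[OF sigma_facts(2)[OF A]]]) (use e[OF A] in simp_all)
    then show "is_iso Q (cl (e A)) \<and> src Q (cl (e A)) = ob id_func A \<and>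
        tgt Q (cl (e A)) = ob (comp_func ?L (Sus Q)) A"
      using A e[OF A] by (simp add: id_func_def comp_func_def)
  next
    fix F assume "ar Q F"
    then obtain f where f: "ar T f" "src T f \<in> \<U>" "tgt T f \<in> \<U>" "F = cl f"
      by (rule Q_rep)
    define A B where "A = src T f" and "B = tgt T f"
    have AB: "A \<in> \<U>" "B \<in> \<U>"
      using f by (simp_all add: A_def B_def)
    obtain s where s: "ar T s" "src T s = W A" "tgt T s = W B"
      "q B \<bullet> s = shm f \<bullet> q A" "mor (Sus Q) (cl f) = cl s"
      using susp_rep[OF f(1) A_def[symmetric] B_def[symmetric] AB] .
    have WAB: "W A \<in> \<U>" "W B \<in> \<U>"
      using AB by simp_all
    obtain u where u: "ar T u" "src T u = chW \<omega> (W A)" "tgt T u = chW \<omega> (W B)"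
      "shm u \<bullet> chq \<omega> (W A) = chq \<omega> (W B) \<bullet> s" "mor ?L (cl s) = cl u"
      using loop_rep[OF s(1-3) WAB] .
    have fe: "ar T f" "src T f = A" "tgt T f = B"
      using f(1) A_def B_def by simp_all
    have "shm (e B \<bullet> f) \<bullet> q A = shm (e B) \<bullet> (q B \<bullet> s)"
      using e(1-3)[OF AB(1)] e(1-3)[OF AB(2)] fe s(4) AB by simp
    also have "\<dots> = chq \<omega> (W B) \<bullet> s"
      using Comp_reduce[OF e(4)[OF AB(2), symmetric], of s] s(1-3) e(1-3)[OF AB(2)] AB by simp
    also have "\<dots> = shm u \<bullet> (shm (e A) \<bullet> q A)"
      using u(4) e(4)[OF AB(1)] by simp
    also have "\<dots> = shm (u \<bullet> e A) \<bullet> q A"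
      using u(1-3) e(1-3)[OF AB(1)] AB by simp
    finally have "eqv (e B \<bullet> f) (u \<bullet> e A)"
      by (subst (asm) syz_eqv_iff_left[OF syz_sigma[OF AB(1)]])
        (use e(1-3)[OF AB(1)] e(1-3)[OF AB(2)] fe u(1-3) AB in simp_all)
    then have "cl (e B) \<bullet>\<^bsub>Q\<^esub> cl f = cl u \<bullet>\<^bsub>Q\<^esub> cl (e A)"
      using e(1-3)[OF AB(1)] e(1-3)[OF AB(2)] fe u(1-3) AB by (simp add: cl_eq_iff)
    then show "cl (e (tgt Q F)) \<bullet>\<^bsub>Q\<^esub> mor id_func F = mor (comp_func ?L (Sus Q)) F \<bullet>\<^bsub>Q\<^esub> cl (e (src Q F))"
      using f s(5) u(5) by (simp add: id_func_def comp_func_def A_def B_def del: cl_Comp)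
  qed
  \<comment> \<open>Dually, \<open>A\<close> and \<open>W (chW \<omega> A)\<close> are both
    cosyzygies of \<open>chW \<omega> A\<close>.\<close>
  have ex_counit: "\<exists>e. ar T e \<and> src T e = W (chW \<omega> A) \<and> tgt T e = A \<and> q (chW \<omega> A) = chq \<omega> A \<bullet> e" if A: "A \<in> \<U>" for A
  proof -
    have *: "ar T (q (chW \<omega> A))" "src T (q (chW \<omega> A)) \<in> \<U>" "tgt T (q (chW \<omega> A)) = sh (chW \<omega> A)"
      using A by simp_all
    obtain s where s: "ar T s" "src T s = src T (q (chW \<omega> A))" "tgt T s = A" "q (chW \<omega> A) = chq \<omega> A \<bullet> s"
      using syz_lift[OF syz_omega[OF A] *] .
    have "src T s = W (chW \<omega> A)"
      using s(2) A by simp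
    then show ?thesis
      using s(1,3,4) by blast
  qed
  define d where "d A = (SOME e. ar T e \<and> src T e = W (chW \<omega> A) \<and> tgt T e = A \<and> q (chW \<omega> A) = chq \<omega> A \<bullet> e)" for A
  have d: "ar T (d A)" "src T (d A) = W (chW \<omega> A)" "tgt T (d A) = A" "q (chW \<omega> A) = chq \<omega> A \<bullet> d A"
    if "A \<in> \<U>" for A
    using someI_ex[OF ex_counit[OF that]] unfolding d_def by simp_all
  show "natural_iso Q Q (comp_func (Sus Q) ?L) id_func (\<lambda>A. cl (d A))"
  proof (rule Q.natural_isoI)
    fix A assume "A \<in> Ob Q"
    then have A: "A \<in> \<U>"
      by simp
    show "ob (comp_func (Sus Q) ?L) A \<in> Ob Q \<and> ob id_func A \<in> Ob Q"
      using A by (simp add: id_func_def comp_func_def)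
    have "is_iso Q (cl (d A))"
      by (rule syz_iso_right[OF syz_sigma[OF omega_facts(2)[OF A]] syz_omega[OF A]]) (use d[OF A] in simp_all)
    then show "is_iso Q (cl (d A)) \<and> src Q (cl (d A)) = ob (comp_func (Sus Q) ?L) A \<and>
        tgt Q (cl (d A)) = ob id_func A"
      using A d[OF A] by (simp add: id_func_def comp_func_def)
  next
    fix F assume "ar Q F"
    then obtain f where f: "ar T f" "src T f \<in> \<U>" "tgt T f \<in> \<U>" "F = cl f"
      by (rule Q_rep)
    define A B where "A = src T f" and "B = tgt T f"
    have AB: "A \<in> \<U>" "B \<in> \<U>"
      using f by (simp_all add: A_def B_def)
    obtain u where u: "ar T u" "src T u = chW \<omega> A" "tgt T u = chW \<omega> B"
      "shm u \<bullet> chq \<omega> A = chq \<omega> B \<bullet> f" "mor ?L (cl f) = cl u"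
      using loop_rep[OF f(1) A_def[symmetric] B_def[symmetric] AB] .
    have WAB: "chW \<omega> A \<in> \<U>" "chW \<omega> B \<in> \<U>"
      using AB by simp_all
    obtain s where s: "ar T s" "src T s = W (chW \<omega> A)" "tgt T s = W (chW \<omega> B)"
      "q (chW \<omega> B) \<bullet> s = shm u \<bullet> q (chW \<omega> A)" "mor (Sus Q) (cl u) = cl s"
      using susp_rep[OF u(1-3) WAB] .
    have fe: "ar T f" "src T f = A" "tgt T f = B"
      using f(1) A_def B_def by simp_all
    have "chq \<omega> B \<bullet> (d B \<bullet> s) = q (chW \<omega> B) \<bullet> s"
      using Comp_reduce[OF d(4)[OF AB(2), symmetric], of s] s(1-3) d(1-3)[OF AB(2)] AB by simp
    also have "\<dots> = shm u \<bullet> (chq \<omega> A \<bullet> d A)"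
      using s(4) d(4)[OF AB(1)] by simp
    also have "\<dots> = (chq \<omega> B \<bullet> f) \<bullet> d A"
      using Comp_reduce[OF u(4), of "d A"] d(1-3)[OF AB(1)] u(1-3) AB fe by simp
    also have "\<dots> = chq \<omega> B \<bullet> (f \<bullet> d A)"
      using d(1-3)[OF AB(1)] fe AB by simp
    finally have "eqv (d B \<bullet> s) (f \<bullet> d A)"
      by (subst (asm) syz_eqv_iff_right[OF syz_omega[OF AB(2)]])
        (use d(1-3)[OF AB(1)] d(1-3)[OF AB(2)] fe s(1-3) AB in simp_all)
    then have "cl (d B) \<bullet>\<^bsub>Q\<^esub> cl s = cl f \<bullet>\<^bsub>Q\<^esub> cl (d A)"
      using d(1-3)[OF AB(1)] d(1-3)[OF AB(2)] fe s(1-3) AB by (simp add: cl_eq_iff)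
    then show "cl (d (tgt Q F)) \<bullet>\<^bsub>Q\<^esub> mor (comp_func (Sus Q) ?L) F = mor id_func F \<bullet>\<^bsub>Q\<^esub> cl (d (src Q F))"
      using f s(5) u(5) by (simp add: id_func_def comp_func_def A_def B_def del: cl_Comp)
  qed
qed

lemma Sus_Q_equivalence: "is_equivalence Q Q (Sus Q)"
  using quasi_inverse_Sus_loop unfolding is_equivalence_def by blast

subsection \<open>Conflations\<close>

lemma Q_isoE:
  assumes "is_iso Q (cl a)" "ar T a" "src T a \<in> \<U>" "tgt T a \<in> \<U>"
  obtains a' where "ar T a'" "src T a' = tgt T a" "tgt T a' = src T a"
    "eqv (a' \<bullet> a) (Ident T (src T a))" "eqv (a \<bullet> a') (Ident T (tgt T a))"
proof -
  have i: "ar Q (inv_of Q (cl a))" "src Q (inv_of Q (cl a)) = tgt T a" "tgt Q (inv_of Q (cl a)) = src T a"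
    "inv_of Q (cl a) \<bullet>\<^bsub>Q\<^esub> cl a = cl (Ident T (src T a))" "cl a \<bullet>\<^bsub>Q\<^esub> inv_of Q (cl a) = cl (Ident T (tgt T a))"
    using Q.inv_of_props[OF assms(1)] assms(2-) by simp_all
  obtain a' where a': "ar T a'" "src T a' \<in> \<U>" "tgt T a' \<in> \<U>" "inv_of Q (cl a) = cl a'"
    using Q_rep[OF i(1)] .
  have st: "src T a' = tgt T a" "tgt T a' = src T a"
    using i(2,3) a' by simp_all
  show thesis
    using that[OF a'(1) st] i(4,5) a' st assms(2-) by (simp add: cl_eq_iff)
qed

text \<open>The connecting map is an extension of an object of \<open>\<X>\<close> by one of
  \<open>\<U>\<close> and vanishes, so the triangle splits; the complementary summand
  \<open>Y\<close> is zero in the quotient.\<close>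

lemma split_left:
  assumes "(B, E, Y, y, e, l) \<in> Tri T" "B \<in> \<U>" "E \<in> \<U>" "Y \<in> \<X>"
  shows "is_iso Q (cl y)"
proof -
  note t = TriD[OF assms(1)]
  have l: "shm (Ident T B) \<bullet> l = Zero T Y (sh (tgt T (Ident T B)))"
    using zero_X_U[of l B] t assms by simp
  have B: "ar T (Ident T B)" "src T (Ident T B) = B"
    using t by simp_all
  obtain r where r: "ar T r" "src T r = E" "tgt T r = tgt T (Ident T B)" "Ident T B = r \<bullet> y"
    using coexact1[OF assms(1) B l] .
  have r3: "tgt T r = B"
    using r(3) t by simp
  have m: "ar T (diff T (y \<bullet> r) (Ident T E))" "src T (diff T (y \<bullet> r) (Ident T E)) = E"
    "tgt T (diff T (y \<bullet> r) (Ident T E)) = E"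
    using r(1,2) r3 t by simp_all
  have m0: "diff T (y \<bullet> r) (Ident T E) \<bullet> y = Zero T B (tgt T (diff T (y \<bullet> r) (Ident T E)))"
    using r(1,2) r3 r(4)[symmetric] t by simp
  obtain z where z: "ar T z" "src T z = Y" "tgt T z = tgt T (diff T (y \<bullet> r) (Ident T E))"
    "diff T (y \<bullet> r) (Ident T E) = z \<bullet> e"
    using coexact2[OF assms(1) m(1,2) m0] .
  have "thru (diff T (y \<bullet> r) (Ident T E))"
    unfolding z(4) by (rule thruI) (use z(1,2) t assms in simp_all)
  then have "eqv (y \<bullet> r) (Ident T E)"
    using r(1,2) r3 t by (simp add: eqv_def)
  then show ?thesis
    using Q_isoI[of y r] r(1,2) r3 r(4)[symmetric] t assms by simp
qed

lemma split_right:
  assumes "(Y, E, D, m, n, l) \<in> Tri T" "Y \<in> \<X>" "E \<in> \<U>" "D \<in> \<U>"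
  shows "is_iso Q (cl n)"
proof -
  note t = TriD[OF assms(1)]
  have l: "l \<bullet> Ident T D = Zero T (src T (Ident T D)) (sh Y)"
    using zero_U_X[of l Y] t assms by simp
  have D: "ar T (Ident T D)" "tgt T (Ident T D) = D"
    using t by simp_all
  obtain r where r: "ar T r" "src T r = src T (Ident T D)" "tgt T r = E" "Ident T D = n \<bullet> r"
    using exact3[OF assms(1) D l] .
  have r2: "src T r = D"
    using r(2) t by simp
  have x: "ar T (diff T (r \<bullet> n) (Ident T E))" "src T (diff T (r \<bullet> n) (Ident T E)) = E"
    "tgt T (diff T (r \<bullet> n) (Ident T E)) = E"
    using r(1,3) r2 t by simp_all
  have x0: "n \<bullet> diff T (r \<bullet> n) (Ident T E) = Zero T (src T (diff T (r \<bullet> n) (Ident T E))) D"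
    using r(1,3) r2 r(4)[symmetric] t Comp_reduce[OF r(4)[symmetric], of n] by simp
  obtain z where z: "ar T z" "src T z = src T (diff T (r \<bullet> n) (Ident T E))" "tgt T z = Y"
    "diff T (r \<bullet> n) (Ident T E) = m \<bullet> z"
    using exact2[OF assms(1) x(1,3) x0] .
  have "thru (diff T (r \<bullet> n) (Ident T E))"
    unfolding z(4) by (rule thruI) (use z(1,3) t assms in simp_all)
  then have "eqv (r \<bullet> n) (Ident T E)"
    using r(1,3) r2 t by (simp add: eqv_def)
  then show ?thesis
    using Q_isoI[of n r] r(1,3) r2 r(4)[symmetric] t assms by simp
qed

text \<open>If \<open>g \<bullet> n\<close> factors through \<open>Y\<close> in \<open>\<X>\<close>,
  the part \<open>Y \<rightarrow> D\<close> lifts along \<open>g\<close> because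
  \<open>T(Y, A[1]) = 0\<close>. Subtracting this lift, which itself factors through
  \<open>\<X>\<close>, makes the composite strictly zero, and exactness in \<open>T\<close>
  applies.\<close>

lemma conflation_exact:
  assumes "(A, B, D, f, g, h) \<in> Tri T" "A \<in> \<U>" "ar T n" "tgt T n = B" "thru (g \<bullet> n)"
  obtains m where "ar T m" "src T m = src T n" "tgt T m = A" "eqv n (f \<bullet> m)"
proof -
  note t = TriD[OF assms(1)]
  obtain a b where ab: "ar T a" "ar T b" "src T b = tgt T a" "tgt T a \<in> \<X>" "g \<bullet> n = b \<bullet> a"
    using thruE[OF assms(5)] .
  have st: "src T a = src T n" "tgt T b = D"
    using arg_cong[OF ab(5), of "src T"] arg_cong[OF ab(5), of "tgt T"] ab(1-3) t assms(3,4) by simp_all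
  have "h \<bullet> b = Zero T (src T b) (sh A)"
    using zero_X_U[of "h \<bullet> b" A] ab(1-4) st t assms(2) by simp
  then obtain y where y: "ar T y" "src T y = src T b" "tgt T y = B" "b = g \<bullet> y"
    using exact3[OF assms(1) ab(2) st(2)] by blast
  have ya: "ar T (y \<bullet> a)" "src T (y \<bullet> a) = src T n" "tgt T (y \<bullet> a) = B"
    using y(1-3) ab(1-3) st by simp_all
  have "g \<bullet> (y \<bullet> a) = g \<bullet> n"
    using Comp_reduce[OF y(4)[symmetric], of a] y(1-3) ab(1-3,5) t by simp
  then have z: "g \<bullet> diff T n (y \<bullet> a) = Zero T (src T (diff T n (y \<bullet> a))) D"
    using ya assms(3,4) t by simp
  have m': "ar T (diff T n (y \<bullet> a))" "tgt T (diff T n (y \<bullet> a)) = B" "src T (diff T n (y \<bullet> a)) = src T n"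
    using ya assms(3,4) by simp_all
  obtain m where m: "ar T m" "src T m = src T (diff T n (y \<bullet> a))" "tgt T m = A" "diff T n (y \<bullet> a) = f \<bullet> m"
    using exact2[OF assms(1) m'(1,2) z] .
  have "diff T n (f \<bullet> m) = y \<bullet> a"
    unfolding m(4)[symmetric] using diff_Add_cancel(2)[of n "y \<bullet> a"] ya assms(3,4) by simp
  moreover have "thru (y \<bullet> a)"
    by (rule thruI) (use y(1-3) ab(1-4) in simp_all)
  ultimately have "eqv n (f \<bullet> m)"
    using m(1-3) m'(3) assms(3,4) t by (simp add: eqv_def)
  then show thesis
    using that[of m] m(1-3) m'(3) by simp
qed

text \<open>Modulo \<open>\<X>\<close>, the difference \<open>b - 1\<close> vanishes on \<open>A\<close> and in \<open>D\<close>, hence squares to zero.\<close>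

lemma conflation_endo_iso:
  assumes t: "(A, B, D, f, g, h) \<in> Tri T" and U: "A \<in> \<U>" "B \<in> \<U>" "D \<in> \<U>"
    and b: "ar T b" "src T b = B" "tgt T b = B" "b \<bullet> f = f \<bullet> a" "c \<bullet> g = g \<bullet> b"
    and ac: "eqv a (Ident T A)" "eqv c (Ident T D)"
  shows "is_iso Q (cl b)"
proof -
  note t' = TriD[OF t]
  have a: "ar T a" "src T a = A" "tgt T a = A" and c: "ar T c" "src T c = D" "tgt T c = D"
    using ac t' by (auto simp: eqv_def)
  define n where "n = diff T b (Ident T B)"
  have n: "ar T n" "src T n = B" "tgt T n = B"
    using b(1-3) t' by (simp_all add: n_def)
  have *: "n \<bullet> f = f \<bullet> diff T a (Ident T A)"
    using b a t' by (simp add: n_def)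
  have nf: "thru (n \<bullet> f)"
    unfolding * by (rule thru_Comp_left) (use ac(1) a t' in \<open>simp_all add: eqv_def\<close>)
  have *: "g \<bullet> n = diff T c (Ident T D) \<bullet> g"
    using b(1-3) b(5)[symmetric] c t' by (simp add: n_def)
  have gn: "thru (g \<bullet> n)"
    unfolding * by (rule thru_Comp_right) (use ac(2) c t' in \<open>simp_all add: eqv_def\<close>)
  obtain m where m: "ar T m" "src T m = src T n" "tgt T m = A" "eqv n (f \<bullet> m)"
    using conflation_exact[OF t U(1) n(1,3) gn] .
  have "eqv (n \<bullet> n) ((n \<bullet> f) \<bullet> m)"
    using eqv_Comp_left[OF m(4) n(1)] m(1-3) n t' by simp
  moreover have "thru ((n \<bullet> f) \<bullet> m)"
    by (rule thru_Comp_right) (use nf m(1-3) n t' in simp_all)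
  then have "eqv ((n \<bullet> f) \<bullet> m) (Zero T B B)"
    using eqv_Zero_iff[of "(n \<bullet> f) \<bullet> m"] m(1-3) n t' by simp
  ultimately have "eqv (n \<bullet> n) (Zero T B B)"
    using eqv_trans by blast
  then have "is_iso Q (Add Q (cl (Ident T B)) (cl n))"
    using Q.iso_Ident_Add[of "cl n"] n U by (simp add: cl_eq_iff)
  moreover have "Add T (Ident T B) n = b"
    using diff_Add_cancel(3)[of b "Ident T B"] b(1-3) t' by (simp add: n_def)
  ultimately show ?thesis
    using n t' U by simp
qed

text \<open>Inverses of \<open>a\<close> and \<open>c\<close> modulo \<open>\<X>\<close> give a
  morphism of triangles in the other direction. Its two composites with \<open>b\<close> lie over
  maps equivalent to identities, which is the case settled by
  \<open>conflation_endo_iso\<close>.\<close>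

lemma conflation_five:
  assumes t: "(A, B, D, f, g, h) \<in> Tri T" and U: "A \<in> \<U>" "B \<in> \<U>" "D \<in> \<U>"
    and t': "(A', B', D', f', g', h') \<in> Tri T" and U': "A' \<in> \<U>" "B' \<in> \<U>" "D' \<in> \<U>"
    and a: "ar T a" "src T a = A" "tgt T a = A'" and b: "ar T b" "src T b = B" "tgt T b = B'"
    and c: "ar T c" "src T c = D" "tgt T c = D'"
    and eq: "b \<bullet> f = f' \<bullet> a" "c \<bullet> g = g' \<bullet> b" "h' \<bullet> c = shm a \<bullet> h"
    and is_iso: "is_iso Q (cl a)" "is_iso Q (cl c)"
  shows "is_iso Q (cl b)"
proof -
  note d = TriD[OF t] and d' = TriD[OF t']
  have aU: "src T a \<in> \<U>" "tgt T a \<in> \<U>" and cU: "src T c \<in> \<U>" "tgt T c \<in> \<U>"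
    using U U' a c by simp_all
  obtain a' where a': "ar T a'" "src T a' = tgt T a" "tgt T a' = src T a"
    "eqv (a' \<bullet> a) (Ident T (src T a))" "eqv (a \<bullet> a') (Ident T (tgt T a))"
    using Q_isoE[OF is_iso(1) a(1) aU] .
  obtain c' where c': "ar T c'" "src T c' = tgt T c" "tgt T c' = src T c"
    "eqv (c' \<bullet> c) (Ident T (src T c))" "eqv (c \<bullet> c') (Ident T (tgt T c))"
    using Q_isoE[OF is_iso(2) c(1) cU] .
  have c'st: "src T c' = D'" "tgt T c' = D" and a'st: "src T a' = A'" "tgt T a' = A"
    using a'(2,3) c'(2,3) a c by simp_all
  \<comment> \<open>\<open>c \<bullet> c'\<close> is the identity only modulo \<open>\<X>\<close>,
    but the extension class \<open>h'\<close> does not see the difference. This is what yields the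
    strict equation needed for \<open>Tri_map2\<close>.\<close>
  have "h' = h' \<bullet> (c \<bullet> c')"
    using ext_eqv_right[OF c'(5), of h' A'] c'(1) c'st c d' U' by simp
  also have "\<dots> = (shm a \<bullet> h) \<bullet> c'"
    using Comp_reduce[OF eq(3), of c'] c'(1) c'st c d' by simp
  finally have h': "(shm a \<bullet> h) \<bullet> c' = h'" ..
  have "shm a' \<bullet> h' = shm (a' \<bullet> a) \<bullet> (h \<bullet> c')"
    unfolding h'[symmetric] using a'(1) a'st c'(1) c'st a c d by simp
  also have "\<dots> = h \<bullet> c'"
    using ext_eqv_left[OF a'(4), of "h \<bullet> c'"] a'(1) a'st c'(1) c'st a c d U' by simp
  finally have hc: "h \<bullet> c' = shm a' \<bullet> h'" ..
  obtain b' where b': "ar T b'" "src T b' = B'" "tgt T b' = B" "b' \<bullet> f' = f \<bullet> a'" "c' \<bullet> g' = g \<bullet> b'"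
    using Tri_map2[OF t' t a'(1) a'st c'(1) c'st hc] .
  have "is_iso Q (cl (b' \<bullet> b))"
  proof (rule conflation_endo_iso[OF t U, of _ "a' \<bullet> a" "c' \<bullet> c"])
    show "(b' \<bullet> b) \<bullet> f = f \<bullet> (a' \<bullet> a)"
      using eq(1) Comp_reduce[OF b'(4), of a] b'(1-3) b a a'(1) a'st d d' by simp
    show "(c' \<bullet> c) \<bullet> g = g \<bullet> (b' \<bullet> b)"
      using eq(2) Comp_reduce[OF b'(5), of b] b'(1-3) b c c'(1) c'st d d' by simp
  qed (use b b' a'(4) c'(4) a c in simp_all)
  moreover have "is_iso Q (cl (b \<bullet> b'))"
  proof (rule conflation_endo_iso[OF t' U', of _ "a \<bullet> a'" "c \<bullet> c'"])
    show "(b \<bullet> b') \<bullet> f' = f' \<bullet> (a \<bullet> a')"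
      using b'(4) Comp_reduce[OF eq(1), of a'] b'(1-3) b a a'(1) a'st d d' by simp
    show "(c \<bullet> c') \<bullet> g' = g' \<bullet> (b \<bullet> b')"
      using b'(5) Comp_reduce[OF eq(2), of b'] b'(1-3) b c c'(1) c'st d d' by simp
  qed (use b b' a'(5) c'(5) a c in simp_all)
  ultimately show ?thesis
    using Q.iso_of_left_right[of "cl b" "cl b'" "cl b'"] b b'(1-3) U U' by simp
qed

subsection \<open>Standard triangles\<close>

sublocale Q: suspended_category Q
  by unfold_locales (rule Sus_Q_functor)

definition is_std :: "'o \<Rightarrow> 'o \<Rightarrow> 'o \<Rightarrow> 'm \<Rightarrow> 'm \<Rightarrow> 'm \<Rightarrow> bool" where
  "is_std A B D f v w \<longleftrightarrow> A \<in> \<U> \<and> B \<in> \<U> \<and> ar T f \<and> src T f = A \<and> tgt T f = B \<and>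
    (B, D, W A, v, w, neg T (shm f \<bullet> q A)) \<in> Tri T"

lemma is_stdD:
  assumes "is_std A B D f v w"
  shows "A \<in> \<U>" "B \<in> \<U>" "D \<in> \<U>" "ar T f" "src T f = A" "tgt T f = B"
    "ar T v" "src T v = B" "tgt T v = D" "ar T w" "src T w = D" "tgt T w = W A"
    "(B, D, W A, v, w, neg T (shm f \<bullet> q A)) \<in> Tri T"
proof -
  have s: "A \<in> \<U>" "B \<in> \<U>" "ar T f" "src T f = A" "tgt T f = B"
    "(B, D, W A, v, w, neg T (shm f \<bullet> q A)) \<in> Tri T"
    using assms by (simp_all add: is_std_def)
  then show "D \<in> \<U>"
    using ext_closed by simp
  show "A \<in> \<U>" "B \<in> \<U>" "ar T f" "src T f = A" "tgt T f = B"
    "ar T v" "src T v = B" "tgt T v = D" "ar T w" "src T w = D" "tgt T w = W A"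
    "(B, D, W A, v, w, neg T (shm f \<bullet> q A)) \<in> Tri T"
    using s TriD[OF s(6)] by simp_all
qed

lemma ex_std:
  assumes "ar T f" "src T f = A" "tgt T f = B" "A \<in> \<U>" "B \<in> \<U>"
  obtains D v w where "is_std A B D f v w"
proof -
  have "ar T (neg T (shm f \<bullet> q A))" "src T (neg T (shm f \<bullet> q A)) = W A"
    "tgt T (neg T (shm f \<bullet> q A)) = sh B" "B \<in> Ob T"
    using assms by simp_all
  then obtain D v w where "(B, D, W A, v, w, neg T (shm f \<bullet> q A)) \<in> Tri T"
    using Tri_complete3 by blast
  then show thesis
    using that assms unfolding is_std_def by blast
qed

lemma std_iff: "t \<in> std \<longleftrightarrow> (\<exists>A B D f v w. is_std A B D f v w \<and> t = (A, B, D, cl f, cl v, cl w))"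
proof -
  have "A \<in> \<U> \<and> B \<in> \<U> \<and> f \<in> Hom T A B \<longleftrightarrow> A \<in> \<U> \<and> B \<in> \<U> \<and> ar T f \<and> src T f = A \<and> tgt T f = B" for A B f
    using Hom_iff[of A B f] by auto
  then show ?thesis
    unfolding std_def is_std_def by blast
qed

lemma std_candidate: "is_std A B D f v w \<Longrightarrow> (A, B, D, cl f, cl v, cl w) \<in> candidate_triangles Q"
  using is_stdD[of A B D f v w] by (intro Q.candidateI) simp_all

text \<open>Candidate triangles and their isomorphisms do not read the field \<open>Tri\<close>, so
  they are the same before and after it is filled in.\<close>

lemma Tri_Q: "Tri Q = {t \<in> candidate_triangles Q. \<exists>t' \<in> std. tri_iso Q t t'}"
proof -
  let ?R = "suspended_subfactor T \<U> \<X> \<sigma>"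
  have Q: "Q = ?R\<lparr>Tri := Tri Q\<rparr>" "Tri Q = {t \<in> candidate_triangles ?R. \<exists>t' \<in> std. tri_iso ?R t t'}"
    by (simp_all add: Q_def Let_def)
  have 1: "candidate_triangles (?R\<lparr>Tri := x\<rparr>) = candidate_triangles ?R" for x
    by (simp add: candidate_triangles_def)
  have 2: "tri_iso (?R\<lparr>Tri := x\<rparr>) t t' = tri_iso ?R t t'" for x t t'
    by (cases t; cases t') (simp add: isos_def)
  have "candidate_triangles Q = candidate_triangles ?R" "tri_iso Q t t' = tri_iso ?R t t'" for t t'
    using 1[of "Tri Q"] 2[of "Tri Q"] Q(1) by metis+
  then show ?thesis
    using Q(2) by simp
qed

lemma TriQ_candidate: "(A, B, D, F, G, H) \<in> Tri Q \<Longrightarrow> (A, B, D, F, G, H) \<in> candidate_triangles Q"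
  using Tri_Q by blast

lemmas TriQD = Q.candidateD[OF TriQ_candidate]

lemma TriQE:
  assumes "(A, B, D, F, G, H) \<in> Tri Q"
  obtains A' B' D' f v w a b c where "is_std A' B' D' f v w"
    "is_iso Q a" "src Q a = A" "tgt Q a = A'" "is_iso Q b" "src Q b = B" "tgt Q b = B'"
    "is_iso Q c" "src Q c = D" "tgt Q c = D'"
    "b \<bullet>\<^bsub>Q\<^esub> F = cl f \<bullet>\<^bsub>Q\<^esub> a" "c \<bullet>\<^bsub>Q\<^esub> G = cl v \<bullet>\<^bsub>Q\<^esub> b" "mor (Sus Q) a \<bullet>\<^bsub>Q\<^esub> H = cl w \<bullet>\<^bsub>Q\<^esub> c"
proof -
  obtain t' where t': "t' \<in> std" "tri_iso Q (A, B, D, F, G, H) t'"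
    using assms Tri_Q by auto
  obtain A' B' D' f v w where s: "is_std A' B' D' f v w" and "t' = (A', B', D', cl f, cl v, cl w)"
    using t'(1) std_iff by blast
  then have i: "tri_iso Q (A, B, D, F, G, H) (A', B', D', cl f, cl v, cl w)"
    using t'(2) by simp
  obtain a b c where "is_iso Q a" "src Q a = A" "tgt Q a = A'" "is_iso Q b" "src Q b = B" "tgt Q b = B'"
    "is_iso Q c" "src Q c = D" "tgt Q c = D'"
    "b \<bullet>\<^bsub>Q\<^esub> F = cl f \<bullet>\<^bsub>Q\<^esub> a" "c \<bullet>\<^bsub>Q\<^esub> G = cl v \<bullet>\<^bsub>Q\<^esub> b" "mor (Sus Q) a \<bullet>\<^bsub>Q\<^esub> H = cl w \<bullet>\<^bsub>Q\<^esub> c"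
    using i unfolding Q.tri_iso_iff[OF TriQ_candidate[OF assms] std_candidate[OF s]] by blast
  then show thesis
    using that s by blast
qed

lemma TriQI:
  assumes "is_std A' B' D' f v w" "(A, B, D, F, G, H) \<in> candidate_triangles Q"
    "is_iso Q a" "src Q a = A" "tgt Q a = A'" "is_iso Q b" "src Q b = B" "tgt Q b = B'"
    "is_iso Q c" "src Q c = D" "tgt Q c = D'"
    "b \<bullet>\<^bsub>Q\<^esub> F = cl f \<bullet>\<^bsub>Q\<^esub> a" "c \<bullet>\<^bsub>Q\<^esub> G = cl v \<bullet>\<^bsub>Q\<^esub> b" "mor (Sus Q) a \<bullet>\<^bsub>Q\<^esub> H = cl w \<bullet>\<^bsub>Q\<^esub> c"
  shows "(A, B, D, F, G, H) \<in> Tri Q"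
proof -
  have "tri_iso Q (A, B, D, F, G, H) (A', B', D', cl f, cl v, cl w)"
    unfolding Q.tri_iso_iff[OF assms(2) std_candidate[OF assms(1)]] using assms(3-) by blast
  moreover have "(A', B', D', cl f, cl v, cl w) \<in> std"
    using assms(1) std_iff by blast
  ultimately show ?thesis
    unfolding Tri_Q using assms(2) by blast
qed

lemmas Sus_Q_arrow [simp] = Q.functor_arrow[OF Sus_Q_functor]
lemmas Sus_Q_Comp = Q.functor_Comp[OF Sus_Q_functor]
lemmas Sus_Q_iso [simp] = Q.functor_iso[OF Sus_Q_functor]
lemmas Sus_Q_Ident = Q.functor_Ident[OF Sus_Q_functor]

text \<open>The square only commutes modulo \<open>\<X>\<close>, yet \<open>f\<close> and
  \<open>f'\<close> enter the defining triangles through \<open>f[1] \<bullet> q A\<close> and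
  \<open>f'[1] \<bullet> q A'\<close>. There the relation becomes strict, so \<open>y\<close> and a
  representative \<open>r\<close> of the suspension of \<open>x\<close> extend to a morphism of
  triangles of \<open>T\<close>.\<close>

lemma std_map:
  assumes s: "is_std A B D f v w" and s': "is_std A' B' D' f' v' w'"
    and x: "ar T x" "src T x = A" "tgt T x = A'" and y: "ar T y" "src T y = B" "tgt T y = B'"
    and eq: "eqv (y \<bullet> f) (f' \<bullet> x)"
  obtains c r where "ar T c" "src T c = D" "tgt T c = D'" "ar T r" "src T r = W A" "tgt T r = W A'"
    "mor (Sus Q) (cl x) = cl r" "c \<bullet> v = v' \<bullet> y" "r \<bullet> w = w' \<bullet> c"
    "is_iso Q (cl x) \<Longrightarrow> is_iso Q (cl y) \<Longrightarrow> is_iso Q (cl c)"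
proof -
  note d = is_stdD[OF s] and d' = is_stdD[OF s']
  obtain r where r: "ar T r" "src T r = W A" "tgt T r = W A'" "q A' \<bullet> r = shm x \<bullet> q A"
    "mor (Sus Q) (cl x) = cl r"
    using susp_rep[OF x d(1) d'(1)] .
  have "shm (y \<bullet> f) \<bullet> q A = shm (f' \<bullet> x) \<bullet> q A"
    by (rule ext_eqv_left[OF eq]) (use d y in simp_all)
  then have k: "neg T (shm f' \<bullet> q A') \<bullet> r = shm y \<bullet> neg T (shm f \<bullet> q A)"
    using d d' x y r(1-4) by simp
  obtain c where c: "ar T c" "src T c = D" "tgt T c = D'" "c \<bullet> v = v' \<bullet> y" "r \<bullet> w = w' \<bullet> c"
    using Tri_map2[OF d(13) d'(13) y r(1-3) k] .
  have "is_iso Q (cl c)" if "is_iso Q (cl x)" "is_iso Q (cl y)"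
  proof (rule conflation_five[OF d(13) _ _ _ d'(13) _ _ _ y c(1-3) r(1-3) c(4,5) k that(2)])
    show "is_iso Q (cl r)"
      unfolding r(5)[symmetric] using that(1) by simp
  qed (use d d' in simp_all)
  then show thesis
    using that[OF c(1-3) r(1-3,5) c(4,5)] by blast
qed

subsection \<open>The triangulated structure of the subfactor\<close>

lemma Q_Ident [simp]:
  "\<lbrakk>ar Q F; src Q F = A\<rbrakk> \<Longrightarrow> F \<bullet>\<^bsub>Q\<^esub> cl (Ident T A) = F"
  "\<lbrakk>ar Q F; tgt Q F = A\<rbrakk> \<Longrightarrow> cl (Ident T A) \<bullet>\<^bsub>Q\<^esub> F = F"
  "A \<in> \<U> \<Longrightarrow> mor (Sus Q) (cl (Ident T A)) = cl (Ident T (W A))"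
  "A \<in> \<U> \<Longrightarrow> is_iso Q (cl (Ident T A))"
  using Q.Comp_Ident'[of F A] Q.Ident_Comp'[of F A] Sus_Q_Ident[of A] Q.iso_Ident[of A] by simp_all

lemma TriQ_isoI:
  assumes t: "(A, B, D, F, G, H) \<in> Tri Q"
    and x: "is_iso Q x" "src Q x = A" and y: "is_iso Q y" "src Q y = B" and z: "is_iso Q z" "src Q z = D"
    and F': "ar Q F'" "src Q F' = tgt Q x" "tgt Q F' = tgt Q y"
    and G': "ar Q G'" "src Q G' = tgt Q y" "tgt Q G' = tgt Q z"
    and H': "ar Q H'" "src Q H' = tgt Q z" "tgt Q H' = W (tgt Q x)"
    and eq: "y \<bullet>\<^bsub>Q\<^esub> F = F' \<bullet>\<^bsub>Q\<^esub> x" "z \<bullet>\<^bsub>Q\<^esub> G = G' \<bullet>\<^bsub>Q\<^esub> y" "mor (Sus Q) x \<bullet>\<^bsub>Q\<^esub> H = H' \<bullet>\<^bsub>Q\<^esub> z"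
  shows "(tgt Q x, tgt Q y, tgt Q z, F', G', H') \<in> Tri Q"
proof -
  note cl_Comp [simp del]
  note d = TriQD[OF t]
  obtain A' B' D' f v w a b c where s: "is_std A' B' D' f v w"
    and a: "is_iso Q a" "src Q a = A" "tgt Q a = A'" and b: "is_iso Q b" "src Q b = B" "tgt Q b = B'"
    and c: "is_iso Q c" "src Q c = D" "tgt Q c = D'"
    and sq: "b \<bullet>\<^bsub>Q\<^esub> F = cl f \<bullet>\<^bsub>Q\<^esub> a" "c \<bullet>\<^bsub>Q\<^esub> G = cl v \<bullet>\<^bsub>Q\<^esub> b" "mor (Sus Q) a \<bullet>\<^bsub>Q\<^esub> H = cl w \<bullet>\<^bsub>Q\<^esub> c"
    using TriQE[OF t] .
  note e = is_stdD[OF s]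
  have inv: "inv_of Q y \<bullet>\<^bsub>Q\<^esub> F' = F \<bullet>\<^bsub>Q\<^esub> inv_of Q x" "inv_of Q z \<bullet>\<^bsub>Q\<^esub> G' = G \<bullet>\<^bsub>Q\<^esub> inv_of Q y"
    "mor (Sus Q) (inv_of Q x) \<bullet>\<^bsub>Q\<^esub> H' = H \<bullet>\<^bsub>Q\<^esub> inv_of Q z"
    using Q.inv_of_square[OF x(1) y(1) d(4) F'(1) _ _ _ _ eq(1)]
      Q.inv_of_square[OF y(1) z(1) d(7) G'(1) _ _ _ _ eq(2)]
      Q.inv_of_square[OF z(1) Sus_Q_iso(1)[OF x(1)] d(10) H'(1) _ _ _ _ eq(3)]
      x y z F' G' H' d by simp_all
  show ?thesis
  proof (rule TriQI[OF s, of _ _ _ _ _ _ "a \<bullet>\<^bsub>Q\<^esub> inv_of Q x" "b \<bullet>\<^bsub>Q\<^esub> inv_of Q y" "c \<bullet>\<^bsub>Q\<^esub> inv_of Q z"])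
    show "(tgt Q x, tgt Q y, tgt Q z, F', G', H') \<in> candidate_triangles Q"
      using F' G' H' by (intro Q.candidateI) simp_all
    show "(b \<bullet>\<^bsub>Q\<^esub> inv_of Q y) \<bullet>\<^bsub>Q\<^esub> F' = cl f \<bullet>\<^bsub>Q\<^esub> (a \<bullet>\<^bsub>Q\<^esub> inv_of Q x)"
      using inv(1) Q.Comp_reduce[OF sq(1), of "inv_of Q x"] a b x y F' d e by simp
    show "(c \<bullet>\<^bsub>Q\<^esub> inv_of Q z) \<bullet>\<^bsub>Q\<^esub> G' = cl v \<bullet>\<^bsub>Q\<^esub> (b \<bullet>\<^bsub>Q\<^esub> inv_of Q y)"
      using inv(2) Q.Comp_reduce[OF sq(2), of "inv_of Q y"] b c y z G' d e by simp
    show "mor (Sus Q) (a \<bullet>\<^bsub>Q\<^esub> inv_of Q x) \<bullet>\<^bsub>Q\<^esub> H' = cl w \<bullet>\<^bsub>Q\<^esub> (c \<bullet>\<^bsub>Q\<^esub> inv_of Q z)"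
      using inv(3) Q.Comp_reduce[OF sq(3), of "inv_of Q z"] a c x z H' d e by (simp add: Sus_Q_Comp)
  qed (use a b c x y z in simp_all)
qed

text \<open>Lets a triangle be compared with a standard triangle of one's choice on any isomorphic
  first map. The octahedral axiom needs this freedom for the triangle on the composite.\<close>

lemma TriQ_std_iso:
  assumes t: "(A, B, P, F, p, p') \<in> Tri Q" and s1: "is_std A1 B1 D1 f1 v1 w1"
    and \<alpha>: "is_iso Q \<alpha>" "src Q \<alpha> = A" "tgt Q \<alpha> = A1" and \<beta>: "is_iso Q \<beta>" "src Q \<beta> = B" "tgt Q \<beta> = B1"
    and eq: "\<beta> \<bullet>\<^bsub>Q\<^esub> F = cl f1 \<bullet>\<^bsub>Q\<^esub> \<alpha>"
  obtains \<gamma> where "is_iso Q \<gamma>" "src Q \<gamma> = P" "tgt Q \<gamma> = D1" "\<gamma> \<bullet>\<^bsub>Q\<^esub> p = cl v1 \<bullet>\<^bsub>Q\<^esub> \<beta>"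
    "cl w1 \<bullet>\<^bsub>Q\<^esub> \<gamma> = mor (Sus Q) \<alpha> \<bullet>\<^bsub>Q\<^esub> p'"
proof -
  note d = TriQD[OF t]
  obtain A0 B0 D0 f0 v0 w0 a b c where s0: "is_std A0 B0 D0 f0 v0 w0"
    and a: "is_iso Q a" "src Q a = A" "tgt Q a = A0" and b: "is_iso Q b" "src Q b = B" "tgt Q b = B0"
    and c: "is_iso Q c" "src Q c = P" "tgt Q c = D0"
    and sq: "b \<bullet>\<^bsub>Q\<^esub> F = cl f0 \<bullet>\<^bsub>Q\<^esub> a" "c \<bullet>\<^bsub>Q\<^esub> p = cl v0 \<bullet>\<^bsub>Q\<^esub> b" "mor (Sus Q) a \<bullet>\<^bsub>Q\<^esub> p' = cl w0 \<bullet>\<^bsub>Q\<^esub> c"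
    using TriQE[OF t] .
  note e0 = is_stdD[OF s0] and e1 = is_stdD[OF s1]
  have "ar Q (\<alpha> \<bullet>\<^bsub>Q\<^esub> inv_of Q a)" "ar Q (\<beta> \<bullet>\<^bsub>Q\<^esub> inv_of Q b)"
    using \<alpha> \<beta> a b by simp_all
  then obtain x y where x: "ar T x" "src T x \<in> \<U>" "tgt T x \<in> \<U>" "\<alpha> \<bullet>\<^bsub>Q\<^esub> inv_of Q a = cl x"
    and y: "ar T y" "src T y \<in> \<U>" "tgt T y \<in> \<U>" "\<beta> \<bullet>\<^bsub>Q\<^esub> inv_of Q b = cl y"
    by (metis Q_rep)
  have x': "src T x = A0" "tgt T x = A1" and y': "src T y = B0" "tgt T y = B1"
    using arg_cong[OF x(4), of "src Q"] arg_cong[OF x(4), of "tgt Q"] arg_cong[OF y(4), of "src Q"]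
      arg_cong[OF y(4), of "tgt Q"] x(1-3) y(1-3) \<alpha> \<beta> a b by simp_all
  have xa: "cl x \<bullet>\<^bsub>Q\<^esub> a = \<alpha>" and yb: "cl y \<bullet>\<^bsub>Q\<^esub> b = \<beta>"
    unfolding x(4)[symmetric] y(4)[symmetric] using a b \<alpha> \<beta> by simp_all
  have "cl y \<bullet>\<^bsub>Q\<^esub> cl f0 = \<beta> \<bullet>\<^bsub>Q\<^esub> (inv_of Q b \<bullet>\<^bsub>Q\<^esub> cl f0)"
    unfolding y(4)[symmetric] using b \<beta> e0 by simp
  also have "inv_of Q b \<bullet>\<^bsub>Q\<^esub> cl f0 = F \<bullet>\<^bsub>Q\<^esub> inv_of Q a"
    by (rule Q.inv_of_square) (use a b sq(1) d e0 in simp_all)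
  also have "\<beta> \<bullet>\<^bsub>Q\<^esub> (F \<bullet>\<^bsub>Q\<^esub> inv_of Q a) = cl f1 \<bullet>\<^bsub>Q\<^esub> cl x"
    unfolding x(4)[symmetric] using Q.Comp_reduce[OF eq, of "inv_of Q a"] a \<alpha> \<beta> d e1 by simp
  finally have "eqv (y \<bullet> f0) (f1 \<bullet> x)"
    using x(1) x' y(1) y' e0 e1 by (simp add: cl_eq_iff)
  then obtain z r where z: "ar T z" "src T z = D0" "tgt T z = D1" and r: "ar T r" "src T r = W A0" "tgt T r = W A1"
    and zr: "mor (Sus Q) (cl x) = cl r" "z \<bullet> v0 = v1 \<bullet> y" "r \<bullet> w0 = w1 \<bullet> z"
    and is_iso: "is_iso Q (cl x) \<Longrightarrow> is_iso Q (cl y) \<Longrightarrow> is_iso Q (cl z)"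
    using std_map[OF s0 s1 x(1) x' y(1) y'] by metis
  have isoz: "is_iso Q (cl z)"
    by (rule is_iso; unfold x(4)[symmetric] y(4)[symmetric]) (use a b \<alpha> \<beta> in simp_all)
  have zv: "cl z \<bullet>\<^bsub>Q\<^esub> cl v0 = cl v1 \<bullet>\<^bsub>Q\<^esub> cl y" and rw: "cl w1 \<bullet>\<^bsub>Q\<^esub> cl z = cl r \<bullet>\<^bsub>Q\<^esub> cl w0"
    using zr(2,3) z r y(1) y' e0 e1 by simp_all
  note cl_Comp [simp del]
  show thesis
  proof (rule that[of "cl z \<bullet>\<^bsub>Q\<^esub> c"])
    show "(cl z \<bullet>\<^bsub>Q\<^esub> c) \<bullet>\<^bsub>Q\<^esub> p = cl v1 \<bullet>\<^bsub>Q\<^esub> \<beta>"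
      using sq(2) Q.Comp_reduce[OF zv, of b] yb y(1) y' z c b d e0 e1 by simp
    have "cl r \<bullet>\<^bsub>Q\<^esub> mor (Sus Q) a = mor (Sus Q) \<alpha>"
      unfolding zr(1)[symmetric] using Sus_Q_Comp[of a "cl x"] a x(1) x' xa e0 e1 by simp
    then have "cl r \<bullet>\<^bsub>Q\<^esub> (mor (Sus Q) a \<bullet>\<^bsub>Q\<^esub> p') = mor (Sus Q) \<alpha> \<bullet>\<^bsub>Q\<^esub> p'"
      by (rule Q.Comp_reduce) (use r a d e0 e1 in simp_all)
    then show "cl w1 \<bullet>\<^bsub>Q\<^esub> (cl z \<bullet>\<^bsub>Q\<^esub> c) = mor (Sus Q) \<alpha> \<bullet>\<^bsub>Q\<^esub> p'"
      using sq(3) Q.Comp_reduce[OF rw, of c] r z c e0 e1 by simp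
  qed (use isoz z c e0 e1 in simp_all)
qed

text \<open>A normal form: the isomorphism with a standard triangle can be taken to be the identity
  on the first two objects.\<close>

lemma TriQ_std:
  assumes t: "(A, B, P, F, p, p') \<in> Tri Q"
  obtains D f v w \<gamma> where "is_std A B D f v w" "F = cl f" "is_iso Q \<gamma>" "src Q \<gamma> = P" "tgt Q \<gamma> = D"
    "\<gamma> \<bullet>\<^bsub>Q\<^esub> p = cl v" "cl w \<bullet>\<^bsub>Q\<^esub> \<gamma> = p'"
proof -
  note d = TriQD[OF t]
  obtain f where f: "ar T f" "src T f \<in> \<U>" "tgt T f \<in> \<U>" "F = cl f"
    using Q_rep[OF d(4)] .
  have st: "src T f = A" "tgt T f = B" "A \<in> \<U>" "B \<in> \<U>"
    using f d by simp_all
  obtain D v w where s: "is_std A B D f v w"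
    using ex_std[OF f(1) st] .
  note e = is_stdD[OF s]
  have i: "is_iso Q (Ident Q A)" "src Q (Ident Q A) = A" "tgt Q (Ident Q A) = A"
    "is_iso Q (Ident Q B)" "src Q (Ident Q B) = B" "tgt Q (Ident Q B) = B"
    using Q.iso_Ident[of A] Q.iso_Ident[of B] st by simp_all
  have sq: "Ident Q B \<bullet>\<^bsub>Q\<^esub> F = cl f \<bullet>\<^bsub>Q\<^esub> Ident Q A"
    using f st by simp
  obtain \<gamma> where \<gamma>: "is_iso Q \<gamma>" "src Q \<gamma> = P" "tgt Q \<gamma> = D" "\<gamma> \<bullet>\<^bsub>Q\<^esub> p = cl v \<bullet>\<^bsub>Q\<^esub> Ident Q B"
    "cl w \<bullet>\<^bsub>Q\<^esub> \<gamma> = mor (Sus Q) (Ident Q A) \<bullet>\<^bsub>Q\<^esub> p'"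
    using TriQ_std_iso[OF t s i sq] .
  have "cl v \<bullet>\<^bsub>Q\<^esub> Ident Q B = cl v" "mor (Sus Q) (Ident Q A) \<bullet>\<^bsub>Q\<^esub> p' = p'"
    using Sus_Q_Ident[of A] Q.Ident_Comp'[of p' "W A"] e d by simp_all
  then show thesis
    using that[OF s f(4) \<gamma>(1-3)] \<gamma>(4,5) by simp
qed

lemma std_TriQ:
  assumes s: "is_std A B D f v w"
  shows "(A, B, D, cl f, cl v, cl w) \<in> Tri Q"
proof -
  note e = is_stdD[OF s]
  note i = Q.iso_Ident[of A] Q.iso_Ident[of B] Q.iso_Ident[of D]
  show ?thesis
    by (rule TriQI[OF s std_candidate[OF s], of "Ident Q A" "Ident Q B" "Ident Q D"])
      (use i e Sus_Q_Ident[of A] in simp_all)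
qed

text \<open>The standard third object \<open>D'\<close> for \<open>f\<close> differs from
  \<open>D\<close>: by the octahedron it is an extension of \<open>D\<close> by
  \<open>chX \<sigma> A\<close>. That extension splits, and the object of \<open>\<X>\<close>
  disappears in the quotient.\<close>

lemma conflation_TriQ:
  assumes t: "(A, B, D, f, g, q A \<bullet> \<delta>) \<in> Tri T" and U: "A \<in> \<U>" "B \<in> \<U>" "D \<in> \<U>"
    and \<delta>: "ar T \<delta>" "src T \<delta> = D" "tgt T \<delta> = W A"
  shows "(A, B, D, cl f, cl g, cl \<delta>) \<in> Tri Q"
proof -
  note d = TriD[OF t]
  obtain D' v w where s: "is_std A B D' f v w"
    using ex_std[OF d(4-6) U(1,2)] .
  note e = is_stdD[OF s]
  have t3: "(B, D', W A, v, neg T w, shm f \<bullet> q A) \<in> Tri T"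
    using Tri_neg(3)[OF e(13)] e by simp
  obtain \<mu> \<nu> where \<mu>: "(chX \<sigma> A, D', D, \<mu>, \<nu>, shm (chi \<sigma> A) \<bullet> (q A \<bullet> \<delta>)) \<in> Tri T"
    "\<mu> \<bullet> chi \<sigma> A = v \<bullet> f" "neg T w \<bullet> \<mu> = chp \<sigma> A"
    "\<nu> \<bullet> v = g" "(q A \<bullet> \<delta>) \<bullet> \<nu> = neg T (q A \<bullet> neg T w)"
    using octahedron_extension[OF conjunct1[OF sigma[OF U(1)]] t t3] .
  note d' = TriD[OF \<mu>(1)]
  \<comment> \<open>One sign comes from the octahedron and one from moving the sign of
    \<open>std\<close> onto \<open>w\<close>. They cancel, so \<open>cl \<delta>\<close> appears in
    the triangle without a sign.\<close>
  have "q A \<bullet> (\<delta> \<bullet> \<nu>) = q A \<bullet> w"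
    using \<mu>(5) \<delta> d' e U by simp
  then have "eqv (\<delta> \<bullet> \<nu>) w"
    using syz_eqv_iff_right[OF syz_sigma[OF U(1)], of "\<delta> \<bullet> \<nu>" w] \<delta> d' e U by simp
  then have w: "cl w = cl \<delta> \<bullet>\<^bsub>Q\<^esub> cl \<nu>"
    using \<delta> d' e U by (simp add: cl_eq_iff eqv_sym)
  have g: "cl g = cl \<nu> \<bullet>\<^bsub>Q\<^esub> cl v"
    using \<mu>(4) d' e U by simp
  have is_iso: "is_iso Q (cl \<nu>)"
    by (rule split_right[OF \<mu>(1)]) (use e U in simp_all)
  note inv = Q.inv_of_props[OF is_iso]
  have cl: "ar Q (cl f)" "src Q (cl f) = A" "tgt Q (cl f) = B" "ar Q (cl g)" "src Q (cl g) = B" "tgt Q (cl g) = D"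
    "ar Q (cl \<delta>)" "src Q (cl \<delta>) = D" "tgt Q (cl \<delta>) = W A" "ar Q (cl \<nu>)" "src Q (cl \<nu>) = D'" "tgt Q (cl \<nu>) = D"
    "ar Q (cl v)" "src Q (cl v) = B" "tgt Q (cl v) = D'"
    using d d' e \<delta> U by simp_all
  note i = Q.iso_Ident[of A] Q.iso_Ident[of B]
  note cl_Comp [simp del]
  show ?thesis
  proof (rule TriQI[OF s, of _ _ _ _ _ _ "Ident Q A" "Ident Q B" "inv_of Q (cl \<nu>)"])
    show "(A, B, D, cl f, cl g, cl \<delta>) \<in> candidate_triangles Q"
      using cl by (intro Q.candidateI) simp_all
    show "inv_of Q (cl \<nu>) \<bullet>\<^bsub>Q\<^esub> cl g = cl v \<bullet>\<^bsub>Q\<^esub> Ident Q B"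
      unfolding g using is_iso cl U Q.Comp_Ident'[of "cl v" B] by (simp del: Q_sel)
    show "mor (Sus Q) (Ident Q A) \<bullet>\<^bsub>Q\<^esub> cl \<delta> = cl w \<bullet>\<^bsub>Q\<^esub> inv_of Q (cl \<nu>)"
      unfolding w using is_iso cl U Sus_Q_Ident[of A] Q.Ident_Comp'[of "cl \<delta>" "W A"] inv
      by simp
    show "Ident Q B \<bullet>\<^bsub>Q\<^esub> cl f = cl f \<bullet>\<^bsub>Q\<^esub> Ident Q A"
      using Q.Comp_Ident'[of "cl f" A] Q.Ident_Comp'[of "cl f" B] cl by metis
  qed (use i is_iso cl inv U in simp_all)
qed

text \<open>A converse to \<open>conflation_TriQ\<close>. The extension of \<open>D\<close> by
  \<open>A\<close> with class \<open>q A \<bullet> w\<close> has a middle term \<open>E\<close> that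
  receives \<open>B\<close> with third vertex in \<open>\<X>\<close>; hence \<open>B\<close> and
  \<open>E\<close> agree in the quotient, while \<open>a\<close> becomes an honest
  inflation.\<close>

lemma std_conflation:
  assumes s: "is_std A B D f v w"
  obtains E a b y where "E \<in> \<U>" "(A, E, D, a, b, q A \<bullet> w) \<in> Tri T" "ar T y" "src T y = B" "tgt T y = E"
    "is_iso Q (cl y)" "b \<bullet> y = v" "eqv (y \<bullet> f) a"
proof -
  note e = is_stdD[OF s]
  have h: "ar T (q A \<bullet> w)" "src T (q A \<bullet> w) = D" "tgt T (q A \<bullet> w) = sh A" "A \<in> Ob T"
    using e by simp_all
  obtain E a b where t: "(A, E, D, a, b, q A \<bullet> w) \<in> Tri T"
    using Tri_complete3[OF h] .
  have E: "E \<in> \<U>"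
    using ext_closed[OF t] e by simp
  note d = TriD[OF t]
  obtain y k l where y: "(B, E, chX \<sigma> A, y, k, l) \<in> Tri T" "b \<bullet> y = v"
    "shm y \<bullet> neg T (shm f \<bullet> q A) = neg T (shm a \<bullet> q A)" "k \<bullet> a = chi \<sigma> A" "chp \<sigma> A \<bullet> k = w \<bullet> b"
    using octahedron_base_change[OF conjunct1[OF sigma[OF e(1)]] t e(13)] .
  note d' = TriD[OF y(1)]
  have "shm (y \<bullet> f) \<bullet> q A = shm a \<bullet> q A"
    using y(3) d d' e by simp
  then have "eqv (y \<bullet> f) a"
    using syz_eqv_iff_left[OF syz_sigma[OF e(1)], of "y \<bullet> f" a] d d' e E by simp
  moreover have "is_iso Q (cl y)"
    by (rule split_left[OF y(1)]) (use e E in simp_all)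
  ultimately show thesis
    using that[OF E t d'(4-6)] y(2) by blast
qed

lemma TriQ_rot:
  assumes t: "(A, B, P, F, G, H) \<in> Tri Q"
  shows "(B, P, W A, G, H, neg Q (mor (Sus Q) F)) \<in> Tri Q"
proof -
  note d = TriQD[OF t]
  obtain D f v w \<gamma> where s: "is_std A B D f v w" and F: "F = cl f"
    and \<gamma>: "is_iso Q \<gamma>" "src Q \<gamma> = P" "tgt Q \<gamma> = D" "\<gamma> \<bullet>\<^bsub>Q\<^esub> G = cl v" "cl w \<bullet>\<^bsub>Q\<^esub> \<gamma> = H"
    using TriQ_std[OF t] .
  note e = is_stdD[OF s]
  obtain r where r: "ar T r" "src T r = W A" "tgt T r = W B" "q B \<bullet> r = shm f \<bullet> q A" "mor (Sus Q) (cl f) = cl r"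
    using susp_rep[OF e(4-6,1,2)] .
  \<comment> \<open>The triangle of \<open>T\<close> that defines a standard triangle has all its
    terms in \<open>\<U>\<close>, and its class is that of minus the suspension of \<open>f\<close>.
    So the rotated triangle is again induced by a triangle of \<open>T\<close>.\<close>
  have t': "(B, D, W A, v, w, q B \<bullet> neg T r) \<in> Tri T"
    using e r by simp
  have c: "(B, D, W A, cl v, cl w, cl (neg T r)) \<in> Tri Q"
    by (rule conflation_TriQ[OF t']) (use e r in simp_all)
  have r': "neg Q (mor (Sus Q) F) = cl (neg T r)"
    using r e F by simp
  have cl: "ar Q (cl v)" "src Q (cl v) = B" "tgt Q (cl v) = D" "ar Q (cl w)" "src Q (cl w) = D" "tgt Q (cl w) = W A"
    "ar Q (cl (neg T r))" "src Q (cl (neg T r)) = W A" "tgt Q (cl (neg T r)) = W B"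
    using e r by simp_all
  have W: "W A \<in> Ob Q" "B \<in> Ob Q" "W B \<in> Ob Q"
    using e by simp_all
  note [simp del] = cl_Comp Q_sel
  have "(tgt Q (Ident Q B), tgt Q (inv_of Q \<gamma>), tgt Q (Ident Q (W A)), G, H, cl (neg T r)) \<in> Tri Q"
    by (rule TriQ_isoI[OF c]) (use W \<gamma> \<gamma>(4)[symmetric] \<gamma>(5)[symmetric] cl d Sus_Q_Ident[of B] in simp_all)
  then show ?thesis
    unfolding r' using W \<gamma> by simp
qed

text \<open>Both the given triangle on \<open>B \<rightarrow> P\<close> and the standard triangle on
  \<open>F\<close> yield extensions by \<open>B\<close> in \<open>T\<close>, with middle terms
  \<open>E\<close> (isomorphic to \<open>P\<close> in the quotient) and \<open>D\<close>. The last
  map prescribed by the hypothesis matches their classes, so \<open>E\<close> and \<open>D\<close>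
  are isomorphic over them by the five lemma.\<close>

lemma TriQ_unrot:
  assumes t: "(B, P, W A, G, H, neg Q (mor (Sus Q) F)) \<in> Tri Q"
    and F: "ar Q F" "src Q F = A" "tgt Q F = B"
  shows "(A, B, P, F, G, H) \<in> Tri Q"
proof -
  note d = TriQD[OF t]
  obtain f where f: "ar T f" "src T f \<in> \<U>" "tgt T f \<in> \<U>" "F = cl f"
    using Q_rep[OF F(1)] .
  have st: "src T f = A" "tgt T f = B" "A \<in> \<U>" "B \<in> \<U>"
    using f F by simp_all
  obtain D v w where s: "is_std A B D f v w"
    using ex_std[OF f(1) st] .
  note e = is_stdD[OF s]
  obtain D' g v' w' \<gamma> where s': "is_std B P D' g v' w'" and G: "G = cl g"
    and \<gamma>: "is_iso Q \<gamma>" "src Q \<gamma> = W A" "tgt Q \<gamma> = D'" "\<gamma> \<bullet>\<^bsub>Q\<^esub> H = cl v'" "cl w' \<bullet>\<^bsub>Q\<^esub> \<gamma> = neg Q (mor (Sus Q) F)"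
    using TriQ_std[OF t] .
  note e' = is_stdD[OF s']
  obtain E a b y where E: "E \<in> \<U>" and t': "(B, E, D', a, b, q B \<bullet> w') \<in> Tri T"
    and y: "ar T y" "src T y = P" "tgt T y = E" "is_iso Q (cl y)" "b \<bullet> y = v'" "eqv (y \<bullet> g) a"
    using std_conflation[OF s'] .
  note d' = TriD[OF t']
  obtain r where r: "ar T r" "src T r = W A" "tgt T r = W B" "q B \<bullet> r = shm f \<bullet> q A" "mor (Sus Q) (cl f) = cl r"
    using susp_rep[OF e(4-6,1,2)] .
  note inv = Q.inv_of_props[OF \<gamma>(1)]
  obtain k where k: "ar T k" "src T k \<in> \<U>" "tgt T k \<in> \<U>" "inv_of Q \<gamma> = cl k"
    using Q_rep[OF inv(1)] .
  have k': "src T k = D'" "tgt T k = W A"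
    using inv(2,3) k \<gamma>(2,3) by simp_all
  have "cl w' = (cl w' \<bullet>\<^bsub>Q\<^esub> \<gamma>) \<bullet>\<^bsub>Q\<^esub> inv_of Q \<gamma>"
    using \<gamma>(1-3) e' Q.Comp_Ident'[of "cl w'" D'] by simp
  also have "\<dots> = cl (neg T (r \<bullet> k))"
    unfolding \<gamma>(5) k(4) using r k k' f e by simp
  finally have w': "eqv w' (neg T (r \<bullet> k))"
    using e' r(1-3) k(1) k' e by (simp add: cl_eq_iff)
  \<comment> \<open>\<open>w'\<close> is known only modulo \<open>\<X>\<close>; composing with
    \<open>q B\<close> makes the equality of extension classes strict.\<close>
  have "q B \<bullet> w' = q B \<bullet> neg T (r \<bullet> k)"
    by (rule ext_eqv_right[OF w', of _ B]) (use e' in simp_all)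
  also have "\<dots> = neg T (shm f \<bullet> q A) \<bullet> k"
    using Comp_reduce[OF r(4), of k] r(1-3) k(1) k' e by simp
  finally have hk: "neg T (shm f \<bullet> q A) \<bullet> k = shm (Ident T B) \<bullet> (q B \<bullet> w')"
    using e e' k(1) k' by simp
  have B: "ar T (Ident T B)" "src T (Ident T B) = B" "tgt T (Ident T B) = B"
    using e by simp_all
  obtain m where m: "ar T m" "src T m = E" "tgt T m = D" "m \<bullet> a = v \<bullet> Ident T B" "k \<bullet> b = w \<bullet> m"
    using Tri_map2[OF t' e(13) B k(1) k' hk] .
  have "is_iso Q (cl m)"
  proof (rule conflation_five[OF t' _ _ _ e(13) _ _ _ B m(1-3) k(1) k' m(4,5) hk])
    show "is_iso Q (cl k)"
      unfolding k(4)[symmetric] using \<gamma>(1) by simp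
    show "is_iso Q (cl (Ident T B))"
      using Q.iso_Ident[of B] e by simp
  qed (use e e' E in simp_all)
  then have is_iso: "is_iso Q (cl m \<bullet>\<^bsub>Q\<^esub> cl y)"
    using y(4) m(1-3) y(1-3) E e e' by (intro Q.iso_Comp) simp_all
  have "eqv (m \<bullet> (y \<bullet> g)) v"
    using eqv_Comp_left[OF y(6) m(1)] m y(1-3) e e' d' by simp
  then have mg: "(cl m \<bullet>\<^bsub>Q\<^esub> cl y) \<bullet>\<^bsub>Q\<^esub> G = cl v"
    using G m(1-3) y(1-3) e e' E by (simp add: cl_eq_iff)
  have "cl w \<bullet>\<^bsub>Q\<^esub> (cl m \<bullet>\<^bsub>Q\<^esub> cl y) = cl k \<bullet>\<^bsub>Q\<^esub> cl (b \<bullet> y)"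
    using Comp_reduce[OF m(5)[symmetric], of y] m(1-3) y(1-3) k(1) k' e e' d' E by simp
  also have "\<dots> = inv_of Q \<gamma> \<bullet>\<^bsub>Q\<^esub> (\<gamma> \<bullet>\<^bsub>Q\<^esub> H)"
    by (simp only: y(5) \<gamma>(4) k(4))
  also have "\<dots> = H"
    using \<gamma>(1-3) d by simp
  finally have H: "cl w \<bullet>\<^bsub>Q\<^esub> (cl m \<bullet>\<^bsub>Q\<^esub> cl y) = H" .
  have cl: "ar Q (cl m)" "src Q (cl m) = E" "tgt Q (cl m) = D" "ar Q (cl y)" "src Q (cl y) = P" "tgt Q (cl y) = E"
    "ar Q (cl f)" "src Q (cl f) = A" "tgt Q (cl f) = B" "ar Q (cl v)" "src Q (cl v) = B" "tgt Q (cl v) = D"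
    using m(1-3) y(1-3) E e e' by simp_all
  have AB: "A \<in> Ob Q" "B \<in> Ob Q" "W A \<in> Ob Q"
    using e by simp_all
  note [simp del] = cl_Comp Q_sel
  show ?thesis
    by (rule TriQI[OF s, of _ _ _ _ _ _ "Ident Q A" "Ident Q B" "cl m \<bullet>\<^bsub>Q\<^esub> cl y"])
      (use AB cl is_iso mg H F f d Sus_Q_Ident[of A] in \<open>simp_all add: Q.candidateI\<close>)
qed

text \<open>The standard triangle on the identity is the chosen triangle through
  \<open>chX \<sigma> A\<close> with two signs changed, and its third object lies in
  \<open>\<X>\<close>.\<close>

lemma TriQ_Ident:
  assumes "A \<in> \<U>" "zero_object Q Z"
  shows "(A, A, Z, Ident Q A, Zero Q A Z, Zero Q Z (ob (Sus Q) A)) \<in> Tri Q"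
proof -
  have s: "is_std A A (chX \<sigma> A) (Ident T A) (chi \<sigma> A) (neg T (chp \<sigma> A))"
    using Tri_neg(3)[OF conjunct1[OF sigma[OF assms(1)]]] assms by (simp add: is_std_def)
  note e = is_stdD[OF s]
  have zX: "zero_object Q (chX \<sigma> A)"
    using X_zero_object assms by simp
  have Z: "Z \<in> \<U>" "chX \<sigma> A \<in> \<U>"
    using Q.zero_object_Ob[OF assms(2)] e by simp_all
  show ?thesis
  proof (rule TriQI[OF s, of _ _ _ _ _ _ "Ident Q A" "Ident Q A" "Zero Q Z (chX \<sigma> A)"])
    show "(A, A, Z, Ident Q A, Zero Q A Z, Zero Q Z (ob (Sus Q) A)) \<in> candidate_triangles Q"
      using Z assms(1) by (intro Q.candidateI) simp_all
    show "is_iso Q (Zero Q Z (chX \<sigma> A))"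
      by (rule Q.zero_object_iso[OF assms(2) zX])
    have "cl (chi \<sigma> A) = Zero Q A (chX \<sigma> A)"
      using Q.zero_object_to[OF zX, of "cl (chi \<sigma> A)"] assms(1) by simp
    then show "Zero Q Z (chX \<sigma> A) \<bullet>\<^bsub>Q\<^esub> Zero Q A Z = cl (chi \<sigma> A) \<bullet>\<^bsub>Q\<^esub> Ident Q A"
      using Z assms(1) by simp
    have "cl (neg T (chp \<sigma> A)) = Zero Q (chX \<sigma> A) (W A)"
      using Q.zero_object_from[OF zX, of "cl (neg T (chp \<sigma> A))"] assms(1) by simp
    then show "mor (Sus Q) (Ident Q A) \<bullet>\<^bsub>Q\<^esub> Zero Q Z (ob (Sus Q) A)
        = cl (neg T (chp \<sigma> A)) \<bullet>\<^bsub>Q\<^esub> Zero Q Z (chX \<sigma> A)"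
      using Z assms(1) by simp
  qed (use assms(1) Z in simp_all)
qed

lemma TriQ_map:
  assumes t: "(A, B, P, F, G, H) \<in> Tri Q" and t': "(A', B', P', F', G', H') \<in> Tri Q"
    and \<alpha>: "ar Q \<alpha>" "src Q \<alpha> = A" "tgt Q \<alpha> = A'" and \<beta>: "ar Q \<beta>" "src Q \<beta> = B" "tgt Q \<beta> = B'"
    and eq: "\<beta> \<bullet>\<^bsub>Q\<^esub> F = F' \<bullet>\<^bsub>Q\<^esub> \<alpha>"
  shows "\<exists>c. tri_map Q (A, B, P, F, G, H) (A', B', P', F', G', H') (\<alpha>, \<beta>, c)"
proof -
  note d = TriQD[OF t] and d' = TriQD[OF t']
  obtain D f v w \<gamma> where s: "is_std A B D f v w" and F: "F = cl f"
    and \<gamma>: "is_iso Q \<gamma>" "src Q \<gamma> = P" "tgt Q \<gamma> = D" "\<gamma> \<bullet>\<^bsub>Q\<^esub> G = cl v" "cl w \<bullet>\<^bsub>Q\<^esub> \<gamma> = H"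
    using TriQ_std[OF t] .
  obtain D' f' v' w' \<gamma>' where s': "is_std A' B' D' f' v' w'" and F': "F' = cl f'"
    and \<gamma>': "is_iso Q \<gamma>'" "src Q \<gamma>' = P'" "tgt Q \<gamma>' = D'" "\<gamma>' \<bullet>\<^bsub>Q\<^esub> G' = cl v'" "cl w' \<bullet>\<^bsub>Q\<^esub> \<gamma>' = H'"
    using TriQ_std[OF t'] .
  note e = is_stdD[OF s] and e' = is_stdD[OF s']
  obtain x where x: "ar T x" "src T x \<in> \<U>" "tgt T x \<in> \<U>" "\<alpha> = cl x"
    using Q_rep[OF \<alpha>(1)] .
  obtain y where y: "ar T y" "src T y \<in> \<U>" "tgt T y \<in> \<U>" "\<beta> = cl y"
    using Q_rep[OF \<beta>(1)] .
  have x': "src T x = A" "tgt T x = A'" and y': "src T y = B" "tgt T y = B'"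
    using \<alpha> \<beta> x y by simp_all
  have "eqv (y \<bullet> f) (f' \<bullet> x)"
    using eq x y x' y' F F' e e' by (simp add: cl_eq_iff)
  then obtain c r where c: "ar T c" "src T c = D" "tgt T c = D'" and r: "ar T r" "src T r = W A" "tgt T r = W A'"
    and cr: "mor (Sus Q) (cl x) = cl r" "c \<bullet> v = v' \<bullet> y" "r \<bullet> w = w' \<bullet> c"
    using std_map[OF s s' x(1) x' y(1) y'] by metis
  have cv: "cl c \<bullet>\<^bsub>Q\<^esub> cl v = cl v' \<bullet>\<^bsub>Q\<^esub> \<beta>" and rw: "mor (Sus Q) \<alpha> \<bullet>\<^bsub>Q\<^esub> cl w = cl w' \<bullet>\<^bsub>Q\<^esub> cl c"
    using cr c r y x y' x' e e' by simp_all
  have cl: "ar Q (cl c)" "src Q (cl c) = D" "tgt Q (cl c) = D'" "ar Q (cl v)" "src Q (cl v) = B" "tgt Q (cl v) = D"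
    "ar Q (cl v')" "src Q (cl v') = B'" "tgt Q (cl v') = D'" "ar Q (cl w)" "src Q (cl w) = D" "tgt Q (cl w) = W A"
    "ar Q (cl w')" "src Q (cl w') = D'" "tgt Q (cl w') = W A'"
    using c e e' by simp_all
  note cl_Comp [simp del]
  have "inv_of Q \<gamma>' \<bullet>\<^bsub>Q\<^esub> (cl c \<bullet>\<^bsub>Q\<^esub> (\<gamma> \<bullet>\<^bsub>Q\<^esub> G)) = inv_of Q \<gamma>' \<bullet>\<^bsub>Q\<^esub> ((\<gamma>' \<bullet>\<^bsub>Q\<^esub> G') \<bullet>\<^bsub>Q\<^esub> \<beta>)"
    using \<gamma>(4) \<gamma>'(4) cv by simp
  also have "\<dots> = G' \<bullet>\<^bsub>Q\<^esub> \<beta>"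
    using \<gamma>'(1-3) \<beta> d' by simp
  finally have 1: "(inv_of Q \<gamma>' \<bullet>\<^bsub>Q\<^esub> (cl c \<bullet>\<^bsub>Q\<^esub> \<gamma>)) \<bullet>\<^bsub>Q\<^esub> G = G' \<bullet>\<^bsub>Q\<^esub> \<beta>"
    using \<gamma>(1-3) \<gamma>'(1-3) cl d by simp
  have "mor (Sus Q) \<alpha> \<bullet>\<^bsub>Q\<^esub> (cl w \<bullet>\<^bsub>Q\<^esub> \<gamma>) = cl w' \<bullet>\<^bsub>Q\<^esub> (cl c \<bullet>\<^bsub>Q\<^esub> \<gamma>)"
    using Q.Comp_reduce[OF rw, of \<gamma>] \<gamma>(1-3) cl \<alpha> by simp
  also have "\<dots> = (cl w' \<bullet>\<^bsub>Q\<^esub> \<gamma>') \<bullet>\<^bsub>Q\<^esub> (inv_of Q \<gamma>' \<bullet>\<^bsub>Q\<^esub> (cl c \<bullet>\<^bsub>Q\<^esub> \<gamma>))"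
    using \<gamma>(1-3) \<gamma>'(1-3) cl by simp
  finally have 2: "mor (Sus Q) \<alpha> \<bullet>\<^bsub>Q\<^esub> H = H' \<bullet>\<^bsub>Q\<^esub> (inv_of Q \<gamma>' \<bullet>\<^bsub>Q\<^esub> (cl c \<bullet>\<^bsub>Q\<^esub> \<gamma>))"
    by (simp only: \<gamma>(5) \<gamma>'(5))
  show ?thesis
    using 1 2 \<alpha> \<beta> eq \<gamma>(1-3) \<gamma>'(1-3) cl
    by (intro exI[of _ "inv_of Q \<gamma>' \<bullet>\<^bsub>Q\<^esub> (cl c \<bullet>\<^bsub>Q\<^esub> \<gamma>)"]
        iffD2[OF Q.tri_map_iff[OF TriQ_candidate[OF t] TriQ_candidate[OF t']]]) simp
qed

text \<open>The second map may be replaced by an inflation, to which the octahedral axiom of \<open>T\<close> applies.\<close>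

lemma TriQ_octahedral:
  assumes t1: "(X, Y, P, F, p, p') \<in> Tri Q" and t2: "(Y, Z, R, G, r, r') \<in> Tri Q"
    and t3: "(X, Z, V, G \<bullet>\<^bsub>Q\<^esub> F, s, s') \<in> Tri Q"
  shows "\<exists>u v. (P, V, R, u, v, mor (Sus Q) p \<bullet>\<^bsub>Q\<^esub> r') \<in> Tri Q \<and>
    tri_map Q (X, Y, P, F, p, p') (X, Z, V, G \<bullet>\<^bsub>Q\<^esub> F, s, s') (Ident Q X, G, u) \<and>
    tri_map Q (X, Z, V, G \<bullet>\<^bsub>Q\<^esub> F, s, s') (Y, Z, R, G, r, r') (F, Ident Q Z, v)"
proof -
  note d1 = TriQD[OF t1] and d2 = TriQD[OF t2] and d3 = TriQD[OF t3]
  obtain D1 f v1 w1 \<gamma>1 where s1: "is_std X Y D1 f v1 w1" and F: "F = cl f"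
    and \<gamma>1: "is_iso Q \<gamma>1" "src Q \<gamma>1 = P" "tgt Q \<gamma>1 = D1" "\<gamma>1 \<bullet>\<^bsub>Q\<^esub> p = cl v1" "cl w1 \<bullet>\<^bsub>Q\<^esub> \<gamma>1 = p'"
    using TriQ_std[OF t1] .
  obtain D2 g v2 w2 \<gamma>2 where s2: "is_std Y Z D2 g v2 w2" and G: "G = cl g"
    and \<gamma>2: "is_iso Q \<gamma>2" "src Q \<gamma>2 = R" "tgt Q \<gamma>2 = D2" "\<gamma>2 \<bullet>\<^bsub>Q\<^esub> r = cl v2" "cl w2 \<bullet>\<^bsub>Q\<^esub> \<gamma>2 = r'"
    using TriQ_std[OF t2] .
  note e1 = is_stdD[OF s1] and e2 = is_stdD[OF s2]
  obtain E a b y where E: "E \<in> \<U>" and c: "(Y, E, D2, a, b, q Y \<bullet> w2) \<in> Tri T"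
    and y: "ar T y" "src T y = Z" "tgt T y = E" "is_iso Q (cl y)" "b \<bullet> y = v2" "eqv (y \<bullet> g) a"
    using std_conflation[OF s2] .
  note dc = TriD[OF c]
  have af: "ar T (a \<bullet> f)" "src T (a \<bullet> f) = X" "tgt T (a \<bullet> f) = E"
    using e1 dc by simp_all
  \<comment> \<open>The composite is taken in \<open>T\<close> as \<open>a \<bullet> f\<close>,
    which represents \<open>G \<bullet> F\<close> followed by the isomorphism \<open>cl y\<close>.
    Since \<open>a\<close> starts a triangle with terms in \<open>\<U>\<close>,
    \<open>octahedron_extension\<close> applies to it.\<close>
  obtain D3 v3 w3 where s3: "is_std X E D3 (a \<bullet> f) v3 w3"
    using ex_std[OF af e1(1) E] .
  note e3 = is_stdD[OF s3]
  have clX: "is_iso Q (cl (Ident T X))" "src Q (cl (Ident T X)) = X" "tgt Q (cl (Ident T X)) = X"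
    using e1 by simp_all
  have cly: "src Q (cl y) = Z" "tgt Q (cl y) = E"
    using y(1-3) e2 E by simp_all
  have yG: "cl y \<bullet>\<^bsub>Q\<^esub> G = cl a"
    unfolding G using y e2 dc E by (simp add: cl_eq_iff)
  have sq: "cl y \<bullet>\<^bsub>Q\<^esub> (G \<bullet>\<^bsub>Q\<^esub> F) = cl (a \<bullet> f) \<bullet>\<^bsub>Q\<^esub> cl (Ident T X)"
    using Q.Comp_reduce[OF yG, of F] y(1-3) cly e1 e2 dc E d1 d2 F by simp
  obtain \<gamma>3 where \<gamma>3: "is_iso Q \<gamma>3" "src Q \<gamma>3 = V" "tgt Q \<gamma>3 = D3" "\<gamma>3 \<bullet>\<^bsub>Q\<^esub> s = cl v3 \<bullet>\<^bsub>Q\<^esub> cl y"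
    "cl w3 \<bullet>\<^bsub>Q\<^esub> \<gamma>3 = mor (Sus Q) (cl (Ident T X)) \<bullet>\<^bsub>Q\<^esub> s'"
    using TriQ_std_iso[OF t3 s3 clX y(4) cly sq] .
  have w3s: "cl w3 \<bullet>\<^bsub>Q\<^esub> \<gamma>3 = s'"
    using \<gamma>3(5) e1 d3 by simp
  have k: "shm a \<bullet> neg T (shm f \<bullet> q X) = neg T (shm (a \<bullet> f) \<bullet> q X)"
    using e1 dc by simp
  obtain \<mu> \<nu> where \<mu>: "(D1, D3, D2, \<mu>, \<nu>, shm v1 \<bullet> (q Y \<bullet> w2)) \<in> Tri T"
    "\<mu> \<bullet> v1 = v3 \<bullet> a" "w3 \<bullet> \<mu> = w1" "\<nu> \<bullet> v3 = b" "(q Y \<bullet> w2) \<bullet> \<nu> = neg T (neg T (shm f \<bullet> q X) \<bullet> w3)"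
    using octahedron_extension[OF e1(13) c e3(13)[folded k]] .
  note dm = TriD[OF \<mu>(1)]
  obtain n where n: "ar T n" "src T n = W Y" "tgt T n = W D1" "q D1 \<bullet> n = shm v1 \<bullet> q Y" "mor (Sus Q) (cl v1) = cl n"
    using susp_rep[OF e1(7-9,2,3)] .
  obtain m where m: "ar T m" "src T m = W X" "tgt T m = W Y" "q Y \<bullet> m = shm f \<bullet> q X" "mor (Sus Q) (cl f) = cl m"
    using susp_rep[OF e1(4-6,1,2)] .
  have "(D1, D3, D2, \<mu>, \<nu>, q D1 \<bullet> (n \<bullet> w2)) \<in> Tri T"
    using \<mu>(1) Comp_reduce[OF n(4), of w2] n(1-3) e1 e2 by simp
  then have tm: "(D1, D3, D2, cl \<mu>, cl \<nu>, cl (n \<bullet> w2)) \<in> Tri Q"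
    by (rule conflation_TriQ) (use n(1-3) e1 e2 e3 in simp_all)
  have "q Y \<bullet> (w2 \<bullet> \<nu>) = q Y \<bullet> (m \<bullet> w3)"
    using \<mu>(5) Comp_reduce[OF m(4), of w3] m(1-3) e1 e2 e3 dm by simp
  then have "eqv (w2 \<bullet> \<nu>) (m \<bullet> w3)"
    by (subst (asm) syz_eqv_iff_right[OF syz_sigma[OF e2(1)]]) (use m(1-3) e1 e2 e3 dm in simp_all)
  then have w2\<nu>: "cl w2 \<bullet>\<^bsub>Q\<^esub> cl \<nu> = mor (Sus Q) F \<bullet>\<^bsub>Q\<^esub> cl w3"
    unfolding F m(5) using m(1-3) e1 e2 e3 dm by (simp add: cl_eq_iff)
  have clc: "cl \<mu> \<bullet>\<^bsub>Q\<^esub> cl v1 = cl v3 \<bullet>\<^bsub>Q\<^esub> cl a" "cl w3 \<bullet>\<^bsub>Q\<^esub> cl \<mu> = cl w1" "cl \<nu> \<bullet>\<^bsub>Q\<^esub> cl v3 = cl b"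
    "cl b \<bullet>\<^bsub>Q\<^esub> cl y = cl v2" "cl (n \<bullet> w2) = mor (Sus Q) (cl v1) \<bullet>\<^bsub>Q\<^esub> cl w2"
    using \<mu>(2-4) y(1-3,5) n e1 e2 e3 dm dc E by simp_all
  have cl: "ar Q (cl \<mu>)" "src Q (cl \<mu>) = D1" "tgt Q (cl \<mu>) = D3" "ar Q (cl \<nu>)" "src Q (cl \<nu>) = D3" "tgt Q (cl \<nu>) = D2"
    "ar Q (cl v1)" "src Q (cl v1) = Y" "tgt Q (cl v1) = D1" "ar Q (cl v2)" "src Q (cl v2) = Z" "tgt Q (cl v2) = D2"
    "ar Q (cl v3)" "src Q (cl v3) = E" "tgt Q (cl v3) = D3" "ar Q (cl w1)" "src Q (cl w1) = D1" "tgt Q (cl w1) = W X"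
    "ar Q (cl w2)" "src Q (cl w2) = D2" "tgt Q (cl w2) = W Y" "ar Q (cl w3)" "src Q (cl w3) = D3" "tgt Q (cl w3) = W X"
    "ar Q (cl a)" "src Q (cl a) = Y" "tgt Q (cl a) = E" "ar Q (cl b)" "src Q (cl b) = E" "tgt Q (cl b) = D2"
    "ar Q (cl y)" "src Q (cl y) = Z" "tgt Q (cl y) = E"
    using e1(1-3,7-12) e2(2,3,7-12) e3(3,7-12) dm(4-9) dc(4-9) E y(1-3) by simp_all
  note cl_Comp [simp del]
  define u where "u = inv_of Q \<gamma>3 \<bullet>\<^bsub>Q\<^esub> (cl \<mu> \<bullet>\<^bsub>Q\<^esub> \<gamma>1)"
  define v where "v = inv_of Q \<gamma>2 \<bullet>\<^bsub>Q\<^esub> (cl \<nu> \<bullet>\<^bsub>Q\<^esub> \<gamma>3)"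
  have u: "ar Q u" "src Q u = P" "tgt Q u = V" and v: "ar Q v" "src Q v = V" "tgt Q v = R"
    using \<gamma>1(1-3) \<gamma>2(1-3) \<gamma>3(1-3) cl by (simp_all add: u_def v_def)
  have \<gamma>u: "\<gamma>3 \<bullet>\<^bsub>Q\<^esub> u = cl \<mu> \<bullet>\<^bsub>Q\<^esub> \<gamma>1" and \<gamma>v: "\<gamma>2 \<bullet>\<^bsub>Q\<^esub> v = cl \<nu> \<bullet>\<^bsub>Q\<^esub> \<gamma>3"
    using \<gamma>1(1-3) \<gamma>2(1-3) \<gamma>3(1-3) cl by (simp_all add: u_def v_def)
  have "(tgt Q (inv_of Q \<gamma>1), tgt Q (inv_of Q \<gamma>3), tgt Q (inv_of Q \<gamma>2), u, v, mor (Sus Q) p \<bullet>\<^bsub>Q\<^esub> r') \<in> Tri Q"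
  proof (rule TriQ_isoI[OF tm])
    show "inv_of Q \<gamma>3 \<bullet>\<^bsub>Q\<^esub> cl \<mu> = u \<bullet>\<^bsub>Q\<^esub> inv_of Q \<gamma>1" "inv_of Q \<gamma>2 \<bullet>\<^bsub>Q\<^esub> cl \<nu> = v \<bullet>\<^bsub>Q\<^esub> inv_of Q \<gamma>3"
      using \<gamma>1(1-3) \<gamma>2(1-3) \<gamma>3(1-3) cl by (simp_all add: u_def v_def)
    have p: "p = inv_of Q \<gamma>1 \<bullet>\<^bsub>Q\<^esub> cl v1"
      unfolding \<gamma>1(4)[symmetric] using \<gamma>1(1-3) d1 by simp
    show "mor (Sus Q) (inv_of Q \<gamma>1) \<bullet>\<^bsub>Q\<^esub> cl (n \<bullet> w2) = (mor (Sus Q) p \<bullet>\<^bsub>Q\<^esub> r') \<bullet>\<^bsub>Q\<^esub> inv_of Q \<gamma>2"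
      unfolding clc(5) p \<gamma>2(5)[symmetric] using \<gamma>1(1-3) \<gamma>2(1-3) cl by (simp add: Sus_Q_Comp)
  qed (use u v \<gamma>1(1-3) \<gamma>2(1-3) \<gamma>3(1-3) d1 d2 in simp_all)
  then have T: "(P, V, R, u, v, mor (Sus Q) p \<bullet>\<^bsub>Q\<^esub> r') \<in> Tri Q"
    using \<gamma>1(1-3) \<gamma>2(1-3) \<gamma>3(1-3) by simp
  have "u \<bullet>\<^bsub>Q\<^esub> p = s \<bullet>\<^bsub>Q\<^esub> G"
  proof (rule Q.iso_cancel_left[OF \<gamma>3(1)])
    have "\<gamma>3 \<bullet>\<^bsub>Q\<^esub> (u \<bullet>\<^bsub>Q\<^esub> p) = cl \<mu> \<bullet>\<^bsub>Q\<^esub> (\<gamma>1 \<bullet>\<^bsub>Q\<^esub> p)"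
      using Q.Comp_reduce[OF \<gamma>u, of p] u \<gamma>1(1-3) \<gamma>3(1-3) d1 cl by simp
    also have "\<dots> = cl v3 \<bullet>\<^bsub>Q\<^esub> (cl y \<bullet>\<^bsub>Q\<^esub> G)"
      unfolding \<gamma>1(4) clc(1) yG ..
    also have "\<dots> = \<gamma>3 \<bullet>\<^bsub>Q\<^esub> (s \<bullet>\<^bsub>Q\<^esub> G)"
      using Q.Comp_reduce[OF \<gamma>3(4), of G] \<gamma>3(1-3) d2 d3 cl by simp
    finally show "\<gamma>3 \<bullet>\<^bsub>Q\<^esub> (u \<bullet>\<^bsub>Q\<^esub> p) = \<gamma>3 \<bullet>\<^bsub>Q\<^esub> (s \<bullet>\<^bsub>Q\<^esub> G)" .
  qed (use u \<gamma>3(1-3) d1 d2 d3 in simp_all)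
  moreover have "s' \<bullet>\<^bsub>Q\<^esub> u = p'"
  proof -
    have "s' \<bullet>\<^bsub>Q\<^esub> u = cl w3 \<bullet>\<^bsub>Q\<^esub> (cl \<mu> \<bullet>\<^bsub>Q\<^esub> \<gamma>1)"
      unfolding w3s[symmetric] \<gamma>u[symmetric] using u \<gamma>3(1-3) cl by simp
    also have "\<dots> = cl w1 \<bullet>\<^bsub>Q\<^esub> \<gamma>1"
      using Q.Comp_reduce[OF clc(2), of \<gamma>1] \<gamma>1(1-3) cl by simp
    finally show ?thesis
      unfolding \<gamma>1(5) .
  qed
  ultimately have m1: "tri_map Q (X, Y, P, F, p, p') (X, Z, V, G \<bullet>\<^bsub>Q\<^esub> F, s, s') (Ident Q X, G, u)"
    unfolding Q.tri_map_iff[OF TriQ_candidate[OF t1] TriQ_candidate[OF t3]]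
    using u d1 d2 d3 by simp
  have "v \<bullet>\<^bsub>Q\<^esub> s = r"
  proof (rule Q.iso_cancel_left[OF \<gamma>2(1)])
    have "\<gamma>2 \<bullet>\<^bsub>Q\<^esub> (v \<bullet>\<^bsub>Q\<^esub> s) = cl \<nu> \<bullet>\<^bsub>Q\<^esub> (cl v3 \<bullet>\<^bsub>Q\<^esub> cl y)"
      using Q.Comp_reduce[OF \<gamma>v, of s] \<gamma>3(4) v \<gamma>3(1-3) \<gamma>2(1-3) d3 cl by simp
    also have "\<dots> = cl v2"
      using Q.Comp_reduce[OF clc(3), of "cl y"] clc(4) cl by simp
    finally show "\<gamma>2 \<bullet>\<^bsub>Q\<^esub> (v \<bullet>\<^bsub>Q\<^esub> s) = \<gamma>2 \<bullet>\<^bsub>Q\<^esub> r"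
      unfolding \<gamma>2(4) .
  qed (use v \<gamma>2(1-3) d2 d3 in simp_all)
  moreover have "r' \<bullet>\<^bsub>Q\<^esub> v = mor (Sus Q) F \<bullet>\<^bsub>Q\<^esub> s'"
  proof -
    have "r' \<bullet>\<^bsub>Q\<^esub> v = cl w2 \<bullet>\<^bsub>Q\<^esub> (cl \<nu> \<bullet>\<^bsub>Q\<^esub> \<gamma>3)"
      unfolding \<gamma>2(5)[symmetric] \<gamma>v[symmetric] using v \<gamma>2(1-3) cl by simp
    also have "\<dots> = mor (Sus Q) F \<bullet>\<^bsub>Q\<^esub> (cl w3 \<bullet>\<^bsub>Q\<^esub> \<gamma>3)"
      using Q.Comp_reduce[OF w2\<nu>, of \<gamma>3] \<gamma>3(1-3) cl d1 by simp
    finally show ?thesis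
      unfolding w3s .
  qed
  ultimately have m2: "tri_map Q (X, Z, V, G \<bullet>\<^bsub>Q\<^esub> F, s, s') (Y, Z, R, G, r, r') (F, Ident Q Z, v)"
    unfolding Q.tri_map_iff[OF TriQ_candidate[OF t3] TriQ_candidate[OF t2]]
    using v d1 d2 d3 by simp
  show ?thesis
    using T m1 m2 by blast
qed

theorem Q_triangulated: "triangulated_category Q"
proof (intro triangulated_category.intro Q_additive triangulated_category_axioms.intro)
  show "is_equivalence Q Q (Sus Q)"
    by (rule Sus_Q_equivalence)
  show "additive_functor Q Q (Sus Q)"
    by (rule Sus_Q_additive)
  show "Tri Q \<subseteq> candidate_triangles Q"
    unfolding Tri_Q by blast
next
  fix t t' assume t: "t \<in> Tri Q" and t': "t' \<in> candidate_triangles Q" and i: "tri_iso Q t t'"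
  obtain A B D F G H where tt: "t = (A, B, D, F, G, H)"
    by (cases t)
  obtain A' B' D' F' G' H' where tt': "t' = (A', B', D', F', G', H')"
    by (cases t')
  note t1 = t[unfolded tt] and t2 = t'[unfolded tt']
  obtain a b c where abc: "is_iso Q a" "src Q a = A" "tgt Q a = A'" "is_iso Q b" "src Q b = B" "tgt Q b = B'"
    "is_iso Q c" "src Q c = D" "tgt Q c = D'"
    "b \<bullet>\<^bsub>Q\<^esub> F = F' \<bullet>\<^bsub>Q\<^esub> a" "c \<bullet>\<^bsub>Q\<^esub> G = G' \<bullet>\<^bsub>Q\<^esub> b" "mor (Sus Q) a \<bullet>\<^bsub>Q\<^esub> H = H' \<bullet>\<^bsub>Q\<^esub> c"
    using i unfolding tt tt' Q.tri_iso_iff[OF TriQ_candidate[OF t1] t2] by blast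
  have "(tgt Q a, tgt Q b, tgt Q c, F', G', H') \<in> Tri Q"
    by (rule TriQ_isoI[OF t1 abc(1,2,4,5,7,8) _ _ _ _ _ _ _ _ _ abc(10-12)])
      (use abc Q.candidateD[OF t2] in simp_all)
  then show "t' \<in> Tri Q"
    using abc tt' by simp
next
  show "(A, A, Z, Ident Q A, Zero Q A Z, Zero Q Z (ob (Sus Q) A)) \<in> Tri Q"
    if "A \<in> Ob Q" "zero_object Q Z" for A Z
    using TriQ_Ident[of A Z] that by simp
next
  fix A B F assume *: "A \<in> Ob Q" "B \<in> Ob Q" "F \<in> Hom Q A B"
  have AB: "A \<in> \<U>" "B \<in> \<U>"
    using * by simp_all
  obtain f where f: "ar T f" "src T f = A" "tgt T f = B" "F = cl f"
    by (rule Q_HomE[of F A B]) (use * in auto)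
  obtain D v w where "is_std A B D f v w"
    using ex_std[OF f(1-3) AB] .
  then show "\<exists>D G H. (A, B, D, F, G, H) \<in> Tri Q"
    unfolding f(4) using std_TriQ by blast
next
  fix A B D F G H assume *: "(A, B, D, F, G, H) \<in> candidate_triangles Q"
  note d = Q.candidateD[OF *]
  have "Neg Q (ob (Sus Q) A) (ob (Sus Q) B) (mor (Sus Q) F) = neg Q (mor (Sus Q) F)"
    by (rule Q.Neg_eq) (use d in simp_all)
  then show "(A, B, D, F, G, H) \<in> Tri Q \<longleftrightarrow>
      (B, D, ob (Sus Q) A, G, H, Neg Q (ob (Sus Q) A) (ob (Sus Q) B) (mor (Sus Q) F)) \<in> Tri Q"
    using TriQ_rot[of A B D F G H] TriQ_unrot[of B D A G H F] d(4-6) by auto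
next
  fix A B D F G H A' B' D' F' G' H' a b
  assume *: "(A, B, D, F, G, H) \<in> Tri Q" "(A', B', D', F', G', H') \<in> Tri Q"
    "a \<in> Hom Q A A'" "b \<in> Hom Q B B'" "b \<bullet>\<^bsub>Q\<^esub> F = F' \<bullet>\<^bsub>Q\<^esub> a"
  have "ar Q a \<and> src Q a = A \<and> tgt Q a = A'" "ar Q b \<and> src Q b = B \<and> tgt Q b = B'"
    using Q.Hom_arrow[OF *(3)] Q.Hom_arrow[OF *(4)] TriQD[OF *(1)] TriQD[OF *(2)] by blast+
  then show "\<exists>c. tri_map Q (A, B, D, F, G, H) (A', B', D', F', G', H') (a, b, c)"
    using TriQ_map[OF *(1,2) _ _ _ _ _ _ *(5)] by blast
next
  show "\<exists>u v. (P, R, V, u, v, mor (Sus Q) p \<bullet>\<^bsub>Q\<^esub> r') \<in> Tri Q \<and>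
        tri_map Q (X, Y, P, f, p, p') (X, Z, R, g \<bullet>\<^bsub>Q\<^esub> f, s, s') (Ident Q X, g, u) \<and>
        tri_map Q (X, Z, R, g \<bullet>\<^bsub>Q\<^esub> f, s, s') (Y, Z, V, g, r, r') (f, Ident Q Z, v)"
    if "(X, Y, P, f, p, p') \<in> Tri Q" "(Y, Z, V, g, r, r') \<in> Tri Q" "(X, Z, R, g \<bullet>\<^bsub>Q\<^esub> f, s, s') \<in> Tri Q"
    for X Y P f p p' Z V g r r' R s s'
    using TriQ_octahedral[OF that] .
qed

end

section \<open>Return to the stated signs, and split triangles\<close>

context triangulated_category
begin

theorem subfactor_triangulated:
  assumes U: "subcategory T \<U>" "extension_closed T \<U>" and X: "subcategory T \<X>" "\<X> \<subseteq> \<U>"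
    and Ext: "\<And>A B. \<lbrakk>A \<in> \<U>; B \<in> \<X>\<rbrakk> \<Longrightarrow> Hom T A (sh B) = {Zero T A (sh B)}"
      "\<And>A B. \<lbrakk>A \<in> \<X>; B \<in> \<U>\<rbrakk> \<Longrightarrow> Hom T A (sh B) = {Zero T A (sh B)}"
    and \<sigma>: "sigma_choice T \<U> \<X> \<sigma>" "\<And>A. A \<in> \<U> \<Longrightarrow> chW \<sigma> A \<in> \<U>"
    and \<omega>: "omega_choice T \<U> \<X> \<omega>" "\<And>A. A \<in> \<U> \<Longrightarrow> chW \<omega> A \<in> \<U>"
  shows "triangulated_category (subfactor T \<U> \<X> \<sigma>) \<and>
    quasi_inverse (subfactor T \<U> \<X> \<sigma>) (subfactor T \<U> \<X> \<sigma>)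
      (sigma_functor T \<U> \<X> \<sigma>) (omega_functor T \<U> \<X> \<omega>)"
proof -
  \<comment> \<open>Negating both \<open>chp\<close> and \<open>chq\<close> again gives triangles.
    Both squares that involve them are preserved, so the suspension functor is unchanged, while the
    sign in \<open>std\<close> becomes the one of \<open>standard_triangles\<close>.\<close>
  define \<tau> where "\<tau> = \<sigma>\<lparr>chp := \<lambda>A. neg T (chp \<sigma> A), chq := \<lambda>A. neg T (chq \<sigma> A)\<rparr>"
  have \<tau>_sel [simp]: "chX \<tau> = chX \<sigma>" "chW \<tau> = chW \<sigma>" "chi \<tau> = chi \<sigma>"
    "chp \<tau> A = neg T (chp \<sigma> A)" "chq \<tau> A = neg T (chq \<sigma> A)" for A
    by (simp_all add: \<tau>_def)
  have sig: "(A, chX \<sigma> A, chW \<sigma> A, chi \<sigma> A, chp \<sigma> A, chq \<sigma> A) \<in> Tri T \<and> chX \<sigma> A \<in> \<X>" if "A \<in> \<U>" for A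
    using \<sigma>(1) that unfolding sigma_choice_def sigma_triangle_def left_approx_def by blast
  have tau: "(A, chX \<sigma> A, chW \<sigma> A, chi \<sigma> A, neg T (chp \<sigma> A), neg T (chq \<sigma> A)) \<in> Tri T" if "A \<in> \<U>" for A
    using Tri_neg(3)[OF conjunct1[OF sig[OF that]]] by simp
  have om: "(chW \<omega> A, chX \<omega> A, A, chi \<omega> A, chp \<omega> A, chq \<omega> A) \<in> Tri T \<and> chX \<omega> A \<in> \<X>" if "A \<in> \<U>" for A
    using \<omega>(1) that unfolding omega_choice_def omega_triangle_def right_approx_def by blast
  interpret F: frobenius_subfactor T \<U> \<X> \<tau> \<omega>
  proof (unfold_locales, goal_cases)
    case (7 A)
    then show ?case
      using tau sig \<sigma>(2) by simp
  next
    case (8 A)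
    then show ?case
      using om \<omega>(2) by simp
  qed (use U X Ext in simp_all)
  have map: "tri_map T (A, chX \<tau> A, chW \<tau> A, chi \<tau> A, chp \<tau> A, chq \<tau> A)
        (B, chX \<tau> B, chW \<tau> B, chi \<tau> B, chp \<tau> B, chq \<tau> B) (f, x, s) \<longleftrightarrow>
      tri_map T (A, chX \<sigma> A, chW \<sigma> A, chi \<sigma> A, chp \<sigma> A, chq \<sigma> A)
        (B, chX \<sigma> B, chW \<sigma> B, chi \<sigma> B, chp \<sigma> B, chq \<sigma> B) (f, x, s)" (is "?L \<longleftrightarrow> ?R")
    if AB: "A \<in> \<U>" "B \<in> \<U>" for A B f x s
  proof -
    note c = subsetD[OF Tri_candidate]
    note t = TriD[OF conjunct1[OF sig[OF AB(1)]]] TriD[OF conjunct1[OF sig[OF AB(2)]]]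
    have eq: "s \<bullet> neg T (chp \<sigma> A) = neg T (chp \<sigma> B) \<bullet> x \<longleftrightarrow> s \<bullet> chp \<sigma> A = chp \<sigma> B \<bullet> x"
      "shm f \<bullet> neg T (chq \<sigma> A) = neg T (chq \<sigma> B) \<bullet> s \<longleftrightarrow> shm f \<bullet> chq \<sigma> A = chq \<sigma> B \<bullet> s"
      if "ar T x" "src T x = chX \<sigma> A" "tgt T x = chX \<sigma> B" "ar T s" "src T s = chW \<sigma> A" "tgt T s = chW \<sigma> B"
        "ar T f" "src T f = A" "tgt T f = B"
      using t that by simp_all
    show ?thesis
      unfolding \<tau>_sel tri_map_iff[OF c[OF tau[OF AB(1)]] c[OF tau[OF AB(2)]]]
        tri_map_iff[OF c[OF conjunct1[OF sig[OF AB(1)]]] c[OF conjunct1[OF sig[OF AB(2)]]]]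
      using eq by blast
  qed
  have "{cls T \<U> \<X> s | A B f x s. A \<in> \<U> \<and> B \<in> \<U> \<and> f \<in> G \<and>
        tri_map T (A, chX \<tau> A, chW \<tau> A, chi \<tau> A, chp \<tau> A, chq \<tau> A)
          (B, chX \<tau> B, chW \<tau> B, chi \<tau> B, chp \<tau> B, chq \<tau> B) (f, x, s)} =
      {cls T \<U> \<X> s | A B f x s. A \<in> \<U> \<and> B \<in> \<U> \<and> f \<in> G \<and>
        tri_map T (A, chX \<sigma> A, chW \<sigma> A, chi \<sigma> A, chp \<sigma> A, chq \<sigma> A)
          (B, chX \<sigma> B, chW \<sigma> B, chi \<sigma> B, chp \<sigma> B, chq \<sigma> B) (f, x, s)}" for G
    using map by blast
  then have fun_eq: "sigma_functor T \<U> \<X> \<tau> = sigma_functor T \<U> \<X> \<sigma>"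
    unfolding sigma_functor_def by simp
  have "(B, D, chW \<sigma> A, v, w, shm f \<bullet> chq \<sigma> A) \<in> Tri T \<longleftrightarrow>
      (B, D, chW \<tau> A, v, w, neg T (shm f \<bullet> chq \<tau> A)) \<in> Tri T"
    if "A \<in> \<U>" "B \<in> \<U>" "f \<in> Hom T A B" for A B D f v w
    using that TriD[OF conjunct1[OF sig[OF that(1)]]] Hom_arrow[OF that(3)] by simp
  then have std_eq: "standard_triangles T \<U> \<X> \<sigma> = F.std"
    unfolding standard_triangles_def F.std_def by blast
  have "suspended_subfactor T \<U> \<X> \<tau> = suspended_subfactor T \<U> \<X> \<sigma>"
    unfolding suspended_subfactor_def fun_eq ..
  then have Q_eq: "F.Q = subfactor T \<U> \<X> \<sigma>"
    unfolding F.Q_def subfactor_def std_eq by simp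
  show ?thesis
    using F.Q_triangulated F.quasi_inverse_Sus_loop unfolding Q_eq F.Sus_Q[symmetric, unfolded fun_eq] by simp
qed

text \<open>Exactness lifts the identity of \<open>D\<close> to a section \<open>s\<close>. The
  remaining idempotent \<open>1 - s \<bullet> g\<close> is killed by \<open>g\<close>, and its
  factor through \<open>f\<close> is the projection to \<open>A\<close>.\<close>

lemma split_biproduct:
  assumes t: "(A, B, D, f, g, Zero T D (sh A)) \<in> Tri T"
  shows "is_biproduct T A D B"
proof -
  note d = TriD[OF t]
  have 1: "ar T (Ident T D)" "tgt T (Ident T D) = D" "Zero T D (sh A) \<bullet> Ident T D = Zero T (src T (Ident T D)) (sh A)"
    using d by simp_all
  obtain s where s: "ar T s" "src T s = src T (Ident T D)" "tgt T s = B" "Ident T D = g \<bullet> s"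
    using exact3[OF t 1] .
  have s2: "src T s = D"
    using s(2) d by simp
  have x: "ar T (diff T (Ident T B) (s \<bullet> g))" "tgt T (diff T (Ident T B) (s \<bullet> g)) = B"
    "g \<bullet> diff T (Ident T B) (s \<bullet> g) = Zero T (src T (diff T (Ident T B) (s \<bullet> g))) D"
    using d s(1,3) s2 Comp_reduce[OF s(4)[symmetric], of g] by simp_all
  obtain k where k: "ar T k" "src T k = src T (diff T (Ident T B) (s \<bullet> g))" "tgt T k = A"
    "diff T (Ident T B) (s \<bullet> g) = f \<bullet> k"
    using exact2[OF t x] .
  have k2: "src T k = B"
    using k(2) d s(1,3) s2 by simp
  \<comment> \<open>\<open>f\<close> is monic because its suspension can only kill maps that factor
    through the zero third map. This lets the remaining biproduct identities be checked after
    composing with \<open>f\<close>.\<close>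
  have mono: "x = y" if xy: "ar T x" "ar T y" "src T x = src T y" "tgt T x = A" "tgt T y = A" "f \<bullet> x = f \<bullet> y" for x y
  proof -
    have fz: "f \<bullet> diff T x y = Zero T (src T x) B"
      using xy d by simp
    have "shm f \<bullet> shm (diff T x y) = shm (f \<bullet> diff T x y)"
      by (rule shm_Comp[symmetric]) (use xy d in simp_all)
    also have "\<dots> = Zero T (sh (src T x)) (sh B)"
      unfolding fz using xy(1) d by simp
    finally have *: "ar T (shm (diff T x y))" "tgt T (shm (diff T x y)) = sh A"
      "shm f \<bullet> shm (diff T x y) = Zero T (src T (shm (diff T x y))) (sh B)"
      using xy by simp_all
    obtain z where z: "ar T z" "src T z = src T (shm (diff T x y))" "tgt T z = D"
      "shm (diff T x y) = Zero T D (sh A) \<bullet> z"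
      using exact4[OF t *] .
    have "src T z = sh (src T x)"
      using z(2) xy(1-5) by simp
    then have "shm (diff T x y) = shm (Zero T (src T x) A)"
      unfolding z(4) using z(1,3) xy(1) d by simp
    then have "diff T x y = Zero T (src T x) A"
      by (rule shm_inj) (use xy d in simp_all)
    then show ?thesis
      using diff_eq_Zero_iff[of x y] xy by simp
  qed
  have fk: "f \<bullet> (k \<bullet> x) = diff T (Ident T B) (s \<bullet> g) \<bullet> x" if "ar T x" "tgt T x = B" for x
    using that k(1,3) k2 d k(4) by simp
  have kf: "k \<bullet> f = Ident T A"
    by (rule mono) (use fk[of f] k(1,3) k2 d s(1,3) s2 Tri_comp_zero[OF t] in \<open>simp_all add: diff_def\<close>)
  have ks: "k \<bullet> s = Zero T D A"
    by (rule mono) (use fk[of s] k(1,3) k2 d s(1,3) s2 s(4)[symmetric] in simp_all)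
  show ?thesis
    by (rule is_biproductI[of f s k g])
      (use kf ks d s(1,3) s2 k(1,3) k2 s(4)[symmetric] k(4)[symmetric] Tri_comp_zero[OF t]
        diff_Add_cancel(1)[of "Ident T B" "s \<bullet> g"] in simp_all)
qed

section \<open>Vanishing of Hom, orthogonals and approximations\<close>

definition zh :: "'o \<Rightarrow> 'o \<Rightarrow> bool" where
  "zh A B \<longleftrightarrow> Hom T A B = {Zero T A B}"

lemma zh_iff: "\<lbrakk>A \<in> Ob T; B \<in> Ob T\<rbrakk> \<Longrightarrow> zh A B \<longleftrightarrow> (\<forall>f. ar T f \<longrightarrow> src T f = A \<longrightarrow> tgt T f = B \<longrightarrow> f = Zero T A B)"
  unfolding zh_def using Hom_iff[of A B] Zero_arrow[of A B] by blast

lemma zhD: "\<lbrakk>zh A B; ar T f; src T f = A; tgt T f = B\<rbrakk> \<Longrightarrow> f = Zero T A B"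
  using zh_iff[of A B] ar_Ob[of f] by blast

lemma zhI: "\<lbrakk>A \<in> Ob T; B \<in> Ob T; \<And>f. \<lbrakk>ar T f; src T f = A; tgt T f = B\<rbrakk> \<Longrightarrow> f = Zero T A B\<rbrakk> \<Longrightarrow> zh A B"
  using zh_iff by blast

lemma zh_isomorphic:
  assumes "zh A B" "isomorphic T A A'" "isomorphic T B B'" "A \<in> Ob T" "B \<in> Ob T" "A' \<in> Ob T" "B' \<in> Ob T"
  shows "zh A' B'"
proof (rule zhI)
  obtain a where a: "is_iso T a" "src T a = A" "tgt T a = A'"
    using isomorphic_iff[OF assms(4,6)] assms(2) by blast
  obtain b where b: "is_iso T b" "src T b = B" "tgt T b = B'"
    using isomorphic_iff[OF assms(5,7)] assms(3) by blast
  fix f assume f: "ar T f" "src T f = A'" "tgt T f = B'"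
  have z: "inv_of T b \<bullet> (f \<bullet> a) = Zero T A B"
    by (rule zhD[OF assms(1)]) (use a b f in simp_all)
  have "f = b \<bullet> ((inv_of T b \<bullet> (f \<bullet> a)) \<bullet> inv_of T a)"
    using a b f by simp
  then show "f = Zero T A' B'"
    unfolding z using a b assms(4-7) by simp
qed (use assms in simp_all)

lemma zh_equivalence:
  assumes F: "is_equivalence T T F" "additive_functor T T F" and AB: "A \<in> Ob T" "B \<in> Ob T"
  shows "zh (ob F A) (ob F B) \<longleftrightarrow> zh A B"
proof
  note F' = functor_arrow[OF equivalence_functor[OF F(1)]] functor_Ob[OF equivalence_functor[OF F(1)]]
  show "zh A B" if z: "zh (ob F A) (ob F B)"
  proof (rule zhI[OF AB])
    fix f assume f: "ar T f" "src T f = A" "tgt T f = B"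
    have "mor F f = mor F (Zero T A B)"
      using zhD[OF z, of "mor F f"] f F' AB additive_Zero[OF F(2)] by simp
    then show "f = Zero T A B"
      using equivalence_faithful[OF F(1), of f "Zero T A B"] f AB by simp
  qed
  show "zh (ob F A) (ob F B)" if z: "zh A B"
  proof (rule zhI)
    fix h assume h: "ar T h" "src T h = ob F A" "tgt T h = ob F B"
    obtain f where f: "ar T f" "src T f = A" "tgt T f = B" "mor F f = h"
      using equivalence_full[OF F(1) AB h] .
    have "f = Zero T A B"
      using zhD[OF z f(1-3)] .
    then show "h = Zero T (ob F A) (ob F B)"
      using f(4) additive_Zero[OF F(2) AB] by simp
  qed (use AB F' in simp_all)
qed

lemmas zh_sh [simp] = zh_equivalence[OF Sus_equivalence Sus_additive]

text \<open>The objects without extensions by \<open>\<X>\<close>. Testing against suspended objects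
  describes \<open>\<^sup>\<bottom>\<X>[1]\<close> without desuspending the object tested;
  \<open>shift_left_perp\<close> makes the identification.\<close>

definition perp :: "'o set \<Rightarrow> 'o set" where
  "perp \<X> = {A \<in> Ob T. \<forall>B \<in> \<X>. zh A (sh B)}"

lemma shift_left_perp:
  assumes "\<X> \<subseteq> Ob T"
  shows "shift T (left_perp T \<X>) = perp \<X>"
proof -
  have "(\<exists>B \<in> left_perp T \<X>. isomorphic T A (sh B)) \<longleftrightarrow> (\<forall>B \<in> \<X>. zh A (sh B))" if A: "A \<in> Ob T" for A
  proof
    assume "\<exists>B \<in> left_perp T \<X>. isomorphic T A (sh B)"
    then obtain B where B: "B \<in> Ob T" "\<And>Y. Y \<in> \<X> \<Longrightarrow> zh B Y" "isomorphic T A (sh B)"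
      unfolding left_perp_def zh_def by blast
    show "\<forall>Y \<in> \<X>. zh A (sh Y)"
    proof
      fix Y assume Y: "Y \<in> \<X>"
      show "zh A (sh Y)"
        by (rule zh_isomorphic[of "sh B" "sh Y"])
          (use B Y A assms isomorphic_sym[OF A _ B(3)] isomorphic_refl in auto)
    qed
  next
    assume z: "\<forall>B \<in> \<X>. zh A (sh B)"
    obtain B e where B: "B \<in> Ob T" "is_iso T e" "src T e = sh B" "tgt T e = A"
      using shm_surj[OF A] .
    have i: "isomorphic T (sh B) A"
      using B isomorphic_iff[of "sh B" A] A by auto
    have "zh B Y" if Y: "Y \<in> \<X>" for Y
    proof -
      have "zh (sh B) (sh Y)"
        by (rule zh_isomorphic[of A "sh Y"])
          (use z Y B A assms isomorphic_sym[OF _ A i] isomorphic_refl in auto)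
      then show ?thesis
        using B Y assms by auto
    qed
    then have "B \<in> left_perp T \<X>"
      unfolding left_perp_def zh_def using B(1) by blast
    then show "\<exists>B \<in> left_perp T \<X>. isomorphic T A (sh B)"
      using isomorphic_sym[OF _ A i] B(1) by auto
  qed
  then show ?thesis
    unfolding shift_def replete_image_def perp_def by blast
qed

lemma heart_eq: "\<U> \<subseteq> Ob T \<Longrightarrow> heart T \<U> = \<U> \<inter> perp \<U>"
  by (simp add: heart_def shift_left_perp)

lemma rigid_iff:
  assumes "\<X> \<subseteq> Ob T"
  shows "rigid T \<X> \<longleftrightarrow> (\<forall>A \<in> \<X>. \<forall>B \<in> \<X>. zh A (sh B))"
proof
  show "\<forall>A \<in> \<X>. \<forall>B \<in> \<X>. zh A (sh B)" if r: "rigid T \<X>"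
  proof (intro ballI)
    fix A B assume AB: "A \<in> \<X>" "B \<in> \<X>"
    have "sh B \<in> Ob T"
      using AB assms by auto
    then have "sh B \<in> shift T \<X>"
      unfolding shift_def replete_image_def using isomorphic_refl AB(2) by blast
    then show "zh A (sh B)"
      using r AB(1) unfolding rigid_def zh_def by blast
  qed
  show "rigid T \<X>" if r: "\<forall>A \<in> \<X>. \<forall>B \<in> \<X>. zh A (sh B)"
    unfolding rigid_def zh_def[symmetric]
  proof (intro ballI)
    fix A Y assume A: "A \<in> \<X>" and "Y \<in> shift T \<X>"
    then obtain B where B: "B \<in> \<X>" "Y \<in> Ob T" "isomorphic T Y (sh B)"
      unfolding shift_def replete_image_def by blast
    have Ob: "A \<in> Ob T" "sh B \<in> Ob T"
      using A B assms by auto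
    show "zh A Y"
      by (rule zh_isomorphic[of A "sh B"])
        (use r A B Ob isomorphic_refl isomorphic_sym[OF B(2) Ob(2) B(3)] in auto)
  qed
qed

lemma subcategoryD:
  assumes "subcategory T \<U>"
  shows "\<U> \<subseteq> Ob T" "\<And>A B P. \<lbrakk>A \<in> \<U>; B \<in> \<U>; is_biproduct T A B P\<rbrakk> \<Longrightarrow> P \<in> \<U>"
    "\<And>A B. \<lbrakk>A \<in> \<U>; B \<in> Ob T; isomorphic T A B\<rbrakk> \<Longrightarrow> B \<in> \<U>"
    "\<And>A B P. \<lbrakk>P \<in> \<U>; A \<in> Ob T; B \<in> Ob T; is_biproduct T A B P\<rbrakk> \<Longrightarrow> A \<in> \<U> \<and> B \<in> \<U>"
    "\<exists>Z \<in> \<U>. zero_object T Z"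
  using assms unfolding subcategory_def by blast+

lemma perp_subcategory:
  assumes "\<X> \<subseteq> Ob T"
  shows "subcategory T (perp \<X>)"
  unfolding subcategory_def
proof (intro conjI ballI allI impI)
  show "perp \<X> \<subseteq> Ob T"
    by (auto simp: perp_def)
  obtain Z where Z: "Z \<in> Ob T" "zero_object T Z"
    using ex_zero .
  have "zh Z (sh B)" if B: "B \<in> \<X>" for B
  proof (rule zhI)
    show "sh B \<in> Ob T"
      using B assms by auto
    show "f = Zero T Z (sh B)" if "ar T f" "src T f = Z" "tgt T f = sh B" for f
      using zero_object_from[OF Z(2) that(1,2)] that(3) by simp
  qed (rule Z)
  then show "\<exists>Z \<in> perp \<X>. zero_object T Z"
    using Z by (auto simp: perp_def)
next
  fix A B P assume AB: "A \<in> perp \<X>" "B \<in> perp \<X>" and P: "is_biproduct T A B P"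
  have Ob: "A \<in> Ob T" "B \<in> Ob T"
    using AB by (simp_all add: perp_def)
  obtain i j p q where b: "P \<in> Ob T" "ar T i" "ar T j" "ar T p" "ar T q" "src T i = A" "tgt T i = P"
    "src T j = B" "tgt T j = P" "src T p = P" "tgt T p = A" "src T q = P" "tgt T q = B"
    "p \<bullet> i = Ident T A" "q \<bullet> j = Ident T B" "q \<bullet> i = Zero T A B" "p \<bullet> j = Zero T B A"
    "Add T (i \<bullet> p) (j \<bullet> q) = Ident T P"
    using is_biproductE[OF P Ob] .
  have "zh P (sh Y)" if Y: "Y \<in> \<X>" for Y
  proof (rule zhI)
    have Yo: "Y \<in> Ob T"
      using Y assms by auto
    then show "sh Y \<in> Ob T"
      by simp
    fix f assume f: "ar T f" "src T f = P" "tgt T f = sh Y"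
    have z: "f \<bullet> i = Zero T A (sh Y)" "f \<bullet> j = Zero T B (sh Y)"
      using zhD[of A "sh Y" "f \<bullet> i"] zhD[of B "sh Y" "f \<bullet> j"] AB Y f b by (simp_all add: perp_def)
    have "f = f \<bullet> Add T (i \<bullet> p) (j \<bullet> q)"
      unfolding b(18) using f by simp
    also have "\<dots> = Add T (f \<bullet> (i \<bullet> p)) (f \<bullet> (j \<bullet> q))"
      using f b(1-13) by simp
    also have "\<dots> = Zero T P (sh Y)"
      using Comp_reduce[OF z(1), of p] Comp_reduce[OF z(2), of q] f b(1-13) Yo Ob by simp
    finally show "f = Zero T P (sh Y)" .
  qed (use b in simp)
  then show "P \<in> perp \<X>"
    using b(1) by (simp add: perp_def)
next
  fix A B assume A: "A \<in> perp \<X>" and B: "B \<in> Ob T" "isomorphic T A B"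
  have "zh B (sh Y)" if "Y \<in> \<X>" for Y
    by (rule zh_isomorphic[of A "sh Y"]) (use A B that assms isomorphic_refl in \<open>auto simp: perp_def\<close>)
  then show "B \<in> perp \<X>"
    using B by (simp add: perp_def)
next
  fix P A B assume PX: "P \<in> perp \<X>" and Ob: "A \<in> Ob T" "B \<in> Ob T" and P: "is_biproduct T A B P"
  obtain i j p q where b: "P \<in> Ob T" "ar T i" "ar T j" "ar T p" "ar T q" "src T i = A" "tgt T i = P"
    "src T j = B" "tgt T j = P" "src T p = P" "tgt T p = A" "src T q = P" "tgt T q = B"
    "p \<bullet> i = Ident T A" "q \<bullet> j = Ident T B" "q \<bullet> i = Zero T A B" "p \<bullet> j = Zero T B A"
    "Add T (i \<bullet> p) (j \<bullet> q) = Ident T P"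
    using is_biproductE[OF P Ob] .
  have retract: "zh D (sh Y)" if Y: "Y \<in> \<X>" and r: "ar T r" "ar T s" "src T s = D" "tgt T s = P" "src T r = P" "tgt T r = D"
    "r \<bullet> s = Ident T D" for D Y r s
  proof (rule zhI)
    have Yo: "Y \<in> Ob T"
      using Y assms by auto
    then show "sh Y \<in> Ob T"
      by simp
    fix f assume f: "ar T f" "src T f = D" "tgt T f = sh Y"
    have z: "f \<bullet> r = Zero T P (sh Y)"
      using zhD[of P "sh Y" "f \<bullet> r"] PX Y f r by (simp add: perp_def)
    have "f = (f \<bullet> r) \<bullet> s"
      using f r by simp
    then show "f = Zero T D (sh Y)"
      unfolding z using r Yo b(1) by simp
  qed (use r ar_Ob in blast)
  show "A \<in> perp \<X>" "B \<in> perp \<X>"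
    using retract[of _ p i A] retract[of _ q j B] b Ob by (simp_all add: perp_def)
qed

lemma perp_extension_closed:
  assumes "\<X> \<subseteq> Ob T"
  shows "extension_closed T (perp \<X>)"
  unfolding extension_closed_def
proof (intro allI impI)
  fix A B D f g h assume t: "(A, B, D, f, g, h) \<in> Tri T" and AD: "A \<in> perp \<X>" "D \<in> perp \<X>"
  note d = TriD[OF t]
  have "zh B (sh Y)" if Y: "Y \<in> \<X>" for Y
  proof (rule zhI)
    have Yo: "Y \<in> Ob T"
      using Y assms by auto
    then show "sh Y \<in> Ob T"
      by simp
    fix x assume x: "ar T x" "src T x = B" "tgt T x = sh Y"
    have "x \<bullet> f = Zero T A (tgt T x)"
      using zhD[of A "sh Y" "x \<bullet> f"] AD Y x d by (simp add: perp_def)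
    then obtain y where y: "ar T y" "src T y = D" "tgt T y = tgt T x" "x = y \<bullet> g"
      using coexact2[OF t x(1,2)] by blast
    have "y = Zero T D (sh Y)"
      using zhD[of D "sh Y" y] AD Y y(1-3) x(3) by (simp add: perp_def)
    then show "x = Zero T B (sh Y)"
      using y(4) d Yo by simp
  qed (use d in simp)
  then show "B \<in> perp \<X>"
    using d by (simp add: perp_def)
qed

lemma subcategory_Int:
  assumes "subcategory T \<U>" "subcategory T \<V>"
  shows "subcategory T (\<U> \<inter> \<V>)"
proof -
  obtain Z where Z: "Z \<in> \<U>" "zero_object T Z"
    using subcategoryD(5)[OF assms(1)] by blast
  obtain Z' where Z': "Z' \<in> \<V>" "zero_object T Z'"
    using subcategoryD(5)[OF assms(2)] by blast
  have Zo: "Z \<in> Ob T" "Z' \<in> Ob T"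
    using zero_object_Ob Z Z' by simp_all
  have "isomorphic T Z Z'"
    unfolding isomorphic_iff[OF Zo] using zero_object_iso[OF Z(2) Z'(2)] Zero_arrow(2,3)[OF Zo] by blast
  then have "Z' \<in> \<U>"
    using subcategoryD(3)[OF assms(1) Z(1)] zero_object_Ob[OF Z'(2)] by blast
  then have "\<exists>Z \<in> \<U> \<inter> \<V>. zero_object T Z"
    using Z' by blast
  moreover have "\<U> \<inter> \<V> \<subseteq> Ob T"
    using subcategoryD(1)[OF assms(1)] by blast
  moreover have "\<forall>A \<in> \<U> \<inter> \<V>. \<forall>B \<in> \<U> \<inter> \<V>. \<forall>P. is_biproduct T A B P \<longrightarrow> P \<in> \<U> \<inter> \<V>"
    using subcategoryD(2)[OF assms(1)] subcategoryD(2)[OF assms(2)] by blast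
  moreover have "\<forall>A \<in> \<U> \<inter> \<V>. \<forall>B \<in> Ob T. isomorphic T A B \<longrightarrow> B \<in> \<U> \<inter> \<V>"
    using subcategoryD(3)[OF assms(1)] subcategoryD(3)[OF assms(2)] by blast
  moreover have "\<forall>P \<in> \<U> \<inter> \<V>. \<forall>A \<in> Ob T. \<forall>B \<in> Ob T. is_biproduct T A B P \<longrightarrow> A \<in> \<U> \<inter> \<V> \<and> B \<in> \<U> \<inter> \<V>"
    using subcategoryD(4)[OF assms(1)] subcategoryD(4)[OF assms(2)] by blast
  ultimately show ?thesis
    unfolding subcategory_def by (intro conjI)
qed

subsection \<open>Approximations\<close>

lemma left_approxD:
  assumes "left_approx T \<X> A X f" "\<X> \<subseteq> Ob T" "A \<in> Ob T"
  shows "X \<in> \<X>" "X \<in> Ob T" "ar T f" "src T f = A" "tgt T f = X"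
  using assms Hom_arrow[of f A X] unfolding left_approx_def by blast+

lemma left_approx_factor:
  assumes f: "left_approx T \<X> A X f" and X: "\<X> \<subseteq> Ob T" "A \<in> Ob T"
    and g: "ar T g" "src T g = A" "tgt T g \<in> \<X>"
  obtains h where "ar T h" "src T h = X" "tgt T h = tgt T g" "g = h \<bullet> f"
proof -
  have "g \<in> Hom T A (tgt T g)"
    using g arrow_self[of g] by simp
  then obtain h where h: "h \<in> Hom T X (tgt T g)" "g = h \<bullet> f"
    using f g(3) unfolding left_approx_def by blast
  have "ar T h \<and> src T h = X \<and> tgt T h = tgt T g"
    by (rule Hom_arrow[OF h(1)]) (use left_approxD(2)[OF f X] g(1) in simp_all)
  then show thesis
    using that[of h] h(2) by blast
qed

lemma left_approxI:
  assumes "X \<in> \<X>" "ar T f" "src T f = A" "tgt T f = X" "\<X> \<subseteq> Ob T"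
    "\<And>g. \<lbrakk>ar T g; src T g = A; tgt T g \<in> \<X>\<rbrakk> \<Longrightarrow> \<exists>h. ar T h \<and> src T h = X \<and> tgt T h = tgt T g \<and> g = h \<bullet> f"
  shows "left_approx T \<X> A X f"
  unfolding left_approx_def
proof (intro conjI ballI)
  show "f \<in> Hom T A X"
    using assms arrow_self[of f] by simp
  fix Y g assume Y: "Y \<in> \<X>" "g \<in> Hom T A Y"
  have g: "ar T g" "src T g = A" "tgt T g = Y"
    using Hom_arrow[OF Y(2)] Y assms ar_Ob[of f] by auto
  then obtain h where "ar T h" "src T h = X" "tgt T h = Y" "g = h \<bullet> f"
    using assms(6)[of g] Y by blast
  then show "\<exists>h \<in> Hom T X Y. g = h \<bullet> f"
    using arrow_self[of h] by auto
qed (rule assms)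

lemma right_approxD:
  assumes "right_approx T \<X> A X f" "\<X> \<subseteq> Ob T" "A \<in> Ob T"
  shows "X \<in> \<X>" "X \<in> Ob T" "ar T f" "src T f = X" "tgt T f = A"
  using assms Hom_arrow[of f X A] unfolding right_approx_def by blast+

lemma right_approx_factor:
  assumes f: "right_approx T \<X> A X f" and X: "\<X> \<subseteq> Ob T" "A \<in> Ob T"
    and g: "ar T g" "tgt T g = A" "src T g \<in> \<X>"
  obtains h where "ar T h" "src T h = src T g" "tgt T h = X" "g = f \<bullet> h"
proof -
  have "g \<in> Hom T (src T g) A"
    using g arrow_self[of g] by simp
  then obtain h where h: "h \<in> Hom T (src T g) X" "g = f \<bullet> h"
    using f g(3) unfolding right_approx_def by blast
  have "ar T h \<and> src T h = src T g \<and> tgt T h = X"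
    by (rule Hom_arrow[OF h(1)]) (use right_approxD(2)[OF f X] g(1) in simp_all)
  then show thesis
    using that[of h] h(2) by blast
qed

lemma right_approxI:
  assumes "X \<in> \<X>" "ar T f" "src T f = X" "tgt T f = A" "\<X> \<subseteq> Ob T"
    "\<And>g. \<lbrakk>ar T g; tgt T g = A; src T g \<in> \<X>\<rbrakk> \<Longrightarrow> \<exists>h. ar T h \<and> src T h = src T g \<and> tgt T h = X \<and> g = f \<bullet> h"
  shows "right_approx T \<X> A X f"
  unfolding right_approx_def
proof (intro conjI ballI)
  show "f \<in> Hom T X A"
    using assms arrow_self[of f] by simp
  fix Y g assume Y: "Y \<in> \<X>" "g \<in> Hom T Y A"
  have g: "ar T g" "src T g = Y" "tgt T g = A"
    using Hom_arrow[OF Y(2)] Y assms ar_Ob[of f] by auto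
  then obtain h where "ar T h" "src T h = Y" "tgt T h = X" "g = f \<bullet> h"
    using assms(6)[of g] Y by blast
  then show "\<exists>h \<in> Hom T Y X. g = f \<bullet> h"
    using arrow_self[of h] by auto
qed (rule assms)

text \<open>Wakamatsu's lemma: minimality of \<open>g\<close> makes the pullback of an extension along \<open>k\<close> split.\<close>

lemma wakamatsu_left:
  assumes U: "\<U> \<subseteq> Ob T" "extension_closed T \<U>" and g: "left_approx T \<U> A V g"
    and min: "\<And>h. \<lbrakk>ar T h; src T h = V; tgt T h = V; h \<bullet> g = g\<rbrakk> \<Longrightarrow> is_iso T h"
    and t: "(A, V, D, g, k, l) \<in> Tri T" and Y: "Y \<in> \<U>"
  shows "zh D (sh Y)"
proof (rule zhI)
  note d = TriD[OF t]
  note V = left_approxD[OF g U(1) d(1)]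
  have Yo: "Y \<in> Ob T"
    using Y U by auto
  show "D \<in> Ob T" "sh Y \<in> Ob T"
    using d Yo by simp_all
  fix x assume x: "ar T x" "src T x = D" "tgt T x = sh Y"
  have xk: "ar T (x \<bullet> k)" "src T (x \<bullet> k) = V" "tgt T (x \<bullet> k) = sh Y"
    using x d by simp_all
  obtain V' m \<pi> where t': "(Y, V', V, m, \<pi>, x \<bullet> k) \<in> Tri T"
    using Tri_complete3[OF xk Yo] .
  note d' = TriD[OF t']
  have V': "V' \<in> \<U>"
    using U(2) t' Y V(1) unfolding extension_closed_def by blast
  have "(x \<bullet> k) \<bullet> g = Zero T (src T g) (sh Y)"
    using Tri_comp_zero[OF t] x d Yo by simp
  then obtain g' where g': "ar T g'" "src T g' = src T g" "tgt T g' = V'" "g = \<pi> \<bullet> g'"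
    using exact3[OF t' d(4,6)] by blast
  have g'A: "src T g' = A" "tgt T g' \<in> \<U>"
    using g'(2,3) d V' by simp_all
  obtain w where w: "ar T w" "src T w = V" "tgt T w = tgt T g'" "g' = w \<bullet> g"
    using left_approx_factor[OF g U(1) d(1) g'(1) g'A] .
  have is_iso: "is_iso T (\<pi> \<bullet> w)"
    by (rule min) (use w(1-3) w(4)[symmetric] g'(3) g'(4)[symmetric] d d' in simp_all)
  have *: "(x \<bullet> k) \<bullet> (\<pi> \<bullet> w) = Zero T V (sh Y) \<bullet> (\<pi> \<bullet> w)"
    using Comp_reduce[OF Tri_comp_zero2[OF t'], of w] w(1-3) g'(3) xk d' Yo x d by simp
  have "x \<bullet> k = Zero T V (sh Y)"
    by (rule iso_cancel_right[OF is_iso _ _ _ _ *]) (use w(1-3) g'(3) xk d d' Yo in simp_all)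
  \<comment> \<open>The extension class has been killed on \<open>V\<close>, so \<open>x\<close>
    comes from a map \<open>A \<rightarrow> Y\<close> suspended. The latter factors through the
    approximation \<open>g\<close>, and consecutive maps in the triangle finish.\<close>
  then have "x \<bullet> k = Zero T V (tgt T x)"
    using x(3) by simp
  then obtain y where y: "ar T y" "src T y = sh A" "tgt T y = tgt T x" "x = y \<bullet> l"
    using coexact3[OF t x(1,2)] by blast
  have y3: "tgt T y = sh Y"
    using y(3) x(3) by simp
  obtain y' where y': "ar T y'" "src T y' = A" "tgt T y' = Y" "shm y' = y"
    using shm_full[OF d(1) Yo y(1,2) y3] .
  have "tgt T y' \<in> \<U>"
    using y'(3) Y by simp
  then obtain u where u: "ar T u" "src T u = V" "tgt T u = tgt T y'" "y' = u \<bullet> g"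
    using left_approx_factor[OF g U(1) d(1) y'(1,2)] by blast
  have "x = (shm u \<bullet> shm g) \<bullet> l"
    using y(4) u(1,2) d unfolding y'(4)[symmetric] u(4) by simp
  also have "\<dots> = shm u \<bullet> (shm g \<bullet> l)"
    using u(1,2) d by simp
  also have "\<dots> = Zero T D (sh Y)"
    using Tri_comp_zero3[OF t] u(1-3) y'(3) d by simp
  finally show "x = Zero T D (sh Y)" .
qed

text \<open>Dually, the extension of \<open>Y\<close> by \<open>V\<close> with class
  \<open>k[1] \<bullet> x\<close> lies in \<open>\<U>\<close>, and \<open>g\<close> extends to its
  middle term \<open>V'\<close>. Lifting this extension through the approximation gives an
  endomorphism of \<open>V\<close> fixing \<open>g\<close>, so \<open>V \<rightarrow> V'\<close> is
  split by minimality.\<close>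

lemma wakamatsu_right:
  assumes U: "\<U> \<subseteq> Ob T" "extension_closed T \<U>" and g: "right_approx T \<U> B V g"
    and min: "\<And>h. \<lbrakk>ar T h; src T h = V; tgt T h = V; g \<bullet> h = g\<rbrakk> \<Longrightarrow> is_iso T h"
    and t: "(D, V, B, k, g, l) \<in> Tri T" and Y: "Y \<in> \<U>"
  shows "zh Y (sh D)"
proof (rule zhI)
  note d = TriD[OF t]
  note V = right_approxD[OF g U(1) d(3)]
  have Yo: "Y \<in> Ob T"
    using Y U by auto
  show "sh D \<in> Ob T" "Y \<in> Ob T"
    using d Yo by simp_all
  fix x assume x: "ar T x" "src T x = Y" "tgt T x = sh D"
  have kx: "ar T (shm k \<bullet> x)" "src T (shm k \<bullet> x) = Y" "tgt T (shm k \<bullet> x) = sh V"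
    using x d by simp_all
  obtain V' m n where t': "(V, V', Y, m, n, shm k \<bullet> x) \<in> Tri T"
    using Tri_complete3[OF kx d(2)] .
  note d' = TriD[OF t']
  have V': "V' \<in> \<U>"
    using U(2) t' Y V(1) unfolding extension_closed_def by blast
  have "shm g \<bullet> shm k = Zero T (sh D) (sh B)"
    using Tri_comp_zero[OF t] d by (simp flip: shm_Comp)
  then have "shm g \<bullet> (shm k \<bullet> x) = Zero T Y (sh (tgt T g))"
    using Comp_reduce[of "shm g" "shm k" "Zero T (sh D) (sh B)" x] x d by simp
  then obtain g' where g': "ar T g'" "src T g' = V'" "tgt T g' = tgt T g" "g = g' \<bullet> m"
    using coexact1[OF t' d(7,8)] by blast
  have g'B: "tgt T g' = B" "src T g' \<in> \<U>"
    using g'(2,3) d V' by simp_all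
  obtain w where w: "ar T w" "src T w = src T g'" "tgt T w = V" "g' = g \<bullet> w"
    using right_approx_factor[OF g U(1) d(3) g'(1) g'B] .
  have w2: "src T w = V'"
    using w(2) g'(2) by simp
  have "(g \<bullet> w) \<bullet> m = g"
    using g'(4) w(4) by simp
  then have "g \<bullet> (w \<bullet> m) = g"
    using w(1,3) w2 d d' by simp
  then have is_iso: "is_iso T (w \<bullet> m)"
    by (intro min[of "w \<bullet> m"]) (use w(1,3) w2 d d' in simp_all)
  have "shm (w \<bullet> m) \<bullet> (shm k \<bullet> x) = shm w \<bullet> (shm m \<bullet> (shm k \<bullet> x))"
    using w(1,3) w2 d d' x by simp
  also have "\<dots> = shm (w \<bullet> m) \<bullet> Zero T Y (sh V)"
    using Tri_comp_zero3[OF t'] w(1,3) w2 d d' x Yo by simp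
  finally have *: "shm (w \<bullet> m) \<bullet> (shm k \<bullet> x) = shm (w \<bullet> m) \<bullet> Zero T Y (sh V)" .
  have "shm k \<bullet> x = Zero T Y (sh V)"
    by (rule iso_cancel_left[OF shm_iso(1)[OF is_iso] _ _ _ _ *]) (use w(1,3) w2 kx d d' Yo in simp_all)
  then have "shm k \<bullet> x = Zero T (src T x) (sh V)"
    using x(2) by simp
  then obtain y where y: "ar T y" "src T y = src T x" "tgt T y = B" "x = l \<bullet> y"
    using exact4[OF t x(1,3)] by blast
  have "src T y \<in> \<U>"
    using y(2) x(2) Y by simp
  then obtain u where u: "ar T u" "src T u = src T y" "tgt T u = V" "y = g \<bullet> u"
    using right_approx_factor[OF g U(1) d(3) y(1,3)] by blast
  have "x = l \<bullet> (g \<bullet> u)"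
    using y(4) u(4) by simp
  also have "\<dots> = Zero T (src T u) (sh D)"
    using Comp_reduce[OF Tri_comp_zero2[OF t], of u] u(1,3) d by simp
  finally show "x = Zero T Y (sh D)"
    using u(2) y(2) x(2) by simp
qed

end

section \<open>Serre stability and the passage between \<open>\<U>\<close> and its heart\<close>

section \<open>The correspondence\<close>

text \<open>The consequences of Serre duality, Hom-finiteness and split idempotents on which the bijection
  depends.\<close>

locale minimal_serre_category = triangulated_category T
  for T :: "('o, 'm, 'z) triang_scheme" (structure) +
  fixes S :: "('o, 'm, 'o, 'm) func"
  assumes S_equivalence: "is_equivalence T T S" and S_additive: "additive_functor T T S"
    and S_shift: "A \<in> Ob T \<Longrightarrow> isomorphic T (ob S (ob (Sus T) A)) (ob (Sus T) (ob S A))"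
    and duality: "\<lbrakk>A \<in> Ob T; B \<in> Ob T; Hom T A B = {Zero T A B}\<rbrakk> \<Longrightarrow> Hom T B (ob S A) = {Zero T B (ob S A)}"
    and left_minimal: "ar T f \<Longrightarrow> \<exists>V V' r s. V \<in> Ob T \<and> V' \<in> Ob T \<and> is_biproduct T V V' (tgt T f) \<and>
      ar T r \<and> src T r = tgt T f \<and> tgt T r = V \<and> ar T s \<and> src T s = V \<and> tgt T s = tgt T f \<and> s \<bullet> (r \<bullet> f) = f \<and>
      (\<forall>h. ar T h \<and> src T h = V \<and> tgt T h = V \<and> h \<bullet> (r \<bullet> f) = r \<bullet> f \<longrightarrow> is_iso T h)"
    and right_minimal: "ar T f \<Longrightarrow> \<exists>V V' r s. V \<in> Ob T \<and> V' \<in> Ob T \<and> is_biproduct T V V' (src T f) \<and>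
      ar T r \<and> src T r = src T f \<and> tgt T r = V \<and> ar T s \<and> src T s = V \<and> tgt T s = src T f \<and> (f \<bullet> s) \<bullet> r = f \<and>
      (\<forall>h. ar T h \<and> src T h = V \<and> tgt T h = V \<and> (f \<bullet> s) \<bullet> h = f \<bullet> s \<longrightarrow> is_iso T h)"
begin

lemma S_Ob [simp]: "A \<in> Ob T \<Longrightarrow> ob S A \<in> Ob T"
  using functor_Ob[OF equivalence_functor[OF S_equivalence]] .

lemmas S_isomorphic_iff = equivalence_isomorphic_iff[OF S_equivalence]
lemmas zh_S = zh_equivalence[OF S_equivalence S_additive]

lemma zh_duality: "\<lbrakk>A \<in> Ob T; B \<in> Ob T; zh A B\<rbrakk> \<Longrightarrow> zh B (ob S A)"
  using duality unfolding zh_def .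

lemma ex_S:
  assumes "A \<in> Ob T"
  obtains B where "B \<in> Ob T" "isomorphic T (ob S B) A"
proof -
  obtain B e where "B \<in> Ob T" "is_iso T e" "src T e = ob S B" "tgt T e = A"
    using equivalence_surj[OF S_equivalence assms] .
  then show thesis
    using that[of B] isomorphic_iff[of "ob S B" A] assms by auto
qed

lemma ex_desuspension:
  assumes "A \<in> Ob T"
  obtains B where "B \<in> Ob T" "isomorphic T (sh B) A"
proof -
  obtain B e where "B \<in> Ob T" "is_iso T e" "src T e = sh B" "tgt T e = A"
    using shm_surj[OF assms] .
  then show thesis
    using that[of B] isomorphic_iff[of "sh B" A] assms by auto
qed

lemma ex_double_desuspension:
  assumes "A \<in> Ob T"
  obtains D where "D \<in> Ob T" "isomorphic T (sh (sh D)) A"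
proof -
  obtain B where B: "B \<in> Ob T" "isomorphic T (sh B) A"
    using ex_desuspension[OF assms] .
  obtain D where D: "D \<in> Ob T" "isomorphic T (sh D) B"
    using ex_desuspension[OF B(1)] .
  have "isomorphic T (sh (sh D)) (sh B)"
    using D B sh_isomorphic_iff[of "sh D" B] by simp
  then show thesis
    using that[OF D(1)] isomorphic_trans[of "sh (sh D)" "sh B" A] B D assms by simp
qed

lemma shift_shift:
  assumes "\<U> \<subseteq> Ob T"
  shows "shift T (shift T \<U>) = {A \<in> Ob T. \<exists>B \<in> \<U>. isomorphic T A (sh (sh B))}"
proof -
  have "(\<exists>B. B \<in> Ob T \<and> (\<exists>D \<in> \<U>. isomorphic T B (sh D)) \<and> isomorphic T A (sh B)) \<longleftrightarrow>
      (\<exists>D \<in> \<U>. isomorphic T A (sh (sh D)))" if A: "A \<in> Ob T" for A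
  proof
    assume "\<exists>B. B \<in> Ob T \<and> (\<exists>D \<in> \<U>. isomorphic T B (sh D)) \<and> isomorphic T A (sh B)"
    then obtain B D where B: "B \<in> Ob T" "isomorphic T A (sh B)" and D: "D \<in> \<U>" "isomorphic T B (sh D)"
      by blast
    have Do: "D \<in> Ob T"
      using D assms by blast
    have "isomorphic T A (sh (sh D))"
      using isomorphic_trans[of A "sh B" "sh (sh D)"] sh_isomorphic_iff[of B "sh D"] A B D Do by simp
    then show "\<exists>D \<in> \<U>. isomorphic T A (sh (sh D))"
      using D by blast
  next
    assume "\<exists>D \<in> \<U>. isomorphic T A (sh (sh D))"
    then obtain D where D: "D \<in> \<U>" "isomorphic T A (sh (sh D))"
      by blast
    then have Do: "sh D \<in> Ob T"
      using assms by auto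
    show "\<exists>B. B \<in> Ob T \<and> (\<exists>D \<in> \<U>. isomorphic T B (sh D)) \<and> isomorphic T A (sh B)"
      using D Do isomorphic_refl[OF Do] by blast
  qed
  then show ?thesis
    unfolding shift_def replete_image_def by blast
qed

text \<open>The condition object by object: \<open>D\<close> stands for \<open>S B[-2]\<close>, so
  membership is invariant under the autoequivalence \<open>S[-2]\<close>. In this form it passes
  immediately to intersections.\<close>

definition stable :: "'o set \<Rightarrow> bool" where
  "stable \<U> \<longleftrightarrow> (\<forall>B \<in> Ob T. \<forall>D \<in> Ob T. isomorphic T (sh (sh D)) (ob S B) \<longrightarrow> (B \<in> \<U> \<longleftrightarrow> D \<in> \<U>))"

text \<open>\<open>S\<close> and the double suspension are essentially surjective, so equality of
  the two replete images can be tested by pairs \<open>B\<close>, \<open>D\<close>. Closure under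
  isomorphism allows the witness in \<open>\<U>\<close> to be exchanged for the given
  object.\<close>

lemma serre_stable_iff:
  assumes U: "\<U> \<subseteq> Ob T" and closed: "\<And>A B. \<lbrakk>A \<in> \<U>; B \<in> Ob T; isomorphic T A B\<rbrakk> \<Longrightarrow> B \<in> \<U>"
  shows "serre_stable T S \<U> \<longleftrightarrow> stable \<U>"
proof
  assume st: "serre_stable T S \<U>"
  have iff: "(\<exists>B \<in> \<U>. isomorphic T A (ob S B)) \<longleftrightarrow> (\<exists>D \<in> \<U>. isomorphic T A (sh (sh D)))" if "A \<in> Ob T" for A
  proof -
    have "A \<in> replete_image T S \<U> \<longleftrightarrow> A \<in> shift T (shift T \<U>)"
      using st unfolding serre_stable_def by simp
    then show ?thesis
      unfolding shift_shift[OF U] replete_image_def using that by simp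
  qed
  show "stable \<U>"
    unfolding stable_def
  proof (intro ballI impI)
    fix B D assume BD: "B \<in> Ob T" "D \<in> Ob T" and i: "isomorphic T (sh (sh D)) (ob S B)"
    have i': "isomorphic T (ob S B) (sh (sh D))"
      using isomorphic_sym[OF _ _ i] BD by simp
    show "B \<in> \<U> \<longleftrightarrow> D \<in> \<U>"
    proof
      assume "B \<in> \<U>"
      then obtain E where E: "E \<in> \<U>" "isomorphic T (ob S B) (sh (sh E))"
        using iff[of "ob S B"] isomorphic_refl[of "ob S B"] BD by auto
      have Eo: "E \<in> Ob T"
        using E U by blast
      have "isomorphic T (sh (sh D)) (sh (sh E))"
        using isomorphic_trans[of "sh (sh D)" "ob S B" "sh (sh E)"] i E Eo BD by simp
      then have "isomorphic T D E"
        using sh_isomorphic_iff[of "sh D" "sh E"] sh_isomorphic_iff[of D E] BD Eo by simp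
      then show "D \<in> \<U>"
        using closed[OF E(1) BD(2)] isomorphic_sym[OF BD(2) Eo] by blast
    next
      assume "D \<in> \<U>"
      then obtain E where E: "E \<in> \<U>" "isomorphic T (sh (sh D)) (ob S E)"
        using iff[of "sh (sh D)"] isomorphic_refl[of "sh (sh D)"] BD by auto
      have Eo: "E \<in> Ob T"
        using E U by blast
      have "isomorphic T (ob S B) (ob S E)"
        using isomorphic_trans[of "ob S B" "sh (sh D)" "ob S E"] i' E Eo BD by simp
      then have "isomorphic T B E"
        using S_isomorphic_iff[of B E] BD Eo by simp
      then show "B \<in> \<U>"
        using closed[OF E(1) BD(1)] isomorphic_sym[OF BD(1) Eo] by blast
    qed
  qed
next
  assume st: "stable \<U>"
  have "(\<exists>B \<in> \<U>. isomorphic T A (ob S B)) \<longleftrightarrow> (\<exists>D \<in> \<U>. isomorphic T A (sh (sh D)))" if A: "A \<in> Ob T" for A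
  proof
    assume "\<exists>B \<in> \<U>. isomorphic T A (ob S B)"
    then obtain B where B: "B \<in> \<U>" "isomorphic T A (ob S B)"
      by blast
    have Bo: "B \<in> Ob T"
      using B U by blast
    obtain D where D: "D \<in> Ob T" "isomorphic T (sh (sh D)) A"
      using ex_double_desuspension[OF A] .
    have "isomorphic T (sh (sh D)) (ob S B)"
      using isomorphic_trans[of "sh (sh D)" A "ob S B"] A B Bo D by simp
    then have "D \<in> \<U>"
      using st B Bo D unfolding stable_def by blast
    then show "\<exists>D \<in> \<U>. isomorphic T A (sh (sh D))"
      using isomorphic_sym[OF _ A D(2)] D(1) by auto
  next
    assume "\<exists>D \<in> \<U>. isomorphic T A (sh (sh D))"
    then obtain D where D: "D \<in> \<U>" "isomorphic T A (sh (sh D))"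
      by blast
    have Do: "D \<in> Ob T"
      using D U by blast
    obtain B where B: "B \<in> Ob T" "isomorphic T (ob S B) A"
      using ex_S[OF A] .
    have "isomorphic T (ob S B) (sh (sh D))"
      using isomorphic_trans[of "ob S B" A "sh (sh D)"] A B Do D by simp
    then have "isomorphic T (sh (sh D)) (ob S B)"
      using isomorphic_sym[of "ob S B" "sh (sh D)"] B Do by simp
    then have "B \<in> \<U>"
      using st B Do D unfolding stable_def by blast
    then show "\<exists>B \<in> \<U>. isomorphic T A (ob S B)"
      using isomorphic_sym[OF _ A B(2)] B(1) by auto
  qed
  then show "serre_stable T S \<U>"
    unfolding serre_stable_def shift_shift[OF U] replete_image_def by blast
qed

lemma stable_Int: "\<lbrakk>stable \<U>; stable \<V>\<rbrakk> \<Longrightarrow> stable (\<U> \<inter> \<V>)"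
  unfolding stable_def by simp

text \<open>If \<open>D[2]\<close> is isomorphic to \<open>S B\<close>, duality turns
  \<open>T(A, D[1]) = 0\<close> into \<open>T(D[1], S A) = 0\<close>. One more suspension makes this
  \<open>T(S B, S A[1]) = 0\<close>, that is \<open>T(B, A[1]) = 0\<close>; stability matches the
  objects \<open>B\<close> and \<open>D\<close> of \<open>\<U>\<close>.\<close>

lemma perp_symmetric:
  assumes U: "\<U> \<subseteq> Ob T" "stable \<U>" and A: "A \<in> Ob T"
  shows "(\<forall>B \<in> \<U>. zh A (sh B)) \<longleftrightarrow> (\<forall>B \<in> \<U>. zh B (sh A))"
proof
  assume z: "\<forall>B \<in> \<U>. zh A (sh B)"
  show "\<forall>B \<in> \<U>. zh B (sh A)"
  proof
    fix B assume B: "B \<in> \<U>"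
    have Bo: "B \<in> Ob T"
      using B U by blast
    obtain D where D: "D \<in> Ob T" "isomorphic T (sh (sh D)) (ob S B)"
      using ex_double_desuspension[OF S_Ob[OF Bo]] .
    have "D \<in> \<U>"
      using U(2) B Bo D unfolding stable_def by blast
    then have "zh (sh D) (ob S A)"
      using z zh_duality[of A "sh D"] A D by simp
    then have 1: "zh (sh (sh D)) (sh (ob S A))"
      using A D by simp
    have "zh (ob S B) (ob S (sh A))"
      by (rule zh_isomorphic[OF 1 D(2) isomorphic_sym[OF _ _ S_shift[OF A]]]) (use A D Bo in simp_all)
    then show "zh B (sh A)"
      using zh_S[of B "sh A"] A Bo by simp
  qed
next
  assume z: "\<forall>B \<in> \<U>. zh B (sh A)"
  show "\<forall>B \<in> \<U>. zh A (sh B)"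
  proof
    fix D assume D: "D \<in> \<U>"
    have Do: "D \<in> Ob T"
      using D U by blast
    obtain B where B: "B \<in> Ob T" "isomorphic T (ob S B) (sh (sh D))"
      using ex_S[of "sh (sh D)"] Do by auto
    have "B \<in> \<U>"
      using U(2) B Do D isomorphic_sym[OF _ _ B(2)] unfolding stable_def by simp
    then have 1: "zh (sh A) (ob S B)"
      using z zh_duality[of B "sh A"] A B by simp
    have "zh (sh A) (sh (sh D))"
      by (rule zh_isomorphic[OF 1 isomorphic_refl B(2)]) (use A B Do in simp_all)
    then show "zh A (sh D)"
      using A Do by simp
  qed
qed

text \<open>Vanishing of \<open>T(D, E[1])\<close> is vanishing of \<open>T(D[2], E[3])\<close>, and
  under the two isomorphisms this becomes \<open>T(S B, S (Y[1]))\<close>. So replacing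
  \<open>D\<close> by \<open>B\<close> permutes the test objects within \<open>\<X>\<close>.\<close>

lemma perp_stable:
  assumes X: "\<X> \<subseteq> Ob T" "stable \<X>"
  shows "stable (perp \<X>)"
  unfolding stable_def
proof (intro ballI impI)
  fix B D assume BD: "B \<in> Ob T" "D \<in> Ob T" and i: "isomorphic T (sh (sh D)) (ob S B)"
  have iY: "isomorphic T (sh (sh (sh E))) (ob S (sh Y))"
    if "Y \<in> Ob T" "E \<in> Ob T" "isomorphic T (sh (sh E)) (ob S Y)" for Y E
    by (rule isomorphic_trans[of _ "sh (ob S Y)"])
      (use that isomorphic_sym[OF _ _ S_shift] sh_isomorphic_iff[of "sh (sh E)" "ob S Y"] in simp_all)
  have iff: "zh D (sh E) \<longleftrightarrow> zh B (sh Y)"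
    if Y: "Y \<in> Ob T" "E \<in> Ob T" "isomorphic T (sh (sh E)) (ob S Y)" for Y E
  proof -
    have "zh D (sh E) \<longleftrightarrow> zh (sh (sh D)) (sh (sh (sh E)))"
      using BD Y by simp
    also have "\<dots> \<longleftrightarrow> zh (ob S B) (ob S (sh Y))"
    proof
      show "zh (ob S B) (ob S (sh Y))" if "zh (sh (sh D)) (sh (sh (sh E)))"
        by (rule zh_isomorphic[OF that i iY[OF Y]]) (use BD Y in simp_all)
      show "zh (sh (sh D)) (sh (sh (sh E)))" if "zh (ob S B) (ob S (sh Y))"
        by (rule zh_isomorphic[OF that isomorphic_sym[OF _ _ i] isomorphic_sym[OF _ _ iY[OF Y]]])
          (use BD Y in simp_all)
    qed
    also have "\<dots> \<longleftrightarrow> zh B (sh Y)"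
      using zh_S[of B "sh Y"] BD Y by simp
    finally show ?thesis .
  qed
  show "B \<in> perp \<X> \<longleftrightarrow> D \<in> perp \<X>"
  proof
    assume B: "B \<in> perp \<X>"
    have "zh D (sh E)" if E: "E \<in> \<X>" for E
    proof -
      have Eo: "E \<in> Ob T"
        using E X by blast
      obtain Y where Y: "Y \<in> Ob T" "isomorphic T (ob S Y) (sh (sh E))"
        using ex_S[of "sh (sh E)"] Eo by auto
      have i': "isomorphic T (sh (sh E)) (ob S Y)"
        using isomorphic_sym[OF _ _ Y(2)] Y Eo by simp
      then have "Y \<in> \<X>"
        using X(2) E Eo Y unfolding stable_def by blast
      then show ?thesis
        using iff[OF Y(1) Eo i'] B by (simp add: perp_def)
    qed
    then show "D \<in> perp \<X>"
      using BD by (simp add: perp_def)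
  next
    assume D: "D \<in> perp \<X>"
    have "zh B (sh Y)" if Y: "Y \<in> \<X>" for Y
    proof -
      have Yo: "Y \<in> Ob T"
        using Y X by blast
      obtain E where E: "E \<in> Ob T" "isomorphic T (sh (sh E)) (ob S Y)"
        using ex_double_desuspension[OF S_Ob[OF Yo]] .
      then have "E \<in> \<X>"
        using X(2) Y Yo unfolding stable_def by blast
      then show ?thesis
        using iff[OF Yo E] D by (simp add: perp_def)
    qed
    then show "B \<in> perp \<X>"
      using BD by (simp add: perp_def)
  qed
qed

subsection \<open>From rigid to extension closed subcategories\<close>

context
  fixes \<X>
  assumes X: "subcategory T \<X>" "stable \<X>" and rigid: "\<And>A B. \<lbrakk>A \<in> \<X>; B \<in> \<X>\<rbrakk> \<Longrightarrow> zh A (sh B)"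
begin

lemma XO: "\<X> \<subseteq> Ob T"
  using subcategoryD(1)[OF X(1)] .

lemma perp_iff: "A \<in> perp \<X> \<longleftrightarrow> A \<in> Ob T \<and> (\<forall>B \<in> \<X>. zh B (sh A))"
  using perp_symmetric[OF XO X(2)] unfolding perp_def by blast

lemma subset_perp: "\<X> \<subseteq> perp \<X>"
  using rigid XO unfolding perp_def by blast

text \<open>By rigidity a map from \<open>\<X>\<close> to \<open>V[1]\<close> dies in
  \<open>Y[1]\<close> and so comes from a map to \<open>A\<close>. That map factors through the
  approximation, which the connecting map kills. No minimal approximation enters here.\<close>

lemma syzygy_in_perp:
  assumes t: "(V, Y, A, i, p, r) \<in> Tri T" and p: "right_approx T \<X> A Y p"
  shows "V \<in> perp \<X>"
  unfolding perp_iff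
proof (intro conjI ballI)
  note d = TriD[OF t]
  show "V \<in> Ob T"
    by (rule d)
  fix B assume B: "B \<in> \<X>"
  have Bo: "B \<in> Ob T"
    using B XO by blast
  show "zh B (sh V)"
  proof (rule zhI)
    fix g assume g: "ar T g" "src T g = B" "tgt T g = sh V"
    have Y: "Y \<in> \<X>"
      using right_approxD[OF p XO d(3)] by simp
    have "shm i \<bullet> g = Zero T (src T g) (sh Y)"
      using zhD[OF rigid[OF B Y], of "shm i \<bullet> g"] g d by simp
    then obtain y where y: "ar T y" "src T y = src T g" "tgt T y = A" "g = r \<bullet> y"
      using exact4[OF t g(1,3)] by blast
    have "src T y \<in> \<X>"
      using y(2) g(2) B by simp
    then obtain k where k: "ar T k" "src T k = src T y" "tgt T k = Y" "y = p \<bullet> k"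
      using right_approx_factor[OF p XO d(3) y(1,3)] by blast
    have "g = r \<bullet> (p \<bullet> k)"
      using y(4) k(4) by simp
    also have "\<dots> = Zero T (src T k) (sh V)"
      using Comp_reduce[OF Tri_comp_zero2[OF t], of k] k(1,3) d by simp
    finally show "g = Zero T B (sh V)"
      using k(2) y(2) g(2) by simp
  qed (use Bo d in simp_all)
qed

lemma cosyzygy_in_perp:
  assumes t: "(A, Y, V, i, p, r) \<in> Tri T" and i: "left_approx T \<X> A Y i"
  shows "V \<in> perp \<X>"
  unfolding perp_def
proof (intro CollectI conjI ballI)
  note d = TriD[OF t]
  show "V \<in> Ob T"
    by (rule d)
  fix B assume B: "B \<in> \<X>"
  have Bo: "B \<in> Ob T"
    using B XO by blast
  show "zh V (sh B)"
  proof (rule zhI)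
    fix g assume g: "ar T g" "src T g = V" "tgt T g = sh B"
    have Y: "Y \<in> \<X>"
      using left_approxD[OF i XO d(1)] by simp
    have "g \<bullet> p = Zero T Y (tgt T g)"
      using zhD[OF rigid[OF Y B], of "g \<bullet> p"] g d by simp
    then obtain y where y: "ar T y" "src T y = sh A" "tgt T y = tgt T g" "g = y \<bullet> r"
      using coexact3[OF t g(1,2)] by blast
    have y3: "tgt T y = sh B"
      using y(3) g(3) by simp
    obtain y' where y': "ar T y'" "src T y' = A" "tgt T y' = B" "shm y' = y"
      using shm_full[OF d(1) Bo y(1,2) y3] .
    have "tgt T y' \<in> \<X>"
      using y'(3) B by simp
    then obtain u where u: "ar T u" "src T u = Y" "tgt T u = tgt T y'" "y' = u \<bullet> i"
      using left_approx_factor[OF i XO d(1) y'(1,2)] by blast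
    have "g = shm u \<bullet> (shm i \<bullet> r)"
      using y(4) u(1,2) d unfolding y'(4)[symmetric] u(4) by simp
    also have "\<dots> = Zero T V (sh B)"
      using Tri_comp_zero3[OF t] u(1-3) y'(3) d by simp
    finally show "g = Zero T V (sh B)" .
  qed (use Bo d in simp_all)
qed

lemma perp_frobenius:
  assumes ff: "functorially_finite_in T (Ob T) \<X>"
  shows "frobenius_subcat T \<X> (perp \<X>)"
  unfolding frobenius_subcat_def
proof (intro conjI)
  show "subcategory T (perp \<X>)" "extension_closed T (perp \<X>)" "subcategory T \<X>" "\<X> \<subseteq> perp \<X>"
    using perp_subcategory[OF XO] perp_extension_closed[OF XO] X(1) subset_perp by simp_all
  show "functorially_finite_in T (perp \<X>) \<X>"
    using ff unfolding functorially_finite_in_def perp_def by blast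
  \<comment> \<open>For this \<open>\<U>\<close> all maps from \<open>\<U>\<close> to
    \<open>\<X>[1]\<close> vanish, not just the ghosts.\<close>
  show "\<forall>A \<in> perp \<X>. \<forall>B \<in> shift T \<X>. Gh T \<X> A B = {Zero T A B}"
  proof (intro ballI)
    fix A B assume A: "A \<in> perp \<X>" and "B \<in> shift T \<X>"
    then obtain Y where Y: "Y \<in> \<X>" "B \<in> Ob T" "isomorphic T B (sh Y)"
      unfolding shift_def replete_image_def by blast
    have Ob: "A \<in> Ob T" "sh Y \<in> Ob T"
      using A Y XO by (auto simp: perp_def)
    have "zh A B"
      by (rule zh_isomorphic[of A "sh Y"])
        (use A Y Ob isomorphic_refl isomorphic_sym[OF Y(2) Ob(2) Y(3)] in \<open>auto simp: perp_def\<close>)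
    moreover have "Zero T A B \<bullet> g = Zero T D B" if "D \<in> \<X>" "g \<in> Hom T D A" for D g
    proof -
      have "ar T g \<and> src T g = D \<and> tgt T g = A"
        by (rule Hom_arrow[OF that(2)]) (use that(1) XO Ob in auto)
      then show ?thesis
        using Zero_Comp[of g B A] Y(2) by simp
    qed
    ultimately show "Gh T \<X> A B = {Zero T A B}"
      unfolding Gh_def zh_def by auto
  qed
  \<comment> \<open>This half lies on the other side of the orthogonality and rests on
    \<open>perp_iff\<close>, hence on Serre stability.\<close>
  show "\<forall>A \<in> unshift T \<X>. \<forall>B \<in> perp \<X>. CoGh T \<X> A B = {Zero T A B}"
  proof (intro ballI)
    fix A B assume "A \<in> unshift T \<X>" and B: "B \<in> perp \<X>"
    then obtain Y where Y: "Y \<in> \<X>" "A \<in> Ob T" "isomorphic T (sh A) Y"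
      unfolding unshift_def by blast
    have Ob: "B \<in> Ob T" "Y \<in> Ob T"
      using B Y XO by (auto simp: perp_def)
    have "zh Y (sh B)"
      using B Y(1) perp_iff by blast
    then have "zh (sh A) (sh B)"
      by (rule zh_isomorphic[OF _ isomorphic_sym[OF _ _ Y(3)] isomorphic_refl]) (use Ob Y in simp_all)
    then have "zh A B"
      using Ob Y by simp
    moreover have "g \<bullet> Zero T A B = Zero T A D" if "D \<in> \<X>" "g \<in> Hom T B D" for D g
    proof -
      have "ar T g \<and> src T g = B \<and> tgt T g = D"
        by (rule Hom_arrow[OF that(2)]) (use that(1) XO Ob in auto)
      then show ?thesis
        using Comp_Zero[of g A B] Y(2) by simp
    qed
    ultimately show "CoGh T \<X> A B = {Zero T A B}"
      unfolding CoGh_def zh_def by auto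
  qed
  show "\<forall>A \<in> perp \<X>. \<forall>Y V i p r. omega_triangle T \<X> A Y V i p r \<longrightarrow> V \<in> perp \<X>"
    unfolding omega_triangle_def using syzygy_in_perp by blast
  show "\<forall>A \<in> perp \<X>. \<forall>Y V i p r. sigma_triangle T \<X> A Y V i p r \<longrightarrow> V \<in> perp \<X>"
    unfolding sigma_triangle_def using cosyzygy_in_perp by blast
qed

text \<open>A left \<open>\<X>\<close>-approximation of \<open>A'\<close>, a desuspension of
  \<open>A\<close>, suspends to \<open>h : A \<rightarrow> Y[1]\<close>. Its fibre \<open>V\<close>
  has no extensions by \<open>\<X>\<close>, by rigidity and the approximation property. Maps from
  \<open>perp \<X>\<close> to \<open>A\<close> die in \<open>Y[1]\<close> and therefore lift to
  \<open>V\<close>.\<close>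

lemma perp_right_approx:
  assumes ff: "functorially_finite_in T (Ob T) \<X>" and A: "A \<in> Ob T"
  shows "\<exists>V f. right_approx T (perp \<X>) A V f"
proof -
  obtain A' e where e: "A' \<in> Ob T" "is_iso T e" "src T e = sh A'" "tgt T e = A"
    using shm_surj[OF A] .
  obtain Y f where f: "left_approx T \<X> A' Y f"
    using ff e(1) unfolding functorially_finite_in_def by blast
  note f' = left_approxD[OF f XO e(1)]
  define h where "h = shm f \<bullet> inv_of T e"
  have h: "ar T h" "src T h = A" "tgt T h = sh Y"
    using f' e by (simp_all add: h_def)
  obtain V a b where t: "(Y, V, A, a, b, h) \<in> Tri T"
    using Tri_complete3[OF h f'(2)] .
  note d = TriD[OF t]
  have factor: "\<exists>k. ar T k \<and> src T k = Y \<and> tgt T k = B \<and> g = shm k \<bullet> h"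
    if B: "B \<in> \<X>" and g: "ar T g" "src T g = A" "tgt T g = sh B" for B g
  proof -
    have Bo: "B \<in> Ob T"
      using B XO by blast
    have ge: "ar T (g \<bullet> e)" "src T (g \<bullet> e) = sh A'" "tgt T (g \<bullet> e) = sh B"
      using g e by simp_all
    obtain g' where g': "ar T g'" "src T g' = A'" "tgt T g' = B" "shm g' = g \<bullet> e"
      using shm_full[OF e(1) Bo ge] .
    have "tgt T g' \<in> \<X>"
      using g'(3) B by simp
    then obtain k where k: "ar T k" "src T k = Y" "tgt T k = tgt T g'" "g' = k \<bullet> f"
      using left_approx_factor[OF f XO e(1) g'(1,2)] by blast
    have "shm (k \<bullet> f) = g \<bullet> e"
      using g'(4) k(4) by simp
    then have kf: "shm k \<bullet> shm f = g \<bullet> e"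
      using k(1,2) f' by simp
    have "shm k \<bullet> h = g"
      using Comp_reduce[OF kf, of "inv_of T e"] k(1,2) f' e g by (simp add: h_def)
    then show ?thesis
      using k(1-3) g'(3) by auto
  qed
  have "V \<in> perp \<X>"
    unfolding perp_def
  proof (intro CollectI conjI ballI)
    show "V \<in> Ob T"
      by (rule d)
    fix B assume B: "B \<in> \<X>"
    have Bo: "B \<in> Ob T"
      using B XO by blast
    show "zh V (sh B)"
    proof (rule zhI)
      fix g assume g: "ar T g" "src T g = V" "tgt T g = sh B"
      have "g \<bullet> a = Zero T Y (tgt T g)"
        using zhD[OF rigid[OF f'(1) B], of "g \<bullet> a"] g d by simp
      then obtain y where y: "ar T y" "src T y = A" "tgt T y = tgt T g" "g = y \<bullet> b"
        using coexact2[OF t g(1,2)] by blast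
      obtain k where k: "ar T k" "src T k = Y" "tgt T k = B" "y = shm k \<bullet> h"
        using factor[OF B y(1,2)] y(3) g(3) by auto
      have "g = shm k \<bullet> (h \<bullet> b)"
        unfolding y(4) k(4) using k(1,2) d by simp
      then show "g = Zero T V (sh B)"
        using Tri_comp_zero2[OF t] k(1-3) d by simp
    qed (use Bo d in simp_all)
  qed
  moreover have "\<exists>k. ar T k \<and> src T k = src T g \<and> tgt T k = V \<and> g = b \<bullet> k"
    if g: "ar T g" "tgt T g = A" "src T g \<in> perp \<X>" for g
  proof -
    have "zh (src T g) (sh Y)"
      using g(3) f'(1) by (simp add: perp_def)
    then have "h \<bullet> g = Zero T (src T g) (sh Y)"
      by (rule zhD) (use g d in simp_all)
    then show ?thesis
      using exact3[OF t g(1,2)] by metis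
  qed
  ultimately have "right_approx T (perp \<X>) A V b"
    using d subcategoryD(1)[OF perp_subcategory[OF XO]] by (intro right_approxI) blast+
  then show ?thesis
    by blast
qed

text \<open>Dually, a right \<open>\<X>\<close>-approximation \<open>Y \<rightarrow> A[1]\<close> is
  read as an extension class, and \<open>A\<close> maps to the middle term. Here both orthogonality
  arguments use the right-hand description of \<open>perp \<X>\<close>.\<close>

lemma perp_left_approx:
  assumes ff: "functorially_finite_in T (Ob T) \<X>" and A: "A \<in> Ob T"
  shows "\<exists>V f. left_approx T (perp \<X>) A V f"
proof -
  have shA: "sh A \<in> Ob T"
    using A by simp
  obtain Y f where f: "right_approx T \<X> (sh A) Y f"
    using ff shA unfolding functorially_finite_in_def by blast
  note f' = right_approxD[OF f XO shA]
  obtain V a b where t: "(A, V, Y, a, b, f) \<in> Tri T"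
    using Tri_complete3[OF f'(3-5) A] .
  note d = TriD[OF t]
  have ts: "(sh A, sh V, sh Y, shm a, shm b, neg T (shm f)) \<in> Tri T"
    using Tri_shift[OF d(4-12)] t by simp
  have V: "V \<in> perp \<X>"
    unfolding perp_iff
  proof (intro conjI ballI)
    show "V \<in> Ob T"
      by (rule d)
    fix B assume B: "B \<in> \<X>"
    have Bo: "B \<in> Ob T"
      using B XO by blast
    show "zh B (sh V)"
    proof (rule zhI)
      fix g assume g: "ar T g" "src T g = B" "tgt T g = sh V"
      have "shm b \<bullet> g = Zero T (src T g) (sh Y)"
        using zhD[OF rigid[OF B f'(1)], of "shm b \<bullet> g"] g d by simp
      then obtain y where y: "ar T y" "src T y = src T g" "tgt T y = sh A" "g = shm a \<bullet> y"
        using exact2[OF ts g(1,3)] by blast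
      have "src T y \<in> \<X>"
        using y(2) g(2) B by simp
      then obtain k where k: "ar T k" "src T k = src T y" "tgt T k = Y" "y = f \<bullet> k"
        using right_approx_factor[OF f XO shA y(1,3)] by blast
      have "g = shm a \<bullet> (f \<bullet> k)"
        using y(4) k(4) by simp
      also have "\<dots> = Zero T (src T k) (sh V)"
        using Comp_reduce[OF Tri_comp_zero3[OF t], of k] k(1,3) d by simp
      finally show "g = Zero T B (sh V)"
        using k(2) y(2) g(2) by simp
    qed (use Bo d in simp_all)
  qed
  have "\<exists>k. ar T k \<and> src T k = V \<and> tgt T k = tgt T g \<and> g = k \<bullet> a"
    if g: "ar T g" "src T g = A" "tgt T g \<in> perp \<X>" for g
  proof -
    have "zh Y (sh (tgt T g))"
      using g(3) f'(1) perp_iff by blast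
    then have "shm g \<bullet> f = Zero T Y (sh (tgt T g))"
      by (rule zhD) (use g d in simp_all)
    then show ?thesis
      using coexact1[OF t g(1,2)] by metis
  qed
  then have "left_approx T (perp \<X>) A V a"
    using V d subcategoryD(1)[OF perp_subcategory[OF XO]] by (intro left_approxI) blast+
  then show ?thesis
    by blast
qed

lemma perp_functorially_finite:
  "functorially_finite_in T (Ob T) \<X> \<Longrightarrow> functorially_finite_in T (Ob T) (perp \<X>)"
  unfolding functorially_finite_in_def[of T "Ob T" "perp \<X>"]
  using perp_left_approx perp_right_approx by blast

text \<open>The syzygy of an object \<open>A\<close> of \<open>perp \<X>\<close> lies in
  \<open>perp \<X>\<close> as well. If \<open>A\<close> also has no extensions by
  \<open>perp \<X>\<close>, its approximation triangle splits and \<open>A\<close> is a summand of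
  an object of \<open>\<X>\<close>.\<close>

lemma perp_Int_perp_perp:
  assumes ff: "functorially_finite_in T (Ob T) \<X>"
  shows "perp \<X> \<inter> perp (perp \<X>) = \<X>"
proof
  show "\<X> \<subseteq> perp \<X> \<inter> perp (perp \<X>)"
  proof
    fix A assume A: "A \<in> \<X>"
    have "zh A (sh B)" if "B \<in> perp \<X>" for B
      using that A perp_iff by blast
    then show "A \<in> perp \<X> \<inter> perp (perp \<X>)"
      using A XO subset_perp by (auto simp: perp_def)
  qed
  show "perp \<X> \<inter> perp (perp \<X>) \<subseteq> \<X>"
  proof
    fix A assume A: "A \<in> perp \<X> \<inter> perp (perp \<X>)"
    have Ao: "A \<in> Ob T"
      using A by (simp add: perp_def)
    obtain Y p where p: "right_approx T \<X> A Y p"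
      using ff Ao unfolding functorially_finite_in_def by blast
    note p' = right_approxD[OF p XO Ao]
    obtain V j r where t: "(V, Y, A, j, p, r) \<in> Tri T"
      using Tri_complete2[OF p'(3-5)] .
    note d = TriD[OF t]
    have "zh A (sh V)"
      using A syzygy_in_perp[OF t p] by (simp add: perp_def)
    then have "r = Zero T A (sh V)"
      by (rule zhD) (use d in simp_all)
    then have "is_biproduct T V A Y"
      using split_biproduct t by blast
    then show "A \<in> \<X>"
      using subcategoryD(4)[OF X(1) p'(1) d(1) Ao] by blast
  qed
qed

end

subsection \<open>From extension closed to rigid subcategories\<close>

text \<open>A minimal version of the map ends at a direct summand of \<open>V\<close>, which remains
  in \<open>\<U>\<close>, and factoring through \<open>f\<close> is the same as factoring through
  \<open>r \<bullet> f\<close>.\<close>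

lemma minimal_left_approx:
  assumes U: "subcategory T \<U>" and A: "A \<in> Ob T" and f: "left_approx T \<U> A V f"
  obtains V' f' where "left_approx T \<U> A V' f'"
    "\<And>h. \<lbrakk>ar T h; src T h = V'; tgt T h = V'; h \<bullet> f' = f'\<rbrakk> \<Longrightarrow> is_iso T h"
proof -
  note UO = subcategoryD(1)[OF U]
  note f' = left_approxD[OF f UO A]
  obtain V' V'' r s where r: "V' \<in> Ob T" "V'' \<in> Ob T" "is_biproduct T V' V'' (tgt T f)"
    "ar T r" "src T r = tgt T f" "tgt T r = V'" "ar T s" "src T s = V'" "tgt T s = tgt T f" "s \<bullet> (r \<bullet> f) = f"
    and min: "\<forall>h. ar T h \<and> src T h = V' \<and> tgt T h = V' \<and> h \<bullet> (r \<bullet> f) = r \<bullet> f \<longrightarrow> is_iso T h"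
    using left_minimal[OF f'(3)] by blast
  have V': "V' \<in> \<U>"
    using subcategoryD(4)[OF U _ r(1,2,3)] f'(1,5) by simp
  have "\<exists>k. ar T k \<and> src T k = V' \<and> tgt T k = tgt T g \<and> g = k \<bullet> (r \<bullet> f)"
    if g: "ar T g" "src T g = A" "tgt T g \<in> \<U>" for g
  proof -
    obtain k where k: "ar T k" "src T k = V" "tgt T k = tgt T g" "g = k \<bullet> f"
      using left_approx_factor[OF f UO A g] .
    have "(k \<bullet> s) \<bullet> (r \<bullet> f) = k \<bullet> (s \<bullet> (r \<bullet> f))"
      using k(1,2) r(4-9) f' by simp
    then have "g = (k \<bullet> s) \<bullet> (r \<bullet> f)"
      unfolding r(10) k(4)[symmetric] ..
    then show ?thesis
      using k(1-3) r(7-9) f' by (intro exI[of _ "k \<bullet> s"]) simp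
  qed
  then have "left_approx T \<U> A V' (r \<bullet> f)"
    using V' UO r(4-6) f' by (intro left_approxI) simp_all
  then show thesis
    using that min by blast
qed

lemma minimal_right_approx:
  assumes U: "subcategory T \<U>" and A: "A \<in> Ob T" and f: "right_approx T \<U> A V f"
  obtains V' f' where "right_approx T \<U> A V' f'"
    "\<And>h. \<lbrakk>ar T h; src T h = V'; tgt T h = V'; f' \<bullet> h = f'\<rbrakk> \<Longrightarrow> is_iso T h"
proof -
  note UO = subcategoryD(1)[OF U]
  note f' = right_approxD[OF f UO A]
  obtain V' V'' r s where r: "V' \<in> Ob T" "V'' \<in> Ob T" "is_biproduct T V' V'' (src T f)"
    "ar T r" "src T r = src T f" "tgt T r = V'" "ar T s" "src T s = V'" "tgt T s = src T f" "(f \<bullet> s) \<bullet> r = f"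
    and min: "\<forall>h. ar T h \<and> src T h = V' \<and> tgt T h = V' \<and> (f \<bullet> s) \<bullet> h = f \<bullet> s \<longrightarrow> is_iso T h"
    using right_minimal[OF f'(3)] by blast
  have V': "V' \<in> \<U>"
    using subcategoryD(4)[OF U _ r(1,2,3)] f'(1,4) by simp
  have "\<exists>k. ar T k \<and> src T k = src T g \<and> tgt T k = V' \<and> g = (f \<bullet> s) \<bullet> k"
    if g: "ar T g" "tgt T g = A" "src T g \<in> \<U>" for g
  proof -
    obtain k where k: "ar T k" "src T k = src T g" "tgt T k = V" "g = f \<bullet> k"
      using right_approx_factor[OF f UO A g] .
    have "(f \<bullet> s) \<bullet> (r \<bullet> k) = ((f \<bullet> s) \<bullet> r) \<bullet> k"
      using k(1,3) r(4-9) f' by simp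
    then have "g = (f \<bullet> s) \<bullet> (r \<bullet> k)"
      unfolding r(10) k(4)[symmetric] ..
    then show ?thesis
      using k(1-3) r(4-6) f' by (intro exI[of _ "r \<bullet> k"]) simp
  qed
  then have "right_approx T \<U> A V' (f \<bullet> s)"
    using V' UO r(7-9) f' by (intro right_approxI) simp_all
  then show thesis
    using that min by blast
qed

text \<open>Take a right \<open>\<U>\<close>-approximation \<open>U0 \<rightarrow> A\<close> and a
  minimal left \<open>\<U>\<close>-approximation \<open>B \<rightarrow> V\<close> with
  \<open>B[1]\<close> isomorphic to \<open>U0\<close>. The cone \<open>D\<close> is in
  \<open>\<U>\<close> as an extension of \<open>U0\<close> by \<open>V\<close>, and in
  \<open>perp \<U>\<close> by Wakamatsu's lemma. A map from the heart to \<open>U0\<close> dies in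
  \<open>V[1]\<close>, hence lifts to \<open>D\<close>. Left approximations arise dually.\<close>

lemma heart_functorially_finite:
  assumes U: "subcategory T \<U>" "extension_closed T \<U>" "stable \<U>"
    and ff: "functorially_finite_in T (Ob T) \<U>"
  shows "functorially_finite_in T (Ob T) (\<U> \<inter> perp \<U>)"
  unfolding functorially_finite_in_def
proof (intro ballI conjI)
  note UO = subcategoryD(1)[OF U(1)]
  have HO: "\<U> \<inter> perp \<U> \<subseteq> Ob T"
    using UO by blast
  fix A assume A: "A \<in> Ob T"
  show "\<exists>Y f. right_approx T (\<U> \<inter> perp \<U>) A Y f"
  proof -
    obtain U0 a where a: "right_approx T \<U> A U0 a"
      using ff A unfolding functorially_finite_in_def by blast
    note a' = right_approxD[OF a UO A]
    obtain B e where e: "B \<in> Ob T" "is_iso T e" "src T e = sh B" "tgt T e = U0"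
      using shm_surj[OF a'(2)] .
    obtain V0 g0 where g0: "left_approx T \<U> B V0 g0"
      using ff e(1) unfolding functorially_finite_in_def by blast
    obtain V g where g: "left_approx T \<U> B V g"
      and min: "\<And>h. \<lbrakk>ar T h; src T h = V; tgt T h = V; h \<bullet> g = g\<rbrakk> \<Longrightarrow> is_iso T h"
      using minimal_left_approx[OF U(1) e(1) g0] by blast
    note g' = left_approxD[OF g UO e(1)]
    obtain D k l where t: "(B, V, D, g, k, l) \<in> Tri T"
      using Tri_complete1[OF g'(3-5)] .
    note d = TriD[OF t]
    have "isomorphic T U0 (sh B)"
      using isomorphic_sym[of "sh B" U0] isomorphic_iff[of "sh B" U0] e a'(2) by auto
    then have shB: "sh B \<in> \<U>"
      using subcategoryD(3)[OF U(1) a'(1)] e(1) by simp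
    have t': "(V, D, sh B, k, l, neg T (shm g)) \<in> Tri T"
      by (rule Tri_rot[OF t])
    have "D \<in> \<U>"
      using U(2) t' g'(1) shB unfolding extension_closed_def by blast
    moreover have "\<forall>Y \<in> \<U>. zh D (sh Y)"
      using wakamatsu_left[OF UO U(2) g min t] by blast
    then have "D \<in> perp \<U>"
      using d(3) by (simp add: perp_def)
    ultimately have D: "D \<in> \<U> \<inter> perp \<U>"
      by simp
    have c: "ar T (a \<bullet> (e \<bullet> l))" "src T (a \<bullet> (e \<bullet> l)) = D" "tgt T (a \<bullet> (e \<bullet> l)) = A"
      using d a' e by simp_all
    have "\<exists>z. ar T z \<and> src T z = src T y \<and> tgt T z = D \<and> y = (a \<bullet> (e \<bullet> l)) \<bullet> z"
      if y: "ar T y" "tgt T y = A" "src T y \<in> \<U> \<inter> perp \<U>" for y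
    proof -
      obtain y' where y': "ar T y'" "src T y' = src T y" "tgt T y' = U0" "y = a \<bullet> y'"
        using right_approx_factor[OF a UO A y(1,2)] y(3) by blast
      have x: "ar T (inv_of T e \<bullet> y')" "src T (inv_of T e \<bullet> y') = src T y" "tgt T (inv_of T e \<bullet> y') = sh B"
        using y'(1-3) e by simp_all
      have "zh (src T y) (sh V)"
        using y(3) g'(1) by (simp add: perp_def)
      then have "neg T (shm g) \<bullet> (inv_of T e \<bullet> y') = Zero T (src T y) (sh V)"
        by (rule zhD) (use x d in simp_all)
      then have "neg T (shm g) \<bullet> (inv_of T e \<bullet> y') = Zero T (src T (inv_of T e \<bullet> y')) (sh V)"
        using x(2) by simp
      then obtain z where z: "ar T z" "src T z = src T (inv_of T e \<bullet> y')" "tgt T z = D" "inv_of T e \<bullet> y' = l \<bullet> z"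
        using exact3[OF t' x(1,3)] by blast
      have "(a \<bullet> (e \<bullet> l)) \<bullet> z = a \<bullet> (e \<bullet> (l \<bullet> z))"
        using z(1,3) d a' e by simp
      also have "\<dots> = y"
        unfolding z(4)[symmetric] y'(4) using y'(1-3) e by simp
      finally show ?thesis
        using z(1-3) x(2) by auto
    qed
    then have "right_approx T (\<U> \<inter> perp \<U>) A D (a \<bullet> (e \<bullet> l))"
      by (intro right_approxI[OF D c HO]) blast+
    then show ?thesis
      by blast
  qed
  show "\<exists>Y f. left_approx T (\<U> \<inter> perp \<U>) A Y f"
  proof -
    obtain U0 a where a: "left_approx T \<U> A U0 a"
      using ff A unfolding functorially_finite_in_def by blast
    note a' = left_approxD[OF a UO A]
    have shU: "sh U0 \<in> Ob T"
      using a'(2) by simp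
    obtain V0 g0 where g0: "right_approx T \<U> (sh U0) V0 g0"
      using ff shU unfolding functorially_finite_in_def by blast
    obtain V g where g: "right_approx T \<U> (sh U0) V g"
      and min: "\<And>h. \<lbrakk>ar T h; src T h = V; tgt T h = V; g \<bullet> h = g\<rbrakk> \<Longrightarrow> is_iso T h"
      using minimal_right_approx[OF U(1) shU g0] by blast
    note g' = right_approxD[OF g UO shU]
    obtain D k l where t: "(D, V, sh U0, k, g, l) \<in> Tri T"
      using Tri_complete2[OF g'(3-5)] .
    note d = TriD[OF t]
    have nl: "ar T (neg T l)" "src T (neg T l) = sh U0" "tgt T (neg T l) = sh D"
      using d by simp_all
    obtain m where m: "ar T m" "src T m = U0" "tgt T m = D" "shm m = neg T l"
      using shm_full[OF a'(2) d(1) nl] .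
    \<comment> \<open>Desuspending the connecting map, with its sign, shows that the fibre
      \<open>D\<close> of \<open>g\<close> is an extension of \<open>V\<close> by
      \<open>U0\<close>.\<close>
    have t': "(U0, D, V, m, k, g) \<in> Tri T"
      by (rule Tri_unrot) (use t m d in simp_all)
    have "D \<in> \<U>"
      using U(2) t' g'(1) a'(1) unfolding extension_closed_def by blast
    moreover have "\<forall>Y \<in> \<U>. zh Y (sh D)"
      using wakamatsu_right[OF UO U(2) g min t] by blast
    then have "D \<in> perp \<U>"
      using perp_symmetric[OF UO U(3) d(1)] d(1) by (simp add: perp_def)
    ultimately have D: "D \<in> \<U> \<inter> perp \<U>"
      by simp
    have c: "ar T (m \<bullet> a)" "src T (m \<bullet> a) = A" "tgt T (m \<bullet> a) = D"
      using m(1-3) a' by simp_all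
    have "\<exists>z. ar T z \<and> src T z = D \<and> tgt T z = tgt T y \<and> y = z \<bullet> (m \<bullet> a)"
      if y: "ar T y" "src T y = A" "tgt T y \<in> \<U> \<inter> perp \<U>" for y
    proof -
      obtain y' where y': "ar T y'" "src T y' = U0" "tgt T y' = tgt T y" "y = y' \<bullet> a"
        using left_approx_factor[OF a UO A y(1,2)] y(3) by blast
      have "\<forall>Y \<in> \<U>. zh Y (sh (tgt T y))"
        using perp_symmetric[OF UO U(3), of "tgt T y"] y(3) by (simp add: perp_def)
      then have "zh V (sh (tgt T y))"
        using g'(1) by blast
      then have "shm y' \<bullet> g = Zero T V (sh (tgt T y))"
        by (rule zhD) (use y'(1-3) d in simp_all)
      then have "shm y' \<bullet> g = Zero T V (sh (tgt T y'))"
        using y'(3) by simp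
      then obtain z where z: "ar T z" "src T z = D" "tgt T z = tgt T y'" "y' = z \<bullet> m"
        using coexact1[OF t' y'(1,2)] by blast
      have "z \<bullet> (m \<bullet> a) = (z \<bullet> m) \<bullet> a"
        using z(1,2) m(1-3) a' by simp
      also have "\<dots> = y"
        unfolding z(4)[symmetric] y'(4) ..
      finally show ?thesis
        using z(1-3) y'(3) by auto
    qed
    then have "left_approx T (\<U> \<inter> perp \<U>) A D (m \<bullet> a)"
      by (intro left_approxI[OF D c HO]) blast+
    then show ?thesis
      by blast
  qed
qed

subsection \<open>The bijection\<close>

lemma rigid_subcatsD:
  assumes "\<X> \<in> rigid_subcats T S"
  shows "subcategory T \<X>" "functorially_finite_in T (Ob T) \<X>" "stable \<X>" "\<X> \<subseteq> Ob T"
    "\<And>A B. \<lbrakk>A \<in> \<X>; B \<in> \<X>\<rbrakk> \<Longrightarrow> zh A (sh B)"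
proof -
  have s: "subcategory T \<X>" "functorially_finite_in T (Ob T) \<X>" "rigid T \<X>" "serre_stable T S \<X>"
    using assms by (simp_all add: rigid_subcats_def)
  note X = subcategoryD[OF s(1)]
  show "subcategory T \<X>" "functorially_finite_in T (Ob T) \<X>" "stable \<X>" "\<X> \<subseteq> Ob T"
    using s serre_stable_iff[OF X(1,3)] X(1) by simp_all
  show "zh A (sh B)" if "A \<in> \<X>" "B \<in> \<X>" for A B
    using s(3) that rigid_iff[OF X(1)] by blast
qed

lemma maximal_subcatsD:
  assumes "\<U> \<in> maximal_extension_closed_subcats T S"
  shows "subcategory T \<U>" "functorially_finite_in T (Ob T) \<U>" "extension_closed T \<U>" "stable \<U>"
    "\<U> \<subseteq> Ob T" "maximal_subcat T S \<U>"
proof -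
  have s: "subcategory T \<U>" "functorially_finite_in T (Ob T) \<U>" "extension_closed T \<U>"
    "serre_stable T S \<U>" "maximal_subcat T S \<U>"
    using assms by (simp_all add: maximal_extension_closed_subcats_def)
  note U = subcategoryD[OF s(1)]
  show "subcategory T \<U>" "functorially_finite_in T (Ob T) \<U>" "extension_closed T \<U>" "stable \<U>"
    "\<U> \<subseteq> Ob T" "maximal_subcat T S \<U>"
    using s serre_stable_iff[OF U(1,3)] U(1) by simp_all
qed

lemma stable_serre_stable:
  assumes "subcategory T \<U>" "stable \<U>"
  shows "serre_stable T S \<U>"
proof -
  have "serre_stable T S \<U> \<longleftrightarrow> stable \<U>"
    by (rule serre_stable_iff[OF subcategoryD(1)[OF assms(1)]]) (rule subcategoryD(3)[OF assms(1)])
  then show ?thesis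
    using assms(2) by simp
qed

lemma heart_perp:
  assumes "\<X> \<in> rigid_subcats T S"
  shows "heart T (perp \<X>) = \<X>"
proof -
  note X = rigid_subcatsD[OF assms]
  show ?thesis
    using perp_Int_perp_perp[OF X(1,3,5,2)] heart_eq[of "perp \<X>"] by (auto simp: perp_def)
qed

text \<open>An object of \<open>\<V>\<close> admits no extension of the heart of \<open>\<V>\<close>
  by it. If that heart is \<open>\<X>\<close>, then \<open>\<V>\<close> lies in
  \<open>perp \<X>\<close>, so \<open>perp \<X>\<close> is the largest candidate with this
  heart.\<close>

lemma perp_maximal:
  assumes "\<X> \<in> rigid_subcats T S"
  shows "perp \<X> \<in> maximal_extension_closed_subcats T S"
proof -
  note X = rigid_subcatsD[OF assms]
  have sub: "subcategory T (perp \<X>)"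
    using perp_subcategory[OF X(4)] .
  have "maximal_subcat T S (perp \<X>)"
    unfolding maximal_subcat_def
  proof (intro allI impI, elim conjE)
    fix \<V> assume V: "subcategory T \<V>" "perp \<X> \<subseteq> \<V>" "heart T \<V> = heart T (perp \<X>)"
    have VO: "\<V> \<subseteq> Ob T"
      using subcategoryD(1)[OF V(1)] .
    have h: "\<X> = \<V> \<inter> perp \<V>"
      using V(3) heart_perp[OF assms] heart_eq[OF VO] by simp
    have "\<V> \<subseteq> perp \<X>"
    proof
      fix A assume A: "A \<in> \<V>"
      have "zh B (sh A)" if "B \<in> \<X>" for B
        using that A h by (auto simp: perp_def)
      then show "A \<in> perp \<X>"
        using perp_iff[OF X(1,3,5)] A VO by blast
    qed
    then show "perp \<X> = \<V>"
      using V(2) by blast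
  qed
  then show ?thesis
    using sub perp_functorially_finite[OF X(1,3,5,2)] perp_extension_closed[OF X(4)]
      stable_serre_stable[OF sub perp_stable[OF X(4,3)]]
    by (simp add: maximal_extension_closed_subcats_def)
qed

lemma heart_rigid:
  assumes "\<U> \<in> maximal_extension_closed_subcats T S"
  shows "heart T \<U> \<in> rigid_subcats T S"
proof -
  note U = maximal_subcatsD[OF assms]
  note h = heart_eq[OF U(5)]
  have sub: "subcategory T (\<U> \<inter> perp \<U>)"
    using subcategory_Int[OF U(1) perp_subcategory[OF U(5)]] .
  have O: "\<U> \<inter> perp \<U> \<subseteq> Ob T"
    using U(5) by blast
  have "rigid T (\<U> \<inter> perp \<U>)"
    unfolding rigid_iff[OF O] by (auto simp: perp_def)
  moreover have "serre_stable T S (\<U> \<inter> perp \<U>)"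
    using stable_serre_stable[OF sub stable_Int[OF U(4) perp_stable[OF U(5,4)]]] .
  ultimately show ?thesis
    unfolding h using sub heart_functorially_finite[OF U(1,3,4,2)] by (simp add: rigid_subcats_def)
qed

text \<open>\<open>\<U>\<close> is contained in \<open>perp (heart T \<U>)\<close>, which has the
  same heart; maximality forces equality.\<close>

lemma perp_heart:
  assumes "\<U> \<in> maximal_extension_closed_subcats T S"
  shows "perp (heart T \<U>) = \<U>"
proof -
  note U = maximal_subcatsD[OF assms]
  note X = rigid_subcatsD[OF heart_rigid[OF assms]]
  have P: "perp (heart T \<U>) \<in> maximal_extension_closed_subcats T S"
    using perp_maximal[OF heart_rigid[OF assms]] .
  have "\<U> \<subseteq> perp (heart T \<U>)"
  proof
    fix A assume A: "A \<in> \<U>"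
    have "zh B (sh A)" if "B \<in> heart T \<U>" for B
      using that A unfolding heart_eq[OF U(5)] by (simp add: perp_def)
    then show "A \<in> perp (heart T \<U>)"
      using perp_iff[OF X(1,3,5)] A U(5) by blast
  qed
  moreover have "heart T (perp (heart T \<U>)) = heart T \<U>"
    using heart_perp[OF heart_rigid[OF assms]] .
  ultimately have "\<U> = perp (heart T \<U>)"
    using U(6) P unfolding maximal_subcat_def maximal_extension_closed_subcats_def by blast
  then show ?thesis ..
qed

lemma perp_subfactor:
  assumes X: "\<X> \<in> rigid_subcats T S"
    and \<sigma>: "sigma_choice T (perp \<X>) \<X> \<sigma>" and \<omega>: "omega_choice T (perp \<X>) \<X> \<omega>"
  shows "triangulated_category (subfactor T (perp \<X>) \<X> \<sigma>) \<and>
    quasi_inverse (subfactor T (perp \<X>) \<X> \<sigma>) (subfactor T (perp \<X>) \<X> \<sigma>)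
      (sigma_functor T (perp \<X>) \<X> \<sigma>) (omega_functor T (perp \<X>) \<X> \<omega>)"
proof -
  note X' = rigid_subcatsD[OF X]
  note F = perp_frobenius[OF X'(1,3,5,2), unfolded frobenius_subcat_def]
  show ?thesis
  proof (rule subfactor_triangulated[OF _ _ X'(1) _ _ _ \<sigma> _ \<omega>])
    show "Hom T A (sh B) = {Zero T A (sh B)}" if "A \<in> perp \<X>" "B \<in> \<X>" for A B
      using that unfolding perp_def zh_def by blast
    show "Hom T A (sh B) = {Zero T A (sh B)}" if "A \<in> \<X>" "B \<in> perp \<X>" for A B
      using that perp_iff[OF X'(1,3,5)] unfolding zh_def by blast
    show "chW \<sigma> A \<in> perp \<X>" if "A \<in> perp \<X>" for A
      using \<sigma> F that unfolding sigma_choice_def by blast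
    show "chW \<omega> A \<in> perp \<X>" if "A \<in> perp \<X>" for A
      using \<omega> F that unfolding omega_choice_def by blast
  qed (use F in blast)+
qed

theorem correspondence:
  "bij_betw (heart T) (maximal_extension_closed_subcats T S) (rigid_subcats T S) \<and>
    bij_betw (\<lambda>\<X>. shift T (left_perp T \<X>)) (rigid_subcats T S)
      (maximal_extension_closed_subcats T S) \<and>
    (\<forall>\<U> \<in> maximal_extension_closed_subcats T S.
      shift T (left_perp T (heart T \<U>)) = \<U>) \<and>
    (\<forall>\<X> \<in> rigid_subcats T S. heart T (shift T (left_perp T \<X>)) = \<X>) \<and>
    (\<forall>\<U> \<in> maximal_extension_closed_subcats T S. \<forall>\<X> \<in> rigid_subcats T S.
      \<X> = heart T \<U> \<and> \<U> = shift T (left_perp T \<X>) \<longrightarrow>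
        frobenius_subcat T \<X> \<U> \<and>
        (\<forall>\<sigma> \<omega>. sigma_choice T \<U> \<X> \<sigma> \<and> omega_choice T \<U> \<X> \<omega> \<longrightarrow>
          triangulated_category (subfactor T \<U> \<X> \<sigma>) \<and>
          quasi_inverse (subfactor T \<U> \<X> \<sigma>) (subfactor T \<U> \<X> \<sigma>)
            (sigma_functor T \<U> \<X> \<sigma>) (omega_functor T \<U> \<X> \<omega>)))"
proof -
  have sp: "shift T (left_perp T \<X>) = perp \<X>" if "\<X> \<in> rigid_subcats T S" for \<X>
    using shift_left_perp[OF rigid_subcatsD(4)[OF that]] .
  have 1: "shift T (left_perp T (heart T \<U>)) = \<U>" if "\<U> \<in> maximal_extension_closed_subcats T S" for \<U>
    using sp[OF heart_rigid[OF that]] perp_heart[OF that] by simp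
  have 2: "heart T (shift T (left_perp T \<X>)) = \<X>" if "\<X> \<in> rigid_subcats T S" for \<X>
    using sp[OF that] heart_perp[OF that] by simp
  have 3: "shift T (left_perp T \<X>) \<in> maximal_extension_closed_subcats T S" if "\<X> \<in> rigid_subcats T S" for \<X>
    using sp[OF that] perp_maximal[OF that] by simp
  have b1: "bij_betw (heart T) (maximal_extension_closed_subcats T S) (rigid_subcats T S)"
    by (rule bij_betw_byWitness[of _ "\<lambda>\<X>. shift T (left_perp T \<X>)"]) (use 1 2 3 heart_rigid in auto)
  have b2: "bij_betw (\<lambda>\<X>. shift T (left_perp T \<X>)) (rigid_subcats T S)
      (maximal_extension_closed_subcats T S)"
    by (rule bij_betw_byWitness[of _ "heart T"]) (use 1 2 3 heart_rigid in auto)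
  have frob: "frobenius_subcat T \<X> \<U> \<and>
      (\<forall>\<sigma> \<omega>. sigma_choice T \<U> \<X> \<sigma> \<and> omega_choice T \<U> \<X> \<omega> \<longrightarrow>
        triangulated_category (subfactor T \<U> \<X> \<sigma>) \<and>
        quasi_inverse (subfactor T \<U> \<X> \<sigma>) (subfactor T \<U> \<X> \<sigma>)
          (sigma_functor T \<U> \<X> \<sigma>) (omega_functor T \<U> \<X> \<omega>))"
    if X: "\<X> \<in> rigid_subcats T S" and U: "\<U> = shift T (left_perp T \<X>)" for \<U> \<X>
    unfolding U sp[OF X] using perp_frobenius[OF rigid_subcatsD(1,3,5,2)[OF X]] perp_subfactor[OF X] by blast
  show ?thesis
    by (intro conjI[OF b1] conjI[OF b2] conjI[of "Ball _ _"] ballI impI; (elim conjE)?)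
      (rule 1 2 frob; assumption)+
qed

end

section \<open>Dimension counts in finite-dimensional modules\<close>

section \<open>Minimal versions of maps\<close>

locale vector_space_module = field K + module K M
  for K :: "('k, 'r) ring_scheme" (structure) and M :: "('k, 'v, 'z) module_scheme" (structure)
begin

definition lin_subspace :: "'v set \<Rightarrow> bool" where
  "lin_subspace W \<longleftrightarrow> W \<subseteq> carrier M \<and> \<zero>\<^bsub>M\<^esub> \<in> W \<and> (\<forall>x \<in> W. \<forall>y \<in> W. x \<oplus>\<^bsub>M\<^esub> y \<in> W) \<and>
    (\<forall>a \<in> carrier K. \<forall>x \<in> W. a \<odot>\<^bsub>M\<^esub> x \<in> W)"

primrec flag :: "'v list \<Rightarrow> 'v set" where
  "flag [] = {\<zero>\<^bsub>M\<^esub>}"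
| "flag (s # xs) = {x \<oplus>\<^bsub>M\<^esub> a \<odot>\<^bsub>M\<^esub> s | x a. x \<in> flag xs \<and> a \<in> carrier K}"

text \<open>The number of jumps of the flag inside \<open>W\<close>. It is strictly monotone in \<open>W\<close>, which is all that is
  needed of a dimension.\<close>

primrec jumps :: "'v list \<Rightarrow> 'v set \<Rightarrow> nat" where
  "jumps [] W = 0"
| "jumps (s # xs) W = jumps xs W + (if W \<inter> flag (s # xs) \<subseteq> flag xs then 0 else 1)"

lemma flag_lin_subspace: "set xs \<subseteq> carrier M \<Longrightarrow> lin_subspace (flag xs)"
proof (induction xs)
  case Nil
  then show ?case
    by (auto simp: lin_subspace_def smult_r_null)
next
  case (Cons s xs)
  then have s: "s \<in> carrier M" and F: "lin_subspace (flag xs)"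
    by auto
  have F': "\<And>x. x \<in> flag xs \<Longrightarrow> x \<in> carrier M"
    using F unfolding lin_subspace_def by blast
  show ?case
    unfolding lin_subspace_def
  proof (intro conjI ballI)
    show "flag (s # xs) \<subseteq> carrier M"
      using s F' by auto
    have "\<zero>\<^bsub>M\<^esub> = \<zero>\<^bsub>M\<^esub> \<oplus>\<^bsub>M\<^esub> \<zero> \<odot>\<^bsub>M\<^esub> s" "\<zero>\<^bsub>M\<^esub> \<in> flag xs"
      using s F by (simp_all add: smult_l_null lin_subspace_def)
    then show "\<zero>\<^bsub>M\<^esub> \<in> flag (s # xs)"
      by auto
    fix v assume "v \<in> flag (s # xs)"
    then obtain x a where x: "x \<in> flag xs" "a \<in> carrier K" "v = x \<oplus>\<^bsub>M\<^esub> a \<odot>\<^bsub>M\<^esub> s"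
      by auto
    show "v \<oplus>\<^bsub>M\<^esub> w \<in> flag (s # xs)" if w: "w \<in> flag (s # xs)" for w
    proof -
      obtain y b where y: "y \<in> flag xs" "b \<in> carrier K" "w = y \<oplus>\<^bsub>M\<^esub> b \<odot>\<^bsub>M\<^esub> s"
        using w by auto
      have "v \<oplus>\<^bsub>M\<^esub> w = (x \<oplus>\<^bsub>M\<^esub> y) \<oplus>\<^bsub>M\<^esub> (a \<oplus> b) \<odot>\<^bsub>M\<^esub> s"
        using x y s F' by (simp add: smult_l_distr M.a_ac)
      moreover have "x \<oplus>\<^bsub>M\<^esub> y \<in> flag xs" "a \<oplus> b \<in> carrier K"
        using F x y by (simp_all add: lin_subspace_def)
      ultimately show ?thesis
        by auto
    qed
    fix c assume c: "c \<in> carrier K"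
    have "c \<odot>\<^bsub>M\<^esub> v = c \<odot>\<^bsub>M\<^esub> x \<oplus>\<^bsub>M\<^esub> (c \<otimes> a) \<odot>\<^bsub>M\<^esub> s"
      using x s c F' by (simp add: smult_r_distr smult_assoc1)
    moreover have "c \<odot>\<^bsub>M\<^esub> x \<in> flag xs" "c \<otimes> a \<in> carrier K"
      using F x c by (simp_all add: lin_subspace_def)
    ultimately show "c \<odot>\<^bsub>M\<^esub> v \<in> flag (s # xs)"
      by auto
  qed
qed

text \<open>One step of the flag adds at most one dimension, so a vector \<open>w0\<close> outside
  \<open>flag xs\<close> can clear the coordinate of \<open>w\<close> along
  \<open>s\<close>.\<close>

lemma flag_step:
  assumes sub: "set (s # xs) \<subseteq> carrier M" and w: "w \<in> flag (s # xs)"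
    and w0: "w0 \<in> flag (s # xs)" "w0 \<notin> flag xs"
  obtains c where "c \<in> carrier K" "w \<oplus>\<^bsub>M\<^esub> c \<odot>\<^bsub>M\<^esub> w0 \<in> flag xs"
proof -
  have s: "s \<in> carrier M" and F: "lin_subspace (flag xs)"
    using sub flag_lin_subspace by auto
  have F': "\<And>x. x \<in> flag xs \<Longrightarrow> x \<in> carrier M"
    using F unfolding lin_subspace_def by blast
  obtain x a where x: "x \<in> flag xs" "a \<in> carrier K" "w = x \<oplus>\<^bsub>M\<^esub> a \<odot>\<^bsub>M\<^esub> s"
    using w by auto
  obtain x0 a0 where x0: "x0 \<in> flag xs" "a0 \<in> carrier K" "w0 = x0 \<oplus>\<^bsub>M\<^esub> a0 \<odot>\<^bsub>M\<^esub> s"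
    using w0(1) by auto
  have "a0 \<noteq> \<zero>"
    using w0(2) x0 s F' by (auto simp: smult_l_null)
  then have a0: "a0 \<in> Units K"
    using x0(2) field_Units by blast
  define c where "c = \<ominus> (a \<otimes> inv a0)"
  have c: "c \<in> carrier K" "c \<otimes> a0 = \<ominus> a"
    using x(2) x0(2) a0 by (simp_all add: c_def l_minus m_assoc)
  have "w \<oplus>\<^bsub>M\<^esub> c \<odot>\<^bsub>M\<^esub> w0 = (x \<oplus>\<^bsub>M\<^esub> c \<odot>\<^bsub>M\<^esub> x0) \<oplus>\<^bsub>M\<^esub> (a \<odot>\<^bsub>M\<^esub> s \<oplus>\<^bsub>M\<^esub> (c \<otimes> a0) \<odot>\<^bsub>M\<^esub> s)"
    using x x0 c(1) s F' by (simp add: smult_r_distr smult_assoc1 M.a_ac)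
  also have "a \<odot>\<^bsub>M\<^esub> s \<oplus>\<^bsub>M\<^esub> (c \<otimes> a0) \<odot>\<^bsub>M\<^esub> s = (a \<oplus> \<ominus> a) \<odot>\<^bsub>M\<^esub> s"
    unfolding c(2) using x(2) s smult_l_distr[of a "\<ominus> a" s] by simp
  also have "\<dots> = \<zero>\<^bsub>M\<^esub>"
    using x(2) s by (simp add: abelian_group.r_neg[OF is_abelian_group] smult_l_null)
  also have "(x \<oplus>\<^bsub>M\<^esub> c \<odot>\<^bsub>M\<^esub> x0) \<oplus>\<^bsub>M\<^esub> \<zero>\<^bsub>M\<^esub> = x \<oplus>\<^bsub>M\<^esub> c \<odot>\<^bsub>M\<^esub> x0"
    using x x0 c(1) F' by simp
  finally have "w \<oplus>\<^bsub>M\<^esub> c \<odot>\<^bsub>M\<^esub> w0 \<in> flag xs"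
    using F x x0 c(1) by (simp add: lin_subspace_def)
  then show thesis
    using that c(1) by blast
qed

lemma jumps_mono: "W \<subseteq> W' \<Longrightarrow> jumps xs W \<le> jumps xs W'"
  by (induction xs) (auto intro: add_mono)

text \<open>Consider the step at which \<open>W'\<close> first leaves \<open>W\<close>, at a vector
  \<open>w\<close>. If \<open>W\<close> had a jump there, a vector \<open>w0\<close> of
  \<open>W\<close> would move \<open>w\<close> into \<open>flag xs\<close>, where \<open>W'\<close>
  lies in \<open>W\<close>, and \<open>w\<close> itself would be in \<open>W\<close>. So
  \<open>W'\<close> jumps there and \<open>W\<close> does not.\<close>

lemma jumps_strict:
  "\<lbrakk>set xs \<subseteq> carrier M; lin_subspace W; lin_subspace W'; W \<subseteq> W'; \<not> W' \<inter> flag xs \<subseteq> W\<rbrakk>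
    \<Longrightarrow> jumps xs W < jumps xs W'"
proof (induction xs)
  case Nil
  then show ?case
    by (auto simp: lin_subspace_def)
next
  case (Cons s xs)
  show ?case
  proof (cases "W' \<inter> flag xs \<subseteq> W")
    case False
    then have "jumps xs W < jumps xs W'"
      using Cons by simp
    moreover have "W' \<inter> flag (s # xs) \<subseteq> flag xs \<Longrightarrow> W \<inter> flag (s # xs) \<subseteq> flag xs"
      using Cons.prems(4) by blast
    ultimately show ?thesis
      by (simp del: flag.simps)
  next
    case True
    obtain w where w: "w \<in> W'" "w \<in> flag (s # xs)" "w \<notin> W"
      using Cons.prems(5) by blast
    have "W \<inter> flag (s # xs) \<subseteq> flag xs"
    proof (rule ccontr)
      assume "\<not> W \<inter> flag (s # xs) \<subseteq> flag xs"
      then obtain w0 where w0: "w0 \<in> W" "w0 \<in> flag (s # xs)" "w0 \<notin> flag xs"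
        by blast
      obtain c where c: "c \<in> carrier K" "w \<oplus>\<^bsub>M\<^esub> c \<odot>\<^bsub>M\<^esub> w0 \<in> flag xs"
        using flag_step[OF Cons.prems(1) w(2) w0(2,3)] .
      have cw: "c \<odot>\<^bsub>M\<^esub> w0 \<in> W" "(\<ominus> c) \<odot>\<^bsub>M\<^esub> w0 \<in> W" "w0 \<in> carrier M" "w \<in> carrier M"
        using Cons.prems(2,3) w0(1) w(1) c(1) unfolding lin_subspace_def by auto
      then have "w \<oplus>\<^bsub>M\<^esub> c \<odot>\<^bsub>M\<^esub> w0 \<in> W'"
        using Cons.prems(3,4) w(1) unfolding lin_subspace_def by blast
      then have "w \<oplus>\<^bsub>M\<^esub> c \<odot>\<^bsub>M\<^esub> w0 \<in> W"
        using True c(2) by blast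
      then have "(w \<oplus>\<^bsub>M\<^esub> c \<odot>\<^bsub>M\<^esub> w0) \<oplus>\<^bsub>M\<^esub> (\<ominus> c) \<odot>\<^bsub>M\<^esub> w0 \<in> W"
        using Cons.prems(2) cw(2) unfolding lin_subspace_def by blast
      moreover have "(w \<oplus>\<^bsub>M\<^esub> c \<odot>\<^bsub>M\<^esub> w0) \<oplus>\<^bsub>M\<^esub> (\<ominus> c) \<odot>\<^bsub>M\<^esub> w0 = w \<oplus>\<^bsub>M\<^esub> (c \<oplus> \<ominus> c) \<odot>\<^bsub>M\<^esub> w0"
        using cw(3,4) c(1) smult_l_distr[of c "\<ominus> c" w0] by (simp add: M.a_assoc)
      ultimately show False
        using cw(3,4) c(1) w(3) by (simp add: abelian_group.r_neg[OF is_abelian_group] smult_l_null)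
    qed
    moreover have "\<not> W' \<inter> flag (s # xs) \<subseteq> flag xs"
      using True w by blast
    ultimately show ?thesis
      using jumps_mono[OF Cons.prems(4), of xs] by (simp del: flag.simps)
  qed
qed

lemma finsum_in_flag:
  assumes "set xs \<subseteq> carrier M" "distinct xs" "c \<in> set xs \<rightarrow> carrier K"
  shows "(\<Oplus>\<^bsub>M\<^esub>s\<in>set xs. c s \<odot>\<^bsub>M\<^esub> s) \<in> flag xs"
  using assms
proof (induction xs)
  case Nil
  then show ?case
    by simp
next
  case (Cons s xs)
  have c: "c s \<in> carrier K" "c \<in> set xs \<rightarrow> carrier K"
    using Cons.prems(3) by auto
  have IH: "(\<Oplus>\<^bsub>M\<^esub>s\<in>set xs. c s \<odot>\<^bsub>M\<^esub> s) \<in> flag xs"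
    using Cons c by simp
  have F: "(\<Oplus>\<^bsub>M\<^esub>s\<in>set xs. c s \<odot>\<^bsub>M\<^esub> s) \<in> carrier M"
    using IH flag_lin_subspace[of xs] Cons.prems(1) unfolding lin_subspace_def by auto
  have "(\<Oplus>\<^bsub>M\<^esub>s\<in>set (s # xs). c s \<odot>\<^bsub>M\<^esub> s) = c s \<odot>\<^bsub>M\<^esub> s \<oplus>\<^bsub>M\<^esub> (\<Oplus>\<^bsub>M\<^esub>s\<in>set xs. c s \<odot>\<^bsub>M\<^esub> s)"
    using Cons.prems c by (simp, intro M.finsum_insert) auto
  also have "\<dots> = (\<Oplus>\<^bsub>M\<^esub>s\<in>set xs. c s \<odot>\<^bsub>M\<^esub> s) \<oplus>\<^bsub>M\<^esub> c s \<odot>\<^bsub>M\<^esub> s"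
    using Cons.prems c F by (intro M.a_comm) auto
  finally show ?case
    using IH c by auto
qed

lemma ex_dimension:
  assumes "finite_dimensional K M"
  obtains d :: "'v set \<Rightarrow> nat" where
    "\<And>W W'. \<lbrakk>lin_subspace W; lin_subspace W'; W \<subset> W'\<rbrakk> \<Longrightarrow> d W < d W'"
proof -
  obtain B where B: "finite B" "B \<subseteq> carrier M"
    "\<forall>x \<in> carrier M. \<exists>c \<in> B \<rightarrow> carrier K. x = (\<Oplus>\<^bsub>M\<^esub>s\<in>B. c s \<odot>\<^bsub>M\<^esub> s)"
    using assms unfolding finite_dimensional_def by blast
  obtain xs where xs: "set xs = B" "distinct xs"
    using finite_distinct_list[OF B(1)] by blast
  have F: "carrier M \<subseteq> flag xs"
    using B(2,3) finsum_in_flag[of xs] xs by auto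
  have "jumps xs W < jumps xs W'" if "lin_subspace W" "lin_subspace W'" "W \<subset> W'" for W W'
    by (rule jumps_strict) (use that F B(2) xs in \<open>auto simp: lin_subspace_def\<close>)
  then show thesis
    using that by blast
qed

end

section \<open>Endomorphism algebras, Fitting's lemma and minimal summands\<close>

context serre_triangulated_category
begin

lemma hom_module_sel [simp]:
  "carrier (hom_module T A B) = Hom T A B" "add (hom_module T A B) = Add T"
  "zero (hom_module T A B) = Zero T A B" "smult (hom_module T A B) = Smult T"
  by (simp_all add: hom_module_def)

lemma Smult_arrow [simp]:
  assumes "a \<in> carrier K" "ar T f"
  shows "ar T (Smult T a f)" "src T (Smult T a f) = src T f" "tgt T (Smult T a f) = tgt T f"
proof -
  have "Smult T a f \<in> Hom T (src T f) (tgt T f)"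
    using module.smult_closed[OF hom_vector_space[of "src T f" "tgt T f"], of a f] assms arrow_self[of f] by simp
  then show "ar T (Smult T a f)" "src T (Smult T a f) = src T f" "tgt T (Smult T a f) = tgt T f"
    using Hom_arrow assms by simp_all
qed

lemma Comp_Smult' [simp]:
  assumes "ar T f" "ar T g" "src T g = tgt T f" "a \<in> carrier K"
  shows "g \<bullet>\<^bsub>T\<^esub> Smult T a f = Smult T a (g \<bullet>\<^bsub>T\<^esub> f)" "Smult T a g \<bullet>\<^bsub>T\<^esub> f = Smult T a (g \<bullet>\<^bsub>T\<^esub> f)"
  using Comp_Smult[of "src T f" "tgt T f" "tgt T g" f g a] Smult_Comp[of "src T f" "tgt T f" "tgt T g" f g a]
    assms arrow_self[of f] arrow_self[of g] by simp_all

definition endo :: "'o \<Rightarrow> 'm \<Rightarrow> bool" where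
  "endo V x \<longleftrightarrow> ar T x \<and> src T x = V \<and> tgt T x = V"

lemma endo_Comp [simp]: "\<lbrakk>endo V x; endo V y\<rbrakk> \<Longrightarrow> endo V (x \<bullet>\<^bsub>T\<^esub> y)"
  by (simp add: endo_def)

lemma endo_Ident [simp]: "V \<in> Ob T \<Longrightarrow> endo V (Ident T V)"
  by (simp add: endo_def)

lemma endo_assoc: "\<lbrakk>endo V x; endo V y; endo V z\<rbrakk> \<Longrightarrow> (x \<bullet>\<^bsub>T\<^esub> y) \<bullet>\<^bsub>T\<^esub> z = x \<bullet>\<^bsub>T\<^esub> (y \<bullet>\<^bsub>T\<^esub> z)"
  by (simp add: endo_def)

text \<open>Linear self-maps of the space of endomorphisms of \<open>V\<close>. Their images cover
  the right ideals \<open>a End\<close>, the left ideals \<open>End a\<close> and the corners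
  \<open>e End e\<close> needed below, with a single proof that they are subspaces.\<close>

definition linear_endo :: "'o \<Rightarrow> ('m \<Rightarrow> 'm) \<Rightarrow> bool" where
  "linear_endo V \<phi> \<longleftrightarrow> (\<forall>x. endo V x \<longrightarrow> endo V (\<phi> x)) \<and> \<phi> (Zero T V V) = Zero T V V \<and>
    (\<forall>x y. endo V x \<longrightarrow> endo V y \<longrightarrow> \<phi> (Add T x y) = Add T (\<phi> x) (\<phi> y)) \<and>
    (\<forall>a x. a \<in> carrier K \<longrightarrow> endo V x \<longrightarrow> \<phi> (Smult T a x) = Smult T a (\<phi> x))"

lemma ex_dimension_linear_endo:
  assumes V: "V \<in> Ob T"
  obtains d :: "'m set \<Rightarrow> nat" where
    "\<And>\<phi> \<psi>. \<lbrakk>linear_endo V \<phi>; linear_endo V \<psi>; \<phi> ` Collect (endo V) \<subset> \<psi> ` Collect (endo V)\<rbrakk>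
      \<Longrightarrow> d (\<phi> ` Collect (endo V)) < d (\<psi> ` Collect (endo V))"
proof -
  interpret V: vector_space_module K "hom_module T V V"
    by (rule vector_space_module.intro[OF field_axioms hom_vector_space[OF V V]])
  obtain d where d: "\<And>W W'. \<lbrakk>V.lin_subspace W; V.lin_subspace W'; W \<subset> W'\<rbrakk> \<Longrightarrow> (d W :: nat) < d W'"
    using V.ex_dimension[OF Hom_finite[OF V V]] by blast
  have endo_Hom: "x \<in> Hom T V V \<longleftrightarrow> endo V x" for x
    using Hom_iff[OF V V] by (simp add: endo_def)
  have sub: "V.lin_subspace (\<phi> ` Collect (endo V))" if \<phi>: "linear_endo V \<phi>" for \<phi>
    unfolding V.lin_subspace_def hom_module_sel
  proof (intro conjI ballI)
    note L = \<phi>[unfolded linear_endo_def]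
    show "\<phi> ` Collect (endo V) \<subseteq> Hom T V V"
      using L endo_Hom by auto
    show "Zero T V V \<in> \<phi> ` Collect (endo V)"
      by (rule image_eqI[of _ _ "Zero T V V"]) (use L V in \<open>simp_all add: endo_def\<close>)
    fix x assume "x \<in> \<phi> ` Collect (endo V)"
    then obtain x' where x: "endo V x'" "x = \<phi> x'"
      by auto
    show "Add T x y \<in> \<phi> ` Collect (endo V)" if y: "y \<in> \<phi> ` Collect (endo V)" for y
    proof -
      obtain y' where y: "endo V y'" "y = \<phi> y'"
        using y by auto
      have "endo V (Add T x' y')"
        using x(1) y(1) by (simp add: endo_def)
      then show ?thesis
        using L x y by (intro image_eqI[of _ _ "Add T x' y'"]) simp_all
    qed
    show "Smult T a x \<in> \<phi> ` Collect (endo V)" if a: "a \<in> carrier K" for a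
    proof -
      have "endo V (Smult T a x')"
        using x(1) a by (simp add: endo_def)
      then show ?thesis
        using L x a by (intro image_eqI[of _ _ "Smult T a x'"]) simp_all
    qed
  qed
  show thesis
    by (rule that[of d]) (use d sub in blast)
qed

lemma linear_endo_mult:
  assumes "endo V a"
  shows "linear_endo V (\<lambda>x. a \<bullet>\<^bsub>T\<^esub> x)" "linear_endo V (\<lambda>x. x \<bullet>\<^bsub>T\<^esub> a)" "linear_endo V (\<lambda>x. a \<bullet>\<^bsub>T\<^esub> (x \<bullet>\<^bsub>T\<^esub> a))"
proof -
  have "V \<in> Ob T"
    using assms ar_Ob(1)[of a] by (simp add: endo_def)
  then show "linear_endo V (\<lambda>x. a \<bullet>\<^bsub>T\<^esub> x)" "linear_endo V (\<lambda>x. x \<bullet>\<^bsub>T\<^esub> a)" "linear_endo V (\<lambda>x. a \<bullet>\<^bsub>T\<^esub> (x \<bullet>\<^bsub>T\<^esub> a))"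
    using assms unfolding linear_endo_def endo_def by simp_all
qed

text \<open>From a member of least dimension on, no later member can be strictly smaller.\<close>

lemma chain_stabilises:
  assumes V: "V \<in> Ob T" and \<phi>: "\<And>n. linear_endo V (\<phi> n)"
    and dec: "\<And>m n. m \<le> n \<Longrightarrow> \<phi> n ` Collect (endo V) \<subseteq> \<phi> m ` Collect (endo V)"
  obtains n :: nat where "\<And>m. n \<le> m \<Longrightarrow> \<phi> m ` Collect (endo V) = \<phi> n ` Collect (endo V)"
proof -
  obtain d :: "'m set \<Rightarrow> nat" where d: "\<And>\<phi> \<psi>. \<lbrakk>linear_endo V \<phi>; linear_endo V \<psi>;
      \<phi> ` Collect (endo V) \<subset> \<psi> ` Collect (endo V)\<rbrakk> \<Longrightarrow> d (\<phi> ` Collect (endo V)) < d (\<psi> ` Collect (endo V))"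
    using ex_dimension_linear_endo[OF V] by blast
  obtain n where n: "\<And>m. d (\<phi> n ` Collect (endo V)) \<le> d (\<phi> m ` Collect (endo V))"
    using ex_has_least_nat[of "\<lambda>_. True" 0 "\<lambda>n. d (\<phi> n ` Collect (endo V))"] by auto
  have "\<phi> m ` Collect (endo V) = \<phi> n ` Collect (endo V)" if m: "n \<le> m" for m
  proof (rule ccontr)
    assume "\<phi> m ` Collect (endo V) \<noteq> \<phi> n ` Collect (endo V)"
    then have "\<phi> m ` Collect (endo V) \<subset> \<phi> n ` Collect (endo V)"
      using dec[OF m] by blast
    then show False
      using d[OF \<phi> \<phi>] n[of m] by fastforce
  qed
  then show thesis
    using that by blast
qed

primrec power :: "'o \<Rightarrow> 'm \<Rightarrow> nat \<Rightarrow> 'm" where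
  "power V h 0 = Ident T V"
| "power V h (Suc n) = h \<bullet>\<^bsub>T\<^esub> power V h n"

lemma power_endo [simp]: "\<lbrakk>V \<in> Ob T; endo V h\<rbrakk> \<Longrightarrow> endo V (power V h n)"
  by (induction n) simp_all

lemma power_add: "\<lbrakk>V \<in> Ob T; endo V h\<rbrakk> \<Longrightarrow> power V h (m + n) = power V h m \<bullet>\<^bsub>T\<^esub> power V h n"
proof (induction m)
  case 0
  then show ?case
    using power_endo[OF 0, of n] by (simp add: endo_def)
next
  case (Suc m)
  then show ?case
    using endo_assoc[of V h "power V h m" "power V h n"] by simp
qed

text \<open>Fitting's lemma in the form of strong \<open>\<pi>\<close>-regularity of the endomorphism ring.\<close>

lemma strongly_pi_regular:
  assumes V: "V \<in> Ob T" and h: "endo V h"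
  obtains n y z where "endo V y" "endo V z" "power V h (Suc n) = power V h (Suc n) \<bullet>\<^bsub>T\<^esub> (power V h (Suc n) \<bullet>\<^bsub>T\<^esub> y)"
    "power V h (Suc n) = z \<bullet>\<^bsub>T\<^esub> (power V h (Suc n) \<bullet>\<^bsub>T\<^esub> power V h (Suc n))"
proof -
  note p = power_endo[OF V h]
  have dec1: "(\<lambda>x. power V h n \<bullet>\<^bsub>T\<^esub> x) ` Collect (endo V) \<subseteq> (\<lambda>x. power V h m \<bullet>\<^bsub>T\<^esub> x) ` Collect (endo V)"
    if "m \<le> n" for m n
  proof (intro subsetI, elim imageE)
    fix w x assume x: "w = power V h n \<bullet>\<^bsub>T\<^esub> x" "x \<in> Collect (endo V)"
    have w: "w = power V h m \<bullet>\<^bsub>T\<^esub> (power V h (n - m) \<bullet>\<^bsub>T\<^esub> x)"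
      using x power_add[OF V h, of m "n - m"] that p endo_assoc[of V "power V h m" "power V h (n - m)" x] by simp
    show "w \<in> (\<lambda>x. power V h m \<bullet>\<^bsub>T\<^esub> x) ` Collect (endo V)"
      unfolding w by (rule imageI) (use x(2) p in simp)
  qed
  obtain n1 where n1: "\<And>m. n1 \<le> m \<Longrightarrow> (\<lambda>x. power V h m \<bullet>\<^bsub>T\<^esub> x) ` Collect (endo V) = (\<lambda>x. power V h n1 \<bullet>\<^bsub>T\<^esub> x) ` Collect (endo V)"
    by (rule chain_stabilises[of V "\<lambda>n x. power V h n \<bullet>\<^bsub>T\<^esub> x"]) (use V linear_endo_mult(1)[OF p] dec1 in \<open>assumption | blast\<close>)+
  have dec2: "(\<lambda>x. x \<bullet>\<^bsub>T\<^esub> power V h n) ` Collect (endo V) \<subseteq> (\<lambda>x. x \<bullet>\<^bsub>T\<^esub> power V h m) ` Collect (endo V)"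
    if "m \<le> n" for m n
  proof (intro subsetI, elim imageE)
    fix w x assume x: "w = x \<bullet>\<^bsub>T\<^esub> power V h n" "x \<in> Collect (endo V)"
    have w: "w = (x \<bullet>\<^bsub>T\<^esub> power V h (n - m)) \<bullet>\<^bsub>T\<^esub> power V h m"
      using x power_add[OF V h, of "n - m" m] that p endo_assoc[of V x "power V h (n - m)" "power V h m"] by simp
    show "w \<in> (\<lambda>x. x \<bullet>\<^bsub>T\<^esub> power V h m) ` Collect (endo V)"
      unfolding w by (rule imageI) (use x(2) p in simp)
  qed
  obtain n2 where n2: "\<And>m. n2 \<le> m \<Longrightarrow> (\<lambda>x. x \<bullet>\<^bsub>T\<^esub> power V h m) ` Collect (endo V) = (\<lambda>x. x \<bullet>\<^bsub>T\<^esub> power V h n2) ` Collect (endo V)"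
    by (rule chain_stabilises[of V "\<lambda>n x. x \<bullet>\<^bsub>T\<^esub> power V h n"]) (use V linear_endo_mult(2)[OF p] dec2 in \<open>assumption | blast\<close>)+
  \<comment> \<open>A common index for both chains. The power used is the successor, so that a
    factor \<open>h\<close> can later be split off on either side.\<close>
  define n where "n = n1 + n2"
  let ?a = "power V h (Suc n)"
  have a: "endo V ?a"
    by (rule p)
  have aa: "power V h (Suc n + Suc n) = ?a \<bullet>\<^bsub>T\<^esub> ?a"
    by (rule power_add[OF V h])
  have "?a \<in> (\<lambda>x. ?a \<bullet>\<^bsub>T\<^esub> x) ` Collect (endo V)"
    using a V by (intro image_eqI[of _ _ "Ident T V"]) (simp_all add: endo_def)
  then have "?a \<in> (\<lambda>x. power V h (Suc n + Suc n) \<bullet>\<^bsub>T\<^esub> x) ` Collect (endo V)"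
    using n1[of "Suc n"] n1[of "Suc n + Suc n"] unfolding n_def by simp
  then obtain y where y: "endo V y" "?a = (?a \<bullet>\<^bsub>T\<^esub> ?a) \<bullet>\<^bsub>T\<^esub> y"
    unfolding aa by blast
  have "?a \<in> (\<lambda>x. x \<bullet>\<^bsub>T\<^esub> ?a) ` Collect (endo V)"
    using a V by (intro image_eqI[of _ _ "Ident T V"]) (simp_all add: endo_def)
  then have "?a \<in> (\<lambda>x. x \<bullet>\<^bsub>T\<^esub> power V h (Suc n + Suc n)) ` Collect (endo V)"
    using n2[of "Suc n"] n2[of "Suc n + Suc n"] unfolding n_def by simp
  then obtain z where z: "endo V z" "?a = z \<bullet>\<^bsub>T\<^esub> (?a \<bullet>\<^bsub>T\<^esub> ?a)"
    unfolding aa by blast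
  have "?a = ?a \<bullet>\<^bsub>T\<^esub> (?a \<bullet>\<^bsub>T\<^esub> y)"
    using y(2) endo_assoc[OF a a y(1)] by simp
  then show thesis
    using that[OF y(1) z(1)] z(2) by blast
qed

text \<open>With \<open>a\<close> a positive power of \<open>h\<close>, the relations
  \<open>a = a a y\<close> and \<open>a = z a a\<close> give \<open>z a = a y\<close>. This is an
  idempotent that acts as the identity on \<open>a\<close> from both sides, so the hypothesis makes
  it \<open>1\<close>, and \<open>h\<close> has inverses on both sides.\<close>

lemma iso_criterion:
  assumes V: "V \<in> Ob T" and h: "endo V h"
    and idem: "\<And>e n. \<lbrakk>endo V e; e \<bullet>\<^bsub>T\<^esub> e = e; e \<bullet>\<^bsub>T\<^esub> power V h n = power V h n;
      power V h n \<bullet>\<^bsub>T\<^esub> e = power V h n\<rbrakk> \<Longrightarrow> e = Ident T V"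
  shows "is_iso T h"
proof -
  obtain n y z where yz: "endo V y" "endo V z" "power V h (Suc n) = power V h (Suc n) \<bullet>\<^bsub>T\<^esub> (power V h (Suc n) \<bullet>\<^bsub>T\<^esub> y)"
    "power V h (Suc n) = z \<bullet>\<^bsub>T\<^esub> (power V h (Suc n) \<bullet>\<^bsub>T\<^esub> power V h (Suc n))"
    using strongly_pi_regular[OF V h] .
  define a where "a = power V h (Suc n)"
  have a: "endo V a"
    unfolding a_def by (rule power_endo[OF V h])
  have aay: "a \<bullet>\<^bsub>T\<^esub> (a \<bullet>\<^bsub>T\<^esub> y) = a" and zaa: "z \<bullet>\<^bsub>T\<^esub> (a \<bullet>\<^bsub>T\<^esub> a) = a"
    using yz(3,4) unfolding a_def[symmetric] by simp_all
  have zay: "z \<bullet>\<^bsub>T\<^esub> a = a \<bullet>\<^bsub>T\<^esub> y"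
  proof -
    have "z \<bullet>\<^bsub>T\<^esub> a = z \<bullet>\<^bsub>T\<^esub> (a \<bullet>\<^bsub>T\<^esub> (a \<bullet>\<^bsub>T\<^esub> y))"
      unfolding aay ..
    also have "\<dots> = (z \<bullet>\<^bsub>T\<^esub> (a \<bullet>\<^bsub>T\<^esub> a)) \<bullet>\<^bsub>T\<^esub> y"
      using a yz(1,2) by (simp add: endo_def)
    finally show ?thesis
      unfolding zaa .
  qed
  have ea: "(a \<bullet>\<^bsub>T\<^esub> y) \<bullet>\<^bsub>T\<^esub> a = a"
    unfolding zay[symmetric] using zaa a yz(2) by (simp add: endo_def)
  have ae: "a \<bullet>\<^bsub>T\<^esub> (a \<bullet>\<^bsub>T\<^esub> y) = a"
    by (rule aay)
  have "(a \<bullet>\<^bsub>T\<^esub> y) \<bullet>\<^bsub>T\<^esub> (a \<bullet>\<^bsub>T\<^esub> y) = ((a \<bullet>\<^bsub>T\<^esub> y) \<bullet>\<^bsub>T\<^esub> a) \<bullet>\<^bsub>T\<^esub> y"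
    using a yz(1) by (simp add: endo_def)
  then have ee: "(a \<bullet>\<^bsub>T\<^esub> y) \<bullet>\<^bsub>T\<^esub> (a \<bullet>\<^bsub>T\<^esub> y) = a \<bullet>\<^bsub>T\<^esub> y"
    unfolding ea .
  have e1: "a \<bullet>\<^bsub>T\<^esub> y = Ident T V"
    by (rule idem[of _ "Suc n"]) (use a yz(1) ee ea ae in \<open>simp_all add: a_def del: power.simps\<close>)
  have b: "endo V (power V h n)"
    by (rule power_endo[OF V h])
  have a1: "a = h \<bullet>\<^bsub>T\<^esub> power V h n" and a2: "a = power V h n \<bullet>\<^bsub>T\<^esub> h"
    using power_add[OF V h, of n 1] h by (simp_all add: a_def endo_def)
  have r: "h \<bullet>\<^bsub>T\<^esub> (power V h n \<bullet>\<^bsub>T\<^esub> y) = Ident T V"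
    using e1 h b yz(1) unfolding a1 by (simp add: endo_def)
  have l: "(z \<bullet>\<^bsub>T\<^esub> power V h n) \<bullet>\<^bsub>T\<^esub> h = Ident T V"
  proof -
    have "z \<bullet>\<^bsub>T\<^esub> (power V h n \<bullet>\<^bsub>T\<^esub> h) = Ident T V"
      unfolding a2[symmetric] zay by (rule e1)
    then show ?thesis
      using h b yz(2) by (simp add: endo_def)
  qed
  show ?thesis
    by (rule iso_of_left_right[of _ "z \<bullet>\<^bsub>T\<^esub> power V h n" "power V h n \<bullet>\<^bsub>T\<^esub> y"])
      (use r l h b yz(1,2) V in \<open>simp_all add: endo_def\<close>)
qed

text \<open>Minimise the dimension of the corner \<open>e End e\<close>. An idempotent below
  \<open>e\<close> has a smaller corner unless the corners agree, and then \<open>e\<close> lies in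
  the corner of \<open>e'\<close>, so that \<open>e' \<bullet> e = e\<close>.\<close>

lemma minimal_idempotent:
  assumes V: "V \<in> Ob T" and P: "P (Ident T V)" "\<And>e. P e \<Longrightarrow> endo V e \<and> e \<bullet>\<^bsub>T\<^esub> e = e"
  obtains e where "P e" "\<And>e'. \<lbrakk>P e'; e \<bullet>\<^bsub>T\<^esub> e' = e'; e' \<bullet>\<^bsub>T\<^esub> e = e'\<rbrakk> \<Longrightarrow> e' = e"
proof -
  obtain d :: "'m set \<Rightarrow> nat" where d: "\<And>\<phi> \<psi>. \<lbrakk>linear_endo V \<phi>; linear_endo V \<psi>;
      \<phi> ` Collect (endo V) \<subset> \<psi> ` Collect (endo V)\<rbrakk> \<Longrightarrow> d (\<phi> ` Collect (endo V)) < d (\<psi> ` Collect (endo V))"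
    using ex_dimension_linear_endo[OF V] by blast
  define corner where "corner e = (\<lambda>x. e \<bullet>\<^bsub>T\<^esub> (x \<bullet>\<^bsub>T\<^esub> e)) ` Collect (endo V)" for e
  obtain e where e: "P e" "\<And>e'. P e' \<Longrightarrow> d (corner e) \<le> d (corner e')"
    using ex_has_least_nat[of P _ "\<lambda>e. d (corner e)", OF P(1)] by blast
  have "e' = e" if e': "P e'" "e \<bullet>\<^bsub>T\<^esub> e' = e'" "e' \<bullet>\<^bsub>T\<^esub> e = e'" for e'
  proof -
    have E: "endo V e" "e \<bullet>\<^bsub>T\<^esub> e = e" "endo V e'" "e' \<bullet>\<^bsub>T\<^esub> e' = e'"
      using P(2) e(1) e'(1) by blast+
    have "corner e' \<subseteq> corner e"
      unfolding corner_def
    proof (intro subsetI, elim imageE)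
      fix w x assume x: "w = e' \<bullet>\<^bsub>T\<^esub> (x \<bullet>\<^bsub>T\<^esub> e')" "x \<in> Collect (endo V)"
      have "e \<bullet>\<^bsub>T\<^esub> (w \<bullet>\<^bsub>T\<^esub> e) = (e \<bullet>\<^bsub>T\<^esub> e') \<bullet>\<^bsub>T\<^esub> (x \<bullet>\<^bsub>T\<^esub> (e' \<bullet>\<^bsub>T\<^esub> e))"
        using x E(1,3) by (simp add: endo_def)
      then have "w = e \<bullet>\<^bsub>T\<^esub> (w \<bullet>\<^bsub>T\<^esub> e)"
        unfolding e'(2,3) x(1) by simp
      moreover have "endo V w"
        using x E(1,3) by simp
      ultimately show "w \<in> (\<lambda>x. e \<bullet>\<^bsub>T\<^esub> (x \<bullet>\<^bsub>T\<^esub> e)) ` Collect (endo V)"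
        by (intro image_eqI[of _ _ w]) simp_all
    qed
    moreover have "\<not> corner e' \<subset> corner e"
      using d[OF linear_endo_mult(3)[OF E(3)] linear_endo_mult(3)[OF E(1)]] e(2)[OF e'(1)]
      unfolding corner_def by fastforce
    ultimately have eq: "corner e' = corner e"
      by blast
    have "e \<in> corner e"
      unfolding corner_def by (rule image_eqI[of _ _ "Ident T V"]) (use E V in \<open>simp_all add: endo_def\<close>)
    then have "e \<in> corner e'"
      unfolding eq .
    then obtain x where x: "endo V x" "e = e' \<bullet>\<^bsub>T\<^esub> (x \<bullet>\<^bsub>T\<^esub> e')"
      unfolding corner_def by (elim imageE) simp
    have "e' \<bullet>\<^bsub>T\<^esub> e = (e' \<bullet>\<^bsub>T\<^esub> e') \<bullet>\<^bsub>T\<^esub> (x \<bullet>\<^bsub>T\<^esub> e')"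
      unfolding x(2) using x(1) E(3) by (simp add: endo_def)
    also have "\<dots> = e"
      unfolding E(4) x(2)[symmetric] ..
    finally show ?thesis
      using e'(3) by simp
  qed
  then show thesis
    using that e(1) by blast
qed

lemma split_idempotent:
  assumes V: "V \<in> Ob T" and e: "endo V e" "e \<bullet>\<^bsub>T\<^esub> e = e"
  obtains B r s where "B \<in> Ob T" "ar T r" "src T r = V" "tgt T r = B" "ar T s" "src T s = B" "tgt T s = V"
    "s \<bullet>\<^bsub>T\<^esub> r = e" "r \<bullet>\<^bsub>T\<^esub> s = Ident T B"
proof -
  have "e \<in> Hom T V V"
    using e(1) arrow_self[of e] by (simp add: endo_def)
  then obtain B r s where B: "B \<in> Ob T" "r \<in> Hom T V B" "s \<in> Hom T B V" "s \<bullet>\<^bsub>T\<^esub> r = e" "r \<bullet>\<^bsub>T\<^esub> s = Ident T B"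
    using idempotents_split V e(2) unfolding split_idempotents_def by blast
  show thesis
    using that[OF B(1) _ _ _ _ _ _ B(4,5)] Hom_arrow[OF B(2)] Hom_arrow[OF B(3)] B(1) V by blast
qed

text \<open>Splitting \<open>e\<close> and \<open>1 - e\<close> gives the two summands.\<close>

lemma idempotent_biproduct:
  assumes V: "V \<in> Ob T" and e: "endo V e" "e \<bullet>\<^bsub>T\<^esub> e = e"
  obtains B B' r s where "B \<in> Ob T" "B' \<in> Ob T" "is_biproduct T B B' V"
    "ar T r" "src T r = V" "tgt T r = B" "ar T s" "src T s = B" "tgt T s = V"
    "s \<bullet>\<^bsub>T\<^esub> r = e" "r \<bullet>\<^bsub>T\<^esub> s = Ident T B"
proof -
  obtain B r s where r: "B \<in> Ob T" "ar T r" "src T r = V" "tgt T r = B" "ar T s" "src T s = B" "tgt T s = V"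
    "s \<bullet>\<^bsub>T\<^esub> r = e" "r \<bullet>\<^bsub>T\<^esub> s = Ident T B"
    using split_idempotent[OF V e] .
  let ?f = "diff T (Ident T V) e"
  have e': "ar T e" "src T e = V" "tgt T e = V"
    using e(1) by (simp_all add: endo_def)
  have f: "endo V ?f" "?f \<bullet>\<^bsub>T\<^esub> ?f = ?f"
    using V e' e(2) by (simp_all add: endo_def diff_def)
  obtain B' r' s' where r': "B' \<in> Ob T" "ar T r'" "src T r' = V" "tgt T r' = B'" "ar T s'" "src T s' = B'" "tgt T s' = V"
    "s' \<bullet>\<^bsub>T\<^esub> r' = ?f" "r' \<bullet>\<^bsub>T\<^esub> s' = Ident T B'"
    using split_idempotent[OF V f] .
  have es: "e \<bullet>\<^bsub>T\<^esub> s = s"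
    unfolding r(8)[symmetric] using r(1-7,9) by simp
  have "?f \<bullet>\<^bsub>T\<^esub> s = Zero T B V"
    using es e' r V by simp
  then have s'r's: "s' \<bullet>\<^bsub>T\<^esub> (r' \<bullet>\<^bsub>T\<^esub> s) = Zero T B V"
    using Comp_reduce[OF r'(8), of s] r(1-7) r'(1-7) by simp
  have "r' \<bullet>\<^bsub>T\<^esub> s = (r' \<bullet>\<^bsub>T\<^esub> s') \<bullet>\<^bsub>T\<^esub> (r' \<bullet>\<^bsub>T\<^esub> s)"
    unfolding r'(9) using r(1-7) r'(1-7) by simp
  also have "\<dots> = r' \<bullet>\<^bsub>T\<^esub> (s' \<bullet>\<^bsub>T\<^esub> (r' \<bullet>\<^bsub>T\<^esub> s))"
    using r(1-7) r'(1-7) by simp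
  finally have z1: "r' \<bullet>\<^bsub>T\<^esub> s = Zero T B B'"
    unfolding s'r's using r'(1-7) r(1-7) by simp
  have "r \<bullet>\<^bsub>T\<^esub> ?f = diff T r (r \<bullet>\<^bsub>T\<^esub> e)"
    using r(1-7) e' V by simp
  also have "r \<bullet>\<^bsub>T\<^esub> e = r"
    unfolding r(8)[symmetric] using Comp_reduce[OF r(9), of r] r(1-7) by simp
  finally have rf: "r \<bullet>\<^bsub>T\<^esub> ?f = Zero T V B"
    using r(1-7) V by simp
  have "r \<bullet>\<^bsub>T\<^esub> s' = (r \<bullet>\<^bsub>T\<^esub> (s' \<bullet>\<^bsub>T\<^esub> r')) \<bullet>\<^bsub>T\<^esub> s'"
    using r(1-7) r'(1-7,9) by simp
  then have z2: "r \<bullet>\<^bsub>T\<^esub> s' = Zero T B' B"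
    unfolding r'(8) rf using r(1-7) r'(1-7) by simp
  have "is_biproduct T B B' V"
    by (rule is_biproductI[of s s' r r'])
      (use r r' z1 z2 e'(1-3) V diff_Add_cancel(3)[of "Ident T V" e] in simp_all)
  then show thesis
    using that r r'(1) by blast
qed

text \<open>Cut the target down by a minimal idempotent \<open>e\<close> with
  \<open>e \<bullet> f = f\<close>, and let \<open>B\<close> be its image. If \<open>h\<close> fixes
  the restricted map \<open>r \<bullet> f\<close>, so does every idempotent \<open>i\<close> of
  \<open>B\<close> that is absorbed by a power of \<open>h\<close>. Then
  \<open>s \<bullet> (i \<bullet> r)\<close> is an idempotent below \<open>e\<close> fixing
  \<open>f\<close>, so minimality gives \<open>i = 1\<close>, as \<open>iso_criterion\<close>
  requires.\<close>

lemma left_minimal_version: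
  assumes f: "ar T f"
  shows "\<exists>V V' r s. V \<in> Ob T \<and> V' \<in> Ob T \<and> is_biproduct T V V' (tgt T f) \<and>
      ar T r \<and> src T r = tgt T f \<and> tgt T r = V \<and> ar T s \<and> src T s = V \<and> tgt T s = tgt T f \<and>
      s \<bullet>\<^bsub>T\<^esub> (r \<bullet>\<^bsub>T\<^esub> f) = f \<and>
      (\<forall>h. ar T h \<and> src T h = V \<and> tgt T h = V \<and> h \<bullet>\<^bsub>T\<^esub> (r \<bullet>\<^bsub>T\<^esub> f) = r \<bullet>\<^bsub>T\<^esub> f \<longrightarrow> is_iso T h)"
proof -
  define V where "V = tgt T f"
  have V: "V \<in> Ob T" "tgt T f = V"
    using f by (simp_all add: V_def)
  define P where "P e \<longleftrightarrow> endo V e \<and> e \<bullet>\<^bsub>T\<^esub> e = e \<and> e \<bullet>\<^bsub>T\<^esub> f = f" for e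
  obtain e where e: "P e" "\<And>e'. \<lbrakk>P e'; e \<bullet>\<^bsub>T\<^esub> e' = e'; e' \<bullet>\<^bsub>T\<^esub> e = e'\<rbrakk> \<Longrightarrow> e' = e"
    by (rule minimal_idempotent[OF V(1), of P]) (use V f in \<open>auto simp: P_def\<close>)
  have e': "endo V e" "e \<bullet>\<^bsub>T\<^esub> e = e" "e \<bullet>\<^bsub>T\<^esub> f = f"
    using e(1) by (simp_all add: P_def)
  obtain B B' r s where b: "B \<in> Ob T" "B' \<in> Ob T" "is_biproduct T B B' V"
    and r: "ar T r" "src T r = V" "tgt T r = B" and s: "ar T s" "src T s = B" "tgt T s = V"
    and sr: "s \<bullet>\<^bsub>T\<^esub> r = e" and rs: "r \<bullet>\<^bsub>T\<^esub> s = Ident T B"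
    using idempotent_biproduct[OF V(1) e'(1,2)] .
  have rs': "r \<bullet>\<^bsub>T\<^esub> (s \<bullet>\<^bsub>T\<^esub> x) = x" if "ar T x" "tgt T x = B" for x
    using Comp_reduce[OF rs, of x] that r s by simp
  have srf: "s \<bullet>\<^bsub>T\<^esub> (r \<bullet>\<^bsub>T\<^esub> f) = f"
    using Comp_reduce[OF sr, of f] e'(3) r s f V by simp
  have "is_iso T h" if h: "ar T h" "src T h = B" "tgt T h = B" "h \<bullet>\<^bsub>T\<^esub> (r \<bullet>\<^bsub>T\<^esub> f) = r \<bullet>\<^bsub>T\<^esub> f" for h
  proof (rule iso_criterion[OF b(1)])
    show hB: "endo B h"
      using h by (simp add: endo_def)
    fix i n assume i: "endo B i" "i \<bullet>\<^bsub>T\<^esub> i = i" "i \<bullet>\<^bsub>T\<^esub> power B h n = power B h n"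
    have i': "ar T i" "src T i = B" "tgt T i = B"
      using i(1) by (simp_all add: endo_def)
    have pow: "power B h n \<bullet>\<^bsub>T\<^esub> (r \<bullet>\<^bsub>T\<^esub> f) = r \<bullet>\<^bsub>T\<^esub> f" for n
    proof (induction n)
      case (Suc n)
      then show ?case
        using power_endo[OF b(1) hB, of n] h r f V by (simp add: endo_def)
    qed (use b r f V in simp)
    have "power B h n \<bullet>\<^bsub>T\<^esub> (r \<bullet>\<^bsub>T\<^esub> f) = i \<bullet>\<^bsub>T\<^esub> (power B h n \<bullet>\<^bsub>T\<^esub> (r \<bullet>\<^bsub>T\<^esub> f))"
      using Comp_reduce[OF i(3), of "r \<bullet>\<^bsub>T\<^esub> f"] power_endo[OF b(1) hB, of n] i' r f V by (simp add: endo_def)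
    then have irf: "i \<bullet>\<^bsub>T\<^esub> (r \<bullet>\<^bsub>T\<^esub> f) = r \<bullet>\<^bsub>T\<^esub> f"
      unfolding pow by simp
    have ii: "i \<bullet>\<^bsub>T\<^esub> (i \<bullet>\<^bsub>T\<^esub> r) = i \<bullet>\<^bsub>T\<^esub> r"
      using Comp_reduce[OF i(2), of r] i' r by simp
    have "s \<bullet>\<^bsub>T\<^esub> (i \<bullet>\<^bsub>T\<^esub> r) = e"
    proof (rule e(2))
      show "P (s \<bullet>\<^bsub>T\<^esub> (i \<bullet>\<^bsub>T\<^esub> r))"
        using rs'[of "i \<bullet>\<^bsub>T\<^esub> r"] i' r s V f ii irf srf by (simp add: P_def endo_def)
      show "e \<bullet>\<^bsub>T\<^esub> (s \<bullet>\<^bsub>T\<^esub> (i \<bullet>\<^bsub>T\<^esub> r)) = s \<bullet>\<^bsub>T\<^esub> (i \<bullet>\<^bsub>T\<^esub> r)"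
        using rs'[of "i \<bullet>\<^bsub>T\<^esub> r"] i' r s by (simp flip: sr)
      show "(s \<bullet>\<^bsub>T\<^esub> (i \<bullet>\<^bsub>T\<^esub> r)) \<bullet>\<^bsub>T\<^esub> e = s \<bullet>\<^bsub>T\<^esub> (i \<bullet>\<^bsub>T\<^esub> r)"
        using rs'[of r] i' r s by (simp flip: sr)
    qed
    then have "r \<bullet>\<^bsub>T\<^esub> ((s \<bullet>\<^bsub>T\<^esub> (i \<bullet>\<^bsub>T\<^esub> r)) \<bullet>\<^bsub>T\<^esub> s) = r \<bullet>\<^bsub>T\<^esub> ((s \<bullet>\<^bsub>T\<^esub> r) \<bullet>\<^bsub>T\<^esub> s)"
      unfolding sr by simp
    then show "i = Ident T B"
      using rs rs'[of i] rs'[of "Ident T B"] i' r s b(1) by simp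
  qed
  then show ?thesis
    unfolding V(2) using b r s srf by blast
qed

text \<open>The source is cut down by a minimal idempotent with \<open>f \<bullet> e = f\<close>.
  Now the absorption \<open>h^n \<bullet> i = h^n\<close> on the other side shows that
  \<open>i\<close> fixes \<open>f \<bullet> s\<close>.\<close>

lemma right_minimal_version:
  assumes f: "ar T f"
  shows "\<exists>V V' r s. V \<in> Ob T \<and> V' \<in> Ob T \<and> is_biproduct T V V' (src T f) \<and>
      ar T r \<and> src T r = src T f \<and> tgt T r = V \<and> ar T s \<and> src T s = V \<and> tgt T s = src T f \<and>
      (f \<bullet>\<^bsub>T\<^esub> s) \<bullet>\<^bsub>T\<^esub> r = f \<and>
      (\<forall>h. ar T h \<and> src T h = V \<and> tgt T h = V \<and> (f \<bullet>\<^bsub>T\<^esub> s) \<bullet>\<^bsub>T\<^esub> h = f \<bullet>\<^bsub>T\<^esub> s \<longrightarrow> is_iso T h)"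
proof -
  define V where "V = src T f"
  have V: "V \<in> Ob T" "src T f = V"
    using f by (simp_all add: V_def)
  define P where "P e \<longleftrightarrow> endo V e \<and> e \<bullet>\<^bsub>T\<^esub> e = e \<and> f \<bullet>\<^bsub>T\<^esub> e = f" for e
  obtain e where e: "P e" "\<And>e'. \<lbrakk>P e'; e \<bullet>\<^bsub>T\<^esub> e' = e'; e' \<bullet>\<^bsub>T\<^esub> e = e'\<rbrakk> \<Longrightarrow> e' = e"
    by (rule minimal_idempotent[OF V(1), of P]) (use V f in \<open>auto simp: P_def\<close>)
  have e': "endo V e" "e \<bullet>\<^bsub>T\<^esub> e = e" "f \<bullet>\<^bsub>T\<^esub> e = f"
    using e(1) by (simp_all add: P_def)
  obtain B B' r s where b: "B \<in> Ob T" "B' \<in> Ob T" "is_biproduct T B B' V"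
    and r: "ar T r" "src T r = V" "tgt T r = B" and s: "ar T s" "src T s = B" "tgt T s = V"
    and sr: "s \<bullet>\<^bsub>T\<^esub> r = e" and rs: "r \<bullet>\<^bsub>T\<^esub> s = Ident T B"
    using idempotent_biproduct[OF V(1) e'(1,2)] .
  have rs': "r \<bullet>\<^bsub>T\<^esub> (s \<bullet>\<^bsub>T\<^esub> x) = x" if "ar T x" "tgt T x = B" for x
    using Comp_reduce[OF rs, of x] that r s by simp
  have fsr: "(f \<bullet>\<^bsub>T\<^esub> s) \<bullet>\<^bsub>T\<^esub> r = f"
    using e'(3) r s f V sr by simp
  have "is_iso T h" if h: "ar T h" "src T h = B" "tgt T h = B" "(f \<bullet>\<^bsub>T\<^esub> s) \<bullet>\<^bsub>T\<^esub> h = f \<bullet>\<^bsub>T\<^esub> s" for h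
  proof (rule iso_criterion[OF b(1)])
    show hB: "endo B h"
      using h by (simp add: endo_def)
    fix i n assume i: "endo B i" "i \<bullet>\<^bsub>T\<^esub> i = i" "power B h n \<bullet>\<^bsub>T\<^esub> i = power B h n"
    have i': "ar T i" "src T i = B" "tgt T i = B"
      using i(1) by (simp_all add: endo_def)
    have fs: "ar T (f \<bullet>\<^bsub>T\<^esub> s)" "src T (f \<bullet>\<^bsub>T\<^esub> s) = B"
      using s f V by simp_all
    have pow: "(f \<bullet>\<^bsub>T\<^esub> s) \<bullet>\<^bsub>T\<^esub> power B h n = f \<bullet>\<^bsub>T\<^esub> s" for n
    proof (induction n)
      case (Suc n)
      have "(f \<bullet>\<^bsub>T\<^esub> s) \<bullet>\<^bsub>T\<^esub> (h \<bullet>\<^bsub>T\<^esub> power B h n) = (f \<bullet>\<^bsub>T\<^esub> s) \<bullet>\<^bsub>T\<^esub> power B h n"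
        by (rule Comp_reduce[OF h(4)]) (use power_endo[OF b(1) hB, of n] h(1-3) fs in \<open>simp_all add: endo_def\<close>)
      then show ?case
        using Suc by simp
    qed (use b fs in simp)
    have "(f \<bullet>\<^bsub>T\<^esub> s) \<bullet>\<^bsub>T\<^esub> i = ((f \<bullet>\<^bsub>T\<^esub> s) \<bullet>\<^bsub>T\<^esub> power B h n) \<bullet>\<^bsub>T\<^esub> i"
      unfolding pow ..
    also have "\<dots> = (f \<bullet>\<^bsub>T\<^esub> s) \<bullet>\<^bsub>T\<^esub> (power B h n \<bullet>\<^bsub>T\<^esub> i)"
      by (rule Comp_assoc') (use power_endo[OF b(1) hB, of n] i' fs in \<open>simp_all add: endo_def\<close>)
    finally have fsi: "(f \<bullet>\<^bsub>T\<^esub> s) \<bullet>\<^bsub>T\<^esub> i = f \<bullet>\<^bsub>T\<^esub> s"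
      unfolding i(3) pow .
    have ii: "i \<bullet>\<^bsub>T\<^esub> (i \<bullet>\<^bsub>T\<^esub> r) = i \<bullet>\<^bsub>T\<^esub> r"
      using Comp_reduce[OF i(2), of r] i' r by simp
    have "f \<bullet>\<^bsub>T\<^esub> (s \<bullet>\<^bsub>T\<^esub> (i \<bullet>\<^bsub>T\<^esub> r)) = ((f \<bullet>\<^bsub>T\<^esub> s) \<bullet>\<^bsub>T\<^esub> i) \<bullet>\<^bsub>T\<^esub> r"
      using i' r s f V by simp
    then have fsir: "f \<bullet>\<^bsub>T\<^esub> (s \<bullet>\<^bsub>T\<^esub> (i \<bullet>\<^bsub>T\<^esub> r)) = f"
      unfolding fsi fsr .
    have "s \<bullet>\<^bsub>T\<^esub> (i \<bullet>\<^bsub>T\<^esub> r) = e"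
    proof (rule e(2))
      show "P (s \<bullet>\<^bsub>T\<^esub> (i \<bullet>\<^bsub>T\<^esub> r))"
        using rs'[of "i \<bullet>\<^bsub>T\<^esub> r"] i' r s V f ii fsir by (simp add: P_def endo_def)
      show "e \<bullet>\<^bsub>T\<^esub> (s \<bullet>\<^bsub>T\<^esub> (i \<bullet>\<^bsub>T\<^esub> r)) = s \<bullet>\<^bsub>T\<^esub> (i \<bullet>\<^bsub>T\<^esub> r)"
        using rs'[of "i \<bullet>\<^bsub>T\<^esub> r"] i' r s by (simp flip: sr)
      show "(s \<bullet>\<^bsub>T\<^esub> (i \<bullet>\<^bsub>T\<^esub> r)) \<bullet>\<^bsub>T\<^esub> e = s \<bullet>\<^bsub>T\<^esub> (i \<bullet>\<^bsub>T\<^esub> r)"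
        using rs'[of r] i' r s by (simp flip: sr)
    qed
    then have "r \<bullet>\<^bsub>T\<^esub> ((s \<bullet>\<^bsub>T\<^esub> (i \<bullet>\<^bsub>T\<^esub> r)) \<bullet>\<^bsub>T\<^esub> s) = r \<bullet>\<^bsub>T\<^esub> ((s \<bullet>\<^bsub>T\<^esub> r) \<bullet>\<^bsub>T\<^esub> s)"
      unfolding sr by simp
    then show "i = Ident T B"
      using rs rs'[of i] rs'[of "Ident T B"] i' r s b(1) by simp
  qed
  then show ?thesis
    unfolding V(2) using b r s fsr by blast
qed

text \<open>The vanishing half of Serre duality. The dual of a zero space has exactly one element,
  since its functionals are extensional, and the duality bijection then leaves a single map from
  \<open>B\<close> to \<open>S A\<close>.\<close>

lemma Serre_duality_zero:
  assumes AB: "A \<in> Ob T" "B \<in> Ob T" and z: "Hom T A B = {Zero T A B}"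
  shows "Hom T B (ob S A) = {Zero T B (ob S A)}"
proof -
  obtain \<eta> where "serre_duality K T S \<eta>"
    using Serre_duality by blast
  then have bij: "bij_betw (\<eta> A B) (dual_space K (hom_module T A B)) (Hom T B (ob S A))"
    using AB unfolding serre_duality_def by blast
  interpret M: module K "hom_module T A B"
    by (rule hom_vector_space[OF AB])
  have "\<phi> = (\<lambda>x \<in> Hom T A B. \<zero>\<^bsub>K\<^esub>)" if \<phi>: "\<phi> \<in> dual_space K (hom_module T A B)" for \<phi>
  proof
    fix x
    have 0: "Zero T A B \<in> Hom T A B"
      using z by simp
    have "\<phi> (\<zero>\<^bsub>K\<^esub> \<odot>\<^bsub>hom_module T A B\<^esub> Zero T A B) = \<zero>\<^bsub>K\<^esub> \<otimes>\<^bsub>K\<^esub> \<phi> (Zero T A B)"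
      using \<phi> 0 unfolding dual_space_def by simp
    moreover have "\<zero>\<^bsub>K\<^esub> \<odot>\<^bsub>hom_module T A B\<^esub> Zero T A B = Zero T A B"
      using M.smult_l_null[of "Zero T A B"] 0 by simp
    moreover have "\<phi> (Zero T A B) \<in> carrier K"
      using \<phi> 0 unfolding dual_space_def hom_def by auto
    ultimately have "\<phi> (Zero T A B) = \<zero>\<^bsub>K\<^esub>"
      by simp
    then show "\<phi> x = (\<lambda>x \<in> Hom T A B. \<zero>\<^bsub>K\<^esub>) x"
      using \<phi> z unfolding dual_space_def by (auto simp: extensional_def)
  qed
  then have "dual_space K (hom_module T A B) \<subseteq> {\<lambda>x \<in> Hom T A B. \<zero>\<^bsub>K\<^esub>}"
    by blast
  then obtain y where y: "Hom T B (ob S A) \<subseteq> {y}"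
    using bij_betw_imp_surj_on[OF bij] by blast
  have "is_functor T T S"
    using Serre_equivalence unfolding triangulated_equivalence_def additive_functor_def by blast
  then have "ob S A \<in> Ob T"
    using functor_Ob AB by blast
  then have "Zero T B (ob S A) \<in> Hom T B (ob S A)"
    using Zero_arrow[of B "ob S A"] Hom_iff[of B "ob S A"] AB by simp
  then show ?thesis
    using y by blast
qed

lemma minimal_serre_category: "minimal_serre_category T S"
proof (intro minimal_serre_category.intro triangulated_category_axioms minimal_serre_category_axioms.intro)
  have S: "is_equivalence T T S" "additive_functor T T S"
    and "\<exists>\<xi>. natural_iso T T (comp_func S (Sus T)) (comp_func (Sus T) S) \<xi>"
    using Serre_equivalence unfolding triangulated_equivalence_def by blast+
  then obtain \<xi> where \<xi>: "natural_iso T T (comp_func S (Sus T)) (comp_func (Sus T) S) \<xi>"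
    by blast
  show "is_equivalence T T S" "additive_functor T T S"
    by (rule S)+
  show "isomorphic T (ob S (ob (Sus T) A)) (ob (Sus T) (ob S A))" if "A \<in> Ob T" for A
    using \<xi> that unfolding natural_iso_def isomorphic_def comp_func_def by auto
qed (use Serre_duality_zero left_minimal_version right_minimal_version in blast)+

end

theorem theoremE:
  fixes K :: "('k, 'r) ring_scheme"
    and T :: "('k, 'o, 'm, 'z) lin_triang_scheme"
    and S :: "('o, 'm, 'o, 'm) func"
  assumes "serre_triangulated_category K T S"
  shows "bij_betw (heart T) (maximal_extension_closed_subcats T S) (rigid_subcats T S) \<and>
    bij_betw (\<lambda>\<X>. shift T (left_perp T \<X>)) (rigid_subcats T S)
      (maximal_extension_closed_subcats T S) \<and>
    (\<forall>\<U> \<in> maximal_extension_closed_subcats T S.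
      shift T (left_perp T (heart T \<U>)) = \<U>) \<and>
    (\<forall>\<X> \<in> rigid_subcats T S. heart T (shift T (left_perp T \<X>)) = \<X>) \<and>
    (\<forall>\<U> \<in> maximal_extension_closed_subcats T S. \<forall>\<X> \<in> rigid_subcats T S.
      \<X> = heart T \<U> \<and> \<U> = shift T (left_perp T \<X>) \<longrightarrow>
        frobenius_subcat T \<X> \<U> \<and>
        (\<forall>\<sigma> \<omega>. sigma_choice T \<U> \<X> \<sigma> \<and> omega_choice T \<U> \<X> \<omega> \<longrightarrow>
          triangulated_category (subfactor T \<U> \<X> \<sigma>) \<and>
          quasi_inverse (subfactor T \<U> \<X> \<sigma>) (subfactor T \<U> \<X> \<sigma>)
            (sigma_functor T \<U> \<X> \<sigma>) (omega_functor T \<U> \<X> \<omega>)))"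
  using minimal_serre_category.correspondence[OF serre_triangulated_category.minimal_serre_category[OF assms]] .

end
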